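(* Let $\mathcal{F}$ be a saturated family of regular star-extendible homomorphisms between digraph algebras, and suppose that for every algebra $A$ in $\mathrm{Alglim}\,\mathcal{F}$ any two regular masas of $A$ are conjugate by an approximately inner automorphism of $A$. Then $\mathcal{F}$ is functorial.
   Context: Digraph algebras. A digraph algebra is a subalgebra $A$ of a finite-dimensional C*-algebra that contains a maximal abelian self-adjoint subalgebra (masa) of that C*-algebra. $C^*(A)$ is the C*-algebra generated by $A$; it is a finite direct sum of full matrix algebras and ranks are computed there in the usual way. A homomorphism $\phi:A_1\to A_2$ of digraph algebras is star-extendible if it is the restriction of a *-homomorphism $C^*(A_1)\to C^*(A_2)$ (not necessarily unital). It has multiplicity one if $\phi(p)$ has rank at most one for each rank one projection $p\in A_1$. It is regular if $\phi=\phi_1+\dots+\phi_s$ with each $\phi_i:A_1\to A_2$ star-extendible of multiplicity one and the projections $\phi_i(1)$ pairwise orthogonal. Saturated. A family $\mathcal{F}$ of regular maps between digraph algebras is saturated if it contains all regular maps $A\to B$ for every pair $A,B$ which are the domain and range algebras of a map in $\mathcal{F}$. Limits. For a direct system $\{A_k,\phi_k\}$ of digraph algebras with star-extendible maps $\phi_k:A_k\to A_{k+1}$, the algebraic limit $A$ is a subalgebra of the *-algebra which is the algebraic limit of the $C^*(A_k)$; adjoints are taken there. Automorphisms and isomorphisms are star-extendible, that is, restrictions of *-isomorphisms of the *-algebras so generated. $\mathrm{Alglim}\,\mathcal{F}$ is the class of algebraic limits of direct systems with all connecting maps in $\mathcal{F}$. A masa $C$ of $A$ is a maximal abelian self-adjoint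 subalgebra; it is regular if the set $N_C(A)$ of partial isometries $v\in A$ with $v^*Cv\subseteq C$ and $vCv^*\subseteq C$ generates $A$ as an algebra. Functorial family. $\mathcal{F}$ is functorial if the following holds. Let $\{A_k,\phi_k\}$, $\{B_k,\theta_k\}$ be direct systems with all $\phi_k,\theta_k\in\mathcal{F}$, let $(n_k),(m_k)$ be increasing sequences and let $\alpha_k:A_{n_k}\to B_{m_k}$, $\beta_k:B_{m_k}\to A_{n_{k+1}}$ be star-extendible homomorphisms such that $\beta_k\circ\alpha_k$ is the system map $A_{n_k}\to A_{n_{k+1}}$ and $\alpha_{k+1}\circ\beta_k$ is the system map $B_{m_k}\to B_{m_{k+1}}$ for all $k$. Then for every $k$ there are $r_k, s_k$ such that $\alpha_{r_k}\circ\beta_{r_k-1}\circ\dots\circ\beta_k\circ\alpha_k$ and $\beta_{s_k}\circ\alpha_{s_k}\circ\dots\circ\alpha_{k+1}\circ\beta_k$ belong to $\mathcal{F}$. Approximately inner. An automorphism $\alpha$ of an algebraic limit $A$ is approximately inner if for every finite set $S\subseteq A$ there is a unitary $U$ of $A$ (of its unitisation if $A$ is nonunital), with $U, U^*$ both in that algebra, such that $\alpha(a)=U^*aU$ for all $a\in S$.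
   Formalization: "Saturated" is taken to mean that F contains all regular maps A→B whenever A is the domain of some map in F and B the range of some possibly different map in F; if one map of F must go from A to B, the claim fails (all regular maps C→C and M_2→M_2, zero systems). *)

theory Defs
  imports "HOL-Library.FuncSet" "Jordan_Normal_Form.DL_Rank" "Jordan_Normal_Form.Schur_Decomposition"
begin

section \<open>Complex *-algebras\<close>

record 'a star_alg = "'a partial_object" +
  szero :: 'a
  sadd :: "'a \<Rightarrow> 'a \<Rightarrow> 'a"
  smul :: "'a \<Rightarrow> 'a \<Rightarrow> 'a"
  sscale :: "complex \<Rightarrow> 'a \<Rightarrow> 'a"
  sadj :: "'a \<Rightarrow> 'a"

text \<open>Associative, not necessarily unital: algebraic direct limits need not have a unit.\<close>

locale star_algebra =
  fixes E :: "'a star_alg"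
  assumes zero_closed: "szero E \<in> carrier E"
    and add_closed: "\<lbrakk>x \<in> carrier E; y \<in> carrier E\<rbrakk> \<Longrightarrow> sadd E x y \<in> carrier E"
    and mul_closed: "\<lbrakk>x \<in> carrier E; y \<in> carrier E\<rbrakk> \<Longrightarrow> smul E x y \<in> carrier E"
    and scale_closed: "x \<in> carrier E \<Longrightarrow> sscale E c x \<in> carrier E"
    and adj_closed: "x \<in> carrier E \<Longrightarrow> sadj E x \<in> carrier E"
    and add_assoc: "\<lbrakk>x \<in> carrier E; y \<in> carrier E; z \<in> carrier E\<rbrakk>
          \<Longrightarrow> sadd E (sadd E x y) z = sadd E x (sadd E y z)"
    and add_comm: "\<lbrakk>x \<in> carrier E; y \<in> carrier E\<rbrakk> \<Longrightarrow> sadd E x y = sadd E y x"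
    and add_zero: "x \<in> carrier E \<Longrightarrow> sadd E x (szero E) = x"
    and add_inverse: "x \<in> carrier E \<Longrightarrow> sadd E x (sscale E (-1) x) = szero E"
    and scale_add_right: "\<lbrakk>x \<in> carrier E; y \<in> carrier E\<rbrakk>
          \<Longrightarrow> sscale E c (sadd E x y) = sadd E (sscale E c x) (sscale E c y)"
    and scale_add_left: "x \<in> carrier E \<Longrightarrow> sscale E (c + d) x = sadd E (sscale E c x) (sscale E d x)"
    and scale_scale: "x \<in> carrier E \<Longrightarrow> sscale E c (sscale E d x) = sscale E (c * d) x"
    and scale_one: "x \<in> carrier E \<Longrightarrow> sscale E 1 x = x"
    and mul_assoc: "\<lbrakk>x \<in> carrier E; y \<in> carrier E; z \<in> carrier E\<rbrakk>
          \<Longrightarrow> smul E (smul E x y) z = smul E x (smul E y z)"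
    and mul_add_left: "\<lbrakk>x \<in> carrier E; y \<in> carrier E; z \<in> carrier E\<rbrakk>
          \<Longrightarrow> smul E (sadd E x y) z = sadd E (smul E x z) (smul E y z)"
    and mul_add_right: "\<lbrakk>x \<in> carrier E; y \<in> carrier E; z \<in> carrier E\<rbrakk>
          \<Longrightarrow> smul E x (sadd E y z) = sadd E (smul E x y) (smul E x z)"
    and mul_scale_left: "\<lbrakk>x \<in> carrier E; y \<in> carrier E\<rbrakk>
          \<Longrightarrow> smul E (sscale E c x) y = sscale E c (smul E x y)"
    and mul_scale_right: "\<lbrakk>x \<in> carrier E; y \<in> carrier E\<rbrakk>
          \<Longrightarrow> smul E x (sscale E c y) = sscale E c (smul E x y)"
    and adj_adj: "x \<in> carrier E \<Longrightarrow> sadj E (sadj E x) = x"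
    and adj_add: "\<lbrakk>x \<in> carrier E; y \<in> carrier E\<rbrakk>
          \<Longrightarrow> sadj E (sadd E x y) = sadd E (sadj E x) (sadj E y)"
    and adj_scale: "x \<in> carrier E \<Longrightarrow> sadj E (sscale E c x) = sscale E (cnj c) (sadj E x)"
    and adj_mul: "\<lbrakk>x \<in> carrier E; y \<in> carrier E\<rbrakk>
          \<Longrightarrow> sadj E (smul E x y) = smul E (sadj E y) (sadj E x)"

definition subalg :: "'a star_alg \<Rightarrow> 'a set \<Rightarrow> bool" where
  "subalg E S \<longleftrightarrow> S \<subseteq> carrier E \<and> szero E \<in> S
     \<and> (\<forall>x\<in>S. \<forall>y\<in>S. sadd E x y \<in> S)
     \<and> (\<forall>x\<in>S. \<forall>y\<in>S. smul E x y \<in> S)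
     \<and> (\<forall>c. \<forall>x\<in>S. sscale E c x \<in> S)"

definition self_adjoint :: "'a star_alg \<Rightarrow> 'a set \<Rightarrow> bool" where
  "self_adjoint E S \<longleftrightarrow> (\<forall>x\<in>S. sadj E x \<in> S)"

definition alg_gen :: "'a star_alg \<Rightarrow> 'a set \<Rightarrow> 'a set" where
  "alg_gen E X = \<Inter>{S. subalg E S \<and> X \<subseteq> S}"

definition star_gen :: "'a star_alg \<Rightarrow> 'a set \<Rightarrow> 'a set" where
  "star_gen E X = \<Inter>{S. subalg E S \<and> self_adjoint E S \<and> X \<subseteq> S}"

definition star_hom :: "'a star_alg \<Rightarrow> 'b star_alg \<Rightarrow> ('a \<Rightarrow> 'b) \<Rightarrow> bool" where
  "star_hom E E' f \<longleftrightarrow> f \<in> carrier E \<rightarrow> carrier E'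
     \<and> (\<forall>x\<in>carrier E. \<forall>y\<in>carrier E. f (sadd E x y) = sadd E' (f x) (f y))
     \<and> (\<forall>x\<in>carrier E. \<forall>y\<in>carrier E. f (smul E x y) = smul E' (f x) (f y))
     \<and> (\<forall>c. \<forall>x\<in>carrier E. f (sscale E c x) = sscale E' c (f x))
     \<and> (\<forall>x\<in>carrier E. f (sadj E x) = sadj E' (f x))"

definition star_iso :: "'a star_alg \<Rightarrow> 'b star_alg \<Rightarrow> ('a \<Rightarrow> 'b) \<Rightarrow> bool" where
  "star_iso E E' f \<longleftrightarrow> star_hom E E' f \<and> bij_betw f (carrier E) (carrier E')"

definition projection :: "'a star_alg \<Rightarrow> 'a \<Rightarrow> bool" where
  "projection E p \<longleftrightarrow> p \<in> carrier E \<and> smul E p p = p \<and> sadj E p = p"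

definition is_unit_of :: "'a star_alg \<Rightarrow> 'a set \<Rightarrow> 'a \<Rightarrow> bool" where
  "is_unit_of E A e \<longleftrightarrow> e \<in> A \<and> (\<forall>x\<in>A. smul E e x = x \<and> smul E x e = x)"

definition unit_of :: "'a star_alg \<Rightarrow> 'a set \<Rightarrow> 'a" where
  "unit_of E A = (THE e. is_unit_of E A e)"

definition ssum :: "'a star_alg \<Rightarrow> 'a list \<Rightarrow> 'a" where
  "ssum E xs = foldr (sadd E) xs (szero E)"


section \<open>Finite-dimensional C*-algebras\<close>

text \<open>\<open>matrix_sum [n1, ..., nr]\<close> is the direct sum of the full matrix algebras
  of sizes \<open>n1, ..., nr\<close>.\<close>

definition matrix_sum :: "nat list \<Rightarrow> complex mat list star_alg" where
  "matrix_sum ns = \<lparr>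
     carrier = {xs. list_all2 (\<lambda>x n. x \<in> carrier_mat n n) xs ns},
     szero = map (\<lambda>n. 0\<^sub>m n n) ns,
     sadd = map2 (+),
     smul = map2 (*),
     sscale = (\<lambda>c. map (smult_mat c)),
     sadj = map mat_adjoint \<rparr>"

text \<open>The C*-norm of a finite-dimensional C*-algebra is determined by its *-algebra
  structure, and by the structure theorem the *-algebras that arise are the finite direct
  sums of full matrix algebras. The empty sum is the zero algebra.\<close>

definition fd_cstar_algebra :: "'a star_alg \<Rightarrow> bool" where
  "fd_cstar_algebra E \<longleftrightarrow> star_algebra E \<and>
     (\<exists>ns f. (\<forall>n\<in>set ns. 0 < n) \<and> star_iso E (matrix_sum ns) f)"

text \<open>The rank in a finite direct sum of full matrix algebras is the sum of the ranks of the
  summands; it does not depend on the identification with such a sum.\<close>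

definition fd_rank :: "'a star_alg \<Rightarrow> 'a \<Rightarrow> nat" where
  "fd_rank E x = (THE r. \<exists>ns f. (\<forall>n\<in>set ns. 0 < n) \<and> star_iso E (matrix_sum ns) f
     \<and> r = sum_list (map2 vec_space.rank ns (f x)))"


section \<open>Subalgebras of *-algebras, masas, automorphisms\<close>

text \<open>A (not necessarily self-adjoint) algebra is given together with an ambient *-algebra, in
  which adjoints are taken.\<close>

record 'a op_alg =
  ambient :: "'a star_alg"
  elems :: "'a set"

text \<open>The *-algebra generated by an algebra. For a subalgebra of a finite-dimensional
  C*-algebra this is the generated C*-algebra, since every subspace is closed.\<close>

definition cstar :: "'a op_alg \<Rightarrow> 'a star_alg" where
  "cstar A = (ambient A)\<lparr>carrier := star_gen (ambient A) (elems A)\<rparr>"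

definition abelian_sa_subalg :: "'a star_alg \<Rightarrow> 'a set \<Rightarrow> bool" where
  "abelian_sa_subalg E C \<longleftrightarrow> subalg E C \<and> self_adjoint E C
     \<and> (\<forall>x\<in>C. \<forall>y\<in>C. smul E x y = smul E y x)"

definition masa :: "'a op_alg \<Rightarrow> 'a set \<Rightarrow> bool" where
  "masa A C \<longleftrightarrow> abelian_sa_subalg (ambient A) C \<and> C \<subseteq> elems A
     \<and> (\<forall>C'. abelian_sa_subalg (ambient A) C' \<and> C' \<subseteq> elems A \<and> C \<subseteq> C' \<longrightarrow> C' = C)"

definition normalizer :: "'a op_alg \<Rightarrow> 'a set \<Rightarrow> 'a set" where
  "normalizer A C = (let E = ambient A in
     {v \<in> elems A. smul E (smul E v (sadj E v)) v = v
        \<and> (\<forall>c\<in>C. smul E (smul E (sadj E v) c) v \<in> C)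
        \<and> (\<forall>c\<in>C. smul E (smul E v c) (sadj E v) \<in> C)})"

definition regular_masa :: "'a op_alg \<Rightarrow> 'a set \<Rightarrow> bool" where
  "regular_masa A C \<longleftrightarrow> masa A C \<and> alg_gen (ambient A) (normalizer A C) = elems A"

definition automorphism :: "'a op_alg \<Rightarrow> ('a \<Rightarrow> 'a) \<Rightarrow> bool" where
  "automorphism A \<alpha> \<longleftrightarrow> (\<exists>f. star_iso (cstar A) (cstar A) f \<and> f ` elems A = elems A
     \<and> (\<forall>a\<in>elems A. \<alpha> a = f a))"

definition unital :: "'a op_alg \<Rightarrow> bool" where
  "unital A \<longleftrightarrow> (\<exists>e. is_unit_of (ambient A) (elems A) e)"

definition unitaries :: "'a op_alg \<Rightarrow> 'a set" where
  "unitaries A = (let E = ambient A; e = unit_of E (elems A) in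
     {u \<in> elems A. sadj E u \<in> elems A \<and> smul E (sadj E u) u = e \<and> smul E u (sadj E u) = e})"

text \<open>The pair \<open>(x, c)\<close> stands for \<open>x + c 1\<close>, with a new unit \<open>1\<close>.\<close>

definition unitise :: "'a star_alg \<Rightarrow> ('a \<times> complex) star_alg" where
  "unitise E = \<lparr>
     carrier = carrier E \<times> UNIV,
     szero = (szero E, 0),
     sadd = (\<lambda>(x, c) (y, d). (sadd E x y, c + d)),
     smul = (\<lambda>(x, c) (y, d). (sadd E (smul E x y) (sadd E (sscale E c y) (sscale E d x)), c * d)),
     sscale = (\<lambda>b (x, c). (sscale E b x, b * c)),
     sadj = (\<lambda>(x, c). (sadj E x, cnj c)) \<rparr>"

definition unitisation :: "'a op_alg \<Rightarrow> ('a \<times> complex) op_alg" where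
  "unitisation A = \<lparr>ambient = unitise (ambient A), elems = elems A \<times> UNIV\<rparr>"

definition approximately_inner :: "'a op_alg \<Rightarrow> ('a \<Rightarrow> 'a) \<Rightarrow> bool" where
  "approximately_inner A \<alpha> \<longleftrightarrow> (\<forall>S. finite S \<and> S \<subseteq> elems A \<longrightarrow>
     (if unital A
      then let E = ambient A in
        \<exists>u\<in>unitaries A. \<forall>a\<in>S. \<alpha> a = smul E (smul E (sadj E u) a) u
      else let E = unitise (ambient A) in
        \<exists>u\<in>unitaries (unitisation A). \<forall>a\<in>S. (\<alpha> a, 0) = smul E (smul E (sadj E u) (a, 0)) u))"


section \<open>Digraph algebras and their homomorphisms\<close>

definition digraph_algebra :: "'a op_alg \<Rightarrow> bool" where
  "digraph_algebra A \<longleftrightarrow> fd_cstar_algebra (ambient A) \<and> subalg (ambient A) (elems A)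
     \<and> (\<exists>C. masa \<lparr>ambient = ambient A, elems = carrier (ambient A)\<rparr> C \<and> C \<subseteq> elems A)"

text \<open>Homomorphisms are \<open>undefined\<close> outside their domain, so that equality
  of homomorphisms is equality of functions.\<close>

definition star_extendible :: "'a op_alg \<Rightarrow> 'b op_alg \<Rightarrow> ('a \<Rightarrow> 'b) \<Rightarrow> bool" where
  "star_extendible A B \<phi> \<longleftrightarrow> \<phi> \<in> elems A \<rightarrow>\<^sub>E elems B
     \<and> (\<exists>f. star_hom (cstar A) (cstar B) f \<and> (\<forall>a\<in>elems A. \<phi> a = f a))"

text \<open>The extension is unique because \<open>elems A\<close> generates \<open>cstar A\<close>.\<close>

definition star_extension :: "'a op_alg \<Rightarrow> 'b op_alg \<Rightarrow> ('a \<Rightarrow> 'b) \<Rightarrow> 'a \<Rightarrow> 'b" where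
  "star_extension A B \<phi> = (THE f. f \<in> extensional (carrier (cstar A))
     \<and> star_hom (cstar A) (cstar B) f \<and> (\<forall>a\<in>elems A. \<phi> a = f a))"

definition multiplicity_one :: "'a op_alg \<Rightarrow> 'b op_alg \<Rightarrow> ('a \<Rightarrow> 'b) \<Rightarrow> bool" where
  "multiplicity_one A B \<phi> \<longleftrightarrow>
     (\<forall>p\<in>elems A. projection (cstar A) p \<and> fd_rank (cstar A) p = 1 \<longrightarrow> fd_rank (cstar B) (\<phi> p) \<le> 1)"

definition regular_hom :: "'a op_alg \<Rightarrow> 'b op_alg \<Rightarrow> ('a \<Rightarrow> 'b) \<Rightarrow> bool" where
  "regular_hom A B \<phi> \<longleftrightarrow> star_extendible A B \<phi> \<and>
     (let e = unit_of (ambient A) (elems A) in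
      \<exists>(s::nat) \<psi>. 0 < s
        \<and> (\<forall>i<s. star_extendible A B (\<psi> i) \<and> multiplicity_one A B (\<psi> i))
        \<and> (\<forall>i<s. \<forall>j<s. i \<noteq> j \<longrightarrow> smul (ambient B) (\<psi> i e) (\<psi> j e) = szero (ambient B))
        \<and> (\<forall>a\<in>elems A. \<phi> a = ssum (ambient B) (map (\<lambda>i. \<psi> i a) [0..<s])))"

type_synonym 'a arrow = "'a op_alg \<times> ('a \<Rightarrow> 'a) \<times> 'a op_alg"

definition regular_family :: "'a arrow set \<Rightarrow> bool" where
  "regular_family F \<longleftrightarrow>
     (\<forall>(A, \<phi>, B)\<in>F. digraph_algebra A \<and> digraph_algebra B \<and> regular_hom A B \<phi>)"

definition domain_algebras :: "'a arrow set \<Rightarrow> 'a op_alg set" where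
  "domain_algebras F = (\<lambda>(A, \<phi>, B). A) ` F"

definition range_algebras :: "'a arrow set \<Rightarrow> 'a op_alg set" where
  "range_algebras F = (\<lambda>(A, \<phi>, B). B) ` F"

text \<open>\<open>A\<close> and \<open>B\<close> may come from different maps of the family: \<open>A\<close> is the domain
  algebra of one and \<open>B\<close> the range algebra of another.\<close>

definition saturated :: "'a arrow set \<Rightarrow> bool" where
  "saturated F \<longleftrightarrow> (\<forall>A\<in>domain_algebras F. \<forall>B\<in>range_algebras F. \<forall>\<phi>.
     regular_hom A B \<phi> \<longrightarrow> (A, \<phi>, B) \<in> F)"


section \<open>Direct systems and algebraic limits\<close>

text \<open>\<open>steps f m d\<close> composes the \<open>d\<close> maps \<open>f m, ..., f (m + d - 1)\<close>; thus
  \<open>trans f m n\<close>, for \<open>m \<le> n\<close>, is the map of a direct system from stage \<open>m\<close> to stage \<open>n\<close>.\<close>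

primrec steps :: "(nat \<Rightarrow> 'a \<Rightarrow> 'a) \<Rightarrow> nat \<Rightarrow> nat \<Rightarrow> 'a \<Rightarrow> 'a" where
  "steps f m 0 x = x"
| "steps f m (Suc d) x = f (m + d) (steps f m d x)"

definition system_map :: "(nat \<Rightarrow> 'a \<Rightarrow> 'a) \<Rightarrow> nat \<Rightarrow> nat \<Rightarrow> 'a \<Rightarrow> 'a" where
  "system_map f m n = steps f m (n - m)"

text \<open>Elements of the limit are classes of pairs \<open>(k, x)\<close> with \<open>x\<close> in the \<open>k\<close>-th algebra,
  two pairs being equivalent when they agree at some later stage.\<close>

definition lim_class :: "(nat \<Rightarrow> 'a star_alg) \<Rightarrow> (nat \<Rightarrow> 'a \<Rightarrow> 'a) \<Rightarrow> nat \<Rightarrow> 'a \<Rightarrow> (nat \<times> 'a) set" where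
  "lim_class E f k x = {(l, y). y \<in> carrier (E l)
     \<and> (\<exists>n. k \<le> n \<and> l \<le> n \<and> system_map f k n x = system_map f l n y)}"

text \<open>Each union below is a union of equal classes.\<close>

definition lim_op1 ::
  "(nat \<Rightarrow> 'a star_alg) \<Rightarrow> (nat \<Rightarrow> 'a \<Rightarrow> 'a) \<Rightarrow> (nat \<Rightarrow> 'a \<Rightarrow> 'a) \<Rightarrow> (nat \<times> 'a) set \<Rightarrow> (nat \<times> 'a) set" where
  "lim_op1 E f h X = (\<Union>(k, x)\<in>X. lim_class E f k (h k x))"

definition lim_op2 ::
  "(nat \<Rightarrow> 'a star_alg) \<Rightarrow> (nat \<Rightarrow> 'a \<Rightarrow> 'a) \<Rightarrow> (nat \<Rightarrow> 'a \<Rightarrow> 'a \<Rightarrow> 'a)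
     \<Rightarrow> (nat \<times> 'a) set \<Rightarrow> (nat \<times> 'a) set \<Rightarrow> (nat \<times> 'a) set" where
  "lim_op2 E f h X Y = (\<Union>(k, x)\<in>X. \<Union>(l, y)\<in>Y. let n = max k l in
     lim_class E f n (h n (system_map f k n x) (system_map f l n y)))"

definition star_limit :: "(nat \<Rightarrow> 'a star_alg) \<Rightarrow> (nat \<Rightarrow> 'a \<Rightarrow> 'a) \<Rightarrow> (nat \<times> 'a) set star_alg" where
  "star_limit E f = \<lparr>
     carrier = {lim_class E f k x | k x. x \<in> carrier (E k)},
     szero = lim_class E f 0 (szero (E 0)),
     sadd = lim_op2 E f (\<lambda>n. sadd (E n)),
     smul = lim_op2 E f (\<lambda>n. smul (E n)),
     sscale = (\<lambda>c. lim_op1 E f (\<lambda>n. sscale (E n) c)),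
     sadj = lim_op1 E f (\<lambda>n. sadj (E n)) \<rparr>"

definition alg_limit :: "(nat \<Rightarrow> 'a op_alg) \<Rightarrow> (nat \<Rightarrow> 'a \<Rightarrow> 'a) \<Rightarrow> (nat \<times> 'a) set op_alg" where
  "alg_limit A \<phi> =
     (let E = (\<lambda>k. cstar (A k)); f = (\<lambda>k. star_extension (A k) (A (Suc k)) (\<phi> k)) in
      \<lparr>ambient = star_limit E f, elems = {lim_class E f k a | k a. a \<in> elems (A k)}\<rparr>)"

definition direct_system :: "'a arrow set \<Rightarrow> (nat \<Rightarrow> 'a op_alg) \<Rightarrow> (nat \<Rightarrow> 'a \<Rightarrow> 'a) \<Rightarrow> bool" where
  "direct_system F A \<phi> \<longleftrightarrow> (\<forall>k. (A k, \<phi> k, A (Suc k)) \<in> F)"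

definition Alglim :: "'a arrow set \<Rightarrow> (nat \<times> 'a) set op_alg set" where
  "Alglim F = {alg_limit A \<phi> | A \<phi>. direct_system F A \<phi>}"


section \<open>Functorial families\<close>

text \<open>\<open>zigzag \<alpha> \<beta> k j\<close> is \<open>\<alpha> (k + j) \<circ> \<beta> (k + j - 1) \<circ> ... \<circ> \<beta> k \<circ> \<alpha> k\<close>.\<close>

primrec zigzag :: "(nat \<Rightarrow> 'a \<Rightarrow> 'b) \<Rightarrow> (nat \<Rightarrow> 'b \<Rightarrow> 'a) \<Rightarrow> nat \<Rightarrow> nat \<Rightarrow> 'a \<Rightarrow> 'b" where
  "zigzag \<alpha> \<beta> k 0 = \<alpha> k"
| "zigzag \<alpha> \<beta> k (Suc j) = \<alpha> (k + Suc j) \<circ> \<beta> (k + j) \<circ> zigzag \<alpha> \<beta> k j"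

definition intertwining ::
  "(nat \<Rightarrow> 'a op_alg) \<Rightarrow> (nat \<Rightarrow> 'a \<Rightarrow> 'a) \<Rightarrow> (nat \<Rightarrow> 'a op_alg) \<Rightarrow> (nat \<Rightarrow> 'a \<Rightarrow> 'a)
     \<Rightarrow> (nat \<Rightarrow> nat) \<Rightarrow> (nat \<Rightarrow> nat) \<Rightarrow> (nat \<Rightarrow> 'a \<Rightarrow> 'a) \<Rightarrow> (nat \<Rightarrow> 'a \<Rightarrow> 'a) \<Rightarrow> bool" where
  "intertwining A \<phi> B \<theta> n m \<alpha> \<beta> \<longleftrightarrow> strict_mono n \<and> strict_mono m
     \<and> (\<forall>k. star_extendible (A (n k)) (B (m k)) (\<alpha> k))
     \<and> (\<forall>k. star_extendible (B (m k)) (A (n (Suc k))) (\<beta> k))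
     \<and> (\<forall>k. \<forall>a\<in>elems (A (n k)). \<beta> k (\<alpha> k a) = system_map \<phi> (n k) (n (Suc k)) a)
     \<and> (\<forall>k. \<forall>b\<in>elems (B (m k)). \<alpha> (Suc k) (\<beta> k b) = system_map \<theta> (m k) (m (Suc k)) b)"

text \<open>The composite \<open>\<beta> s \<circ> \<alpha> s \<circ> ... \<circ> \<alpha> (k + 1) \<circ> \<beta> k\<close> is the zigzag that starts with
  \<open>\<beta> k\<close> and uses the shifted sequence \<open>\<alpha> (k + 1), \<alpha> (k + 2), ...\<close> in between.\<close>

definition functorial :: "'a arrow set \<Rightarrow> bool" where
  "functorial F \<longleftrightarrow> (\<forall>A \<phi> B \<theta> n m \<alpha> \<beta>.
     direct_system F A \<phi> \<and> direct_system F B \<theta> \<and> intertwining A \<phi> B \<theta> n m \<alpha> \<beta> \<longrightarrow>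
     (\<forall>k.
       (\<exists>r\<ge>k. (A (n k), restrict (zigzag \<alpha> \<beta> k (r - k)) (elems (A (n k))), B (m r)) \<in> F) \<and>
       (\<exists>s\<ge>k. (B (m k), restrict (zigzag \<beta> (\<lambda>i. \<alpha> (Suc i)) k (s - k)) (elems (B (m k))),
                A (n (Suc s))) \<in> F)))"

end

(*
  Frames (maximal families of orthogonal minimal projections) of the algebras of a regular direct
  system can be chosen compatibly: if phi is a sum of multiplicity one maps, the images of the
  projections of a frame extend to a frame of the range, and phi carries diagonals to diagonals and
  normalizers to normalizers. In the limit the diagonals become a regular masa.

  Two intertwined systems A and B have the same limit, which so acquires two regular masas C and D.
  An approximately inner automorphism mapping C to D acts on a stage of A as conjugation by a unitary
  u, which is represented by a unitary V at a late stage of B. The map g = V* alpha V sends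
  the matrix units of A to elements which in the limit normalize D. For a minimal diagonal
  projection q of B, the sum of g(u_p)* q g(u_p) over a transversal of matrix units u_p of A is a
  projection that commutes with the range of g and cuts out of g a map of multiplicity one. In the
  limit this projection lies in D, hence at a later stage it lies in the digraph algebra. Thus g,
  and with it alpha, becomes regular after finitely many connecting maps.
*)

theory Submission
  imports Defs "HOL-Computational_Algebra.Fundamental_Theorem_Algebra"
begin


text \<open>A regular map can always be made to match a diagonal of its domain with one of its
  range; a map that is only star-extendible need not. The masas C and D measure this mismatch inside
  one algebra, and the hypothesis removes it. An arbitrary automorphism would show only that some
  twist of alpha becomes regular; an approximately inner one is a conjugation on a stage, which can
  be expressed at a finite stage and undone at the end. Agreement on a finite set suffices because a
  stage is spanned by finitely many elements. The matrix units u_p lie in C*(A), in general outside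
  the digraph algebra. So the cutting projections may also fall outside B, and membership has to be
  obtained in the limit, from the fact that u_p normalizes C. The argument descends from the limit
  because each property used (unitarity, diagonality, membership) concerns finitely many elements
  and hence holds from some stage on. Connecting maps need not be unital and the limit may lack a
  unit, so unitaries are carried along as their difference from 1. No norm is used: a proper
  involution, finite dimension and a root of a minimal polynomial supply the minimal
  projections.\<close>

definition gsum :: "'a star_alg \<Rightarrow> ('i \<Rightarrow> 'a) \<Rightarrow> 'i set \<Rightarrow> 'a" where
  "gsum E = finprod \<lparr>carrier = carrier E, monoid.mult = sadd E, monoid.one = szero E\<rparr>"

section \<open>Elementary calculus and finite sums in star-algebras\<close>

context star_algebra
begin

abbreviation add_op (infixl "\<boxplus>" 65) where "x \<boxplus> y \<equiv> sadd E x y"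
abbreviation mul_op (infixl "\<boxtimes>" 70) where "x \<boxtimes> y \<equiv> smul E x y"
abbreviation scale_op (infixr "\<cdot>" 75) where "c \<cdot> x \<equiv> sscale E c x"
abbreviation adj_op ("_\<^sup>\<star>" [1000] 999) where "x\<^sup>\<star> \<equiv> sadj E x"
abbreviation diff_op (infixl "\<boxminus>" 65) where "x \<boxminus> y \<equiv> x \<boxplus> (-1) \<cdot> y"

lemmas closed [simp, intro] = zero_closed add_closed mul_closed scale_closed adj_closed

lemma add_left_comm:
  "\<lbrakk>x \<in> carrier E; y \<in> carrier E; z \<in> carrier E\<rbrakk> \<Longrightarrow> x \<boxplus> (y \<boxplus> z) = y \<boxplus> (x \<boxplus> z)"
  by (metis add_assoc add_comm)

lemmas add_ac = add_assoc add_comm add_left_comm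

lemma zero_add [simp]: "x \<in> carrier E \<Longrightarrow> szero E \<boxplus> x = x"
  by (simp add: add_comm[of "szero E"] add_zero)

lemmas add_zero [simp] scale_one [simp] adj_adj [simp] add_inverse [simp]

lemma add_left_cancel:
  assumes "x \<in> carrier E" "y \<in> carrier E" "z \<in> carrier E"
  shows "x \<boxplus> y = x \<boxplus> z \<longleftrightarrow> y = z"
proof
  assume "x \<boxplus> y = x \<boxplus> z"
  then have "(-1) \<cdot> x \<boxplus> (x \<boxplus> y) = (-1) \<cdot> x \<boxplus> (x \<boxplus> z)" by simp
  then show "y = z"
    using assms by (simp add: add_assoc[symmetric] add_comm[of "(-1) \<cdot> x" x])
qed simp

lemma idem_add: "\<lbrakk>x \<in> carrier E; x \<boxplus> x = x\<rbrakk> \<Longrightarrow> x = szero E"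
  using add_left_cancel[of x x "szero E"] by simp

lemma scale_zero_left [simp]: "x \<in> carrier E \<Longrightarrow> 0 \<cdot> x = szero E"
  by (metis add_0 idem_add scale_add_left scale_closed)

lemma scale_zero_right [simp]: "c \<cdot> szero E = szero E"
  by (metis idem_add scale_add_right scale_closed zero_closed add_zero)

lemma mul_zero_left [simp]: "x \<in> carrier E \<Longrightarrow> szero E \<boxtimes> x = szero E"
  by (metis add_zero idem_add mul_add_left mul_closed zero_closed)

lemma mul_zero_right [simp]: "x \<in> carrier E \<Longrightarrow> x \<boxtimes> szero E = szero E"
  by (metis add_zero idem_add mul_add_right mul_closed zero_closed)

lemma adj_zero [simp]: "(szero E)\<^sup>\<star> = szero E"
  by (metis add_zero idem_add adj_add adj_closed zero_closed)

lemma diff_eq_zero: 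
  assumes "x \<in> carrier E" "y \<in> carrier E"
  shows "x \<boxminus> y = szero E \<longleftrightarrow> x = y"
proof
  assume "x \<boxminus> y = szero E"
  then have "y \<boxplus> (x \<boxminus> y) = y" using assms by simp
  moreover have "y \<boxplus> (x \<boxminus> y) = x"
    using assms by (simp add: add_left_comm[of y x])
  ultimately show "x = y" by simp
qed (use assms in simp)

lemma scale_eq_zero:
  assumes "x \<in> carrier E"
  shows "c \<cdot> x = szero E \<longleftrightarrow> c = 0 \<or> x = szero E"
proof
  assume *: "c \<cdot> x = szero E"
  show "c = 0 \<or> x = szero E"
  proof (rule ccontr)
    assume "\<not> ?thesis"
    then have "(1 / c) \<cdot> (c \<cdot> x) = x" using assms by (simp add: scale_scale)
    then show False using * \<open>\<not> (c = 0 \<or> x = szero E)\<close> by simp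
  qed
qed (use assms in auto)

lemma scale_left_inject:
  assumes "x \<in> carrier E" "x \<noteq> szero E" "c \<cdot> x = d \<cdot> x"
  shows "c = d"
proof -
  have "(c - d) \<cdot> x = c \<cdot> x \<boxplus> (-1) \<cdot> (d \<cdot> x)"
    using scale_add_left[of x c "-d"] assms by (simp add: scale_scale)
  then show ?thesis using assms scale_eq_zero by simp
qed

lemma projD:
  assumes "projection E p"
  shows "p \<in> carrier E" "p \<boxtimes> p = p" "p\<^sup>\<star> = p"
  using assms by (auto simp: projection_def)

lemma proj_absorb:
  assumes "projection E p" "x \<in> carrier E"
  shows "p \<boxtimes> (p \<boxtimes> x) = p \<boxtimes> x" "x \<boxtimes> p \<boxtimes> p = x \<boxtimes> p"
  using assms projD[OF assms(1)] by (simp_all add: mul_assoc[symmetric]) (simp add: mul_assoc)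

lemma projection_zero [simp]: "projection E (szero E)"
  by (simp add: projection_def)

text \<open>The library treats finite products over commutative monoids given as records. Reading
  the additive structure as such a record makes the \<open>finprod\<close> lemmas available for
  \<open>gsum\<close>.\<close>

lemma add_monoid: "comm_monoid \<lparr>carrier = carrier E, monoid.mult = sadd E, monoid.one = szero E\<rparr>"
  by (rule comm_monoidI) (auto simp: add_assoc intro: add_comm)

lemma gsum_closed [simp, intro]: "(\<And>i. i \<in> I \<Longrightarrow> f i \<in> carrier E) \<Longrightarrow> gsum E f I \<in> carrier E"
  using comm_monoid.finprod_closed[OF add_monoid, of f I] by (auto simp: gsum_def)

lemma gsum_empty [simp]: "gsum E f {} = szero E"
  using comm_monoid.finprod_empty[OF add_monoid] by (simp add: gsum_def)

lemma gsum_insert [simp]: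
  "\<lbrakk>finite I; i \<notin> I; f i \<in> carrier E; \<And>j. j \<in> I \<Longrightarrow> f j \<in> carrier E\<rbrakk>
    \<Longrightarrow> gsum E f (insert i I) = f i \<boxplus> gsum E f I"
  using comm_monoid.finprod_insert[OF add_monoid, of I i f] by (auto simp: gsum_def)

lemma gsum_cong:
  "\<lbrakk>I = J; \<And>i. i \<in> J \<Longrightarrow> f i = g i; \<And>i. i \<in> J \<Longrightarrow> g i \<in> carrier E\<rbrakk> \<Longrightarrow> gsum E f I = gsum E g J"
  unfolding gsum_def
  by (rule comm_monoid.finprod_cong'[OF add_monoid]) auto

lemma gsum_zero [simp]: "gsum E (\<lambda>i. szero E) I = szero E"
  using comm_monoid.finprod_one_eqI[OF add_monoid, of I "\<lambda>i. szero E"] by (simp add: gsum_def)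

lemma gsum_reindex:
  "\<lbrakk>inj_on h I; \<And>i. i \<in> I \<Longrightarrow> f (h i) \<in> carrier E\<rbrakk> \<Longrightarrow> gsum E f (h ` I) = gsum E (\<lambda>i. f (h i)) I"
  unfolding gsum_def
  by (rule comm_monoid.finprod_reindex[OF add_monoid]) auto

lemma gsum_eq_zero: "(\<And>i. i \<in> I \<Longrightarrow> f i = szero E) \<Longrightarrow> gsum E f I = szero E"
  using gsum_cong[of I I f "\<lambda>i. szero E"] by simp

lemma gsum_add:
  assumes "\<And>i. i \<in> I \<Longrightarrow> f i \<in> carrier E" "\<And>i. i \<in> I \<Longrightarrow> g i \<in> carrier E"
  shows "gsum E (\<lambda>i. f i \<boxplus> g i) I = gsum E f I \<boxplus> gsum E g I"
  using comm_monoid.finprod_multf[OF add_monoid, of f I g] assms by (auto simp: gsum_def)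

lemma gsum_mul_left:
  assumes "finite I" "x \<in> carrier E" "\<And>i. i \<in> I \<Longrightarrow> f i \<in> carrier E"
  shows "x \<boxtimes> gsum E f I = gsum E (\<lambda>i. x \<boxtimes> f i) I"
  using assms by (induction I rule: finite_induct) (auto simp: mul_add_right)

lemma gsum_mul_right:
  assumes "finite I" "x \<in> carrier E" "\<And>i. i \<in> I \<Longrightarrow> f i \<in> carrier E"
  shows "gsum E f I \<boxtimes> x = gsum E (\<lambda>i. f i \<boxtimes> x) I"
  using assms by (induction I rule: finite_induct) (auto simp: mul_add_left)

lemma gsum_scale:
  assumes "finite I" "\<And>i. i \<in> I \<Longrightarrow> f i \<in> carrier E"
  shows "c \<cdot> gsum E f I = gsum E (\<lambda>i. c \<cdot> f i) I"
  using assms by (induction I rule: finite_induct) (auto simp: scale_add_right)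

lemma gsum_adj:
  assumes "finite I" "\<And>i. i \<in> I \<Longrightarrow> f i \<in> carrier E"
  shows "(gsum E f I)\<^sup>\<star> = gsum E (\<lambda>i. (f i)\<^sup>\<star>) I"
  using assms by (induction I rule: finite_induct) (auto simp: adj_add)

lemma gsum_single:
  assumes "finite I" "k \<in> I" "f k \<in> carrier E" "\<And>i. \<lbrakk>i \<in> I; i \<noteq> k\<rbrakk> \<Longrightarrow> f i = szero E"
  shows "gsum E f I = f k"
proof -
  have I: "I = insert k (I - {k})" using assms by auto
  have z: "gsum E f (I - {k}) = szero E" using assms by (intro gsum_eq_zero) auto
  have "gsum E f (insert k (I - {k})) = f k \<boxplus> gsum E f (I - {k})"
    using assms by (intro gsum_insert) auto
  then show ?thesis using I z assms by simp
qed

lemma gsum_Un_disjoint: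
  assumes "finite I" "finite J" "I \<inter> J = {}"
    "\<And>i. i \<in> I \<Longrightarrow> f i \<in> carrier E" "\<And>i. i \<in> J \<Longrightarrow> f i \<in> carrier E"
  shows "gsum E f (I \<union> J) = gsum E f I \<boxplus> gsum E f J"
  using comm_monoid.finprod_Un_disjoint[OF add_monoid, of I J f] assms by (auto simp: gsum_def)

lemma gsum_Sigma:
  assumes "finite I" "\<And>i. i \<in> I \<Longrightarrow> finite (J i)"
    "\<And>i j. \<lbrakk>i \<in> I; j \<in> J i\<rbrakk> \<Longrightarrow> f i j \<in> carrier E"
  shows "gsum E (\<lambda>i. gsum E (f i) (J i)) I = gsum E (\<lambda>(i, j). f i j) (Sigma I J)"
  using assms
proof (induction I rule: finite_induct)
  case (insert k I)
  have S: "Sigma (insert k I) J = Pair k ` J k \<union> Sigma I J" by auto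
  have "gsum E (\<lambda>(i, j). f i j) (Sigma (insert k I) J)
     = gsum E (\<lambda>(i, j). f i j) (Pair k ` J k) \<boxplus> gsum E (\<lambda>(i, j). f i j) (Sigma I J)"
    unfolding S using insert by (intro gsum_Un_disjoint) auto
  also have "gsum E (\<lambda>(i, j). f i j) (Pair k ` J k) = gsum E (f k) (J k)"
    using insert by (subst gsum_reindex) (auto simp: inj_on_def)
  finally show ?case using insert by auto
qed simp

lemma gsum_filter:
  assumes "finite I" "\<And>i. i \<in> I \<Longrightarrow> f i \<in> carrier E"
  shows "gsum E (\<lambda>i. if Q i then f i else szero E) I = gsum E f {i \<in> I. Q i}"
proof -
  have I: "I = {i \<in> I. Q i} \<union> {i \<in> I. \<not> Q i}" by auto
  have "gsum E (\<lambda>i. if Q i then f i else szero E) ({i \<in> I. Q i} \<union> {i \<in> I. \<not> Q i})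
     = gsum E (\<lambda>i. if Q i then f i else szero E) {i \<in> I. Q i}
     \<boxplus> gsum E (\<lambda>i. if Q i then f i else szero E) {i \<in> I. \<not> Q i}"
    using assms by (intro gsum_Un_disjoint) auto
  also have "gsum E (\<lambda>i. if Q i then f i else szero E) {i \<in> I. \<not> Q i} = szero E"
    by (rule gsum_eq_zero) auto
  also have "gsum E (\<lambda>i. if Q i then f i else szero E) {i \<in> I. Q i} = gsum E f {i \<in> I. Q i}"
    using assms by (intro gsum_cong) auto
  finally have "gsum E (\<lambda>i. if Q i then f i else szero E) I = gsum E f {i \<in> I. Q i} \<boxplus> szero E"
    by (simp only: I[symmetric])
  moreover have "gsum E f {i \<in> I. Q i} \<in> carrier E" using assms by (intro gsum_closed) auto
  ultimately show ?thesis by simp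
qed

lemma ssum_eq_gsum:
  assumes "\<And>i. i < s \<Longrightarrow> f i \<in> carrier E"
  shows "ssum E (map f [0..<s]) = gsum E f {..<s}"
proof -
  \<comment> \<open>The start value of the fold is generalised because \<open>[0..<Suc s]\<close>
    grows at its end: the last summand is absorbed into the start value before the induction
    hypothesis applies.\<close>
  have fold: "foldr (sadd E) (map f [0..<s]) y = gsum E f {..<s} \<boxplus> y"
    if "y \<in> carrier E" for y
    using assms that
  proof (induction s arbitrary: y)
    case (Suc s)
    have "gsum E f {..<Suc s} = f s \<boxplus> gsum E f {..<s}"
      unfolding lessThan_Suc using Suc.prems by (intro gsum_insert) auto
    moreover have "gsum E f {..<s} \<in> carrier E" "f s \<in> carrier E"
      using Suc.prems by (auto intro!: gsum_closed)
    ultimately show ?case using Suc by (simp add: add_ac)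
  qed simp
  have "gsum E f {..<s} \<in> carrier E" using assms by auto
  then show ?thesis using fold[of "szero E"] by (simp add: ssum_def)
qed

lemma subalg_gsum:
  assumes "subalg E S" "\<And>i. i \<in> I \<Longrightarrow> f i \<in> S"
  shows "gsum E f I \<in> S"
proof (cases "finite I")
  case True
  then show ?thesis using assms(2)
  proof (induction I rule: finite_induct)
    case (insert i I)
    have "f i \<in> carrier E" "\<And>j. j \<in> I \<Longrightarrow> f j \<in> carrier E"
      using insert assms(1) by (auto simp: subalg_def)
    then show ?case using insert assms(1) by (auto simp: subalg_def)
  qed (use assms in \<open>auto simp: subalg_def\<close>)
next
  \<comment> \<open>Over an infinite index set \<open>finprod\<close> returns the neutral element,
    which is zero here.\<close>
  case False
  then show ?thesis using assms
    by (simp add: gsum_def finprod_def subalg_def)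
qed

end

section \<open>*-homomorphisms\<close>

lemma star_homD:
  assumes "star_hom E E' f"
  shows "x \<in> carrier E \<Longrightarrow> f x \<in> carrier E'"
    "\<lbrakk>x \<in> carrier E; y \<in> carrier E\<rbrakk> \<Longrightarrow> f (sadd E x y) = sadd E' (f x) (f y)"
    "\<lbrakk>x \<in> carrier E; y \<in> carrier E\<rbrakk> \<Longrightarrow> f (smul E x y) = smul E' (f x) (f y)"
    "x \<in> carrier E \<Longrightarrow> f (sscale E c x) = sscale E' c (f x)"
    "x \<in> carrier E \<Longrightarrow> f (sadj E x) = sadj E' (f x)"
  using assms by (auto simp: star_hom_def)

lemma star_hom_zero:
  assumes "star_hom E E' f" "star_algebra E" "star_algebra E'"
  shows "f (szero E) = szero E'"
proof -
  interpret A: star_algebra E by fact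
  interpret B: star_algebra E' by fact
  have "f (sscale E 0 (szero E)) = sscale E' 0 (f (szero E))"
    by (rule star_homD(4)[OF assms(1)]) simp
  moreover have "f (szero E) \<in> carrier E'" by (rule star_homD(1)[OF assms(1)]) simp
  ultimately show ?thesis by (simp del: A.scale_zero_right add: A.scale_zero_left)
qed

lemma star_hom_gsum:
  assumes "star_hom E E' f" "star_algebra E" "star_algebra E'" "finite I"
    "\<And>i. i \<in> I \<Longrightarrow> g i \<in> carrier E"
  shows "f (gsum E g I) = gsum E' (\<lambda>i. f (g i)) I"
proof -
  interpret A: star_algebra E by fact
  interpret B: star_algebra E' by fact
  show ?thesis using assms(4,5)
    by (induction I rule: finite_induct)
      (auto simp: star_hom_zero[OF assms(1-3)] star_homD[OF assms(1)] A.gsum_closed)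
qed

lemma star_hom_comp:
  assumes "star_hom E E' f" "star_hom E' E'' g"
  shows "star_hom E E'' (\<lambda>x. g (f x))"
  using assms by (auto simp: star_hom_def Pi_iff)

lemma star_hom_projection:
  assumes "star_hom E E' f" "projection E p"
  shows "projection E' (f p)"
  using assms by (auto simp: projection_def star_hom_def) metis+

lemma star_hom_cong:
  assumes "star_hom E E' f" "star_algebra E" "\<And>x. x \<in> carrier E \<Longrightarrow> g x = f x"
  shows "star_hom E E' g"
proof -
  interpret star_algebra E by fact
  show ?thesis using assms(1,3) unfolding star_hom_def by (auto simp: Pi_iff)
qed


section \<open>Atomic projections and frames\<close>

text \<open>Zero is included: the atomic projections are those of rank at most one.\<close>

definition atomic :: "'a star_alg \<Rightarrow> 'a \<Rightarrow> bool" where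
  "atomic E p \<longleftrightarrow> projection E p
     \<and> (\<forall>x\<in>carrier E. \<exists>c. smul E (smul E p x) p = sscale E c p)"

definition orthogonal_family :: "'a star_alg \<Rightarrow> 'a set \<Rightarrow> bool" where
  "orthogonal_family E P \<longleftrightarrow> finite P \<and> (\<forall>p\<in>P. projection E p \<and> p \<noteq> szero E)
     \<and> (\<forall>p\<in>P. \<forall>q\<in>P. p \<noteq> q \<longrightarrow> smul E p q = szero E)"

text \<open>Maximality of the family is encoded by its sum being the unit. This is the form in which
  it is used: it expands every element into its corners \<open>p x q\<close>.\<close>

definition frame :: "'a star_alg \<Rightarrow> 'a set \<Rightarrow> bool" where
  "frame E P \<longleftrightarrow> orthogonal_family E P \<and> (\<forall>p\<in>P. atomic E p)
     \<and> is_unit_of E (carrier E) (gsum E (\<lambda>p. p) P)"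

text \<open>The first condition makes the involution proper and also excludes
  \<open>x\<^sup>\<star> x = - p\<close> for a projection \<open>p \<noteq> 0\<close>; this replaces the positivity of \<open>x\<^sup>\<star> x\<close>.\<close>

locale fd_star = star_algebra +
  assumes proper: "\<lbrakk>x \<in> carrier E; y \<in> carrier E;
      sadd E (smul E (sadj E x) x) (smul E (sadj E y) y) = szero E\<rbrakk> \<Longrightarrow> x = szero E"
    and findim: "\<exists>D. \<forall>x::nat \<Rightarrow> 'a. (\<forall>i\<le>D. x i \<in> carrier E) \<longrightarrow>
      (\<exists>c. (\<exists>i\<le>D. c i \<noteq> 0) \<and> gsum E (\<lambda>i. sscale E (c i) (x i)) {..D} = szero E)"

context star_algebra
begin

text \<open>Serves to show \<open>d^* d = 0\<close> for a difference \<open>d\<close>, after which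
  the proper involution gives \<open>d = 0\<close>.\<close>

lemma diff_mul_zero:
  assumes "a \<in> carrier E" "b \<in> carrier E" "d \<in> carrier E" "a \<boxtimes> d = szero E"
  shows "(a \<boxminus> b \<boxtimes> a) \<boxtimes> d = szero E"
  using assms by (simp add: mul_add_left mul_scale_left mul_assoc)

lemma unit_unique:
  assumes "is_unit_of E A e" "is_unit_of E A f"
  shows "e = f"
  using assms unfolding is_unit_of_def by metis

lemma unit_of_eq: "is_unit_of E A e \<Longrightarrow> unit_of E A = e"
  unfolding unit_of_def using unit_unique by blast

lemma projection_gsum:
  assumes "orthogonal_family E P"
  shows "projection E (gsum E (\<lambda>p. p) P)"
    and "p \<in> P \<Longrightarrow> gsum E (\<lambda>p. p) P \<boxtimes> p = p" and "p \<in> P \<Longrightarrow> p \<boxtimes> gsum E (\<lambda>p. p) P = p"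
proof -
  have fin: "finite P" and P: "\<And>p. p \<in> P \<Longrightarrow> projection E p"
    and orth: "\<And>p q. \<lbrakk>p \<in> P; q \<in> P; p \<noteq> q\<rbrakk> \<Longrightarrow> p \<boxtimes> q = szero E"
    using assms by (auto simp: orthogonal_family_def)
  have car: "\<And>p. p \<in> P \<Longrightarrow> p \<in> carrier E" using P by (auto simp: projection_def)
  let ?s = "gsum E (\<lambda>p. p) P"
  have s: "?s \<in> carrier E" using car by auto
  have r: "p \<boxtimes> ?s = p" if "p \<in> P" for p
  proof -
    have "p \<boxtimes> ?s = gsum E (\<lambda>q. p \<boxtimes> q) P" using fin car that by (intro gsum_mul_left) auto
    also have "\<dots> = p \<boxtimes> p" using fin that car orth by (intro gsum_single) auto
    finally show ?thesis using P[OF that] by (simp add: projection_def)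
  qed
  have adj: "?s\<^sup>\<star> = ?s"
  proof -
    have "?s\<^sup>\<star> = gsum E (\<lambda>p. p\<^sup>\<star>) P" using fin car by (intro gsum_adj) auto
    also have "\<dots> = ?s" using P car by (intro gsum_cong) (auto simp: projection_def)
    finally show ?thesis .
  qed
  show "p \<in> P \<Longrightarrow> p \<boxtimes> ?s = p" by (rule r)
  show "p \<in> P \<Longrightarrow> ?s \<boxtimes> p = p"
    using r[of p] adj adj_mul[of p ?s] s car P[of p] by (simp add: projection_def)
  have "?s \<boxtimes> ?s = gsum E (\<lambda>p. p \<boxtimes> ?s) P" using fin car s by (intro gsum_mul_right) auto
  also have "\<dots> = ?s" using r car by (intro gsum_cong) auto
  finally show "projection E ?s" using s adj by (simp add: projection_def)
qed

lemma frame_facts: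
  assumes "frame E P"
  shows "finite P" "p \<in> P \<Longrightarrow> p \<in> carrier E" "p \<in> P \<Longrightarrow> atomic E p" "p \<in> P \<Longrightarrow> projection E p"
    "p \<in> P \<Longrightarrow> p \<noteq> szero E" "\<lbrakk>p \<in> P; q \<in> P; p \<noteq> q\<rbrakk> \<Longrightarrow> p \<boxtimes> q = szero E"
    "is_unit_of E (carrier E) (gsum E (\<lambda>p. p) P)"
  using assms by (auto simp: frame_def orthogonal_family_def projection_def)

lemma frame_left:
  assumes "frame E P" "x \<in> carrier E"
  shows "x = gsum E (\<lambda>p. p \<boxtimes> x) P"
proof -
  note F = frame_facts[OF assms(1)]
  have "x = gsum E (\<lambda>p. p) P \<boxtimes> x" using F(7) assms(2) by (simp add: is_unit_of_def)
  also have "\<dots> = gsum E (\<lambda>p. p \<boxtimes> x) P" using F(1,2) assms by (intro gsum_mul_right) auto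
  finally show ?thesis .
qed

lemma frame_right:
  assumes "frame E P" "x \<in> carrier E"
  shows "x = gsum E (\<lambda>p. x \<boxtimes> p) P"
proof -
  note F = frame_facts[OF assms(1)]
  have "x = x \<boxtimes> gsum E (\<lambda>p. p) P" using F(7) assms(2) by (simp add: is_unit_of_def)
  also have "\<dots> = gsum E (\<lambda>p. x \<boxtimes> p) P" using F(1,2) assms by (intro gsum_mul_left) auto
  finally show ?thesis .
qed

lemma frame_both:
  assumes "frame E P" "x \<in> carrier E"
  shows "x = gsum E (\<lambda>p. gsum E (\<lambda>q. p \<boxtimes> x \<boxtimes> q) P) P"
proof -
  note F = frame_facts[OF assms(1)]
  have "gsum E (\<lambda>q. p \<boxtimes> x \<boxtimes> q) P = p \<boxtimes> x" if "p \<in> P" for p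
    using frame_right[OF assms(1), of "p \<boxtimes> x"] assms(2) that F(2) by simp
  then have "gsum E (\<lambda>p. gsum E (\<lambda>q. p \<boxtimes> x \<boxtimes> q) P) P = gsum E (\<lambda>p. p \<boxtimes> x) P"
    using assms(2) F(2) by (intro gsum_cong) auto
  then show ?thesis using frame_left[OF assms] by simp
qed

lemma frame_ext:
  assumes "frame E P" "x \<in> carrier E" "y \<in> carrier E"
    and "\<And>p q. \<lbrakk>p \<in> P; q \<in> P\<rbrakk> \<Longrightarrow> p \<boxtimes> x \<boxtimes> q = p \<boxtimes> y \<boxtimes> q"
  shows "x = y"
proof -
  note F = frame_facts[OF assms(1)]
  have "x = gsum E (\<lambda>p. gsum E (\<lambda>q. p \<boxtimes> x \<boxtimes> q) P) P" using frame_both assms by blast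
  also have "\<dots> = gsum E (\<lambda>p. gsum E (\<lambda>q. p \<boxtimes> y \<boxtimes> q) P) P"
    using assms F(2) by (intro gsum_cong) (auto intro!: gsum_closed gsum_cong)
  also have "\<dots> = y" using frame_both assms by metis
  finally show ?thesis .
qed

lemma orthogonal_family_insert:
  assumes "orthogonal_family E F" "projection E r" "r \<noteq> szero E"
    and "\<And>f. f \<in> F \<Longrightarrow> r \<boxtimes> f = szero E"
  shows "orthogonal_family E (insert r F)" "r \<notin> F"
proof -
  have "f \<boxtimes> r = szero E" if "f \<in> F" for f
    using adj_mul[of r f] assms that by (auto simp: orthogonal_family_def projection_def)
  then show "orthogonal_family E (insert r F)"
    using assms by (auto simp: orthogonal_family_def)
  show "r \<notin> F" using assms(2-4) by (metis projD(2))
qed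

lemma projection_diff:
  assumes "projection E p" "projection E r" "p \<boxtimes> r = r"
  shows "projection E (p \<boxminus> r)" "r \<boxtimes> p = r" "r \<boxtimes> (p \<boxminus> r) = szero E" "p \<boxtimes> (p \<boxminus> r) = p \<boxminus> r"
proof -
  note p = projD[OF assms(1)] and r = projD[OF assms(2)]
  show rp: "r \<boxtimes> p = r" using adj_mul[of p r] p r assms(3) by simp
  show 1: "r \<boxtimes> (p \<boxminus> r) = szero E"
    using p r rp by (simp add: mul_add_right mul_scale_right)
  show 2: "p \<boxtimes> (p \<boxminus> r) = p \<boxminus> r"
    using p r assms(3) by (simp add: mul_add_right mul_scale_right)
  have "(p \<boxminus> r) \<boxtimes> (p \<boxminus> r) = p \<boxminus> r"
    using p r 1 2 by (simp add: mul_add_left[of p] mul_scale_left)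
  moreover have "(p \<boxminus> r)\<^sup>\<star> = p \<boxminus> r" using p r by (simp add: adj_add adj_scale)
  ultimately show "projection E (p \<boxminus> r)" using p r by (simp add: projection_def)
qed

section \<open>Polynomial calculus in a corner\<close>

primrec powers :: "'a \<Rightarrow> 'a \<Rightarrow> nat \<Rightarrow> 'a" where
  "powers e h 0 = e"
| "powers e h (Suc n) = h \<boxtimes> powers e h n"

text \<open>Horner evaluation at \<open>h\<close>, with \<open>e\<close> in the role of the constant
  1. In the application \<open>e\<close> is the unit of a corner, in general not of the whole
  algebra.\<close>

definition poly_eval :: "'a \<Rightarrow> 'a \<Rightarrow> complex poly \<Rightarrow> 'a" where
  "poly_eval e h q = fold_coeffs (\<lambda>a z. a \<cdot> e \<boxplus> h \<boxtimes> z) q (szero E)"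

context
  fixes e h
  assumes eh: "e \<in> carrier E" "h \<in> carrier E"
begin

lemma powers_closed [simp]: "powers e h n \<in> carrier E"
  using eh by (induction n) auto

lemma poly_eval_0 [simp]: "poly_eval e h 0 = szero E"
  by (simp add: poly_eval_def)

lemma poly_eval_pCons: "poly_eval e h (pCons a q) = a \<cdot> e \<boxplus> h \<boxtimes> poly_eval e h q"
  using eh by (cases "q = 0 \<and> a = 0") (auto simp: poly_eval_def)

lemma poly_eval_closed [simp]: "poly_eval e h q \<in> carrier E"
  using eh by (induction q) (auto simp: poly_eval_pCons)

lemma poly_eval_add: "poly_eval e h (p + q) = poly_eval e h p \<boxplus> poly_eval e h q"
proof (induction p arbitrary: q)
  case (pCons a p)
  obtain b q' where "q = pCons b q'" by (cases q)
  then show ?case using pCons eh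
    by (simp add: poly_eval_pCons scale_add_left mul_add_right add_ac)
qed simp

lemma poly_eval_smult: "poly_eval e h (smult c p) = c \<cdot> poly_eval e h p"
  using eh by (induction p) (simp_all add: poly_eval_pCons scale_add_right scale_scale mul_scale_right)

lemma poly_eval_monom: "poly_eval e h (monom c i) = c \<cdot> powers e h i"
  using eh by (induction i) (simp_all add: monom_Suc poly_eval_pCons monom_0 mul_scale_right)

lemma poly_eval_sum_monom:
  "finite I \<Longrightarrow> poly_eval e h (\<Sum>i\<in>I. monom (c i) i) = gsum E (\<lambda>i. c i \<cdot> powers e h i) I"
  by (induction I rule: finite_induct) (simp_all add: poly_eval_add poly_eval_monom)

text \<open>Since \<open>w\<close> is an eigenvector of left multiplication by \<open>h\<close>, a
  polynomial in \<open>h\<close> acts on it by its value at the eigenvalue.\<close>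

lemma poly_eval_eigen:
  assumes w: "w \<in> carrier E" "h \<boxtimes> w = l \<cdot> w" "e \<boxtimes> w = w"
  shows "poly_eval e h q \<boxtimes> w = poly q l \<cdot> w"
proof (induction q)
  case (pCons a q)
  then show ?case using eh w
    by (simp add: poly_eval_pCons mul_add_left mul_scale_left mul_assoc mul_scale_right scale_scale scale_add_left mult.commute)
qed (use w in simp)

end

end

section \<open>Minimal projections in finite-dimensional star-algebras\<close>

context fd_star
begin

lemma proper0: "\<lbrakk>x \<in> carrier E; x\<^sup>\<star> \<boxtimes> x = szero E\<rbrakk> \<Longrightarrow> x = szero E"
  using proper[of x "szero E"] by simp

text \<open>Self-adjointness of \<open>x^* x\<close> makes \<open>l\<close> real. If
  \<open>l\<close> were negative, then with \<open>c = sqrt (- l)\<close> the sum of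
  \<open>x^* x\<close> and \<open>(c p)^* (c p)\<close> would vanish, and properness would force
  \<open>x = 0\<close>.\<close>

lemma positive:
  assumes x: "x \<in> carrier E" and p: "projection E p" "p \<noteq> szero E" and l: "x\<^sup>\<star> \<boxtimes> x = l \<cdot> p"
  shows "\<exists>r\<ge>0. l = of_real r"
proof -
  note P = projD[OF p(1)]
  have "(x\<^sup>\<star> \<boxtimes> x)\<^sup>\<star> = x\<^sup>\<star> \<boxtimes> x" using x by (simp add: adj_mul)
  then have "cnj l = l" using l P p(2) scale_left_inject[of p] by (simp add: adj_scale)
  then obtain r where r: "l = of_real r" by (metis Reals_cases Reals_cnj_iff)
  have "r \<ge> 0"
  proof (rule ccontr)
    assume neg: "\<not> r \<ge> 0"
    define c where "c = complex_of_real (sqrt (-r))"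
    have c: "cnj c * c = - l" using neg r by (simp add: c_def flip: of_real_mult)
    have "(c \<cdot> p)\<^sup>\<star> \<boxtimes> (c \<cdot> p) = (-l) \<cdot> p"
      using P c by (simp add: adj_scale mul_scale_left mul_scale_right scale_scale mult.commute)
    then have "x\<^sup>\<star> \<boxtimes> x \<boxplus> (c \<cdot> p)\<^sup>\<star> \<boxtimes> (c \<cdot> p) = szero E"
      using l P by (simp flip: scale_add_left)
    then have "x = szero E" using proper[of x "c \<cdot> p"] x P by simp
    then show False using l P p(2) scale_eq_zero[of p l] r neg x by auto
  qed
  then show ?thesis using r by blast
qed

lemma atomicD:
  assumes "atomic E p"
  shows "projection E p" "x \<in> carrier E \<Longrightarrow> \<exists>c. p \<boxtimes> x \<boxtimes> p = c \<cdot> p"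
  using assms by (auto simp: atomic_def)

lemma atomic_zero [simp]: "atomic E (szero E)"
  by (auto simp: atomic_def)

text \<open>Murray-von Neumann equivalence from one nonzero corner element. Atomicity gives
  \<open>x x^* = l p\<close> and \<open>x^* x = m q\<close>; evaluating \<open>x x^* x\<close> in
  two ways gives \<open>l = m\<close>, which is positive, and \<open>c = 1 / sqrt m\<close>
  normalises \<open>x\<close>.\<close>

lemma atomic_equivalence:
  assumes p: "atomic E p" "p \<noteq> szero E" and q: "atomic E q" "q \<noteq> szero E"
    and x: "x \<in> carrier E" "p \<boxtimes> x = x" "x \<boxtimes> q = x" "x \<noteq> szero E"
  shows "\<exists>c. c \<noteq> 0 \<and> (c \<cdot> x) \<boxtimes> (c \<cdot> x)\<^sup>\<star> = p \<and> (c \<cdot> x)\<^sup>\<star> \<boxtimes> (c \<cdot> x) = q"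
proof -
  note P = projD[OF atomicD(1)[OF p(1)]] and Q = projD[OF atomicD(1)[OF q(1)]]
  obtain l where l: "p \<boxtimes> (x \<boxtimes> x\<^sup>\<star>) \<boxtimes> p = l \<cdot> p" using atomicD(2)[OF p(1), of "x \<boxtimes> x\<^sup>\<star>"] x by auto
  obtain m where m: "q \<boxtimes> (x\<^sup>\<star> \<boxtimes> x) \<boxtimes> q = m \<cdot> q" using atomicD(2)[OF q(1), of "x\<^sup>\<star> \<boxtimes> x"] x by auto
  have a1: "x\<^sup>\<star> \<boxtimes> p = x\<^sup>\<star>" using adj_mul[of p x] x P by simp
  have a2: "q \<boxtimes> x\<^sup>\<star> = x\<^sup>\<star>" using adj_mul[of x q] x Q by simp
  have l': "x \<boxtimes> x\<^sup>\<star> = l \<cdot> p" using l x P a1 by (simp add: mul_assoc) (simp add: x(2) mul_assoc[symmetric])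
  have m': "x\<^sup>\<star> \<boxtimes> x = m \<cdot> q" using m x Q a2 by (simp add: mul_assoc) (simp add: a2 mul_assoc[symmetric])
  have "l \<cdot> x = x \<boxtimes> x\<^sup>\<star> \<boxtimes> x" using l' x P by (simp add: mul_scale_left)
  also have "\<dots> = m \<cdot> x" using m' x Q by (simp add: mul_assoc mul_scale_right)
  finally have lm: "l = m" using scale_left_inject x by blast
  obtain r where r: "r \<ge> 0" "m = of_real r" using positive[OF x(1) atomicD(1)[OF q(1)] q(2) m'] by auto
  have "m \<noteq> 0" using proper0[OF x(1)] m' x(4) Q by auto
  then have r0: "r > 0" using r by auto
  define c where "c = complex_of_real (1 / sqrt r)"
  have c: "c * cnj c = 1 / m" "c \<noteq> 0" using r0 r by (simp_all add: c_def flip: of_real_mult)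
  have cm: "c * (cnj c * m) = 1" "c * (cnj c * l) = 1" using c \<open>m \<noteq> 0\<close> lm by (simp_all flip: mult.assoc)
  show ?thesis
    using c cm l' m' x P Q \<open>m \<noteq> 0\<close> lm
    by (intro exI[of _ c]) (simp add: adj_scale mul_scale_left mul_scale_right scale_scale mult.left_commute mult.commute)
qed

text \<open>All claims follow from \<open>u q = u\<close>. The difference \<open>d\<close> of
  \<open>u\<close> and \<open>u q\<close> is annihilated on the left by \<open>u^*\<close>, hence
  \<open>d^* d = 0\<close>, and the involution is proper.\<close>

lemma partial_isometry_absorb:
  assumes u: "u \<in> carrier E" "u\<^sup>\<star> \<boxtimes> u = q" and q: "projection E q"
  shows "u \<boxtimes> q = u" "q \<boxtimes> u\<^sup>\<star> = u\<^sup>\<star>" "projection E (u \<boxtimes> u\<^sup>\<star>)" "u \<boxtimes> u\<^sup>\<star> \<boxtimes> u = u"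
proof -
  note Q = projD[OF q]
  let ?d = "u \<boxminus> u \<boxtimes> q"
  have 1: "u\<^sup>\<star> \<boxtimes> ?d = szero E"
    using u Q by (simp add: mul_add_right mul_scale_right mul_assoc[symmetric])
  have "?d\<^sup>\<star> = u\<^sup>\<star> \<boxminus> q \<boxtimes> u\<^sup>\<star>" using u Q by (simp add: adj_add adj_scale adj_mul)
  moreover have "(u\<^sup>\<star> \<boxminus> q \<boxtimes> u\<^sup>\<star>) \<boxtimes> ?d = szero E"
    by (rule diff_mul_zero) (use u(1) Q 1 in auto)
  ultimately have "?d\<^sup>\<star> \<boxtimes> ?d = szero E" by (simp only:)
  then have "?d = szero E" by (rule proper0[rotated]) (simp add: u(1) Q(1))
  then show uq: "u \<boxtimes> q = u" using diff_eq_zero[of u "u \<boxtimes> q"] u Q by simp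
  then show qu: "q \<boxtimes> u\<^sup>\<star> = u\<^sup>\<star>" using adj_mul[of u q] u Q by simp
  have "u \<boxtimes> u\<^sup>\<star> \<boxtimes> (u \<boxtimes> u\<^sup>\<star>) = u \<boxtimes> (u\<^sup>\<star> \<boxtimes> u \<boxtimes> u\<^sup>\<star>)" using u(1) by (simp add: mul_assoc)
  then have "u \<boxtimes> u\<^sup>\<star> \<boxtimes> (u \<boxtimes> u\<^sup>\<star>) = u \<boxtimes> u\<^sup>\<star>" using u qu by simp
  then show "projection E (u \<boxtimes> u\<^sup>\<star>)" using u by (simp add: projection_def adj_mul)
  show "u \<boxtimes> u\<^sup>\<star> \<boxtimes> u = u" using u uq by (simp add: mul_assoc)
qed

text \<open>Compressing \<open>x\<close> by \<open>u u^*\<close> amounts to compressing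
  \<open>u^* x u\<close> by \<open>q\<close>, so minimality is invariant under Murray-von Neumann
  equivalence.\<close>

lemma atomic_transfer:
  assumes u: "u \<in> carrier E" "u\<^sup>\<star> \<boxtimes> u = q" and q: "atomic E q"
  shows "atomic E (u \<boxtimes> u\<^sup>\<star>)"
proof -
  note Q = projD[OF atomicD(1)[OF q]]
  note A = partial_isometry_absorb[OF u atomicD(1)[OF q]]
  have "\<exists>c. u \<boxtimes> u\<^sup>\<star> \<boxtimes> x \<boxtimes> (u \<boxtimes> u\<^sup>\<star>) = c \<cdot> (u \<boxtimes> u\<^sup>\<star>)" if x: "x \<in> carrier E" for x
  proof -
    obtain c where c: "q \<boxtimes> (u\<^sup>\<star> \<boxtimes> x \<boxtimes> u) \<boxtimes> q = c \<cdot> q"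
      using atomicD(2)[OF q, of "u\<^sup>\<star> \<boxtimes> x \<boxtimes> u"] u x by auto
    have "q \<boxtimes> (u\<^sup>\<star> \<boxtimes> x \<boxtimes> u) \<boxtimes> q = (q \<boxtimes> u\<^sup>\<star>) \<boxtimes> x \<boxtimes> (u \<boxtimes> q)"
      using u(1) Q x by (simp add: mul_assoc)
    then have c': "u\<^sup>\<star> \<boxtimes> x \<boxtimes> u = c \<cdot> q" using c A by simp
    have "u \<boxtimes> u\<^sup>\<star> \<boxtimes> x \<boxtimes> (u \<boxtimes> u\<^sup>\<star>) = u \<boxtimes> (u\<^sup>\<star> \<boxtimes> x \<boxtimes> u) \<boxtimes> u\<^sup>\<star>"
      using u(1) x by (simp add: mul_assoc)
    also have "\<dots> = c \<cdot> (u \<boxtimes> u\<^sup>\<star>)"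
      using c' u(1) Q A by (simp add: mul_scale_left mul_scale_right)
    finally show ?thesis by blast
  qed
  then show ?thesis using A(3) by (simp add: atomic_def)
qed

text \<open>Multiplying by \<open>u^*\<close> moves \<open>y\<close> into the scalar corner of
  \<open>p\<close>; multiplying by \<open>u\<close> moves it back.\<close>

lemma corner_one_dim:
  assumes u: "u \<in> carrier E" "u \<boxtimes> u\<^sup>\<star> = p" "u\<^sup>\<star> \<boxtimes> u = q" and p: "atomic E p" "projection E q"
    and y: "y \<in> carrier E" "p \<boxtimes> y = y" "y \<boxtimes> q = y"
  shows "\<exists>c. y = c \<cdot> u"
proof -
  note P = projD[OF atomicD(1)[OF p(1)]]
  obtain c where c: "p \<boxtimes> (y \<boxtimes> u\<^sup>\<star>) \<boxtimes> p = c \<cdot> p" using atomicD(2)[OF p(1), of "y \<boxtimes> u\<^sup>\<star>"] u y by auto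
  have u': "u\<^sup>\<star> \<boxtimes> p = u\<^sup>\<star>" "p \<boxtimes> u = u"
    using partial_isometry_absorb[of "u\<^sup>\<star>" p] u atomicD(1)[OF p(1)] by simp_all
  have "p \<boxtimes> (y \<boxtimes> u\<^sup>\<star>) \<boxtimes> p = p \<boxtimes> y \<boxtimes> (u\<^sup>\<star> \<boxtimes> p)" using u(1) y(1) P by (simp add: mul_assoc)
  then have "y \<boxtimes> u\<^sup>\<star> = c \<cdot> p" using c u' y by simp
  then have "y \<boxtimes> u\<^sup>\<star> \<boxtimes> u = c \<cdot> u" using u(1) P u' by (simp add: mul_scale_left)
  moreover have "y \<boxtimes> u\<^sup>\<star> \<boxtimes> u = y" using u y by (simp add: mul_assoc)
  ultimately show ?thesis by auto
qed

text \<open>Nonzero orthogonal projections are linearly independent: multiplying a dependence by one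
  of them isolates its coefficient. The dimension therefore bounds their number.\<close>

lemma orthogonal_family_bound: "\<exists>D. \<forall>F. orthogonal_family E F \<longrightarrow> card F \<le> D"
proof -
  obtain D where D: "\<And>x::nat \<Rightarrow> 'a. (\<forall>i\<le>D. x i \<in> carrier E) \<Longrightarrow>
      (\<exists>c. (\<exists>i\<le>D. c i \<noteq> 0) \<and> gsum E (\<lambda>i. sscale E (c i) (x i)) {..D} = szero E)"
    using findim by blast
  have "card F \<le> D" if F: "orthogonal_family E F" for F
  proof (rule ccontr)
    assume "\<not> card F \<le> D"
    then have "card {..D} \<le> card F" by simp
    moreover have "finite F" using F by (simp add: orthogonal_family_def)
    ultimately obtain x where x: "x ` {..D} \<subseteq> F" "inj_on x {..D}" by (metis card_le_inj finite_atMost)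
    have xc: "x i \<in> carrier E" if "i \<le> D" for i
      using x that F by (auto simp: orthogonal_family_def projection_def)
    then obtain c j where c: "j \<le> D" "c j \<noteq> 0" "gsum E (\<lambda>i. c i \<cdot> x i) {..D} = szero E"
      using D[of x] by auto
    have xx: "x j \<boxtimes> x i = szero E" if "i \<le> D" "i \<noteq> j" for i
    proof -
      have "x i \<noteq> x j" using that x(2) c(1) by (auto simp: inj_on_def)
      moreover have "x i \<in> F" "x j \<in> F" using x(1) that c(1) by auto
      ultimately show ?thesis using F unfolding orthogonal_family_def by metis
    qed
    have "x j \<in> F" using x c by auto
    then have pj: "projection E (x j)" "x j \<noteq> szero E" using F by (auto simp: orthogonal_family_def)
    have "szero E = x j \<boxtimes> gsum E (\<lambda>i. c i \<cdot> x i) {..D}" using c xc by simp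
    also have "\<dots> = gsum E (\<lambda>i. x j \<boxtimes> (c i \<cdot> x i)) {..D}"
      using xc c(1) by (intro gsum_mul_left) auto
    also have "\<dots> = x j \<boxtimes> (c j \<cdot> x j)"
      by (rule gsum_single) (use c(1) xc xx in \<open>auto simp: mul_scale_right\<close>)
    also have "\<dots> = c j \<cdot> x j" using pj xc[OF c(1)] by (simp add: mul_scale_right projection_def)
    finally show False using scale_eq_zero[of "x j" "c j"] c pj xc by simp
  qed
  then show ?thesis by blast
qed

text \<open>An algebraic spectral theorem. If \<open>l\<close> is a root of the minimal polynomial
  of \<open>h\<close> in the corner of \<open>e\<close> and \<open>g\<close> is the cofactor of
  \<open>X - l\<close>, then \<open>g\<close> evaluated at \<open>h\<close> is, up to a scalar, a
  nonzero spectral projection for the eigenvalue \<open>l\<close>. As \<open>e\<close> cannot be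
  split, this projection is \<open>e\<close>, and so \<open>h = l e\<close>.\<close>

lemma unsplittable_selfadjoint:
  assumes e: "projection E e" "e \<noteq> szero E"
    and unsplit: "\<And>r. \<lbrakk>projection E r; e \<boxtimes> r = r\<rbrakk> \<Longrightarrow> r = szero E \<or> r = e"
    and h: "h \<in> carrier E" "h\<^sup>\<star> = h" "e \<boxtimes> h = h" "h \<boxtimes> e = h"
  shows "\<exists>c. h = c \<cdot> e"
proof -
  note e' = projD[OF e(1)]
  note cl = poly_eval_closed[OF e'(1) h(1)] powers_closed[OF e'(1) h(1)]
  note ev = poly_eval_0[OF e'(1) h(1)] poly_eval_pCons[OF e'(1) h(1)] poly_eval_add[OF e'(1) h(1)]
    poly_eval_smult[OF e'(1) h(1)] poly_eval_sum_monom[OF e'(1) h(1)]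
  \<comment> \<open>The part of the bicommutant of \<open>h\<close> and \<open>e\<close> that lies
    in the corner. It is commutative, closed under adjoints because \<open>h\<close> and
    \<open>e\<close> are self-adjoint, and contains every polynomial in \<open>h\<close>; so such
    polynomials are normal.\<close>
  define Z where "Z = {z \<in> carrier E. e \<boxtimes> z = z \<and> z \<boxtimes> e = z \<and>
     (\<forall>w\<in>carrier E. w \<boxtimes> h = h \<boxtimes> w \<and> w \<boxtimes> e = e \<boxtimes> w \<longrightarrow> z \<boxtimes> w = w \<boxtimes> z)}"
  have Zc: "z \<in> carrier E" "e \<boxtimes> z = z" "z \<boxtimes> e = z" if "z \<in> Z" for z
    using that by (auto simp: Z_def)
  have Zcomm: "z \<boxtimes> w = w \<boxtimes> z" if "z \<in> Z" "w \<in> Z" for z w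
  proof -
    have "w \<boxtimes> h = h \<boxtimes> w" using \<open>w \<in> Z\<close> h unfolding Z_def by auto
    then show ?thesis using that Zc[OF that(2)] unfolding Z_def by auto
  qed
  have Zadd: "z \<boxplus> w \<in> Z" if "z \<in> Z" "w \<in> Z" for z w
    using that e' by (auto simp: Z_def mul_add_left mul_add_right)
  have Zscale: "c \<cdot> z \<in> Z" if "z \<in> Z" for c z
    using that e' by (auto simp: Z_def mul_scale_left mul_scale_right)
  have Zmul: "z \<boxtimes> w \<in> Z" if "z \<in> Z" "w \<in> Z" for z w
  proof -
    have "z \<boxtimes> w \<boxtimes> v = v \<boxtimes> (z \<boxtimes> w)" if "v \<in> carrier E" "v \<boxtimes> h = h \<boxtimes> v" "v \<boxtimes> e = e \<boxtimes> v" for v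
    proof -
      have "z \<boxtimes> v = v \<boxtimes> z" "w \<boxtimes> v = v \<boxtimes> w" using that \<open>z \<in> Z\<close> \<open>w \<in> Z\<close> by (auto simp: Z_def)
      then show ?thesis using Zc[OF \<open>z \<in> Z\<close>] Zc[OF \<open>w \<in> Z\<close>] that(1)
        by (metis mul_assoc)
    qed
    moreover have "e \<boxtimes> (z \<boxtimes> w) = z \<boxtimes> w" "z \<boxtimes> w \<boxtimes> e = z \<boxtimes> w"
      using Zc[OF \<open>z \<in> Z\<close>] Zc[OF \<open>w \<in> Z\<close>] e' by (metis mul_assoc)+
    ultimately show ?thesis using Zc[OF \<open>z \<in> Z\<close>] Zc[OF \<open>w \<in> Z\<close>] by (auto simp: Z_def)
  qed
  have Zadj: "z\<^sup>\<star> \<in> Z" if "z \<in> Z" for z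
  proof -
    have "z\<^sup>\<star> \<boxtimes> v = v \<boxtimes> z\<^sup>\<star>" if v: "v \<in> carrier E" "v \<boxtimes> h = h \<boxtimes> v" "v \<boxtimes> e = e \<boxtimes> v" for v
    proof -
      have "v\<^sup>\<star> \<boxtimes> h = h \<boxtimes> v\<^sup>\<star>" "v\<^sup>\<star> \<boxtimes> e = e \<boxtimes> v\<^sup>\<star>"
        using v h e' adj_mul[of v h] adj_mul[of h v] adj_mul[of v e] adj_mul[of e v] by simp_all
      then have "z \<boxtimes> v\<^sup>\<star> = v\<^sup>\<star> \<boxtimes> z" using \<open>z \<in> Z\<close> v by (auto simp: Z_def)
      then show ?thesis using adj_mul[of z "v\<^sup>\<star>"] adj_mul[of "v\<^sup>\<star>" z] v Zc[OF \<open>z \<in> Z\<close>] by simp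
    qed
    moreover have "e \<boxtimes> z\<^sup>\<star> = z\<^sup>\<star>" "z\<^sup>\<star> \<boxtimes> e = z\<^sup>\<star>"
      using Zc[OF that] e' adj_mul[of z e] adj_mul[of e z] by simp_all
    ultimately show ?thesis using Zc[OF that] by (auto simp: Z_def)
  qed
  have eZ: "e \<in> Z" using e' by (auto simp: Z_def)
  have hZ: "h \<in> Z" using h by (auto simp: Z_def)
  have zZ: "szero E \<in> Z" using e' by (auto simp: Z_def)
  have evZ: "poly_eval e h q \<in> Z" for q
    by (induction q) (auto simp: ev zZ intro!: Zadd Zscale Zmul eZ hZ)
  obtain D where D: "\<And>x::nat \<Rightarrow> 'a. (\<forall>i\<le>D. x i \<in> carrier E) \<Longrightarrow>
      (\<exists>c. (\<exists>i\<le>D. c i \<noteq> 0) \<and> gsum E (\<lambda>i. sscale E (c i) (x i)) {..D} = szero E)"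
    using findim by blast
  then obtain c j where c: "j \<le> D" "c j \<noteq> 0" "gsum E (\<lambda>i. c i \<cdot> powers e h i) {..D} = szero E"
    using cl by meson
  define q0 where "q0 = (\<Sum>i\<le>D. monom (c i) i)"
  have "coeff q0 j = c j" using c(1) by (simp add: q0_def coeff_sum coeff_monom if_distrib sum.delta cong: if_cong)
  then have "q0 \<noteq> 0 \<and> poly_eval e h q0 = szero E" using c ev(5)[of "{..D}" c] by (auto simp: q0_def)
  \<comment> \<open>An annihilating polynomial exists because too many powers of \<open>h\<close>
    are linearly dependent; one of least degree plays the role of the minimal polynomial. Least
    degree makes its cofactor \<open>g\<close> nonzero at \<open>h\<close>.\<close>
  then obtain q where q: "q \<noteq> 0" "poly_eval e h q = szero E"
    and qmin: "\<And>g. \<lbrakk>g \<noteq> 0; poly_eval e h g = szero E\<rbrakk> \<Longrightarrow> degree q \<le> degree g"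
    using ex_has_least_nat[of "\<lambda>q. q \<noteq> 0 \<and> poly_eval e h q = szero E" q0 degree] by auto
  have "degree q \<noteq> 0"
  proof
    assume "degree q = 0"
    then obtain a where a: "q = [:a:]" by (auto elim: degree_eq_zeroE)
    then have "a \<cdot> e = szero E" using q(2) e' h by (simp add: ev)
    then show False using scale_eq_zero e' e(2) a q(1) by auto
  qed
  then obtain l where "poly q l = 0"
    using fundamental_theorem_of_algebra[of q] constant_degree[of q] by auto
  then obtain g where g: "q = [:- l, 1:] * g" by (metis dvdE poly_eq_0_iff_dvd)
  have g0: "g \<noteq> 0" using g q by auto
  then have deg: "degree q = Suc (degree g)" unfolding g using degree_mult_eq[of "[:- l, 1:]" g] by simp
  define w where "w = poly_eval e h g"
  have wZ: "w \<in> Z" using evZ w_def by simp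
  note w = Zc[OF wZ] and w' = Zc[OF Zadj[OF wZ]]
  have w0: "w \<noteq> szero E" using qmin[OF g0] deg by (auto simp: w_def)
  have "q = smult (-l) g + pCons 0 g" using g by simp
  then have "poly_eval e h (smult (-l) g + pCons 0 g) = szero E" using q(2) by metis
  then have "(-l) \<cdot> w \<boxplus> h \<boxtimes> w = szero E"
    unfolding ev(3) ev(4) using cl h e' by (simp add: ev w_def)
  then have "h \<boxtimes> w \<boxminus> l \<cdot> w = szero E"
    using w h e' by (simp add: scale_scale add_comm)
  then have hw: "h \<boxtimes> w = l \<cdot> w" using diff_eq_zero w h by blast
  have ww: "w \<boxtimes> w = poly g l \<cdot> w"
    unfolding w_def using poly_eval_eigen[OF e'(1) h(1), of "poly_eval e h g" l g] cl hw w w_def by simp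
  have "w \<boxtimes> w \<noteq> szero E"
  proof
    assume z: "w \<boxtimes> w = szero E"
    \<comment> \<open>By normality of \<open>w\<close>, a vanishing square of \<open>w\<close> makes
      the self-adjoint element \<open>w^* w\<close> square to zero; properness, applied twice, then
      kills \<open>w\<close>.\<close>
    let ?v = "w\<^sup>\<star> \<boxtimes> w"
    have "?v \<boxtimes> ?v = w\<^sup>\<star> \<boxtimes> (w \<boxtimes> w\<^sup>\<star>) \<boxtimes> w" using w(1) w'(1) by (simp add: mul_assoc)
    also have "\<dots> = w\<^sup>\<star> \<boxtimes> (w\<^sup>\<star> \<boxtimes> w) \<boxtimes> w" using Zcomm[OF wZ Zadj[OF wZ]] by simp
    also have "\<dots> = w\<^sup>\<star> \<boxtimes> w\<^sup>\<star> \<boxtimes> (w \<boxtimes> w)" using w(1) w'(1) by (simp add: mul_assoc)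
    finally have "?v\<^sup>\<star> \<boxtimes> ?v = szero E" using w(1) z by (simp add: adj_mul)
    then have "?v = szero E" by (rule proper0[rotated]) (simp add: w(1))
    then show False using proper0 w(1) w0 by blast
  qed
  then have gl: "poly g l \<noteq> 0" using ww w by auto
  \<comment> \<open>From \<open>h w = l w\<close> one gets that \<open>w\<close> squared is
    \<open>poly g l\<close> times \<open>w\<close>, so this rescaling is idempotent.\<close>
  define p where "p = (1 / poly g l) \<cdot> w"
  have pZ: "p \<in> Z" using Zscale wZ p_def by simp
  note p = Zc[OF pZ] and p' = Zc[OF Zadj[OF pZ]]
  have pp: "p \<boxtimes> p = p" using w gl ww by (simp add: p_def mul_scale_left mul_scale_right scale_scale)
  have p0: "p \<noteq> szero E" using scale_eq_zero w w0 gl by (simp add: p_def)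
  have comm: "p \<boxtimes> p\<^sup>\<star> = p\<^sup>\<star> \<boxtimes> p" using Zcomm pZ Zadj by blast
  have pp': "p\<^sup>\<star> \<boxtimes> p\<^sup>\<star> = p\<^sup>\<star>" using adj_mul[of p p] pp p by simp
  have "p\<^sup>\<star> = p"
  proof -
    \<comment> \<open>A normal idempotent is self-adjoint: the difference of \<open>p\<close> and
      \<open>p^* p\<close> vanishes by properness, and \<open>p^* p\<close> is self-adjoint.\<close>
    let ?d = "p \<boxminus> p\<^sup>\<star> \<boxtimes> p"
    have "p\<^sup>\<star> \<boxtimes> ?d = szero E"
      using p p' pp' by (simp add: mul_add_right mul_scale_right mul_assoc[symmetric])
    moreover have "?d\<^sup>\<star> = p\<^sup>\<star> \<boxminus> p \<boxtimes> p\<^sup>\<star>" using p p' comm by (simp add: adj_add adj_scale adj_mul)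
    moreover have "(p\<^sup>\<star> \<boxminus> p \<boxtimes> p\<^sup>\<star>) \<boxtimes> ?d = szero E"
      by (rule diff_mul_zero) (use p p' calculation in auto)
    ultimately have "?d\<^sup>\<star> \<boxtimes> ?d = szero E" by (simp only:)
    then have "?d = szero E" by (rule proper0[rotated]) (simp add: p p')
    then have "p = p\<^sup>\<star> \<boxtimes> p" using diff_eq_zero[of p "p\<^sup>\<star> \<boxtimes> p"] p p' by simp
    then show ?thesis using adj_mul[of "p\<^sup>\<star>" p] p p' by simp
  qed
  then have "projection E p" using p pp by (simp add: projection_def)
  then have "p = e" using unsplit p p0 by blast
  then have "h = h \<boxtimes> p" using h by simp
  also have "\<dots> = l \<cdot> p" using hw w h
    by (simp add: p_def mul_scale_right scale_scale mult.commute)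
  finally show ?thesis using \<open>p = e\<close> by blast
qed

text \<open>A general element of the corner is \<open>a + i b\<close> with self-adjoint
  \<open>a\<close> and \<open>b\<close> in the corner, so scalar self-adjoint elements force a
  scalar corner.\<close>

lemma selfadjoint_scalar_atomic:
  assumes e: "projection E e"
    and sa: "\<And>h. \<lbrakk>h \<in> carrier E; h\<^sup>\<star> = h; e \<boxtimes> h = h; h \<boxtimes> e = h\<rbrakk> \<Longrightarrow> \<exists>c. h = c \<cdot> e"
  shows "atomic E e"
proof -
  note e' = projD[OF e]
  have "\<exists>c. e \<boxtimes> x \<boxtimes> e = c \<cdot> e" if x: "x \<in> carrier E" for x
  proof -
    define y where "y = e \<boxtimes> x \<boxtimes> e"
    have y: "y \<in> carrier E" "e \<boxtimes> y = y" "y \<boxtimes> e = y" 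
      using x e' by (simp_all add: y_def mul_assoc proj_absorb[OF e])
    have y': "e \<boxtimes> y\<^sup>\<star> = y\<^sup>\<star>" "y\<^sup>\<star> \<boxtimes> e = y\<^sup>\<star>"
      using adj_mul[of y e] adj_mul[of e y] y e' by simp_all
    define a where "a = (1/2) \<cdot> (y \<boxplus> y\<^sup>\<star>)"
    define b where "b = (-\<i>/2) \<cdot> (y \<boxminus> y\<^sup>\<star>)"
    obtain \<alpha> where \<alpha>: "a = \<alpha> \<cdot> e"
    proof (rule exE[OF sa[of a]])
      show "a \<in> carrier E" "a\<^sup>\<star> = a" "e \<boxtimes> a = a" "a \<boxtimes> e = a"
        using y y' e' by (auto simp: a_def adj_scale adj_add mul_scale_left mul_scale_right mul_add_left mul_add_right add_comm)
    qed blast+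
    obtain \<beta> where \<beta>: "b = \<beta> \<cdot> e"
    proof (rule exE[OF sa[of b]])
      have "b\<^sup>\<star> = (\<i>/2) \<cdot> (y\<^sup>\<star> \<boxminus> y)" using y by (simp add: b_def adj_scale adj_add)
      also have "\<dots> = b" using y by (simp add: b_def scale_add_right scale_scale add_comm)
      finally show "b\<^sup>\<star> = b" .
      show "b \<in> carrier E" "e \<boxtimes> b = b" "b \<boxtimes> e = b"
        using y y' e' by (auto simp: b_def mul_scale_left mul_scale_right mul_add_left mul_add_right)
    qed blast+
    have "\<i> \<cdot> b = (1/2) \<cdot> y \<boxplus> (-1/2) \<cdot> y\<^sup>\<star>" using y by (simp add: b_def scale_scale scale_add_right)
    moreover have "a = (1/2) \<cdot> y \<boxplus> (1/2) \<cdot> y\<^sup>\<star>" using y by (simp add: a_def scale_add_right)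
    ultimately have "a \<boxplus> \<i> \<cdot> b = ((1/2) \<cdot> y \<boxplus> (1/2) \<cdot> y) \<boxplus> ((1/2) \<cdot> y\<^sup>\<star> \<boxplus> (-1/2) \<cdot> y\<^sup>\<star>)"
      using y by (simp add: add_ac)
    also have "\<dots> = y" using y by (simp add: scale_add_left[symmetric])
    finally have "y = (\<alpha> + \<i> * \<beta>) \<cdot> e" using \<alpha> \<beta> e' by (simp add: scale_scale scale_add_left)
    then show ?thesis using y_def by auto
  qed
  then show ?thesis using e by (simp add: atomic_def)
qed

lemma unsplittable_atomic:
  assumes e: "projection E e" "e \<noteq> szero E"
    and unsplit: "\<And>r. \<lbrakk>projection E r; e \<boxtimes> r = r\<rbrakk> \<Longrightarrow> r = szero E \<or> r = e"
  shows "atomic E e"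
  using selfadjoint_scalar_atomic[OF e(1)] unsplittable_selfadjoint[OF e unsplit] by blast

text \<open>An orthogonal family containing \<open>G\<close> of greatest cardinality is a frame. A
  nonzero remainder of the unit could be added to it, and a member that splits could be replaced by
  two; either would enlarge the family.\<close>

lemma frame_extend:
  assumes unit: "is_unit_of E (carrier E) e"
    and G: "orthogonal_family E G" "\<And>g. g \<in> G \<Longrightarrow> atomic E g"
  shows "\<exists>F. frame E F \<and> G \<subseteq> F"
proof -
  obtain D where D: "\<And>F. orthogonal_family E F \<Longrightarrow> card F \<le> D" using orthogonal_family_bound by blast
  let ?Q = "\<lambda>F. orthogonal_family E F \<and> G \<subseteq> F"
  have "\<exists>F. ?Q F \<and> (\<forall>F'. ?Q F' \<longrightarrow> card F' \<le> card F)"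
    \<comment> \<open>The existence rule wants a strict upper bound for the cardinality, hence
      \<open>Suc D\<close>.\<close>
    by (rule ex_has_greatest_nat[of ?Q G card "Suc D"]) (use G D in \<open>auto simp: le_imp_less_Suc\<close>)
  then obtain F where F: "orthogonal_family E F" "G \<subseteq> F"
    and max: "\<And>F'. \<lbrakk>orthogonal_family E F'; G \<subseteq> F'\<rbrakk> \<Longrightarrow> card F' \<le> card F" by blast
  have fin: "finite F" using F by (simp add: orthogonal_family_def)
  have ec: "e \<in> carrier E" and e: "\<And>x. x \<in> carrier E \<Longrightarrow> e \<boxtimes> x = x \<and> x \<boxtimes> e = x"
    using unit by (auto simp: is_unit_of_def)
  have "e\<^sup>\<star> = e" using e[of "e\<^sup>\<star>"] adj_mul[of e "e\<^sup>\<star>"] ec by simp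
  then have pe: "projection E e" using e ec by (simp add: projection_def)
  let ?s = "gsum E (\<lambda>p. p) F"
  note ps = projection_gsum[OF F(1)]
  have es: "e \<boxtimes> ?s = ?s" using e projD[OF ps(1)] by simp
  note d = projection_diff[OF pe ps(1) es]
  have "e \<boxminus> ?s = szero E"
  proof (rule ccontr)
    assume nz: "e \<boxminus> ?s \<noteq> szero E"
    have "(e \<boxminus> ?s) \<boxtimes> f = szero E" if f: "f \<in> F" for f
    proof -
      have "f \<in> carrier E" using f F by (auto simp: orthogonal_family_def projection_def)
      then show ?thesis using ps(2)[OF f] projD[OF ps(1)] e ec
        by (simp add: mul_add_left mul_scale_left)
    qed
    then have "orthogonal_family E (insert (e \<boxminus> ?s) F)" "(e \<boxminus> ?s) \<notin> F"
      using orthogonal_family_insert[OF F(1) d(1) nz] by auto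
    then show False using max[of "insert (e \<boxminus> ?s) F"] F(2) fin by auto
  qed
  then have "?s = e" using diff_eq_zero ec projD[OF ps(1)] by blast
  then have us: "is_unit_of E (carrier E) ?s" using unit by simp
  have "atomic E f" if f: "f \<in> F" for f
  \<comment> \<open>A member of \<open>G\<close> may not be removed from the family, so the
    splitting argument is confined to \<open>f\<close> outside \<open>G\<close>; inside
    \<open>G\<close> atomicity is assumed.\<close>
  proof (cases "f \<in> G")
    case False
    have pf: "projection E f" "f \<noteq> szero E" using F f by (auto simp: orthogonal_family_def)
    note f' = projD[OF pf(1)]
    show ?thesis
    proof (rule unsplittable_atomic[OF pf], rule ccontr)
      fix r assume r: "projection E r" "f \<boxtimes> r = r" and nr: "\<not> (r = szero E \<or> r = f)"
      note d = projection_diff[OF pf(1) r] and r' = projD[OF r(1)]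
      have nd: "f \<boxminus> r \<noteq> szero E" using diff_eq_zero f' r' nr by blast
      have ofF: "orthogonal_family E (F - {f})" using F by (auto simp: orthogonal_family_def)
      have 1: "r \<boxtimes> g = szero E" if "g \<in> F - {f}" for g
      proof -
        have "g \<in> carrier E" "f \<boxtimes> g = szero E"
          using that f F by (auto simp: orthogonal_family_def projection_def)
        then show ?thesis using mul_assoc[of r f g] d(2) r' f' by simp
      qed
      have 2: "(f \<boxminus> r) \<boxtimes> g = szero E" if "g \<in> insert r (F - {f})" for g
      proof (cases "g = r")
        case True
        then show ?thesis using r r' f' by (simp add: mul_add_left mul_scale_left)
      next
        case False
        then have g: "g \<in> F - {f}" using that by auto
        have "g \<in> carrier E" "f \<boxtimes> g = szero E"
          using g f F by (auto simp: orthogonal_family_def projection_def)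
        then show ?thesis using 1[OF g] r' f' by (simp add: mul_add_left mul_scale_left)
      qed
      note o1 = orthogonal_family_insert[OF ofF r(1) _ 1]
      note o2 = orthogonal_family_insert[OF o1(1) d(1) nd 2]
      have "orthogonal_family E (insert (f \<boxminus> r) (insert r (F - {f})))" using o2 nr by auto
      moreover have "card (insert (f \<boxminus> r) (insert r (F - {f}))) = Suc (card F)"
        using o1(2) o2(2) nr fin f card_Suc_Diff1[OF fin f] by simp
      moreover have "G \<subseteq> insert (f \<boxminus> r) (insert r (F - {f}))" using F(2) False by auto
      ultimately show False using max[of "insert (f \<boxminus> r) (insert r (F - {f}))"] by simp
    qed
  qed (use G in auto)
  then show ?thesis using F us by (auto simp: frame_def)
qed

lemma frame_exists: "is_unit_of E (carrier E) e \<Longrightarrow> \<exists>F. frame E F"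
  using frame_extend[of e "{}"] by (auto simp: orthogonal_family_def)

text \<open>Since \<open>p\<close> is the sum of the products \<open>p q\<close> over the frame,
  some \<open>p q\<close> is nonzero, and this corner element provides the equivalence.\<close>

lemma atomic_equivalent_frame:
  assumes F: "frame E F" and p: "atomic E p" "p \<noteq> szero E"
  shows "\<exists>q\<in>F. \<exists>u\<in>carrier E. u \<boxtimes> u\<^sup>\<star> = p \<and> u\<^sup>\<star> \<boxtimes> u = q"
proof -
  note f = frame_facts[OF F] and P = projD[OF atomicD(1)[OF p(1)]]
  have "\<exists>q\<in>F. p \<boxtimes> q \<noteq> szero E"
  proof (rule ccontr)
    assume "\<not> ?thesis"
    then have "gsum E (\<lambda>q. p \<boxtimes> q) F = szero E" by (intro gsum_eq_zero) auto
    then show False using frame_right[OF F P(1)] p by simp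
  qed
  then obtain q where q: "q \<in> F" "p \<boxtimes> q \<noteq> szero E" by blast
  note Q = projD[OF f(4)[OF q(1)]]
  have "\<exists>c. c \<noteq> 0 \<and> (c \<cdot> (p \<boxtimes> q)) \<boxtimes> (c \<cdot> (p \<boxtimes> q))\<^sup>\<star> = p \<and> (c \<cdot> (p \<boxtimes> q))\<^sup>\<star> \<boxtimes> (c \<cdot> (p \<boxtimes> q)) = q"
    using P Q p q f(3,5)[OF q(1)] proj_absorb[OF atomicD(1)[OF p(1)]] proj_absorb[OF f(4)[OF q(1)]]
    by (intro atomic_equivalence) auto
  then show ?thesis using q(1) P Q by (meson closed)
qed

end


section \<open>*-subalgebras\<close>

definition commutant :: "'a star_alg \<Rightarrow> 'a set \<Rightarrow> 'a set" where
  "commutant E X = {z \<in> carrier E. \<forall>y\<in>X. smul E z y = smul E y z}"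

context star_algebra
begin

lemma subalgebra:
  assumes "subalg E S" "self_adjoint E S"
  shows "star_algebra (E\<lparr>carrier := S\<rparr>)"
proof -
  have S: "\<And>x. x \<in> S \<Longrightarrow> x \<in> carrier E" using assms by (auto simp: subalg_def)
  show ?thesis
    by unfold_locales
      (use assms in \<open>auto simp: subalg_def self_adjoint_def dest!: S
        intro: add_assoc add_comm scale_add_right scale_add_left scale_scale mul_assoc
          mul_add_left mul_add_right mul_scale_left mul_scale_right adj_add adj_scale adj_mul\<close>)
qed

lemma gsum_subalgebra:
  assumes "subalg E S" "self_adjoint E S" "\<And>i. i \<in> I \<Longrightarrow> f i \<in> S"
  shows "gsum (E\<lparr>carrier := S\<rparr>) f I = gsum E f I"
proof -
  interpret S: star_algebra "E\<lparr>carrier := S\<rparr>" using assms by (intro subalgebra)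
  have S: "\<And>x. x \<in> S \<Longrightarrow> x \<in> carrier E" using assms by (auto simp: subalg_def)
  show ?thesis
  proof (cases "finite I")
    case True
    then show ?thesis using assms(3)
    proof (induction I rule: finite_induct)
      case (insert i I)
      have "f i \<in> carrier E" "\<And>j. j \<in> I \<Longrightarrow> f j \<in> carrier E" using insert S by auto
      then show ?case using insert by (simp add: S.gsum_insert)
    qed (use S.gsum_empty in simp)
  qed (simp add: gsum_def finprod_def)
qed

lemma commutant_subalg:
  assumes "X \<subseteq> carrier E"
  shows "subalg E (commutant E X)"
proof -
  have "z \<boxtimes> w \<boxtimes> y = y \<boxtimes> (z \<boxtimes> w)"
    if "z \<in> commutant E X" "w \<in> commutant E X" "y \<in> X" for z w y
  proof -
    have "z \<in> carrier E" "w \<in> carrier E" "y \<in> carrier E" "z \<boxtimes> y = y \<boxtimes> z" "w \<boxtimes> y = y \<boxtimes> w"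
      using that assms by (auto simp: commutant_def)
    then show ?thesis by (metis mul_assoc)
  qed
  moreover have "(z \<boxplus> w) \<boxtimes> y = y \<boxtimes> (z \<boxplus> w)"
    if "z \<in> commutant E X" "w \<in> commutant E X" "y \<in> X" for z w y
    using that assms by (auto simp: commutant_def mul_add_left mul_add_right subset_iff)
  moreover have "c \<cdot> z \<boxtimes> y = y \<boxtimes> c \<cdot> z" if "z \<in> commutant E X" "y \<in> X" for z y c
    using that assms by (auto simp: commutant_def mul_scale_left mul_scale_right subset_iff)
  moreover have "szero E \<in> commutant E X" using assms by (auto simp: commutant_def)
  ultimately show ?thesis by (auto simp: subalg_def commutant_def)
qed

lemma commutant_self_adjoint:
  assumes "X \<subseteq> carrier E" "\<And>x. x \<in> X \<Longrightarrow> x\<^sup>\<star> \<in> X"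
  shows "self_adjoint E (commutant E X)"
proof -
  have "z\<^sup>\<star> \<boxtimes> y = y \<boxtimes> z\<^sup>\<star>" if "z \<in> commutant E X" "y \<in> X" for z y
  proof -
    have "z \<in> carrier E" "y \<in> carrier E" "z \<boxtimes> y\<^sup>\<star> = y\<^sup>\<star> \<boxtimes> z"
      using that assms by (auto simp: commutant_def)
    then show ?thesis using adj_mul[of z "y\<^sup>\<star>"] adj_mul[of "y\<^sup>\<star>" z] by simp
  qed
  then show ?thesis by (auto simp: self_adjoint_def commutant_def)
qed

text \<open>A set of commuting elements lies in its bicommutant, which is again commutative.\<close>

lemma masa_maximal:
  assumes C: "masa \<lparr>ambient = E, elems = carrier E\<rparr> C"
    and x: "x \<in> carrier E" "x\<^sup>\<star> = x" "\<And>c. c \<in> C \<Longrightarrow> x \<boxtimes> c = c \<boxtimes> x"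
  shows "x \<in> C"
proof -
  have C': "C \<subseteq> carrier E" "\<And>c. c \<in> C \<Longrightarrow> c\<^sup>\<star> \<in> C" "\<And>c d. \<lbrakk>c \<in> C; d \<in> C\<rbrakk> \<Longrightarrow> c \<boxtimes> d = d \<boxtimes> c"
    and max: "\<And>C'. \<lbrakk>abelian_sa_subalg E C'; C' \<subseteq> carrier E; C \<subseteq> C'\<rbrakk> \<Longrightarrow> C' = C"
    using C by (auto simp: masa_def abelian_sa_subalg_def self_adjoint_def)
  define X where "X = insert x C"
  define Y where "Y = commutant E X"
  define Z where "Z = commutant E Y"
  have X: "X \<subseteq> carrier E" "\<And>x. x \<in> X \<Longrightarrow> x\<^sup>\<star> \<in> X" using C' x by (auto simp: X_def)
  have Y: "Y \<subseteq> carrier E" "self_adjoint E Y"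
    using commutant_self_adjoint[OF X] by (auto simp: Y_def commutant_def)
  have XY: "X \<subseteq> Y" using C' x by (auto simp: X_def Y_def commutant_def)
  have XZ: "X \<subseteq> Z" using X by (auto simp: Z_def Y_def commutant_def)
  have ZY: "Z \<subseteq> Y" using XY unfolding Z_def Y_def commutant_def by blast
  have "abelian_sa_subalg E Z"
    unfolding abelian_sa_subalg_def Z_def
  proof (intro conjI ballI)
    show "subalg E (commutant E Y)" by (rule commutant_subalg) fact
    show "self_adjoint E (commutant E Y)"
      by (rule commutant_self_adjoint) (use Y in \<open>auto simp: self_adjoint_def\<close>)
  next
    fix z w assume "z \<in> commutant E Y" "w \<in> commutant E Y"
    then show "z \<boxtimes> w = w \<boxtimes> z" using ZY by (auto simp: Z_def commutant_def)
  qed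
  then have "Z = C" using max XZ X_def by (auto simp: Z_def commutant_def)
  then show ?thesis using XZ X_def by auto
qed

end

context fd_star
begin

lemma fd_subalgebra:
  assumes S: "subalg E S" "self_adjoint E S"
  shows "fd_star (E\<lparr>carrier := S\<rparr>)"
proof -
  interpret S: star_algebra "E\<lparr>carrier := S\<rparr>" using assms by (intro subalgebra)
  have Sc: "\<And>x. x \<in> S \<Longrightarrow> x \<in> carrier E" using assms by (auto simp: subalg_def)
  obtain D where D: "\<And>x::nat \<Rightarrow> 'a. (\<forall>i\<le>D. x i \<in> carrier E) \<Longrightarrow>
      (\<exists>c. (\<exists>i\<le>D. c i \<noteq> 0) \<and> gsum E (\<lambda>i. sscale E (c i) (x i)) {..D} = szero E)"
    using findim by blast
  show ?thesis
  proof unfold_locales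
    fix x y
    assume "x \<in> carrier (E\<lparr>carrier := S\<rparr>)" "y \<in> carrier (E\<lparr>carrier := S\<rparr>)"
      "sadd (E\<lparr>carrier := S\<rparr>)
        (smul (E\<lparr>carrier := S\<rparr>) (sadj (E\<lparr>carrier := S\<rparr>) x) x)
        (smul (E\<lparr>carrier := S\<rparr>) (sadj (E\<lparr>carrier := S\<rparr>) y) y) = szero (E\<lparr>carrier := S\<rparr>)"
    then show "x = szero (E\<lparr>carrier := S\<rparr>)" using proper[of x y] Sc by simp
  next
    show "\<exists>D. \<forall>x::nat \<Rightarrow> 'a. (\<forall>i\<le>D. x i \<in> carrier (E\<lparr>carrier := S\<rparr>)) \<longrightarrow>
      (\<exists>c. (\<exists>i\<le>D. c i \<noteq> 0) \<and> gsum (E\<lparr>carrier := S\<rparr>)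
        (\<lambda>i. sscale (E\<lparr>carrier := S\<rparr>) (c i) (x i)) {..D} = szero (E\<lparr>carrier := S\<rparr>))"
    proof (rule exI[of _ D], intro allI impI)
      fix x :: "nat \<Rightarrow> 'a"
      assume "\<forall>i\<le>D. x i \<in> carrier (E\<lparr>carrier := S\<rparr>)"
      then have x: "\<And>i. i \<le> D \<Longrightarrow> x i \<in> S" by simp
      then obtain c where c: "\<exists>i\<le>D. c i \<noteq> 0" "gsum E (\<lambda>i. sscale E (c i) (x i)) {..D} = szero E"
        using D[of x] Sc by blast
      have "gsum (E\<lparr>carrier := S\<rparr>) (\<lambda>i. sscale E (c i) (x i)) {..D} = szero E"
        using gsum_subalgebra[OF S, of "{..D}" "\<lambda>i. sscale E (c i) (x i)"] x S c
        by (auto simp: subalg_def)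
      then show "\<exists>c. (\<exists>i\<le>D. c i \<noteq> 0) \<and> gsum (E\<lparr>carrier := S\<rparr>)
        (\<lambda>i. sscale (E\<lparr>carrier := S\<rparr>) (c i) (x i)) {..D} = szero (E\<lparr>carrier := S\<rparr>)"
        using c(1) by auto
    qed
  qed
qed

lemma frame_subalgebra:
  assumes S: "subalg E S" "self_adjoint E S" and P: "frame E P" "P \<subseteq> S"
  shows "frame (E\<lparr>carrier := S\<rparr>) P"
proof -
  have Sc: "\<And>x. x \<in> S \<Longrightarrow> x \<in> carrier E" using S by (auto simp: subalg_def)
  have "gsum (E\<lparr>carrier := S\<rparr>) (\<lambda>p. p) P = gsum E (\<lambda>p. p) P"
    using P by (intro gsum_subalgebra[OF S]) auto
  moreover have "gsum E (\<lambda>p. p) P \<in> S" using P by (intro subalg_gsum[OF S(1)]) auto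
  ultimately show ?thesis
    using P Sc by (auto simp: frame_def orthogonal_family_def atomic_def projection_def is_unit_of_def)
qed

text \<open>When \<open>S\<close> contains a frame of \<open>E\<close>, every nonzero atom of
  \<open>S\<close> is equivalent, through an element of \<open>S\<close>, to a member of that frame.
  Members of the frame are atoms of \<open>E\<close>, and atomicity is transferred along the
  equivalence.\<close>

lemma atomic_subalgebra:
  assumes S: "subalg E S" "self_adjoint E S" and P: "frame E P" "P \<subseteq> S" and p: "p \<in> S"
  shows "atomic (E\<lparr>carrier := S\<rparr>) p \<longleftrightarrow> atomic E p"
proof
  interpret S: fd_star "E\<lparr>carrier := S\<rparr>" using S by (intro fd_subalgebra)
  have Sc: "\<And>x. x \<in> S \<Longrightarrow> x \<in> carrier E" using S by (auto simp: subalg_def)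
  assume a: "atomic (E\<lparr>carrier := S\<rparr>) p"
  show "atomic E p"
  proof (cases "p = szero E")
    case False
    then obtain q u where qu: "q \<in> P" "u \<in> S" "u \<boxtimes> u\<^sup>\<star> = p" "u\<^sup>\<star> \<boxtimes> u = q"
      using S.atomic_equivalent_frame[OF frame_subalgebra[OF S P] a] by auto
    then show ?thesis using atomic_transfer[of u q] frame_facts(3)[OF P(1)] Sc by auto
  qed simp
next
  have Sc: "\<And>x. x \<in> S \<Longrightarrow> x \<in> carrier E" using S by (auto simp: subalg_def)
  assume "atomic E p"
  then show "atomic (E\<lparr>carrier := S\<rparr>) p"
    using p Sc by (auto simp: atomic_def projection_def)
qed

text \<open>A frame of the commutative algebra \<open>C\<close> is a frame of \<open>E\<close>: a
  self-adjoint element of the corner of an atom \<open>p\<close> of \<open>C\<close> commutes with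
  \<open>C\<close>, lies in \<open>C\<close> by maximality, and is therefore a multiple of
  \<open>p\<close>.\<close>

lemma masa_frame:
  assumes C: "masa \<lparr>ambient = E, elems = carrier E\<rparr> C" and e: "is_unit_of E (carrier E) e"
  shows "\<exists>P\<subseteq>C. frame E P"
proof -
  have C': "subalg E C" "self_adjoint E C" "C \<subseteq> carrier E" "\<And>c d. \<lbrakk>c \<in> C; d \<in> C\<rbrakk> \<Longrightarrow> c \<boxtimes> d = d \<boxtimes> c"
    using C by (auto simp: masa_def abelian_sa_subalg_def)
  interpret C: fd_star "E\<lparr>carrier := C\<rparr>" using C' by (intro fd_subalgebra)
  have ec: "e \<in> carrier E" and e': "\<And>x. x \<in> carrier E \<Longrightarrow> e \<boxtimes> x = x \<and> x \<boxtimes> e = x"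
    using e by (auto simp: is_unit_of_def)
  have "e\<^sup>\<star> = e" using e'[of "e\<^sup>\<star>"] adj_mul[of e "e\<^sup>\<star>"] ec by simp
  then have "e \<in> C" using masa_maximal[OF C, of e] e' ec C'(3) by (metis subsetD)
  then have "is_unit_of (E\<lparr>carrier := C\<rparr>) (carrier (E\<lparr>carrier := C\<rparr>)) e"
    using e' C' by (auto simp: is_unit_of_def)
  then obtain P where P: "frame (E\<lparr>carrier := C\<rparr>) P" using C.frame_exists by blast
  note F = C.frame_facts[OF P]
  have PC: "P \<subseteq> C" using F(2) by auto
  have sum: "gsum (E\<lparr>carrier := C\<rparr>) (\<lambda>p. p) P = gsum E (\<lambda>p. p) P"
    using PC by (intro gsum_subalgebra) (use C' in auto)
  have "gsum E (\<lambda>p. p) P = e"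
  proof -
    have "gsum E (\<lambda>p. p) P \<in> C" "gsum E (\<lambda>p. p) P \<boxtimes> e = e"
      using F(7) sum \<open>e \<in> C\<close> by (auto simp: is_unit_of_def)
    then show ?thesis using e'[of "gsum E (\<lambda>p. p) P"] C'(3) by auto
  qed
  have atom: "atomic E p" if p: "p \<in> P" for p
  proof (rule selfadjoint_scalar_atomic)
    show pp: "projection E p" using F(4)[OF p] PC C'(3) by (auto simp: projection_def)
    fix h assume h: "h \<in> carrier E" "h\<^sup>\<star> = h" "p \<boxtimes> h = h" "h \<boxtimes> p = h"
    have "h \<boxtimes> c = c \<boxtimes> h" if c: "c \<in> C" for c
    proof -
      \<comment> \<open>As \<open>C\<close> is commutative, \<open>p c = p c p\<close>, which is
        \<open>g p\<close> by atomicity in \<open>C\<close>. Since \<open>h\<close> absorbs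
        \<open>p\<close> on both sides, \<open>h c\<close> and \<open>c h\<close> both equal
        \<open>g h\<close>.\<close>
      obtain g where g: "p \<boxtimes> c \<boxtimes> p = g \<cdot> p" using C.atomicD(2)[OF F(3)[OF p], of c] c by auto
      have pc: "p \<in> carrier E" "c \<in> carrier E" "p \<boxtimes> p = p" "p \<in> C"
        using projD[OF pp] c C'(3) PC p by auto
      have "p \<boxtimes> c \<boxtimes> p = p \<boxtimes> (p \<boxtimes> c)" using pc c C'(4)[of c p] by (simp add: mul_assoc)
      then have pg: "p \<boxtimes> c = g \<cdot> p" using g proj_absorb(1)[OF pp pc(2)] by simp
      then have cg: "c \<boxtimes> p = g \<cdot> p" using C'(4)[of c p] pc c by simp
      have "h \<boxtimes> p \<boxtimes> c = g \<cdot> h" using mul_assoc[of h p c] mul_scale_right[of h p g] h pc pg by simp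
      moreover have "c \<boxtimes> (p \<boxtimes> h) = g \<cdot> h"
        using mul_assoc[of c p h] mul_scale_left[of p h g] h pc cg by simp
      ultimately show ?thesis using h by simp
    qed
    then have "h \<in> C" using masa_maximal[OF C h(1,2)] by blast
    then obtain c where "p \<boxtimes> h \<boxtimes> p = c \<cdot> p" using C.atomicD(2)[OF F(3)[OF p], of h] by auto
    then show "\<exists>c. h = c \<cdot> p" using h by auto
  qed
  have "frame E P"
    using F PC C'(3) e atom \<open>gsum E (\<lambda>p. p) P = e\<close> F(1,4,5,6)
    by (auto simp: frame_def orthogonal_family_def atomic_def)
  then show ?thesis using PC by blast
qed

text \<open>Each Murray-von Neumann class of the frame gets a representative \<open>r p\<close> and
  each member \<open>p\<close> a partial isometry \<open>u p\<close> from \<open>p\<close> to it.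
  The products \<open>(u p)^* (u q)\<close> within a class are matrix units; corners between
  different classes vanish.\<close>

lemma matrix_units:
  assumes P: "frame E P"
  obtains r u where
    "\<And>p. p \<in> P \<Longrightarrow> r p \<in> P"
    "\<And>p. p \<in> P \<Longrightarrow> u p \<in> carrier E"
    "\<And>p. p \<in> P \<Longrightarrow> u p \<boxtimes> (u p)\<^sup>\<star> = r p" "\<And>p. p \<in> P \<Longrightarrow> (u p)\<^sup>\<star> \<boxtimes> u p = p"
    "\<And>p q x. \<lbrakk>p \<in> P; q \<in> P; x \<in> carrier E; r p = r q\<rbrakk> \<Longrightarrow> \<exists>c. p \<boxtimes> x \<boxtimes> q = c \<cdot> ((u p)\<^sup>\<star> \<boxtimes> u q)"
    "\<And>p q x. \<lbrakk>p \<in> P; q \<in> P; x \<in> carrier E; r p \<noteq> r q\<rbrakk> \<Longrightarrow> p \<boxtimes> x \<boxtimes> q = szero E"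
proof -
  note F = frame_facts[OF P]
  define R where "R p q \<longleftrightarrow> (\<exists>u\<in>carrier E. u \<boxtimes> u\<^sup>\<star> = p \<and> u\<^sup>\<star> \<boxtimes> u = q)" for p q
  have Rrefl: "R p p" if "p \<in> P" for p
    unfolding R_def using projD[OF F(4)[OF that]] by (intro bexI[of _ p]) auto
  have Rsym: "R q p" if pq: "R p q" for p q
  proof -
    obtain u where "u \<in> carrier E" "u \<boxtimes> u\<^sup>\<star> = p" "u\<^sup>\<star> \<boxtimes> u = q" using pq unfolding R_def by blast
    then show ?thesis unfolding R_def by (intro bexI[of _ "u\<^sup>\<star>"]) auto
  qed
  have Rtrans: "R p t" if Rpq: "R p q" and Rqt: "R q t" and P3: "p \<in> P" "q \<in> P" "t \<in> P" for p q t
  proof -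
    obtain u where u: "u \<in> carrier E" "u \<boxtimes> u\<^sup>\<star> = p" "u\<^sup>\<star> \<boxtimes> u = q" using Rpq unfolding R_def by blast
    obtain v where v: "v \<in> carrier E" "v \<boxtimes> v\<^sup>\<star> = q" "v\<^sup>\<star> \<boxtimes> v = t" using Rqt unfolding R_def by blast
    have pq: "projection E q" using F(4) P3 by simp
    have 1: "u \<boxtimes> q = u" by (rule partial_isometry_absorb(1)[OF u(1,3) pq])
    have 2: "q \<boxtimes> v = v" using partial_isometry_absorb(2)[of "v\<^sup>\<star>" q] pq v(1,2) by simp
    have "u \<boxtimes> v \<boxtimes> (u \<boxtimes> v)\<^sup>\<star> = u \<boxtimes> (v \<boxtimes> v\<^sup>\<star>) \<boxtimes> u\<^sup>\<star>" using u(1) v(1) by (simp add: adj_mul mul_assoc)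
    then have "u \<boxtimes> v \<boxtimes> (u \<boxtimes> v)\<^sup>\<star> = p" using u v 1 by simp
    moreover have "(u \<boxtimes> v)\<^sup>\<star> \<boxtimes> (u \<boxtimes> v) = v\<^sup>\<star> \<boxtimes> (u\<^sup>\<star> \<boxtimes> u \<boxtimes> v)" using u(1) v(1) by (simp add: adj_mul mul_assoc)
    then have "(u \<boxtimes> v)\<^sup>\<star> \<boxtimes> (u \<boxtimes> v) = t" using u v 2 by simp
    ultimately show ?thesis unfolding R_def using u(1) v(1) by (intro bexI[of _ "u \<boxtimes> v"]) auto
  qed
  \<comment> \<open>Equivalent \<open>p\<close> and \<open>q\<close> define the same predicate under
    \<open>SOME\<close>, so the choice depends only on the class.\<close>
  define r where "r p = (SOME p'. p' \<in> P \<and> R p' p)" for p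
  have r: "r p \<in> P \<and> R (r p) p" if "p \<in> P" for p
    unfolding r_def by (rule someI[of _ p]) (use Rrefl that in auto)
  have rR: "r p = r q \<longleftrightarrow> R p q" if "p \<in> P" "q \<in> P" for p q
  proof
    assume "r p = r q"
    then have "R (r p) p" "R (r p) q" "r p \<in> P" using r[OF that(1)] r[OF that(2)] by simp_all
    then show "R p q" using Rtrans Rsym that by blast
  next
    assume "R p q"
    then have "(\<lambda>p'. p' \<in> P \<and> R p' p) = (\<lambda>p'. p' \<in> P \<and> R p' q)"
      using Rtrans Rsym that by (intro ext) blast
    then show "r p = r q" by (simp add: r_def)
  qed
  define u where "u p = (SOME u. u \<in> carrier E \<and> u \<boxtimes> u\<^sup>\<star> = r p \<and> u\<^sup>\<star> \<boxtimes> u = p)" for p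
  have u: "u p \<in> carrier E \<and> u p \<boxtimes> (u p)\<^sup>\<star> = r p \<and> (u p)\<^sup>\<star> \<boxtimes> u p = p" if "p \<in> P" for p
  proof -
    have "\<exists>u. u \<in> carrier E \<and> u \<boxtimes> u\<^sup>\<star> = r p \<and> u\<^sup>\<star> \<boxtimes> u = p"
      using r[OF that] by (auto simp: R_def)
    then show ?thesis unfolding u_def by (rule someI_ex)
  qed
  show thesis
  proof (rule that[of r u])
    fix p assume p: "p \<in> P"
    then show "r p \<in> P" "u p \<in> carrier E" "u p \<boxtimes> (u p)\<^sup>\<star> = r p" "(u p)\<^sup>\<star> \<boxtimes> u p = p"
      using r u by auto
  next
    fix p q x assume pq: "p \<in> P" "q \<in> P" and x: "x \<in> carrier E"
    note p' = projD[OF F(4)[OF pq(1)]] and q' = projD[OF F(4)[OF pq(2)]]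
    have y: "p \<boxtimes> x \<boxtimes> q \<in> carrier E" "p \<boxtimes> (p \<boxtimes> x \<boxtimes> q) = p \<boxtimes> x \<boxtimes> q" "p \<boxtimes> x \<boxtimes> q \<boxtimes> q = p \<boxtimes> x \<boxtimes> q"
      using p' q' x by (simp_all add: mul_assoc proj_absorb[OF F(4)[OF pq(1)]])
    {
      assume eq: "r p = r q"
      note up = u[OF pq(1)] and uq = u[OF pq(2)]
      have upc: "u p \<in> carrier E" "u q \<in> carrier E" using up uq by auto
      have rp: "projection E (r p)" using r[OF pq(1)] F(4) by auto
      have a: "r p \<boxtimes> u p = u p" "r p \<boxtimes> u q = u q"
        using partial_isometry_absorb(2)[of "(u p)\<^sup>\<star>" "r p"] partial_isometry_absorb(2)[of "(u q)\<^sup>\<star>" "r p"]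
          up uq eq rp by simp_all
      let ?v = "(u p)\<^sup>\<star> \<boxtimes> u q"
      have "?v \<boxtimes> ?v\<^sup>\<star> = (u p)\<^sup>\<star> \<boxtimes> (u q \<boxtimes> (u q)\<^sup>\<star> \<boxtimes> u p)"
        using upc by (simp add: adj_mul mul_assoc)
      then have v1: "?v \<boxtimes> ?v\<^sup>\<star> = p" using up uq eq a by metis
      have "?v\<^sup>\<star> \<boxtimes> ?v = (u q)\<^sup>\<star> \<boxtimes> (u p \<boxtimes> (u p)\<^sup>\<star> \<boxtimes> u q)"
        using upc by (simp add: adj_mul mul_assoc)
      then have v2: "?v\<^sup>\<star> \<boxtimes> ?v = q" using up uq eq a by metis
      show "\<exists>c. p \<boxtimes> x \<boxtimes> q = c \<cdot> ?v"
        by (rule corner_one_dim[OF _ v1 v2 F(3)[OF pq(1)] F(4)[OF pq(2)] y]) (use up uq in auto)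
    next
      assume "r p \<noteq> r q"
      then have nR: "\<not> R p q" using rR pq by blast
      show "p \<boxtimes> x \<boxtimes> q = szero E"
      proof (rule ccontr)
        assume "p \<boxtimes> x \<boxtimes> q \<noteq> szero E"
        then obtain c where "(c \<cdot> (p \<boxtimes> x \<boxtimes> q)) \<boxtimes> (c \<cdot> (p \<boxtimes> x \<boxtimes> q))\<^sup>\<star> = p"
          "(c \<cdot> (p \<boxtimes> x \<boxtimes> q))\<^sup>\<star> \<boxtimes> (c \<cdot> (p \<boxtimes> x \<boxtimes> q)) = q"
          using atomic_equivalence[OF F(3)[OF pq(1)] F(5)[OF pq(1)] F(3)[OF pq(2)] F(5)[OF pq(2)] y] by blast
        then show False using nR y(1) scale_closed[OF y(1)] unfolding R_def by blast
      qed
    }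
  qed
qed

end


section \<open>Direct sums of matrix algebras\<close>

text \<open>Gaussian elimination: a pivot index \<open>k\<close> clears the coordinate
  \<open>j\<close> from all other vectors, and the induction hypothesis is applied to the cleared
  vectors in one coordinate less.\<close>

lemma linear_dependence:
  fixes g :: "'i \<Rightarrow> 'j \<Rightarrow> 'k :: field"
  assumes "finite J" "finite I" "card J < card I"
  shows "\<exists>c. (\<exists>i\<in>I. c i \<noteq> 0) \<and> (\<forall>j\<in>J. (\<Sum>i\<in>I. c i * g i j) = 0)"
  using assms
proof (induction J arbitrary: I g rule: finite_induct)
  case empty
  then have "I \<noteq> {}" by auto
  then show ?case by (intro exI[of _ "\<lambda>_. 1"]) auto
next
  case (insert j J)
  show ?case
  proof (cases "\<forall>i\<in>I. g i j = 0")
    case True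
    then show ?thesis using insert.IH[of I g] insert by auto
  next
    case False
    then obtain k where k: "k \<in> I" "g k j \<noteq> 0" by blast
    define g' where "g' i j' = g i j' - g i j / g k j * g k j'" for i j'
    have "card J < card (I - {k})" using insert k by auto
    then have "\<exists>c. (\<exists>i\<in>I - {k}. c i \<noteq> 0) \<and> (\<forall>j\<in>J. (\<Sum>i\<in>I - {k}. c i * g' i j) = 0)"
      using insert by (intro insert.IH) auto
    then obtain c where c: "\<exists>i\<in>I - {k}. c i \<noteq> 0" "\<And>j'. j' \<in> J \<Longrightarrow> (\<Sum>i\<in>I - {k}. c i * g' i j') = 0"
      by blast
    define s where "s = (\<Sum>i\<in>I - {k}. c i * g i j)"
    \<comment> \<open>The coefficient of the pivot vector is chosen to cancel the coordinate
      \<open>j\<close>.\<close>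
    define d where "d = c(k := - s / g k j)"
    have split: "(\<Sum>i\<in>I. d i * g i j') = - s / g k j * g k j' + (\<Sum>i\<in>I - {k}. c i * g i j')" for j'
    proof -
      have "(\<Sum>i\<in>I. d i * g i j') = d k * g k j' + (\<Sum>i\<in>I - {k}. d i * g i j')"
        using insert k by (intro sum.remove) auto
      also have "(\<Sum>i\<in>I - {k}. d i * g i j') = (\<Sum>i\<in>I - {k}. c i * g i j')"
        by (intro sum.cong) (auto simp: d_def)
      finally show ?thesis by (simp add: d_def)
    qed
    have "(\<Sum>i\<in>I. d i * g i j') = 0" if "j' \<in> insert j J" for j'
    proof (cases "j' = j")
      case True
      then show ?thesis using split[of j] k by (simp add: s_def)
    next
      case False
      then have "0 = (\<Sum>i\<in>I - {k}. c i * g' i j')" using c(2) that by simp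
      also have "\<dots> = (\<Sum>i\<in>I - {k}. c i * g i j') - (\<Sum>i\<in>I - {k}. c i * g i j * (g k j' / g k j))"
        by (simp add: g'_def algebra_simps sum_subtractf)
      also have "(\<Sum>i\<in>I - {k}. c i * g i j * (g k j' / g k j)) = s * (g k j' / g k j)"
        by (simp add: s_def sum_distrib_right sum_divide_distrib)
      finally show ?thesis using split[of j'] by simp
    qed
    moreover have "\<exists>i\<in>I. d i \<noteq> 0" using c(1) by (auto simp: d_def)
    ultimately show ?thesis by blast
  qed
qed

lemma mat_adjoint_index:
  fixes A :: "complex mat"
  assumes "A \<in> carrier_mat n n" "i < n" "j < n"
  shows "mat_adjoint A $$ (i, j) = cnj (A $$ (j, i))"
  using assms by (simp add: mat_adjoint_def mat_of_rows_def)

lemma mat_adjoint_carrier: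
  assumes "A \<in> carrier_mat n n"
  shows "mat_adjoint A \<in> carrier_mat n n"
  using assms by (auto simp: mat_adjoint_def mat_of_rows_def)

lemma mat_mult_index:
  assumes "A \<in> carrier_mat n n" "B \<in> carrier_mat n n" "i < n" "j < n"
  shows "(A * B) $$ (i, j) = (\<Sum>k<n. A $$ (i, k) * B $$ (k, j))"
  using assms by (auto simp: scalar_prod_def atLeast0LessThan intro!: sum.cong)

text \<open>The identification with a direct sum of matrix algebras, split into one map per summand.
  Identities between elements can then be checked block by block instead of on lists.\<close>

locale block_form = star_algebra +
  fixes ns :: "nat list" and blk :: "nat \<Rightarrow> 'a \<Rightarrow> complex mat"
  assumes blk_carrier: "\<lbrakk>b < length ns; x \<in> carrier E\<rbrakk> \<Longrightarrow> blk b x \<in> carrier_mat (ns ! b) (ns ! b)"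
    and blk_add: "\<lbrakk>b < length ns; x \<in> carrier E; y \<in> carrier E\<rbrakk> \<Longrightarrow> blk b (sadd E x y) = blk b x + blk b y"
    and blk_mul: "\<lbrakk>b < length ns; x \<in> carrier E; y \<in> carrier E\<rbrakk> \<Longrightarrow> blk b (smul E x y) = blk b x * blk b y"
    and blk_scale: "\<lbrakk>b < length ns; x \<in> carrier E\<rbrakk> \<Longrightarrow> blk b (sscale E c x) = c \<cdot>\<^sub>m blk b x"
    and blk_adj: "\<lbrakk>b < length ns; x \<in> carrier E\<rbrakk> \<Longrightarrow> blk b (sadj E x) = mat_adjoint (blk b x)"
    and blk_ext: "\<lbrakk>x \<in> carrier E; y \<in> carrier E; \<And>b. b < length ns \<Longrightarrow> blk b x = blk b y\<rbrakk> \<Longrightarrow> x = y"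
    and blk_surj: "(\<And>b. b < length ns \<Longrightarrow> Ms b \<in> carrier_mat (ns ! b) (ns ! b)) \<Longrightarrow>
      \<exists>x\<in>carrier E. \<forall>b<length ns. blk b x = Ms b"

lemma star_iso_block_form:
  assumes "star_algebra E" "star_iso E (matrix_sum ns) f"
  shows "block_form E ns (\<lambda>b x. f x ! b)"
proof -
  interpret star_algebra E by fact
  have hom: "star_hom E (matrix_sum ns) f" and bij: "bij_betw f (carrier E) (carrier (matrix_sum ns))"
    using assms(2) by (auto simp: star_iso_def)
  have car: "length (f x) = length ns \<and> (\<forall>b<length ns. f x ! b \<in> carrier_mat (ns ! b) (ns ! b))"
    if "x \<in> carrier E" for x
    using star_homD(1)[OF hom that] by (simp add: matrix_sum_def list_all2_conv_all_nth)
  show ?thesis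
  proof
    fix b x y c assume b: "b < length ns" and x: "x \<in> carrier E" and y: "y \<in> carrier E"
    show "f (sadd E x y) ! b = f x ! b + f y ! b" "f (smul E x y) ! b = f x ! b * f y ! b"
      using star_homD(2,3)[OF hom x y] car[OF x] car[OF y] b by (simp_all add: matrix_sum_def)
  next
    fix b x c assume b: "b < length ns" and x: "x \<in> carrier E"
    show "f x ! b \<in> carrier_mat (ns ! b) (ns ! b)" using car x b by simp
    show "f (sscale E c x) ! b = c \<cdot>\<^sub>m f x ! b" "f (sadj E x) ! b = mat_adjoint (f x ! b)"
      using star_homD(4,5)[OF hom x] car[OF x] b by (simp_all add: matrix_sum_def)
  next
    fix x y assume x: "x \<in> carrier E" and y: "y \<in> carrier E" and eq: "\<And>b. b < length ns \<Longrightarrow> f x ! b = f y ! b"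
    then have "f x = f y" using car[OF x] car[OF y] by (intro nth_equalityI) auto
    then show "x = y" using bij x y by (auto simp: bij_betw_def inj_on_def)
  next
    fix Ms :: "nat \<Rightarrow> complex mat"
    assume "\<And>b. b < length ns \<Longrightarrow> Ms b \<in> carrier_mat (ns ! b) (ns ! b)"
    then have "map Ms [0..<length ns] \<in> carrier (matrix_sum ns)"
      by (simp add: matrix_sum_def list_all2_conv_all_nth)
    then obtain x where "x \<in> carrier E" "f x = map Ms [0..<length ns]"
      using bij by (metis bij_betw_def imageE)
    then show "\<exists>x\<in>carrier E. \<forall>b<length ns. f x ! b = Ms b" by (intro bexI[of _ x]) auto
  qed
qed

context block_form
begin

lemma blk_zero: 
  assumes "b < length ns"
  shows "blk b (szero E) = 0\<^sub>m (ns ! b) (ns ! b)"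
proof -
  have "blk b (0 \<cdot> szero E) = 0 \<cdot>\<^sub>m blk b (szero E)" using assms by (intro blk_scale) auto
  moreover have "0 \<cdot>\<^sub>m blk b (szero E) = 0\<^sub>m (ns ! b) (ns ! b)"
    using blk_carrier[OF assms zero_closed] by (intro eq_matI) auto
  ultimately show ?thesis by simp
qed

lemma blk_gsum_index:
  assumes "b < length ns" "i < ns ! b" "j < ns ! b" "finite I" "\<And>k. k \<in> I \<Longrightarrow> g k \<in> carrier E"
  shows "blk b (gsum E g I) $$ (i, j) = (\<Sum>k\<in>I. blk b (g k) $$ (i, j))"
  using assms(4,5)
proof (induction I rule: finite_induct)
  case (insert k I)
  have "gsum E g I \<in> carrier E" using insert by auto
  then show ?case
    using insert assms(1-3) blk_carrier[OF assms(1), of "gsum E g I"] by (simp add: blk_add)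
qed (use assms in \<open>simp add: blk_zero\<close>)

lemma unit_exists: "\<exists>e. is_unit_of E (carrier E) e \<and> (\<forall>b<length ns. blk b e = 1\<^sub>m (ns ! b))"
proof -
  obtain e where e: "e \<in> carrier E" "\<And>b. b < length ns \<Longrightarrow> blk b e = 1\<^sub>m (ns ! b)"
    using blk_surj[of "\<lambda>b. 1\<^sub>m (ns ! b)"] by auto
  have "e \<boxtimes> x = x \<and> x \<boxtimes> e = x" if x: "x \<in> carrier E" for x
    using e x by (auto intro!: blk_ext simp: blk_mul left_mult_one_mat[OF blk_carrier] right_mult_one_mat[OF blk_carrier])
  then show ?thesis using e by (auto simp: is_unit_of_def)
qed

lemma blk_adj_mul_diag:
  assumes "b < length ns" "j < ns ! b" "x \<in> carrier E"
  shows "blk b (x\<^sup>\<star> \<boxtimes> x) $$ (j, j) = of_real (\<Sum>i<ns ! b. (cmod (blk b x $$ (i, j)))\<^sup>2)"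
proof -
  note c = blk_carrier[OF assms(1,3)]
  have "blk b (x\<^sup>\<star> \<boxtimes> x) $$ (j, j) = (\<Sum>i<ns ! b. cnj (blk b x $$ (i, j)) * blk b x $$ (i, j))"
    using assms c by (simp add: blk_mul blk_adj mat_mult_index[OF mat_adjoint_carrier[OF c] c] mat_adjoint_index[OF c])
  then show ?thesis by (simp add: mult.commute flip: complex_norm_square)
qed

text \<open>Properness: the diagonal entries of \<open>x^* x\<close> are sums of squared moduli of a
  column of \<open>x\<close>, so a vanishing sum of two of them forces every entry to vanish. Finite
  dimension: the index set \<open>J\<close> of all matrix entries bounds independent
  families.\<close>

lemma fd: "fd_star E"
proof
  fix x y assume x: "x \<in> carrier E" and y: "y \<in> carrier E" and z: "x\<^sup>\<star> \<boxtimes> x \<boxplus> y\<^sup>\<star> \<boxtimes> y = szero E"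
  show "x = szero E"
  proof (rule blk_ext[OF x zero_closed])
    fix b assume b: "b < length ns"
    have "blk b x $$ (i, j) = 0" if ij: "i < ns ! b" "j < ns ! b" for i j
    proof -
      have "blk b (x\<^sup>\<star> \<boxtimes> x) $$ (j, j) + blk b (y\<^sup>\<star> \<boxtimes> y) $$ (j, j) = 0"
        using arg_cong[OF z, of "\<lambda>z. blk b z $$ (j, j)"] b ij x y
          blk_carrier[OF b, of "x\<^sup>\<star> \<boxtimes> x"] blk_carrier[OF b, of "y\<^sup>\<star> \<boxtimes> y"]
        by (simp add: blk_add blk_zero)
      then have "(\<Sum>i<ns ! b. (cmod (blk b x $$ (i, j)))\<^sup>2) + (\<Sum>i<ns ! b. (cmod (blk b y $$ (i, j)))\<^sup>2) = 0"
        unfolding blk_adj_mul_diag[OF b ij(2) x] blk_adj_mul_diag[OF b ij(2) y]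
        by (simp only: of_real_add[symmetric] of_real_eq_0_iff)
      moreover have "(\<Sum>i<ns ! b. (cmod (blk b x $$ (i, j)))\<^sup>2) \<ge> 0" "(\<Sum>i<ns ! b. (cmod (blk b y $$ (i, j)))\<^sup>2) \<ge> 0"
        by (auto intro: sum_nonneg)
      ultimately have "(\<Sum>i<ns ! b. (cmod (blk b x $$ (i, j)))\<^sup>2) = 0" by linarith
      then show ?thesis using ij by (subst (asm) sum_nonneg_eq_0_iff) auto
    qed
    then show "blk b x = blk b (szero E)"
      using blk_carrier[OF b x] b by (auto simp: blk_zero)
  qed
next
  define J where "J = Sigma {..<length ns} (\<lambda>b. {..<ns ! b} \<times> {..<ns ! b})"
  have "finite J" by (auto simp: J_def)
  show "\<exists>D. \<forall>x::nat \<Rightarrow> 'a. (\<forall>i\<le>D. x i \<in> carrier E) \<longrightarrow>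
      (\<exists>c. (\<exists>i\<le>D. c i \<noteq> 0) \<and> gsum E (\<lambda>i. c i \<cdot> x i) {..D} = szero E)"
  proof (rule exI[of _ "card J"], intro allI impI)
    fix x :: "nat \<Rightarrow> 'a" assume "\<forall>i\<le>card J. x i \<in> carrier E"
    then have x: "\<And>i. i \<le> card J \<Longrightarrow> x i \<in> carrier E" by simp
    have "\<exists>c. (\<exists>i\<in>{..card J}. c i \<noteq> 0) \<and>
      (\<forall>j\<in>J. (\<Sum>i\<in>{..card J}. c i * (case j of (b, i', j') \<Rightarrow> blk b (x i) $$ (i', j'))) = 0)"
      by (rule linear_dependence[OF \<open>finite J\<close>]) auto
    then obtain c where c: "\<exists>i\<in>{..card J}. c i \<noteq> 0"
      "\<And>j. j \<in> J \<Longrightarrow> (\<Sum>i\<in>{..card J}. c i * (case j of (b, i', j') \<Rightarrow> blk b (x i) $$ (i', j'))) = 0"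
      by blast
    have "gsum E (\<lambda>i. c i \<cdot> x i) {..card J} = szero E"
    proof (rule blk_ext)
      fix b assume b: "b < length ns"
      have "blk b (gsum E (\<lambda>i. c i \<cdot> x i) {..card J}) $$ (i, j) = 0" if ij: "i < ns ! b" "j < ns ! b" for i j
      proof -
        have "blk b (gsum E (\<lambda>i. c i \<cdot> x i) {..card J}) $$ (i, j) = (\<Sum>k\<in>{..card J}. blk b (c k \<cdot> x k) $$ (i, j))"
          using b ij x by (intro blk_gsum_index) auto
        also have "\<dots> = (\<Sum>k\<in>{..card J}. c k * blk b (x k) $$ (i, j))"
        proof (intro sum.cong refl)
          fix k assume "k \<in> {..card J}"
          then have "x k \<in> carrier E" using x by simp
          then show "blk b (c k \<cdot> x k) $$ (i, j) = c k * blk b (x k) $$ (i, j)"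
            using blk_carrier[OF b, of "x k"] b ij by (simp add: blk_scale)
        qed
        also have "\<dots> = 0" using c(2)[of "(b, i, j)"] b ij by (auto simp: J_def)
        finally show ?thesis .
      qed
      moreover have "gsum E (\<lambda>i. c i \<cdot> x i) {..card J} \<in> carrier E"
        using x by (intro gsum_closed) auto
      ultimately show "blk b (gsum E (\<lambda>i. c i \<cdot> x i) {..card J}) = blk b (szero E)"
        using blk_carrier[OF b, of "gsum E (\<lambda>i. c i \<cdot> x i) {..card J}"] b
        by (auto simp: blk_zero)
    qed (use x in \<open>auto intro!: gsum_closed\<close>)
    then show "\<exists>c. (\<exists>i\<le>card J. c i \<noteq> 0) \<and> gsum E (\<lambda>i. c i \<cdot> x i) {..card J} = szero E"
      using c(1) by auto
  qed
qed

sublocale fd_star by (rule fd)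

section \<open>Rank and trace of atomic projections\<close>

definition tr :: "'a \<Rightarrow> complex" where
  "tr x = (\<Sum>b<length ns. \<Sum>i<ns ! b. blk b x $$ (i, i))"

definition rk :: "'a \<Rightarrow> nat" where
  "rk x = (\<Sum>b<length ns. vec_space.rank (ns ! b) (blk b x))"

lemma tr_gsum:
  assumes "finite I" "\<And>k. k \<in> I \<Longrightarrow> g k \<in> carrier E"
  shows "tr (gsum E g I) = (\<Sum>k\<in>I. tr (g k))"
proof -
  have "tr (gsum E g I) = (\<Sum>b<length ns. \<Sum>i<ns ! b. \<Sum>k\<in>I. blk b (g k) $$ (i, i))"
    unfolding tr_def using assms by (intro sum.cong refl blk_gsum_index) auto
  also have "\<dots> = (\<Sum>k\<in>I. tr (g k))"
    unfolding tr_def by (subst sum.swap[of _ _ I], subst sum.swap[of _ I]) (rule refl)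
  finally show ?thesis .
qed

lemma rk_add: "\<lbrakk>x \<in> carrier E; y \<in> carrier E\<rbrakk> \<Longrightarrow> rk (x \<boxplus> y) \<le> rk x + rk y"
  unfolding rk_def sum.distrib[symmetric]
  by (intro sum_mono) (auto simp: blk_add intro!: vec_space.rank_subadditive blk_carrier)

lemma rk_zero: "rk (szero E) = 0"
  by (simp add: rk_def blk_zero vec_space.rank_0I)

lemma rk_gsum:
  assumes "finite I" "\<And>k. k \<in> I \<Longrightarrow> g k \<in> carrier E"
  shows "rk (gsum E g I) \<le> (\<Sum>k\<in>I. rk (g k))"
  using assms
proof (induction I rule: finite_induct)
  case (insert k I)
  have "rk (g k \<boxplus> gsum E g I) \<le> rk (g k) + rk (gsum E g I)" using insert by (intro rk_add) auto
  then show ?case using insert by auto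
qed (simp add: rk_zero)

lemma tr_rk_unit:
  assumes "is_unit_of E (carrier E) e"
  shows "tr e = of_nat (rk e)"
proof -
  have e: "blk b e = 1\<^sub>m (ns ! b)" if "b < length ns" for b
    using unit_exists unit_unique assms that by metis
  have "vec_space.rank n (1\<^sub>m n :: complex mat) = n" for n
    using vec_space.det_rank_iff[of "1\<^sub>m n :: complex mat" n] by simp
  then show ?thesis unfolding tr_def rk_def by (simp add: e)
qed

text \<open>If \<open>x\<close> is the diagonal matrix unit at \<open>(j, j)\<close> of block \<open>b\<close>, then the scalar multiple
  \<open>p x p\<close> of \<open>p\<close> is the product of a column and a row of block \<open>b\<close> of \<open>p\<close>.\<close>

lemma atomic_block:
  assumes p: "atomic E p" "p \<noteq> szero E"
  shows "tr p = 1" "rk p \<le> 1"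
proof -
  note P = projD[OF atomicD(1)[OF p(1)]]
  have "\<exists>b<length ns. \<exists>j<ns ! b. blk b p $$ (j, j) \<noteq> 0"
  proof (rule ccontr)
    assume neg: "\<not> ?thesis"
    have "p = szero E"
    proof (rule blk_ext[OF P(1) zero_closed])
      fix b assume b: "b < length ns"
      have "blk b p $$ (i, j) = 0" if ij: "i < ns ! b" "j < ns ! b" for i j
      proof -
        have "blk b (p\<^sup>\<star> \<boxtimes> p) $$ (j, j) = 0" using neg b ij P by auto
        then have "(\<Sum>i<ns ! b. (cmod (blk b p $$ (i, j)))\<^sup>2) = 0"
          unfolding blk_adj_mul_diag[OF b ij(2) P(1)] by (simp only: of_real_eq_0_iff)
        then show ?thesis using ij by (subst (asm) sum_nonneg_eq_0_iff) auto
      qed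
      then show "blk b p = blk b (szero E)" using blk_carrier[OF b P(1)] b by (auto simp: blk_zero)
    qed
    then show False using p by simp
  qed
  then obtain b j where b: "b < length ns" and j: "j < ns ! b" "blk b p $$ (j, j) \<noteq> 0" by blast
  let ?Ms = "\<lambda>b'. if b' = b then mat (ns ! b) (ns ! b) (\<lambda>(i, k). if i = j \<and> k = j then 1 else 0)
      else 0\<^sub>m (ns ! b') (ns ! b')"
  have "\<exists>x\<in>carrier E. \<forall>b'<length ns. blk b' x = ?Ms b'" by (rule blk_surj) auto
  then obtain x where x: "x \<in> carrier E" "\<And>b'. b' < length ns \<Longrightarrow> blk b' x = ?Ms b'" by blast
  obtain c where c: "p \<boxtimes> x \<boxtimes> p = c \<cdot> p" using atomicD(2)[OF p(1) x(1)] by blast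
  note cb = blk_carrier[OF b P(1)]
  have other: "blk b' (p \<boxtimes> x \<boxtimes> p) = 0\<^sub>m (ns ! b') (ns ! b')" if b': "b' < length ns" "b' \<noteq> b" for b'
    using x b' P blk_carrier[OF b'(1) P(1)] by (simp add: blk_mul)
  have main: "blk b (p \<boxtimes> x \<boxtimes> p) $$ (i, k) = blk b p $$ (i, j) * blk b p $$ (j, k)"
    if ik: "i < ns ! b" "k < ns ! b" for i k
  proof -
    have px: "blk b p * blk b x \<in> carrier_mat (ns ! b) (ns ! b)" using cb blk_carrier[OF b x(1)] by auto
    have e: "(blk b p * blk b x) $$ (i, m) = (if m = j then blk b p $$ (i, j) else 0)" if m: "m < ns ! b" for m
    proof -
      have "(blk b p * blk b x) $$ (i, m) = (\<Sum>l<ns ! b. blk b p $$ (i, l) * blk b x $$ (l, m))"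
        by (rule mat_mult_index[OF cb blk_carrier[OF b x(1)] ik(1) m])
      also have "\<dots> = (\<Sum>l<ns ! b. if l = j then (if m = j then blk b p $$ (i, j) else 0) else 0)"
        using m b by (intro sum.cong) (auto simp: x(2))
      also have "\<dots> = (if m = j then blk b p $$ (i, j) else 0)" using j by simp
      finally show ?thesis .
    qed
    have "blk b (p \<boxtimes> x \<boxtimes> p) $$ (i, k) = (\<Sum>m<ns ! b. (blk b p * blk b x) $$ (i, m) * blk b p $$ (m, k))"
      using b x(1) P(1) mat_mult_index[OF px cb ik] by (simp add: blk_mul)
    also have "\<dots> = (\<Sum>m<ns ! b. if m = j then blk b p $$ (i, j) * blk b p $$ (j, k) else 0)"
      by (intro sum.cong) (auto simp: e)
    also have "\<dots> = blk b p $$ (i, j) * blk b p $$ (j, k)" using j by simp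
    finally show ?thesis .
  qed
  have c0: "c \<noteq> 0"
  proof
    assume "c = 0"
    then have "p \<boxtimes> x \<boxtimes> p = szero E" using c P by simp
    then show False using main[OF j(1) j(1)] j b by (simp add: blk_zero)
  qed
  define v where "v i = blk b p $$ (i, j) / c" for i
  define w where "w k = blk b p $$ (j, k)" for k
  have rank1: "blk b p $$ (i, k) = v i * w k" if "i < ns ! b" "k < ns ! b" for i k
    using main[OF that] c0 cb that b P by (simp add: c blk_scale v_def w_def field_simps)
  have zero: "blk b' p = 0\<^sub>m (ns ! b') (ns ! b')" if b': "b' < length ns" "b' \<noteq> b" for b'
  proof -
    have "c \<cdot>\<^sub>m blk b' p = 0\<^sub>m (ns ! b') (ns ! b')" using other[OF b'] c b' P by (simp add: blk_scale)
    then have "(c \<cdot>\<^sub>m blk b' p) $$ (i, k) = 0" if "i < ns ! b'" "k < ns ! b'" for i k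
      using that by simp
    then show ?thesis using blk_carrier[OF b'(1) P(1)] c0 by (intro eq_matI) auto
  qed
  have only: "(\<Sum>b'<length ns. F b') = F b" if "\<And>b'. b' < length ns \<Longrightarrow> b' \<noteq> b \<Longrightarrow> F b' = 0"
    for F :: "nat \<Rightarrow> 'z :: comm_monoid_add"
  proof -
    have "(\<Sum>b'<length ns. F b') = (\<Sum>b'\<in>{b}. F b')"
      by (rule sum.mono_neutral_right) (use b that in auto)
    then show ?thesis by simp
  qed
  have "rk p = vec_space.rank (ns ! b) (blk b p)"
    unfolding rk_def by (rule only) (simp add: zero vec_space.rank_0I)
  also have "\<dots> \<le> 1"
    by (rule vec_space.rank_le_1_product_entries[OF cb, of v w]) (use cb rank1 in auto)
  finally show "rk p \<le> 1" .
  have "tr p = (\<Sum>i<ns ! b. blk b p $$ (i, i))"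
    unfolding tr_def by (rule only) (simp add: zero)
  also have "\<dots> = (\<Sum>i<ns ! b. v i * w i)" by (intro sum.cong) (auto simp: rank1)
  finally have t: "tr p = (\<Sum>i<ns ! b. v i * w i)" .
  \<comment> \<open>Comparing the entry at \<open>(j, j)\<close> in \<open>p p = p\<close> yields
    that this nonzero entry equals itself times the trace.\<close>
  have "blk b p $$ (j, j) = blk b (p \<boxtimes> p) $$ (j, j)" using P by simp
  also have "\<dots> = (\<Sum>m<ns ! b. blk b p $$ (j, m) * blk b p $$ (m, j))"
    unfolding blk_mul[OF b P(1) P(1)] by (rule mat_mult_index[OF cb cb j(1) j(1)])
  also have "\<dots> = (\<Sum>m<ns ! b. (v j * w j) * (v m * w m))" using j by (intro sum.cong) (auto simp: rank1)
  also have "\<dots> = blk b p $$ (j, j) * tr p" using j by (simp add: t sum_distrib_left rank1)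
  finally show "tr p = 1" using j by simp
qed

text \<open>Rank is only subadditive, while trace is additive; they agree on the unit. Atoms have
  trace 1, so the unit has rank \<open>card F\<close>. As atoms have rank at most 1, subadditivity
  over \<open>G\<close> and its complement in \<open>F\<close> leaves no slack.\<close>

lemma rk_atoms:
  assumes F: "frame E F" and G: "G \<subseteq> F"
  shows "rk (gsum E (\<lambda>p. p) G) = card G"
proof -
  note f = frame_facts[OF F]
  have fin: "finite G" "finite (F - G)" using f(1) G finite_subset by auto
  have le: "rk (gsum E (\<lambda>p. p) H) \<le> card H" if H: "H \<subseteq> F" for H
  proof -
    have "finite H" using H f(1) finite_subset by auto
    then have "rk (gsum E (\<lambda>p. p) H) \<le> (\<Sum>p\<in>H. rk p)" using H f by (intro rk_gsum) auto
    also have "\<dots> \<le> (\<Sum>p\<in>H. 1)" using H atomic_block(2)[OF f(3,5)] by (intro sum_mono) auto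
    finally show ?thesis by simp
  qed
  have "tr (gsum E (\<lambda>p. p) F) = (\<Sum>p\<in>F. tr p)" using f by (intro tr_gsum) auto
  also have "\<dots> = (\<Sum>p\<in>F. 1)" using f by (intro sum.cong refl atomic_block) auto
  finally have "rk (gsum E (\<lambda>p. p) F) = card F" using tr_rk_unit[OF f(7)] by simp
  moreover have "gsum E (\<lambda>p. p) F = gsum E (\<lambda>p. p) G \<boxplus> gsum E (\<lambda>p. p) (F - G)"
    using gsum_Un_disjoint[of G "F - G" "\<lambda>p. p"] fin G f(2) by (auto simp: Un_absorb1)
  moreover have "rk (gsum E (\<lambda>p. p) G \<boxplus> gsum E (\<lambda>p. p) (F - G))
      \<le> rk (gsum E (\<lambda>p. p) G) + rk (gsum E (\<lambda>p. p) (F - G))"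
    using G f by (intro rk_add) auto
  moreover have "card F = card G + card (F - G)"
    using card_Un_disjoint[OF fin] G by (simp add: Un_absorb1)
  ultimately show ?thesis using le[of G] le[of "F - G"] G by auto
qed

end

lemma fd_cstar_block_form:
  assumes "fd_cstar_algebra E"
  obtains ns f where "star_iso E (matrix_sum ns) f" "\<forall>n\<in>set ns. 0 < n" "block_form E ns (\<lambda>b x. f x ! b)"
  using assms star_iso_block_form unfolding fd_cstar_algebra_def by blast

lemma fd_cstar_fd_star: "fd_cstar_algebra E \<Longrightarrow> fd_star E"
  by (metis fd_cstar_block_form block_form.fd)

lemma fd_cstar_unit: "fd_cstar_algebra E \<Longrightarrow> \<exists>e. is_unit_of E (carrier E) e"
  by (metis fd_cstar_block_form block_form.unit_exists)

text \<open>Every identification with a matrix sum gives the value \<open>card G\<close>, so the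
  description in \<open>fd_rank\<close> has exactly one witness.\<close>

lemma fd_rank_atoms:
  assumes E: "fd_cstar_algebra E" and F: "frame E F" and G: "G \<subseteq> F"
  shows "fd_rank E (gsum E (\<lambda>p. p) G) = card G"
proof -
  have sa: "star_algebra E" using E by (simp add: fd_cstar_algebra_def)
  interpret star_algebra E by fact
  have p: "gsum E (\<lambda>p. p) G \<in> carrier E" using frame_facts(2)[OF F] G by auto
  have eq: "sum_list (map2 vec_space.rank ns (f (gsum E (\<lambda>p. p) G))) = card G"
    if f: "\<forall>n\<in>set ns. 0 < n" "star_iso E (matrix_sum ns) f" for ns f
  proof -
    interpret block_form E ns "\<lambda>b x. f x ! b" by (rule star_iso_block_form[OF sa f(2)])
    have "length (f (gsum E (\<lambda>p. p) G)) = length ns"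
      using f(2) p by (auto simp: star_iso_def star_hom_def matrix_sum_def Pi_iff dest: list_all2_lengthD)
    then have "sum_list (map2 vec_space.rank ns (f (gsum E (\<lambda>p. p) G))) = rk (gsum E (\<lambda>p. p) G)"
      by (simp add: rk_def sum_list_sum_nth atLeast0LessThan)
    then show ?thesis using rk_atoms[OF F G] by simp
  qed
  obtain ns f where f: "star_iso E (matrix_sum ns) f" "\<forall>n\<in>set ns. 0 < n" using E by (rule fd_cstar_block_form)
  show ?thesis unfolding fd_rank_def
  proof (rule the_equality)
    show "\<exists>ns f. (\<forall>n\<in>set ns. 0 < n) \<and> star_iso E (matrix_sum ns) f
      \<and> card G = sum_list (map2 vec_space.rank ns (f (gsum E (\<lambda>p. p) G)))"
      using f eq[OF f(2,1)] by (intro exI[of _ ns] exI[of _ f]) simp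
  next
    fix n assume "\<exists>ns f. (\<forall>n\<in>set ns. 0 < n) \<and> star_iso E (matrix_sum ns) f
      \<and> n = sum_list (map2 vec_space.rank ns (f (gsum E (\<lambda>p. p) G)))"
    then show "n = card G" using eq by (elim exE conjE) simp
  qed
qed

text \<open>Decomposing \<open>p\<close> into atoms of its corner and extending them to a frame
  turns the rank of \<open>p\<close> into a number of atoms. This number is at most one exactly when
  the corner of \<open>p\<close> is scalar.\<close>

lemma fd_rank_projection:
  assumes E: "fd_cstar_algebra E" and p: "projection E p"
  shows "fd_rank E p \<le> 1 \<longleftrightarrow> atomic E p" "fd_rank E p = 1 \<longleftrightarrow> atomic E p \<and> p \<noteq> szero E"
proof -
  interpret fd_star E using E by (rule fd_cstar_fd_star)
  obtain e where e: "is_unit_of E (carrier E) e" using fd_cstar_unit[OF E] by blast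
  note P = projD[OF p]
  \<comment> \<open>The corner of \<open>p\<close>. Its unit is \<open>p\<close>, so the members of
    a frame of the corner sum to \<open>p\<close>.\<close>
  define S where "S = {x \<in> carrier E. p \<boxtimes> x = x \<and> x \<boxtimes> p = x}"
  have S: "subalg E S" "self_adjoint E S"
  proof -
    have Smul: "x \<boxtimes> y \<in> S" if "x \<in> S" "y \<in> S" for x y
    proof -
      have xy: "x \<in> carrier E" "y \<in> carrier E" "p \<boxtimes> x = x" "y \<boxtimes> p = y"
        using that by (simp_all add: S_def)
      have "p \<boxtimes> (x \<boxtimes> y) = p \<boxtimes> x \<boxtimes> y" "x \<boxtimes> y \<boxtimes> p = x \<boxtimes> (y \<boxtimes> p)"
        using xy(1,2) P(1) by (simp_all only: mul_assoc)
      then show ?thesis unfolding xy(3,4) using xy(1,2) by (simp add: S_def)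
    qed
    have Sadd: "x \<boxplus> y \<in> S" if "x \<in> S" "y \<in> S" for x y
      using that P(1) by (simp add: S_def mul_add_left mul_add_right)
    have Sscale: "c \<cdot> x \<in> S" if "x \<in> S" for c x
      using that P(1) by (simp add: S_def mul_scale_left mul_scale_right)
    have "szero E \<in> S" "S \<subseteq> carrier E" using P(1) by (auto simp: S_def)
    then show "subalg E S" unfolding subalg_def using Smul Sadd Sscale by blast
    show "self_adjoint E S" unfolding S_def self_adjoint_def
    proof (intro ballI CollectI conjI)
      fix x assume "x \<in> {x \<in> carrier E. p \<boxtimes> x = x \<and> x \<boxtimes> p = x}"
      then have x: "x \<in> carrier E" "p \<boxtimes> x = x" "x \<boxtimes> p = x" by auto
      then show "x\<^sup>\<star> \<in> carrier E" "p \<boxtimes> x\<^sup>\<star> = x\<^sup>\<star>" "x\<^sup>\<star> \<boxtimes> p = x\<^sup>\<star>"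
        using adj_mul[of x p] adj_mul[of p x] P by simp_all
    qed
  qed
  interpret S: fd_star "E\<lparr>carrier := S\<rparr>" using S by (rule fd_subalgebra)
  have "is_unit_of (E\<lparr>carrier := S\<rparr>) (carrier (E\<lparr>carrier := S\<rparr>)) p"
    using P by (auto simp: is_unit_of_def S_def)
  then obtain G where G: "frame (E\<lparr>carrier := S\<rparr>) G"
    and Gp: "gsum (E\<lparr>carrier := S\<rparr>) (\<lambda>p. p) G = p"
    using S.frame_exists S.frame_facts(7) S.unit_unique by metis
  note g = S.frame_facts[OF G]
  have GS: "q \<in> S" if "q \<in> G" for q using g(2)[OF that] by simp
  have sum: "gsum E (\<lambda>p. p) G = p" using gsum_subalgebra[OF S, of G "\<lambda>p. p"] GS Gp by simp
  \<comment> \<open>For \<open>q\<close> below \<open>p\<close>, compressing \<open>x\<close> to the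
    corner of \<open>p\<close> first does not change \<open>q x q\<close>; hence atoms of the corner
    are atoms of \<open>E\<close>.\<close>
  have Gat: "atomic E q" if q: "q \<in> G" for q
  proof -
    have "\<exists>c. q \<boxtimes> x \<boxtimes> q = c \<cdot> q" if x: "x \<in> carrier E" for x
    proof -
      have qS: "q \<in> carrier E" "p \<boxtimes> q = q" "q \<boxtimes> p = q" using GS[OF q] by (auto simp: S_def)
      have "p \<boxtimes> x \<boxtimes> p \<in> S"
        using P x by (simp add: S_def mul_assoc proj_absorb[OF p])
      then obtain c where c: "q \<boxtimes> (p \<boxtimes> x \<boxtimes> p) \<boxtimes> q = c \<cdot> q"
        using S.atomicD(2)[OF g(3)[OF q], of "p \<boxtimes> x \<boxtimes> p"] by auto
      have "q \<boxtimes> (p \<boxtimes> x \<boxtimes> p) \<boxtimes> q = (q \<boxtimes> p) \<boxtimes> x \<boxtimes> (p \<boxtimes> q)"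
        using qS(1) P(1) x by (simp add: mul_assoc)
      then have "q \<boxtimes> x \<boxtimes> q = c \<cdot> q" using c qS by simp
      then show ?thesis by blast
    qed
    moreover have "projection E q" using g(4)[OF q] GS[OF q] by (auto simp: projection_def S_def)
    ultimately show ?thesis by (simp add: atomic_def)
  qed
  have oG: "orthogonal_family E G"
    using g Gat by (auto simp: orthogonal_family_def atomic_def)
  obtain F where F: "frame E F" "G \<subseteq> F" using frame_extend[OF e oG Gat] by blast
  have rk: "fd_rank E p = card G" using fd_rank_atoms[OF E F] sum by simp
  have finG: "finite G" using g(1) .
  have le1: "atomic E p" if cG: "card G \<le> 1"
  proof (cases "G = {}")
    case True
    then show ?thesis using sum by (metis atomic_zero gsum_empty)
  next
    case False
    then have "card G = 1" using cG finG by (simp add: le_Suc_eq)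
    then obtain q where "G = {q}" by (auto simp: card_1_singleton_iff)
    moreover have "gsum E (\<lambda>p. p) {q} = q"
      using calculation GS[of q] by (intro gsum_single[of "{q}" q "\<lambda>p. p"]) (auto simp: S_def)
    ultimately show ?thesis using sum Gat[of q] by simp
  qed
  have at1: "card G = 1" if a: "atomic E p" and nz: "p \<noteq> szero E"
  proof -
    have "q = p" if q: "q \<in> G" for q
    proof -
      have qS: "q \<in> carrier E" "p \<boxtimes> q = q" "q \<boxtimes> p = q" "q \<boxtimes> q = q" "q \<noteq> szero E"
        using GS[OF q] projD(2)[OF atomicD(1)[OF Gat[OF q]]] g(5)[OF q] by (auto simp: S_def)
      obtain c where "p \<boxtimes> q \<boxtimes> p = c \<cdot> p" using atomicD(2)[OF a qS(1)] by blast
      then have c: "q = c \<cdot> p" using qS by simp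
      then have "c \<cdot> q = 1 \<cdot> q" using qS P by (metis mul_scale_left scale_one)
      then have "c = 1" using scale_left_inject qS by blast
      then show ?thesis using c P by simp
    qed
    moreover have "G \<noteq> {}" using sum nz by auto
    ultimately have "G = {p}" by auto
    then show ?thesis by simp
  qed
  show "fd_rank E p \<le> 1 \<longleftrightarrow> atomic E p"
  proof
    assume "atomic E p"
    then show "fd_rank E p \<le> 1"
    proof (cases "p = szero E")
      case True
      have "G = {}"
      proof (rule ccontr)
        assume "G \<noteq> {}"
        then obtain q where "q \<in> G" by blast
        then show False using GS[of q] g(5)[of q] True by (auto simp: S_def)
      qed
      then show ?thesis using rk by simp
    qed (use at1 rk in auto)
  qed (use le1 rk in auto)
  show "fd_rank E p = 1 \<longleftrightarrow> atomic E p \<and> p \<noteq> szero E"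
  proof
    assume "fd_rank E p = 1"
    then have c: "card G = 1" using rk by simp
    then obtain q where "q \<in> G" by (metis card.empty ex_in_conv zero_neq_one)
    then have "p \<noteq> szero E" using GS[of q] g(5)[of q] by (auto simp: S_def)
    then show "atomic E p \<and> p \<noteq> szero E" using le1 c by auto
  qed (use at1 rk in auto)
qed


section \<open>Structure theorem for star-algebras with a frame\<close>

context fd_star
begin

lemma gsum_scale_left:
  assumes "finite I" "x \<in> carrier E"
  shows "gsum E (\<lambda>i. c i \<cdot> x) I = (\<Sum>i\<in>I. c i) \<cdot> x"
  using assms(1) by (induction I rule: finite_induct) (simp_all add: assms(2) scale_add_left)

text \<open>The coefficients of the corners \<open>p x q\<close> with respect to matrix units are
  the entries of the blocks, one block for each equivalence class of the frame. This is what makes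
  the algebra generated by a digraph algebra a direct sum of matrix algebras.\<close>

lemma frame_fd_cstar:
  assumes P: "frame E P"
  shows "fd_cstar_algebra E"
proof -
  note F = frame_facts[OF P]
  obtain r u where r: "\<And>p. p \<in> P \<Longrightarrow> r p \<in> P"
    and u: "\<And>p. p \<in> P \<Longrightarrow> u p \<in> carrier E"
      "\<And>p. p \<in> P \<Longrightarrow> u p \<boxtimes> (u p)\<^sup>\<star> = r p" "\<And>p. p \<in> P \<Longrightarrow> (u p)\<^sup>\<star> \<boxtimes> u p = p"
    and one_dim: "\<And>p q x. \<lbrakk>p \<in> P; q \<in> P; x \<in> carrier E; r p = r q\<rbrakk> \<Longrightarrow> \<exists>c. p \<boxtimes> x \<boxtimes> q = c \<cdot> ((u p)\<^sup>\<star> \<boxtimes> u q)"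
    and off: "\<And>p q x. \<lbrakk>p \<in> P; q \<in> P; x \<in> carrier E; r p \<noteq> r q\<rbrakk> \<Longrightarrow> p \<boxtimes> x \<boxtimes> q = szero E"
    by (rule matrix_units[OF P]) blast
  have PP: "p \<boxtimes> p = p" "p\<^sup>\<star> = p" if "p \<in> P" for p using projD[OF F(4)[OF that]] by auto
  have ru: "r p \<boxtimes> u p = u p" if "p \<in> P" for p
    using partial_isometry_absorb(2)[of "(u p)\<^sup>\<star>" "r p"] u that F(4)[OF r[OF that]] by simp
  define v where "v p q = (u p)\<^sup>\<star> \<boxtimes> u q" for p q
  have vc: "v p q \<in> carrier E" if "p \<in> P" "q \<in> P" for p q using u that by (simp add: v_def)
  have vmul: "v p q \<boxtimes> v q t = v p t" if "p \<in> P" "q \<in> P" "t \<in> P" "r p = r q" "r q = r t" for p q t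
  proof -
    have c: "u p \<in> carrier E" "u q \<in> carrier E" "u t \<in> carrier E" using u that by auto
    have "v p q \<boxtimes> v q t = (u p)\<^sup>\<star> \<boxtimes> (u q \<boxtimes> (u q)\<^sup>\<star> \<boxtimes> u t)"
      using c by (simp add: v_def mul_assoc)
    then show ?thesis using u(2)[OF that(2)] ru[OF that(3)] that(5) by (simp add: v_def)
  qed
  have vself: "v p p = p" if "p \<in> P" for p using u that by (simp add: v_def)
  have vadj: "(v p q)\<^sup>\<star> = v q p" if "p \<in> P" "q \<in> P" for p q
    using u(1) that by (simp add: v_def adj_mul)
  have v0: "v p q \<noteq> szero E" if pq: "p \<in> P" "q \<in> P" "r p = r q" for p q
  proof
    assume "v p q = szero E"
    then have "v p p = szero E" using vmul[OF pq(1,2,1,3) pq(3)[symmetric]] vc[OF pq(2,1)] by simp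
    then show False using vself[OF pq(1)] F(5)[OF pq(1)] by simp
  qed
  have vsupp: "p \<boxtimes> v p q \<boxtimes> q = v p q" if "p \<in> P" "q \<in> P" "r p = r q" for p q
    using vmul[of p p q] vmul[of p q q] that by (simp add: vself)
  \<comment> \<open>The matrix entry at \<open>(p, q)\<close>. It is meaningful only for
    \<open>p\<close> and \<open>q\<close> in one class; between classes the corner is zero.\<close>
  define \<kappa> where "\<kappa> p q x = (SOME c. p \<boxtimes> x \<boxtimes> q = c \<cdot> v p q)" for p q x
  have \<kappa>: "p \<boxtimes> x \<boxtimes> q = \<kappa> p q x \<cdot> v p q"
    if "p \<in> P" "q \<in> P" "r p = r q" "x \<in> carrier E" for p q x
    unfolding \<kappa>_def v_def by (rule someI_ex[OF one_dim]) (use that in auto)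
  have \<kappa>I: "\<kappa> p q x = c" if "p \<boxtimes> x \<boxtimes> q = c \<cdot> v p q" "p \<in> P" "q \<in> P" "r p = r q" "x \<in> carrier E" for p q x c
    using \<kappa>[of p q x] that scale_left_inject[OF vc v0] by simp
  \<comment> \<open>Blocks and rows are positions in lists: \<open>rs\<close> enumerates the
    representatives, one per block, and \<open>cl\<close> the members of a class, one per
    row.\<close>
  define rs where "rs = (SOME rs. set rs = r ` P \<and> distinct rs)"
  have rs: "set rs = r ` P" "distinct rs"
    unfolding rs_def using someI_ex[OF finite_distinct_list[of "r ` P"]] F(1) by auto
  define cl where "cl \<rho> = (SOME ps. set ps = {p \<in> P. r p = \<rho>} \<and> distinct ps)" for \<rho>
  have cl: "set (cl \<rho>) = {p \<in> P. r p = \<rho>}" "distinct (cl \<rho>)" for \<rho>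
    unfolding cl_def using someI_ex[OF finite_distinct_list[of "{p \<in> P. r p = \<rho>}"]] F(1) by auto
  have clP: "cl \<rho> ! i \<in> P \<and> r (cl \<rho> ! i) = \<rho>" if "i < length (cl \<rho>)" for \<rho> i
    using nth_mem[OF that] cl(1) by auto
  define ns where "ns = map (\<lambda>\<rho>. length (cl \<rho>)) rs"
  define f where "f x = map (\<lambda>\<rho>. mat (length (cl \<rho>)) (length (cl \<rho>))
      (\<lambda>(i, j). \<kappa> (cl \<rho> ! i) (cl \<rho> ! j) x)) rs" for x
  have pos: "\<forall>n\<in>set ns. 0 < n"
  proof
    fix n assume "n \<in> set ns"
    then obtain p where p: "p \<in> P" "n = length (cl (r p))" using rs by (auto simp: ns_def)
    then have "p \<in> set (cl (r p))" using cl by auto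
    then show "0 < n" using p(2) by (auto intro: length_pos_if_in_set)
  qed
  have \<kappa>_mul: "\<kappa> p q (x \<boxtimes> y) = (\<Sum>t\<in>{t \<in> P. r t = r p}. \<kappa> p t x * \<kappa> t q y)"
    if pq: "p \<in> P" "q \<in> P" "r p = r q" and x: "x \<in> carrier E" and y: "y \<in> carrier E" for p q x y
  proof (rule \<kappa>I)
    have c: "p \<in> carrier E" "q \<in> carrier E" using F(2) pq by auto
    have "p \<boxtimes> (x \<boxtimes> y) \<boxtimes> q = p \<boxtimes> x \<boxtimes> gsum E (\<lambda>t. t \<boxtimes> (y \<boxtimes> q)) P"
      using c x y frame_left[OF P, of "y \<boxtimes> q"] by (simp add: mul_assoc)
    also have "\<dots> = gsum E (\<lambda>t. p \<boxtimes> x \<boxtimes> (t \<boxtimes> (y \<boxtimes> q))) P"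
      using c x y F(1,2) by (intro gsum_mul_left) auto
    also have "\<dots> = gsum E (\<lambda>t. if r t = r p then (\<kappa> p t x * \<kappa> t q y) \<cdot> v p q else szero E) P"
    proof (rule gsum_cong[OF refl])
      fix t assume t: "t \<in> P"
      have tc: "t \<in> carrier E" using F(2) t by simp
      have "p \<boxtimes> x \<boxtimes> (t \<boxtimes> (y \<boxtimes> q)) = p \<boxtimes> x \<boxtimes> t \<boxtimes> (t \<boxtimes> y \<boxtimes> q)"
        using c x y tc PP(1)[OF t] by (simp add: mul_assoc proj_absorb(1)[OF F(4)[OF t]])
      also have "\<dots> = (if r t = r p then (\<kappa> p t x * \<kappa> t q y) \<cdot> v p q else szero E)"
      proof (cases "r t = r p")
        case True
        then have "p \<boxtimes> x \<boxtimes> t = \<kappa> p t x \<cdot> v p t" "t \<boxtimes> y \<boxtimes> q = \<kappa> t q y \<cdot> v t q"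
          using \<kappa> pq t x y by auto
        then show ?thesis
          using True vmul[of p t q] pq t vc
          by (simp add: mul_scale_left mul_scale_right scale_scale mult.commute)
      next
        case False
        then have "p \<boxtimes> x \<boxtimes> t = szero E" using off pq t x by simp
        then show ?thesis using False c y tc by simp
      qed
      finally show "p \<boxtimes> x \<boxtimes> (t \<boxtimes> (y \<boxtimes> q)) = (if r t = r p then (\<kappa> p t x * \<kappa> t q y) \<cdot> v p q else szero E)" .
      show "(if r t = r p then (\<kappa> p t x * \<kappa> t q y) \<cdot> v p q else szero E) \<in> carrier E"
        using vc pq by simp
    qed
    also have "\<dots> = gsum E (\<lambda>t. (\<kappa> p t x * \<kappa> t q y) \<cdot> v p q) {t \<in> P. r t = r p}"
      using F(1) vc pq by (intro gsum_filter) auto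
    also have "\<dots> = (\<Sum>t\<in>{t \<in> P. r t = r p}. \<kappa> p t x * \<kappa> t q y) \<cdot> v p q"
      using F(1) vc pq by (intro gsum_scale_left) auto
    finally show "p \<boxtimes> (x \<boxtimes> y) \<boxtimes> q = (\<Sum>t\<in>{t \<in> P. r t = r p}. \<kappa> p t x * \<kappa> t q y) \<cdot> v p q" .
  qed (use pq x y in auto)
  have \<kappa>_add: "\<kappa> p q (x \<boxplus> y) = \<kappa> p q x + \<kappa> p q y"
    if pq: "p \<in> P" "q \<in> P" "r p = r q" and x: "x \<in> carrier E" and y: "y \<in> carrier E" for p q x y
    by (rule \<kappa>I) (use pq x y F(2) vc \<kappa> in \<open>auto simp: mul_add_left mul_add_right scale_add_left\<close>)
  have \<kappa>_scale: "\<kappa> p q (c \<cdot> x) = c * \<kappa> p q x"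
    if pq: "p \<in> P" "q \<in> P" "r p = r q" and x: "x \<in> carrier E" for p q x c
    by (rule \<kappa>I) (use pq x F(2) vc \<kappa> in \<open>auto simp: mul_scale_left mul_scale_right scale_scale\<close>)
  have \<kappa>_adj: "\<kappa> p q (x\<^sup>\<star>) = cnj (\<kappa> q p x)"
    if pq: "p \<in> P" "q \<in> P" "r p = r q" and x: "x \<in> carrier E" for p q x
  proof (rule \<kappa>I)
    have c: "p \<in> carrier E" "q \<in> carrier E" using F(2) pq by auto
    have "p \<boxtimes> x\<^sup>\<star> \<boxtimes> q = (q \<boxtimes> x \<boxtimes> p)\<^sup>\<star>" using c x pq PP(2) by (simp add: adj_mul mul_assoc)
    also have "\<dots> = cnj (\<kappa> q p x) \<cdot> v p q" using \<kappa>[of q p x] pq x vadj[of q p] vc by (simp add: adj_scale)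
    finally show "p \<boxtimes> x\<^sup>\<star> \<boxtimes> q = cnj (\<kappa> q p x) \<cdot> v p q" .
  qed (use pq x in auto)
  have sim: "cl \<rho> ! i \<in> P" "r (cl \<rho> ! i) = r (cl \<rho> ! j)" if "i < length (cl \<rho>)" "j < length (cl \<rho>)" for \<rho> i j
    using clP[OF that(1)] clP[OF that(2)] by auto
  have hom: "star_hom E (matrix_sum ns) f"
    unfolding star_hom_def
  proof (intro conjI ballI allI)
    show "f \<in> carrier E \<rightarrow> carrier (matrix_sum ns)"
      by (auto simp: f_def matrix_sum_def ns_def list_all2_conv_all_nth)
  next
    fix x y assume x: "x \<in> carrier E" and y: "y \<in> carrier E"
    show "f (x \<boxplus> y) = sadd (matrix_sum ns) (f x) (f y)"
      by (rule nth_equalityI) (auto simp: f_def matrix_sum_def ns_def intro!: eq_matI \<kappa>_add x y sim)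
    show "f (x \<boxtimes> y) = smul (matrix_sum ns) (f x) (f y)"
    proof (rule nth_equalityI)
      fix b assume "b < length (f (x \<boxtimes> y))"
      then have b: "b < length rs" by (simp add: f_def)
      define ps where "ps = cl (rs ! b)"
      let ?M = "\<lambda>x. mat (length ps) (length ps) (\<lambda>(i, j). \<kappa> (ps ! i) (ps ! j) x)"
      have "?M (x \<boxtimes> y) = ?M x * ?M y"
      proof (rule eq_matI)
        fix i j assume "i < dim_row (?M x * ?M y)" "j < dim_col (?M x * ?M y)"
        then have ij: "i < length ps" "j < length ps" by auto
        have bij: "bij_betw ((!) ps) {..<length ps} {t \<in> P. r t = r (ps ! i)}"
          using cl[of "rs ! b"] clP[of i "rs ! b"] ij by (intro bij_betw_nth) (auto simp: ps_def)
        have "\<kappa> (ps ! i) (ps ! j) (x \<boxtimes> y) = (\<Sum>t\<in>{t \<in> P. r t = r (ps ! i)}. \<kappa> (ps ! i) t x * \<kappa> t (ps ! j) y)"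
          by (rule \<kappa>_mul) (use ij x y sim[of i "rs ! b" j] sim[of j "rs ! b" i] in \<open>auto simp: ps_def\<close>)
        also have "\<dots> = (\<Sum>k<length ps. \<kappa> (ps ! i) (ps ! k) x * \<kappa> (ps ! k) (ps ! j) y)"
          by (rule sum.reindex_bij_betw[OF bij, symmetric])
        also have "\<dots> = (?M x * ?M y) $$ (i, j)"
          using ij by (subst mat_mult_index[of _ "length ps"]) auto
        finally show "?M (x \<boxtimes> y) $$ (i, j) = (?M x * ?M y) $$ (i, j)" using ij by simp
      qed auto
      then show "f (x \<boxtimes> y) ! b = smul (matrix_sum ns) (f x) (f y) ! b"
        using b by (simp add: f_def matrix_sum_def ps_def)
    qed (simp add: f_def matrix_sum_def)
  next
    fix c x assume x: "x \<in> carrier E"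
    show "f (c \<cdot> x) = sscale (matrix_sum ns) c (f x)"
      by (rule nth_equalityI) (auto simp: f_def matrix_sum_def ns_def intro!: eq_matI \<kappa>_scale x sim)
  next
    fix x assume x: "x \<in> carrier E"
    show "f (x\<^sup>\<star>) = sadj (matrix_sum ns) (f x)"
    proof (rule nth_equalityI)
      fix b assume "b < length (f (x\<^sup>\<star>))"
      then have b: "b < length rs" by (simp add: f_def)
      define ps where "ps = cl (rs ! b)"
      let ?M = "\<lambda>x. mat (length ps) (length ps) (\<lambda>(i, j). \<kappa> (ps ! i) (ps ! j) x)"
      have Mc: "?M x \<in> carrier_mat (length ps) (length ps)" by simp
      have "?M (x\<^sup>\<star>) = mat_adjoint (?M x)"
      proof (rule eq_matI)
        fix i j assume "i < dim_row (mat_adjoint (?M x))" "j < dim_col (mat_adjoint (?M x))"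
        then have ij: "i < length ps" "j < length ps" using mat_adjoint_carrier[OF Mc] by auto
        have "\<kappa> (ps ! i) (ps ! j) (x\<^sup>\<star>) = cnj (\<kappa> (ps ! j) (ps ! i) x)"
          by (rule \<kappa>_adj) (use ij x sim[of i "rs ! b" j] sim[of j "rs ! b" i] in \<open>auto simp: ps_def\<close>)
        then show "?M (x\<^sup>\<star>) $$ (i, j) = mat_adjoint (?M x) $$ (i, j)"
          using ij mat_adjoint_index[OF Mc ij] by simp
      qed (use mat_adjoint_carrier[OF Mc] in auto)
      then show "f (x\<^sup>\<star>) ! b = sadj (matrix_sum ns) (f x) ! b"
        using b by (simp add: f_def matrix_sum_def ps_def)
    qed (simp add: f_def matrix_sum_def)
  qed
  define bi where "bi p = (SOME b. b < length rs \<and> rs ! b = r p)" for p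
  have bi: "bi p < length rs \<and> rs ! bi p = r p" if "p \<in> P" for p
    unfolding bi_def by (rule someI_ex) (use rs(1) that in \<open>auto simp: in_set_conv_nth[symmetric]\<close>)
  define ix where "ix p = (SOME i. i < length (cl (r p)) \<and> cl (r p) ! i = p)" for p
  have ix: "ix p < length (cl (r p)) \<and> cl (r p) ! ix p = p" if "p \<in> P" for p
    unfolding ix_def by (rule someI_ex) (use cl(1)[of "r p"] that in \<open>auto simp: in_set_conv_nth[symmetric]\<close>)
  have fpq: "(f x ! bi p) $$ (ix p, ix q) = \<kappa> p q x" if "p \<in> P" "q \<in> P" "r p = r q" for p q x
    using bi[OF that(1)] ix[OF that(1)] ix[OF that(2)] that(3) by (simp add: f_def)
  have inj: "inj_on f (carrier E)"
  proof (rule inj_onI)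
    fix x y assume x: "x \<in> carrier E" and y: "y \<in> carrier E" and eq: "f x = f y"
    show "x = y"
    proof (rule frame_ext[OF P x y])
      fix p q assume pq: "p \<in> P" "q \<in> P"
      show "p \<boxtimes> x \<boxtimes> q = p \<boxtimes> y \<boxtimes> q"
        using \<kappa>[OF pq _ x] \<kappa>[OF pq _ y] fpq[OF pq] off[OF pq x] off[OF pq y] eq by (cases "r p = r q") metis+
    qed
  qed
  have surj: "Ms \<in> f ` carrier E" if Ms: "Ms \<in> carrier (matrix_sum ns)" for Ms
  proof -
    have len: "length Ms = length rs"
      and Mc: "\<And>b. b < length rs \<Longrightarrow> Ms ! b \<in> carrier_mat (length (cl (rs ! b))) (length (cl (rs ! b)))"
      using Ms by (auto simp: matrix_sum_def ns_def list_all2_conv_all_nth)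
    \<comment> \<open>A preimage is assembled by attaching the prescribed matrix entries to the
      matrix units; \<open>bi\<close> and \<open>ix\<close> recover the block and the row of a frame
      member.\<close>
    define m where "m p q = (Ms ! bi p) $$ (ix p, ix q)" for p q
    define w where "w p q = (if r p = r q then m p q \<cdot> v p q else szero E)" for p q
    have wc: "w p q \<in> carrier E" if "p \<in> P" "q \<in> P" for p q using vc that by (simp add: w_def)
    define x where "x = gsum E (\<lambda>p. gsum E (\<lambda>q. w p q) P) P"
    have x: "x \<in> carrier E" using wc by (auto simp: x_def intro!: gsum_closed)
    have ws: "p' \<boxtimes> w p q \<boxtimes> q' = (if p' = p \<and> q' = q then w p q else szero E)"
      if "p \<in> P" "q \<in> P" "p' \<in> P" "q' \<in> P" for p q p' q'
    proof -
      note c = F(2)[OF that(1)] F(2)[OF that(2)] F(2)[OF that(3)] F(2)[OF that(4)]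
      have w: "w p q = p \<boxtimes> w p q \<boxtimes> q" using c vsupp[OF that(1,2)] vc[OF that(1,2)]
        by (simp add: w_def mul_scale_left mul_scale_right)
      have "p' \<boxtimes> w p q \<boxtimes> q' = p' \<boxtimes> (p \<boxtimes> w p q \<boxtimes> q) \<boxtimes> q'" using w by simp
      also have "\<dots> = (p' \<boxtimes> p) \<boxtimes> w p q \<boxtimes> (q \<boxtimes> q')" using c wc[OF that(1,2)] by (simp add: mul_assoc)
      also have "\<dots> = (if p' = p \<and> q' = q then p \<boxtimes> w p q \<boxtimes> q else szero E)"
        using F(6)[OF that(3,1)] F(6)[OF that(2,4)] c wc[OF that(1,2)] PP(1)[OF that(1)] PP(1)[OF that(2)] by auto
      finally show ?thesis using w by simp
    qed
    have px: "p \<boxtimes> x \<boxtimes> q = w p q" if pq: "p \<in> P" "q \<in> P" for p q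
    proof -
      note c = F(2)[OF pq(1)] F(2)[OF pq(2)]
      have g: "gsum E (\<lambda>t. w s t) P \<in> carrier E" if "s \<in> P" for s using wc that by auto
      have "p \<boxtimes> x \<boxtimes> q = gsum E (\<lambda>s. p \<boxtimes> gsum E (\<lambda>t. w s t) P \<boxtimes> q) P"
        unfolding x_def using F(1) c g by (simp add: gsum_mul_left gsum_mul_right)
      also have "\<dots> = gsum E (\<lambda>s. gsum E (\<lambda>t. p \<boxtimes> w s t \<boxtimes> q) P) P"
      proof (rule gsum_cong[OF refl])
        fix s assume s: "s \<in> P"
        show "p \<boxtimes> gsum E (\<lambda>t. w s t) P \<boxtimes> q = gsum E (\<lambda>t. p \<boxtimes> w s t \<boxtimes> q) P"
          using F(1) c wc[OF s] by (simp add: gsum_mul_left gsum_mul_right)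
        show "gsum E (\<lambda>t. p \<boxtimes> w s t \<boxtimes> q) P \<in> carrier E" using c wc[OF s] by auto
      qed
      also have "\<dots> = gsum E (\<lambda>t. p \<boxtimes> w p t \<boxtimes> q) P"
        by (rule gsum_single[OF F(1) pq(1)])
          (use c wc pq ws in \<open>auto intro!: gsum_closed gsum_eq_zero\<close>)
      also have "\<dots> = p \<boxtimes> w p q \<boxtimes> q"
        by (rule gsum_single[OF F(1) pq(2)]) (use c wc pq ws in auto)
      finally show ?thesis using ws pq by simp
    qed
    have "f x = Ms"
    proof (rule nth_equalityI)
      show "length (f x) = length Ms" using len by (simp add: f_def)
      fix b assume "b < length (f x)"
      then have b: "b < length rs" by (simp add: f_def)
      define ps where "ps = cl (rs ! b)"
      have "f x ! b = mat (length ps) (length ps) (\<lambda>(i, j). \<kappa> (ps ! i) (ps ! j) x)"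
        using b by (simp add: f_def ps_def)
      also have "\<dots> = Ms ! b"
      proof (rule eq_matI)
        show "dim_row (mat (length ps) (length ps) (\<lambda>(i, j). \<kappa> (ps ! i) (ps ! j) x)) = dim_row (Ms ! b)"
          "dim_col (mat (length ps) (length ps) (\<lambda>(i, j). \<kappa> (ps ! i) (ps ! j) x)) = dim_col (Ms ! b)"
          using Mc[OF b] by (auto simp: ps_def)
        fix i j assume "i < dim_row (Ms ! b)" "j < dim_col (Ms ! b)"
        then have ij: "i < length ps" "j < length ps" using Mc[OF b] by (auto simp: ps_def)
        have pi: "ps ! i \<in> P" "r (ps ! i) = rs ! b" and pj: "ps ! j \<in> P" "r (ps ! j) = rs ! b"
          using clP[of i "rs ! b"] clP[of j "rs ! b"] ij by (auto simp: ps_def)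
        have "bi (ps ! i) = b"
          using bi[OF pi(1)] pi(2) b nth_eq_iff_index_eq[OF rs(2), of "bi (ps ! i)" b] by simp
        moreover have "ix (ps ! i) = i" "ix (ps ! j) = j"
          using ix[OF pi(1)] ix[OF pj(1)] ij nth_eq_iff_index_eq[OF cl(2)[of "rs ! b"]]
          unfolding pi(2) pj(2) unfolding ps_def by blast+
        ultimately have "m (ps ! i) (ps ! j) = (Ms ! b) $$ (i, j)" by (simp add: m_def)
        moreover have "\<kappa> (ps ! i) (ps ! j) x = m (ps ! i) (ps ! j)"
          by (rule \<kappa>I) (use px[OF pi(1) pj(1)] pi pj x in \<open>auto simp: w_def\<close>)
        ultimately show "mat (length ps) (length ps) (\<lambda>(i, j). \<kappa> (ps ! i) (ps ! j) x) $$ (i, j) = (Ms ! b) $$ (i, j)"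
          using ij by simp
      qed
      finally show "f x ! b = Ms ! b" .
    qed
    then show ?thesis using x by blast
  qed
  have "bij_betw f (carrier E) (carrier (matrix_sum ns))"
    using inj surj star_homD(1)[OF hom] by (auto simp: bij_betw_def)
  then have "star_iso E (matrix_sum ns) f" using hom by (simp add: star_iso_def)
  then show ?thesis using pos star_algebra_axioms unfolding fd_cstar_algebra_def by blast
qed

end


section \<open>Digraph algebras\<close>

lemma cstar_simps:
  "szero (cstar A) = szero (ambient A)" "sadd (cstar A) = sadd (ambient A)"
  "smul (cstar A) = smul (ambient A)" "sscale (cstar A) = sscale (ambient A)"
  "sadj (cstar A) = sadj (ambient A)"
  by (simp_all add: cstar_def)

lemma carrier_cstar: "carrier (cstar A) = star_gen (ambient A) (elems A)"
  by (simp add: cstar_def)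

context star_algebra
begin

lemma star_gen_subalg:
  assumes "X \<subseteq> carrier E"
  shows "subalg E (star_gen E X)" "self_adjoint E (star_gen E X)" "X \<subseteq> star_gen E X"
proof -
  have "subalg E (carrier E) \<and> self_adjoint E (carrier E) \<and> X \<subseteq> carrier E"
    using assms by (auto simp: subalg_def self_adjoint_def)
  then have "star_gen E X \<subseteq> carrier E" unfolding star_gen_def by blast
  then show "subalg E (star_gen E X)" unfolding subalg_def star_gen_def by blast
  show "self_adjoint E (star_gen E X)" unfolding self_adjoint_def star_gen_def by blast
  show "X \<subseteq> star_gen E X" unfolding star_gen_def by blast
qed

lemma star_gen_minimal: "\<lbrakk>subalg E S; self_adjoint E S; X \<subseteq> S\<rbrakk> \<Longrightarrow> star_gen E X \<subseteq> S"
  unfolding star_gen_def by blast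

end

text \<open>The masa provides a frame inside \<open>A\<close>, so the sum of the frame, which is the
  unit, lies in \<open>A\<close> too. The frame remains one for the generated star-algebra, to which
  the structure theorem then applies.\<close>

lemma digraph_algebra_facts:
  assumes "digraph_algebra A"
  shows "fd_cstar_algebra (cstar A)" "subalg (cstar A) (elems A)"
    "\<exists>P\<subseteq>elems A. frame (cstar A) P"
    "is_unit_of (cstar A) (carrier (cstar A)) (unit_of (ambient A) (elems A))"
    "unit_of (ambient A) (elems A) \<in> elems A"
    "star_algebra (ambient A)" "elems A \<subseteq> carrier (ambient A)"
proof -
  have fd: "fd_cstar_algebra (ambient A)" and sub: "subalg (ambient A) (elems A)"
    using assms by (auto simp: digraph_algebra_def)
  obtain C where C: "masa \<lparr>ambient = ambient A, elems = carrier (ambient A)\<rparr> C" "C \<subseteq> elems A"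
    using assms by (auto simp: digraph_algebra_def)
  interpret fd_star "ambient A" by (rule fd_cstar_fd_star[OF fd])
  show "star_algebra (ambient A)" by (rule star_algebra_axioms)
  show elc: "elems A \<subseteq> carrier (ambient A)" using sub by (simp add: subalg_def)
  note g = star_gen_subalg[OF elc]
  have eq: "cstar A = (ambient A)\<lparr>carrier := star_gen (ambient A) (elems A)\<rparr>" by (simp add: cstar_def)
  interpret S: fd_star "cstar A" unfolding eq by (rule fd_subalgebra[OF g(1,2)])
  obtain P where P: "P \<subseteq> C" "frame (ambient A) P"
    using masa_frame[OF C(1)] fd_cstar_unit[OF fd] by blast
  then have PA: "P \<subseteq> elems A" using C by blast
  have fP: "frame (cstar A) P" unfolding eq using PA g by (intro frame_subalgebra[OF g(1,2) P(2)]) blast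
  then show "\<exists>P\<subseteq>elems A. frame (cstar A) P" using PA by blast
  show "fd_cstar_algebra (cstar A)" by (rule S.frame_fd_cstar[OF fP])
  show "subalg (cstar A) (elems A)" using sub g(3) by (simp add: subalg_def carrier_cstar cstar_simps)
  let ?e = "gsum (ambient A) (\<lambda>p. p) P"
  have e: "is_unit_of (ambient A) (carrier (ambient A)) ?e" using frame_facts(7)[OF P(2)] .
  have eA: "?e \<in> elems A" using PA by (intro subalg_gsum[OF sub]) auto
  have "is_unit_of (ambient A) (elems A) ?e" using e eA elc by (auto simp: is_unit_of_def)
  then have u: "unit_of (ambient A) (elems A) = ?e" by (rule unit_of_eq)
  show "unit_of (ambient A) (elems A) \<in> elems A" using u eA by simp
  have "carrier (cstar A) \<subseteq> carrier (ambient A)" using g(1) by (simp add: carrier_cstar subalg_def)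
  then show "is_unit_of (cstar A) (carrier (cstar A)) (unit_of (ambient A) (elems A))"
    using e eA u g(3) by (auto simp: is_unit_of_def carrier_cstar cstar_simps)
qed

lemma digraph_fd_star: "digraph_algebra A \<Longrightarrow> fd_star (cstar A)"
  by (simp add: digraph_algebra_facts(1) fd_cstar_fd_star)

lemma digraph_star_algebra: "digraph_algebra A \<Longrightarrow> star_algebra (cstar A)"
  using digraph_algebra_facts(1) fd_cstar_algebra_def by blast

lemma digraph_elems_carrier: "digraph_algebra A \<Longrightarrow> a \<in> elems A \<Longrightarrow> a \<in> carrier (cstar A)"
  using digraph_algebra_facts(2)[of A] by (auto simp: subalg_def)

text \<open>An induction principle: a property stable under the star-algebra operations holds on
  \<open>cstar A\<close> once it holds on \<open>elems A\<close>.\<close>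

lemma digraph_generates:
  assumes "digraph_algebra A" and S: "subalg (cstar A) S" "self_adjoint (cstar A) S" "elems A \<subseteq> S"
  shows "carrier (cstar A) \<subseteq> S"
proof -
  note d = digraph_algebra_facts[OF assms(1)]
  interpret star_algebra "ambient A" by (rule d(6))
  have "carrier (cstar A) \<subseteq> carrier (ambient A)"
    using star_gen_subalg(1)[OF d(7)] by (simp add: carrier_cstar subalg_def)
  then have "subalg (ambient A) S" "self_adjoint (ambient A) S"
    using S by (auto simp: subalg_def self_adjoint_def cstar_simps)
  then show ?thesis unfolding carrier_cstar using S(3) by (rule star_gen_minimal)
qed

lemma star_hom_unique:
  assumes A: "digraph_algebra A" and f: "star_hom (cstar A) E' f" and g: "star_hom (cstar A) E' g"
    and eq: "\<And>a. a \<in> elems A \<Longrightarrow> f a = g a" and x: "x \<in> carrier (cstar A)"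
  shows "f x = g x"
proof -
  interpret star_algebra "cstar A" using A by (rule digraph_star_algebra)
  let ?S = "{x \<in> carrier (cstar A). f x = g x}"
  have "szero (cstar A) \<in> elems A" using digraph_algebra_facts(2)[OF A] by (simp add: subalg_def)
  then have "subalg (cstar A) ?S"
    unfolding subalg_def using eq[of "szero (cstar A)"]
    by (auto simp only: mem_Collect_eq star_homD[OF f] star_homD[OF g] closed)
  moreover have "self_adjoint (cstar A) ?S"
    unfolding self_adjoint_def by (auto simp only: mem_Collect_eq star_homD[OF f] star_homD[OF g] closed)
  moreover have "elems A \<subseteq> ?S" using eq digraph_elems_carrier[OF A] by blast
  ultimately show ?thesis using digraph_generates[OF A] x by blast
qed

lemma star_extension:
  assumes A: "digraph_algebra A" and ext: "star_extendible A B \<phi>"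
  shows "star_hom (cstar A) (cstar B) (star_extension A B \<phi>)"
    "a \<in> elems A \<Longrightarrow> star_extension A B \<phi> a = \<phi> a" "a \<in> elems A \<Longrightarrow> \<phi> a \<in> elems B"
proof -
  interpret star_algebra "cstar A" using A by (rule digraph_star_algebra)
  obtain f where f: "star_hom (cstar A) (cstar B) f" "\<And>a. a \<in> elems A \<Longrightarrow> \<phi> a = f a"
    using ext by (auto simp: star_extendible_def)
  define g where "g = restrict f (carrier (cstar A))"
  let ?Q = "\<lambda>f. f \<in> extensional (carrier (cstar A)) \<and> star_hom (cstar A) (cstar B) f
      \<and> (\<forall>a\<in>elems A. \<phi> a = f a)"
  have "star_hom (cstar A) (cstar B) g"
    by (rule star_hom_cong[OF f(1)]) (simp_all add: g_def star_algebra_axioms)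
  then have g: "?Q g" using f(2) digraph_elems_carrier[OF A] by (auto simp: g_def)
  have "h = g" if h: "?Q h" for h
  proof (rule extensionalityI[of _ "carrier (cstar A)"])
    show "h \<in> extensional (carrier (cstar A))" "g \<in> extensional (carrier (cstar A))" using g h by auto
    fix x assume x: "x \<in> carrier (cstar A)"
    show "h x = g x" by (rule star_hom_unique[OF A, where E' = "cstar B"]) (use g h x in auto)
  qed
  then have "?Q (star_extension A B \<phi>)"
    unfolding star_extension_def by (rule theI[of ?Q, OF g])
  then show "star_hom (cstar A) (cstar B) (star_extension A B \<phi>)"
    "a \<in> elems A \<Longrightarrow> star_extension A B \<phi> a = \<phi> a" by auto
  show "a \<in> elems A \<Longrightarrow> \<phi> a \<in> elems B" using ext by (auto simp: star_extendible_def)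
qed

section \<open>Decompositions into multiplicity-one homomorphisms\<close>

definition mult_one_hom :: "'a op_alg \<Rightarrow> 'b op_alg \<Rightarrow> ('a \<Rightarrow> 'b) \<Rightarrow> bool" where
  "mult_one_hom A B g \<longleftrightarrow> star_hom (cstar A) (cstar B) g \<and> g ` elems A \<subseteq> elems B
     \<and> (\<forall>p. atomic (cstar A) p \<longrightarrow> atomic (cstar B) (g p))"

text \<open>Orthogonality is required of the whole ranges instead of the images of the unit, and any
  finite index set is allowed, so that products of index sets arising from composition need no
  renumbering.\<close>

definition decomposes :: "'a op_alg \<Rightarrow> 'b op_alg \<Rightarrow> ('a \<Rightarrow> 'b) \<Rightarrow> ('i \<Rightarrow> 'a \<Rightarrow> 'b) \<Rightarrow> 'i set \<Rightarrow> bool" where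
  "decomposes A B f g I \<longleftrightarrow> finite I \<and> (\<forall>i\<in>I. mult_one_hom A B (g i))
     \<and> (\<forall>i\<in>I. \<forall>j\<in>I. i \<noteq> j \<longrightarrow> (\<forall>x\<in>carrier (cstar A). \<forall>y\<in>carrier (cstar A).
           smul (cstar B) (g i x) (g j y) = szero (cstar B)))
     \<and> (\<forall>x\<in>carrier (cstar A). f x = gsum (cstar B) (\<lambda>i. g i x) I)"

text \<open>The counterpart of \<open>regular_hom\<close> for the extensions to the generated C*-algebras.\<close>

definition regular_ext :: "'a op_alg \<Rightarrow> 'b op_alg \<Rightarrow> ('a \<Rightarrow> 'b) \<Rightarrow> bool" where
  "regular_ext A B f \<longleftrightarrow> (\<exists>(s::nat) g. decomposes A B f g {..<s})"

lemma regular_extI: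
  assumes B: "digraph_algebra B" and "decomposes A B f g I"
  shows "regular_ext A B f"
proof -
  interpret star_algebra "cstar B" using B by (rule digraph_star_algebra)
  note d = assms(2)[unfolded decomposes_def]
  obtain h where h: "bij_betw h {..<card I} I"
    using d ex_bij_betw_nat_finite[of I] by (auto simp: atLeast0LessThan)
  have hI: "h i \<in> I" if "i < card I" for i using h that by (auto simp: bij_betw_def)
  have hinj: "h i \<noteq> h j" if "i < card I" "j < card I" "i \<noteq> j" for i j
    using h that by (auto simp: bij_betw_def inj_on_def)
  have "f x = gsum (cstar B) (\<lambda>i. g (h i) x) {..<card I}" if x: "x \<in> carrier (cstar A)" for x
  proof -
    have "gsum (cstar B) (\<lambda>i. g i x) (h ` {..<card I}) = gsum (cstar B) (\<lambda>i. g (h i) x) {..<card I}"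
    proof (rule gsum_reindex)
      show "inj_on h {..<card I}" using h by (simp add: bij_betw_def)
      fix i assume "i \<in> {..<card I}"
      then have "star_hom (cstar A) (cstar B) (g (h i))" using d hI by (auto simp: mult_one_hom_def)
      then show "g (h i) x \<in> carrier (cstar B)" using x by (rule star_homD)
    qed
    then show ?thesis using d h x by (simp add: bij_betw_def)
  qed
  then have "decomposes A B f (\<lambda>i. g (h i)) {..<card I}"
    unfolding decomposes_def using d hI hinj by simp
  then show ?thesis unfolding regular_ext_def by blast
qed

text \<open>Cross terms vanish, so multiplying \<open>f y\<close> by \<open>g i x\<close> leaves
  only the summand with index \<open>i\<close>. This absorption makes the sum \<open>f\<close>
  multiplicative and later isolates single summands.\<close>

lemma decomposesD:
  assumes A: "digraph_algebra A" and B: "digraph_algebra B" and d: "decomposes A B f g I"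
  shows "finite I" "i \<in> I \<Longrightarrow> star_hom (cstar A) (cstar B) (g i)"
    "i \<in> I \<Longrightarrow> a \<in> elems A \<Longrightarrow> g i a \<in> elems B"
    "i \<in> I \<Longrightarrow> atomic (cstar A) p \<Longrightarrow> atomic (cstar B) (g i p)"
    "i \<in> I \<Longrightarrow> x \<in> carrier (cstar A) \<Longrightarrow> g i x \<in> carrier (cstar B)"
    "\<lbrakk>i \<in> I; j \<in> I; i \<noteq> j; x \<in> carrier (cstar A); y \<in> carrier (cstar A)\<rbrakk> \<Longrightarrow> smul (cstar B) (g i x) (g j y) = szero (cstar B)"
    "x \<in> carrier (cstar A) \<Longrightarrow> f x = gsum (cstar B) (\<lambda>i. g i x) I"
    "\<lbrakk>i \<in> I; x \<in> carrier (cstar A); y \<in> carrier (cstar A)\<rbrakk> \<Longrightarrow> smul (cstar B) (g i x) (f y) = g i (smul (cstar A) x y)"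
    "\<lbrakk>i \<in> I; x \<in> carrier (cstar A); y \<in> carrier (cstar A)\<rbrakk> \<Longrightarrow> smul (cstar B) (f x) (g i y) = g i (smul (cstar A) x y)"
    "star_hom (cstar A) (cstar B) f" "a \<in> elems A \<Longrightarrow> f a \<in> elems B"
proof -
  interpret A: star_algebra "cstar A" using A by (rule digraph_star_algebra)
  interpret B: star_algebra "cstar B" using B by (rule digraph_star_algebra)
  note d' = d[unfolded decomposes_def mult_one_hom_def]
  show fin: "finite I" and h: "\<And>i. i \<in> I \<Longrightarrow> star_hom (cstar A) (cstar B) (g i)"
    and el: "\<And>i a. i \<in> I \<Longrightarrow> a \<in> elems A \<Longrightarrow> g i a \<in> elems B"
    and "\<And>i p. i \<in> I \<Longrightarrow> atomic (cstar A) p \<Longrightarrow> atomic (cstar B) (g i p)"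
    and orth: "\<And>i j x y. \<lbrakk>i \<in> I; j \<in> I; i \<noteq> j; x \<in> carrier (cstar A); y \<in> carrier (cstar A)\<rbrakk> \<Longrightarrow>
      smul (cstar B) (g i x) (g j y) = szero (cstar B)"
    and sum: "\<And>x. x \<in> carrier (cstar A) \<Longrightarrow> f x = gsum (cstar B) (\<lambda>i. g i x) I"
    using d' by blast+
  note gc = star_homD(1)[OF h]
  then show "\<And>i x. i \<in> I \<Longrightarrow> x \<in> carrier (cstar A) \<Longrightarrow> g i x \<in> carrier (cstar B)" .
  show gf: "smul (cstar B) (g i x) (f y) = g i (smul (cstar A) x y)"
    if i: "i \<in> I" and x: "x \<in> carrier (cstar A)" and y: "y \<in> carrier (cstar A)" for i x y
  proof -
    have "smul (cstar B) (g i x) (f y) = gsum (cstar B) (\<lambda>j. smul (cstar B) (g i x) (g j y)) I"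
      unfolding sum[OF y] using fin gc i x y by (intro B.gsum_mul_left) auto
    also have "\<dots> = smul (cstar B) (g i x) (g i y)"
      by (rule B.gsum_single[OF fin i]) (use orth[OF i _ _ x y] gc[OF i x] gc[OF i y] in auto)
    finally show ?thesis using star_homD(3)[OF h[OF i] x y] by simp
  qed
  show fg: "smul (cstar B) (f x) (g i y) = g i (smul (cstar A) x y)"
    if i: "i \<in> I" and x: "x \<in> carrier (cstar A)" and y: "y \<in> carrier (cstar A)" for i x y
  proof -
    have "smul (cstar B) (f x) (g i y) = gsum (cstar B) (\<lambda>j. smul (cstar B) (g j x) (g i y)) I"
      unfolding sum[OF x] using fin gc i x y by (intro B.gsum_mul_right) auto
    also have "\<dots> = smul (cstar B) (g i x) (g i y)"
      by (rule B.gsum_single[OF fin i]) (use orth[OF _ i _ x y] gc[OF i x] gc[OF i y] in auto)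
    finally show ?thesis using star_homD(3)[OF h[OF i] x y] by simp
  qed
  have fc: "f x \<in> carrier (cstar B)" if "x \<in> carrier (cstar A)" for x
    unfolding sum[OF that] using gc that by (intro B.gsum_closed) auto
  show "star_hom (cstar A) (cstar B) f"
    unfolding star_hom_def
  proof (intro conjI ballI allI)
    show "f \<in> carrier (cstar A) \<rightarrow> carrier (cstar B)" using fc by auto
  next
    fix x y assume x: "x \<in> carrier (cstar A)" and y: "y \<in> carrier (cstar A)"
    show "f (sadd (cstar A) x y) = sadd (cstar B) (f x) (f y)"
      unfolding sum[OF x] sum[OF y] sum[OF A.add_closed[OF x y]]
      using gc x y by (subst B.gsum_add[symmetric]) (auto intro!: B.gsum_cong star_homD(2)[OF h])
    have "smul (cstar B) (f x) (f y) = gsum (cstar B) (\<lambda>i. smul (cstar B) (g i x) (f y)) I"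
      unfolding sum[OF x] using fin gc x fc[OF y] by (intro B.gsum_mul_right) auto
    also have "\<dots> = gsum (cstar B) (\<lambda>i. g i (smul (cstar A) x y)) I"
      using gf x y gc by (intro B.gsum_cong) auto
    finally show "f (smul (cstar A) x y) = smul (cstar B) (f x) (f y)"
      using sum[OF A.mul_closed[OF x y]] by simp
  next
    fix x c assume x: "x \<in> carrier (cstar A)"
    show "f (sscale (cstar A) c x) = sscale (cstar B) c (f x)"
      unfolding sum[OF x] sum[OF A.scale_closed[OF x]]
      using gc x fin by (subst B.gsum_scale) (auto intro!: B.gsum_cong star_homD(4)[OF h])
  next
    fix x assume x: "x \<in> carrier (cstar A)"
    show "f (sadj (cstar A) x) = sadj (cstar B) (f x)"
      unfolding sum[OF x] sum[OF A.adj_closed[OF x]]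
      using gc x fin by (subst B.gsum_adj) (auto intro!: B.gsum_cong star_homD(5)[OF h])
  qed
  show "f a \<in> elems B" if a: "a \<in> elems A" for a
    unfolding sum[OF digraph_elems_carrier[OF A a]]
    using el a by (intro B.subalg_gsum[OF digraph_algebra_facts(2)[OF B]]) auto
qed

lemma regular_ext_hom:
  assumes "digraph_algebra A" "digraph_algebra B" "regular_ext A B f"
  shows "star_hom (cstar A) (cstar B) f" "a \<in> elems A \<Longrightarrow> f a \<in> elems B"
proof -
  obtain s :: nat and g where d: "decomposes A B f g {..<s}" using assms(3) by (auto simp: regular_ext_def)
  show "star_hom (cstar A) (cstar B) f" "a \<in> elems A \<Longrightarrow> f a \<in> elems B"
    using decomposesD(10,11)[OF assms(1,2) d] by auto
qed

text \<open>The defining condition concerns projections in \<open>A\<close> only. Any nonzero atom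
  of \<open>cstar A\<close> is equivalent, by some \<open>u\<close>, to a member of a frame inside
  \<open>A\<close>, and \<open>f u\<close> transfers atomicity between their images.\<close>

lemma multiplicity_one_iff:
  assumes A: "digraph_algebra A" and B: "digraph_algebra B"
    and f: "star_hom (cstar A) (cstar B) f" "\<And>a. a \<in> elems A \<Longrightarrow> \<psi> a = f a"
  shows "multiplicity_one A B \<psi> \<longleftrightarrow> (\<forall>p. atomic (cstar A) p \<longrightarrow> atomic (cstar B) (f p))"
proof
  interpret A: fd_star "cstar A" using A by (rule digraph_fd_star)
  interpret B: fd_star "cstar B" using B by (rule digraph_fd_star)
  note cA = digraph_algebra_facts(1)[OF A] and cB = digraph_algebra_facts(1)[OF B]
  {
    assume m: "multiplicity_one A B \<psi>"
    show "\<forall>p. atomic (cstar A) p \<longrightarrow> atomic (cstar B) (f p)"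
    proof (intro allI impI)
      fix p assume p: "atomic (cstar A) p"
      show "atomic (cstar B) (f p)"
      proof (cases "p = szero (cstar A)")
        case True
        then show ?thesis
          using star_hom_zero[OF f(1) A.star_algebra_axioms B.star_algebra_axioms] B.atomic_zero by simp
      next
        case False
        obtain P where P: "P \<subseteq> elems A" "frame (cstar A) P" using digraph_algebra_facts(3)[OF A] by blast
        obtain q u where q: "q \<in> P" and u: "u \<in> carrier (cstar A)" "smul (cstar A) u (sadj (cstar A) u) = p"
          "smul (cstar A) (sadj (cstar A) u) u = q"
          using A.atomic_equivalent_frame[OF P(2) p False] by blast
        have qa: "atomic (cstar A) q" "q \<noteq> szero (cstar A)" using A.frame_facts(3,5)[OF P(2) q] by auto
        have "projection (cstar A) q" using qa by (simp add: atomic_def)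
        then have "fd_rank (cstar B) (\<psi> q) \<le> 1"
          using m fd_rank_projection(2)[OF cA] qa q P(1) unfolding multiplicity_one_def by blast
        moreover have "projection (cstar B) (f q)"
          by (rule star_hom_projection[OF f(1)]) fact
        ultimately have fq: "atomic (cstar B) (f q)"
          using fd_rank_projection(1)[OF cB] f(2) q P(1) by auto
        have "smul (cstar B) (sadj (cstar B) (f u)) (f u) = f q"
          unfolding u(3)[symmetric] using star_homD(3,5)[OF f(1)] u(1) by simp
        from B.atomic_transfer[OF star_homD(1)[OF f(1) u(1)] this fq]
        show ?thesis unfolding u(2)[symmetric] using star_homD(3,5)[OF f(1)] u(1) by simp
      qed
    qed
  next
    assume a: "\<forall>p. atomic (cstar A) p \<longrightarrow> atomic (cstar B) (f p)"
    show "multiplicity_one A B \<psi>"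
      unfolding multiplicity_one_def
    proof (intro ballI impI)
      fix p assume p: "p \<in> elems A" "projection (cstar A) p \<and> fd_rank (cstar A) p = 1"
      then have "atomic (cstar A) p" using fd_rank_projection(2)[OF cA] by blast
      then have "atomic (cstar B) (f p)" using a by blast
      then show "fd_rank (cstar B) (\<psi> p) \<le> 1"
        using fd_rank_projection(1)[OF cB, of "f p"] f(2) p(1) by (simp add: atomic_def)
    qed
  }
qed

text \<open>Orthogonality of the images of the unit \<open>e\<close> spreads to the whole ranges by
  writing \<open>g i x\<close> as \<open>g i x\<close> times \<open>g i e\<close>. The sum of the
  extended summands agrees with the extension of the map on \<open>A\<close>, hence
  everywhere.\<close>

lemma regular_hom_ext:
  assumes A: "digraph_algebra A" and B: "digraph_algebra B" and r: "regular_hom A B \<phi>"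
  shows "regular_ext A B (star_extension A B \<phi>)"
proof -
  interpret A: star_algebra "cstar A" using A by (rule digraph_star_algebra)
  interpret B: star_algebra "cstar B" using B by (rule digraph_star_algebra)
  define e where "e = unit_of (ambient A) (elems A)"
  have e: "is_unit_of (cstar A) (carrier (cstar A)) e" "e \<in> elems A"
    using digraph_algebra_facts(4,5)[OF A] by (simp_all add: e_def)
  obtain s :: nat and \<psi> where ext: "star_extendible A B \<phi>"
    and \<psi>: "\<And>i. i < s \<Longrightarrow> star_extendible A B (\<psi> i)" "\<And>i. i < s \<Longrightarrow> multiplicity_one A B (\<psi> i)"
    and orth: "\<And>i j. \<lbrakk>i < s; j < s; i \<noteq> j\<rbrakk> \<Longrightarrow> smul (ambient B) (\<psi> i e) (\<psi> j e) = szero (ambient B)"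
    and sum: "\<And>a. a \<in> elems A \<Longrightarrow> \<phi> a = ssum (ambient B) (map (\<lambda>i. \<psi> i a) [0..<s])"
    using r unfolding regular_hom_def Let_def e_def[symmetric] by blast
  define g where "g i = star_extension A B (\<psi> i)" for i
  note g = star_extension[OF A \<psi>(1), folded g_def]
  note f = star_extension[OF A ext]
  have gc: "g i x \<in> carrier (cstar B)" if "i < s" "x \<in> carrier (cstar A)" for i x
    using star_homD(1)[OF g(1)] that by blast
  have orth': "smul (cstar B) (g i x) (g j y) = szero (cstar B)"
    if ij: "i < s" "j < s" "i \<noteq> j" and x: "x \<in> carrier (cstar A)" and y: "y \<in> carrier (cstar A)" for i j x y
  proof -
    have ec: "e \<in> carrier (cstar A)" using e(1) by (simp add: is_unit_of_def)
    have "g i x = smul (cstar B) (g i x) (g i e)" "g j y = smul (cstar B) (g j e) (g j y)"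
      using star_homD(3)[OF g(1)[OF ij(1)] x ec] star_homD(3)[OF g(1)[OF ij(2)] ec y] e(1) x y
      by (simp_all add: is_unit_of_def)
    then have "smul (cstar B) (g i x) (g j y)
        = smul (cstar B) (smul (cstar B) (g i x) (g i e)) (smul (cstar B) (g j e) (g j y))" by simp
    also have "\<dots> = smul (cstar B) (g i x) (smul (cstar B) (smul (cstar B) (g i e) (g j e)) (g j y))"
      using gc ij x y ec by (simp only: B.mul_assoc B.mul_closed)
    also have "smul (cstar B) (g i e) (g j e) = szero (cstar B)"
      using orth[OF ij] g(2) ij e(2) by (simp add: cstar_simps)
    finally show ?thesis using gc ij x y B.mul_zero_left B.mul_zero_right by metis
  qed
  let ?h = "\<lambda>x. gsum (cstar B) (\<lambda>i. g i x) {..<s}"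
  have m: "mult_one_hom A B (g i)" if i: "i < s" for i
    unfolding mult_one_hom_def using g[OF i] multiplicity_one_iff[OF A B g(1)[OF i], of "\<psi> i"] \<psi>(2)[OF i]
    by auto
  have d: "decomposes A B ?h g {..<s}"
    unfolding decomposes_def using m orth' by auto
  have "star_extension A B \<phi> x = ?h x" if x: "x \<in> carrier (cstar A)" for x
  proof (rule star_hom_unique[OF A f(1) decomposesD(10)[OF A B d] _ x])
    fix a assume a: "a \<in> elems A"
    have "ssum (cstar B) (map (\<lambda>i. g i a) [0..<s]) = ?h a"
      using gc digraph_elems_carrier[OF A a] by (intro B.ssum_eq_gsum) auto
    moreover have "map (\<lambda>i. \<psi> i a) [0..<s] = map (\<lambda>i. g i a) [0..<s]" using g(2) a by simp
    ultimately have "ssum (ambient B) (map (\<lambda>i. \<psi> i a) [0..<s]) = ?h a"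
      by (simp only: ssum_def cstar_simps)
    then show "star_extension A B \<phi> a = ?h a" using f(2)[OF a] sum[OF a] by simp
  qed
  then have "decomposes A B (star_extension A B \<phi>) g {..<s}"
    using d unfolding decomposes_def by auto
  then show ?thesis unfolding regular_ext_def by blast
qed

lemma regular_ext_regular_hom:
  assumes A: "digraph_algebra A" and B: "digraph_algebra B" and r: "regular_ext A B f"
  shows "regular_hom A B (restrict f (elems A))"
proof -
  interpret A: star_algebra "cstar A" using A by (rule digraph_star_algebra)
  interpret B: star_algebra "cstar B" using B by (rule digraph_star_algebra)
  obtain s :: nat and g where d: "decomposes A B f g {..<s}" using r by (auto simp: regular_ext_def)
  note D = decomposesD[OF A B d]
  define e where "e = unit_of (ambient A) (elems A)"
  have e: "e \<in> carrier (cstar A)" "e \<in> elems A"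
    using digraph_algebra_facts(4,5)[OF A] by (simp_all add: e_def is_unit_of_def)
  have zero: "star_hom (cstar A) (cstar B) (\<lambda>x. szero (cstar B))"
    unfolding star_hom_def by auto
  text \<open>The zero map is added because a decomposition must be nonempty.\<close>
  define \<psi> where "\<psi> i = restrict (if i < s then g i else (\<lambda>x. szero (cstar B))) (elems A)" for i
  have ext: "star_extendible A B (\<psi> i) \<and> multiplicity_one A B (\<psi> i)" for i
  proof -
    define k where "k = (if i < s then g i else (\<lambda>x. szero (cstar B)))"
    have kh: "star_hom (cstar A) (cstar B) k" using D(2)[of i] zero by (auto simp: k_def)
    have ka: "\<And>a. a \<in> elems A \<Longrightarrow> \<psi> i a = k a" by (simp add: \<psi>_def k_def)
    have "szero (cstar B) \<in> elems B" using digraph_algebra_facts(2)[OF B] by (simp add: subalg_def)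
    then have "\<psi> i \<in> elems A \<rightarrow>\<^sub>E elems B" using D(3)[of i] by (auto simp: \<psi>_def)
    moreover have "\<forall>p. atomic (cstar A) p \<longrightarrow> atomic (cstar B) (k p)"
      using D(4)[of i] fd_star.atomic_zero[OF digraph_fd_star[OF B]] by (auto simp: k_def)
    ultimately show ?thesis
      using multiplicity_one_iff[OF A B kh ka] kh ka unfolding star_extendible_def by auto
  qed
  have "smul (ambient B) (\<psi> i e) (\<psi> j e) = szero (ambient B)" if "i \<noteq> j" for i j
    using that D(6)[of i j e e] D(5)[of i e] D(5)[of j e] e B.mul_zero_left B.mul_zero_right B.zero_closed
    by (auto simp: \<psi>_def simp flip: cstar_simps)
  moreover have "f a = ssum (ambient B) (map (\<lambda>i. \<psi> i a) [0..<Suc s])" if a: "a \<in> elems A" for a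
  proof -
    have ac: "a \<in> carrier (cstar A)" by (rule digraph_elems_carrier[OF A a])
    have pc: "\<psi> i a \<in> carrier (cstar B)" for i using D(5)[of i a] a ac B.zero_closed by (auto simp: \<psi>_def)
    have "ssum (ambient B) (map (\<lambda>i. \<psi> i a) [0..<Suc s]) = ssum (cstar B) (map (\<lambda>i. \<psi> i a) [0..<Suc s])"
      by (simp add: ssum_def cstar_simps)
    also have "\<dots> = gsum (cstar B) (\<lambda>i. \<psi> i a) {..<Suc s}"
      using pc by (intro B.ssum_eq_gsum) auto
    also have "\<dots> = sadd (cstar B) (\<psi> s a) (gsum (cstar B) (\<lambda>i. \<psi> i a) {..<s})"
      unfolding lessThan_Suc using pc by (intro B.gsum_insert) auto
    also have "\<psi> s a = szero (cstar B)" using a by (simp add: \<psi>_def)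
    also have "gsum (cstar B) (\<lambda>i. \<psi> i a) {..<s} = f a"
      unfolding D(7)[OF ac] using D(5) ac a by (intro B.gsum_cong) (auto simp: \<psi>_def)
    finally show ?thesis using star_homD(1)[OF D(10) ac] B.zero_add by simp
  qed
  moreover have "star_extendible A B (restrict f (elems A))"
    unfolding star_extendible_def using D(10,11) by auto
  ultimately show ?thesis
    unfolding regular_hom_def Let_def e_def[symmetric] using ext
    by (intro conjI exI[of _ "Suc s"] exI[of _ \<psi>]) auto
qed

text \<open>The summands are the composites \<open>k j\<close> after \<open>g i\<close>. For
  different \<open>j\<close> they are orthogonal by the outer decomposition, for equal
  \<open>j\<close> and different \<open>i\<close> because \<open>k j\<close> preserves the inner
  orthogonality.\<close>

lemma regular_ext_comp:
  assumes A: "digraph_algebra A" and B: "digraph_algebra B" and C: "digraph_algebra C"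
    and f: "regular_ext A B f" and h: "regular_ext B C h"
  shows "regular_ext A C (\<lambda>x. h (f x))"
proof -
  interpret A: star_algebra "cstar A" using A by (rule digraph_star_algebra)
  interpret B: star_algebra "cstar B" using B by (rule digraph_star_algebra)
  interpret C: star_algebra "cstar C" using C by (rule digraph_star_algebra)
  obtain s :: nat and g where d: "decomposes A B f g {..<s}" using f by (auto simp: regular_ext_def)
  obtain t :: nat and k where e: "decomposes B C h k {..<t}" using h by (auto simp: regular_ext_def)
  note D = decomposesD[OF A B d] and E = decomposesD[OF B C e]
  have "decomposes A C (\<lambda>x. h (f x)) (\<lambda>(j, i) x. k j (g i x)) ({..<t} \<times> {..<s})"
    unfolding decomposes_def
  proof (intro conjI ballI impI)
    fix p assume "p \<in> {..<t} \<times> {..<s}"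
    then obtain j i where p: "p = (j, i)" "j \<in> {..<t}" "i \<in> {..<s}" by auto
    show "mult_one_hom A C (case p of (j, i) \<Rightarrow> \<lambda>x. k j (g i x))"
      unfolding mult_one_hom_def p(1) prod.case
      using star_hom_comp[OF D(2)[OF p(3)] E(2)[OF p(2)]] D(3,4)[OF p(3)] E(3,4)[OF p(2)] by auto
  next
    fix p q x y assume "p \<in> {..<t} \<times> {..<s}" "q \<in> {..<t} \<times> {..<s}" and ne: "p \<noteq> q"
      and x: "x \<in> carrier (cstar A)" and y: "y \<in> carrier (cstar A)"
    then obtain j i j' i' where p: "p = (j, i)" "j \<in> {..<t}" "i \<in> {..<s}"
      and q: "q = (j', i')" "j' \<in> {..<t}" "i' \<in> {..<s}" by auto
    have c: "g i x \<in> carrier (cstar B)" "g i' y \<in> carrier (cstar B)" using D(5) p q x y by auto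
    show "smul (cstar C) ((case p of (j, i) \<Rightarrow> \<lambda>x. k j (g i x)) x) ((case q of (j, i) \<Rightarrow> \<lambda>x. k j (g i x)) y)
      = szero (cstar C)"
      unfolding p(1) q(1) prod.case
    proof (cases "j = j'")
      case True
      then have "i \<noteq> i'" using ne p q by auto
      then have "smul (cstar B) (g i x) (g i' y) = szero (cstar B)" using D(6) p q x y by blast
      then show "smul (cstar C) (k j (g i x)) (k j' (g i' y)) = szero (cstar C)"
        using star_homD(3)[OF E(2)[OF p(2)] c] True
          star_hom_zero[OF E(2)[OF p(2)] B.star_algebra_axioms C.star_algebra_axioms] by simp
    qed (use E(6)[OF p(2) q(2) _ c] in blast)
  next
    fix x assume x: "x \<in> carrier (cstar A)"
    have "h (f x) = gsum (cstar C) (\<lambda>j. k j (f x)) {..<t}"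
      by (rule E(7)[OF star_homD(1)[OF D(10) x]])
    also have "\<dots> = gsum (cstar C) (\<lambda>j. gsum (cstar C) (\<lambda>i. k j (g i x)) {..<s}) {..<t}"
    proof (rule C.gsum_cong[OF refl])
      fix j assume j: "j \<in> {..<t}"
      show "k j (f x) = gsum (cstar C) (\<lambda>i. k j (g i x)) {..<s}"
        unfolding D(7)[OF x]
        by (rule star_hom_gsum[OF E(2)[OF j] B.star_algebra_axioms C.star_algebra_axioms]) (use D(5) x in auto)
      show "gsum (cstar C) (\<lambda>i. k j (g i x)) {..<s} \<in> carrier (cstar C)"
        using D(5) E(5)[OF j] x by (intro C.gsum_closed) auto
    qed
    also have "\<dots> = gsum (cstar C) (\<lambda>(j, i). k j (g i x)) ({..<t} \<times> {..<s})"
      using D(5) E(5) x by (intro C.gsum_Sigma) auto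
    finally show "h (f x) = gsum (cstar C) (\<lambda>p. (case p of (j, i) \<Rightarrow> \<lambda>x. k j (g i x)) x) ({..<t} \<times> {..<s})"
      by (simp add: case_prod_beta')
  qed simp
  then show ?thesis by (rule regular_extI[OF C])
qed

lemma mult_one_hom_regular_ext:
  assumes B: "digraph_algebra B" and m: "mult_one_hom A B g"
  shows "regular_ext A B g"
proof -
  interpret B: star_algebra "cstar B" using B by (rule digraph_star_algebra)
  have "g x = gsum (cstar B) (\<lambda>i. g x) {()}" if "x \<in> carrier (cstar A)" for x
  proof -
    have "g x \<in> carrier (cstar B)" using m that by (auto simp: mult_one_hom_def star_homD)
    then show ?thesis using B.gsum_single[of "{()}" "()" "\<lambda>i. g x"] by simp
  qed
  then have "decomposes A B g (\<lambda>_. g) {()}" unfolding decomposes_def using m by auto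
  then show ?thesis by (rule regular_extI[OF B])
qed

lemma regular_ext_id:
  assumes A: "digraph_algebra A"
  shows "regular_ext A A (\<lambda>x. x)"
  by (rule mult_one_hom_regular_ext[OF A]) (auto simp: mult_one_hom_def star_hom_def)

text \<open>Conjugation has multiplicity one, since \<open>V p\<close> is a partial isometry from
  \<open>p\<close> to its image. Both \<open>V\<close> and its adjoint must lie in the digraph
  algebra for the conjugation to preserve it.\<close>

lemma regular_ext_conj:
  assumes B: "digraph_algebra B"
    and V: "V \<in> elems B" "sadj (cstar B) V \<in> elems B"
    and unit: "is_unit_of (cstar B) (carrier (cstar B)) e"
      "smul (cstar B) (sadj (cstar B) V) V = e" "smul (cstar B) V (sadj (cstar B) V) = e"
  shows "regular_ext B B (\<lambda>x. smul (cstar B) (smul (cstar B) V x) (sadj (cstar B) V))"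
proof -
  interpret B: fd_star "cstar B" using B by (rule digraph_fd_star)
  have Vc: "V \<in> carrier (cstar B)" using digraph_elems_carrier[OF B V(1)] .
  let ?V' = "sadj (cstar B) V"
  let ?c = "\<lambda>x. smul (cstar B) (smul (cstar B) V x) ?V'"
  have ec: "e \<in> carrier (cstar B)" and e: "\<And>x. x \<in> carrier (cstar B) \<Longrightarrow> smul (cstar B) e x = x"
    using unit(1) by (auto simp: is_unit_of_def)
  have hom: "star_hom (cstar B) (cstar B) ?c"
    unfolding star_hom_def
  proof (intro conjI ballI allI)
    show "?c \<in> carrier (cstar B) \<rightarrow> carrier (cstar B)" using Vc by auto
  next
    fix x y assume x: "x \<in> carrier (cstar B)" and y: "y \<in> carrier (cstar B)"
    show "?c (sadd (cstar B) x y) = sadd (cstar B) (?c x) (?c y)"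
      using x y Vc by (simp add: B.mul_add_left B.mul_add_right)
    have "smul (cstar B) (?c x) (?c y)
        = smul (cstar B) (smul (cstar B) V x) (smul (cstar B) (smul (cstar B) (smul (cstar B) ?V' V) y) ?V')"
      using x y Vc by (simp add: B.mul_assoc)
    also have "\<dots> = ?c (smul (cstar B) x y)"
      unfolding unit(2) e[OF y] using x y Vc by (simp add: B.mul_assoc)
    finally show "?c (smul (cstar B) x y) = smul (cstar B) (?c x) (?c y)" by simp
  next
    fix x c assume x: "x \<in> carrier (cstar B)"
    show "?c (sscale (cstar B) c x) = sscale (cstar B) c (?c x)"
      using x Vc by (simp add: B.mul_scale_left B.mul_scale_right)
  next
    fix x assume x: "x \<in> carrier (cstar B)"
    show "?c (sadj (cstar B) x) = sadj (cstar B) (?c x)"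
      using x Vc by (simp add: B.adj_mul B.mul_assoc)
  qed
  have "?c x \<in> elems B" if "x \<in> elems B" for x
    using digraph_algebra_facts(2)[OF B] V that unfolding subalg_def by blast
  moreover have "atomic (cstar B) (?c p)" if p: "atomic (cstar B) p" for p
  proof -
    note P = B.projD[OF B.atomicD(1)[OF p]]
    let ?u = "smul (cstar B) V p"
    have u: "smul (cstar B) (sadj (cstar B) ?u) ?u = p"
    proof -
      have "smul (cstar B) (sadj (cstar B) ?u) ?u = smul (cstar B) (sadj (cstar B) p) (smul (cstar B) (smul (cstar B) ?V' V) p)"
        using P(1) Vc by (simp add: B.adj_mul B.mul_assoc)
      then show ?thesis unfolding unit(2) e[OF P(1)] P(3) P(2) .
    qed
    have "smul (cstar B) ?u (sadj (cstar B) ?u) = smul (cstar B) (smul (cstar B) V (smul (cstar B) p (sadj (cstar B) p))) ?V'"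
      using P(1) Vc by (simp add: B.adj_mul B.mul_assoc)
    then have "smul (cstar B) ?u (sadj (cstar B) ?u) = ?c p" unfolding P(3) P(2) .
    then show ?thesis using B.atomic_transfer[OF _ u p] P(1) Vc by simp
  qed
  ultimately have "mult_one_hom B B ?c" unfolding mult_one_hom_def using hom by blast
  then show ?thesis by (rule mult_one_hom_regular_ext[OF B])
qed


section \<open>Diagonals and their normalizers\<close>

text \<open>Records only how conjugation acts on the diagonal \<open>commutant E P\<close>, inside
  the full star-algebra. For the normalizers of the limit masa, membership in the algebra and the
  partial isometry property are checked separately.\<close>

definition normalizing :: "'a star_alg \<Rightarrow> 'a set \<Rightarrow> 'a set" where
  "normalizing E P = {v \<in> carrier E. \<forall>d\<in>commutant E P.
     smul E (smul E (sadj E v) d) v \<in> commutant E P \<and> smul E (smul E v d) (sadj E v) \<in> commutant E P}"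

context fd_star
begin

lemma commutant_frame:
  assumes P: "frame E P"
  shows "subalg E (commutant E P)" "self_adjoint E (commutant E P)" "P \<subseteq> commutant E P"
proof -
  note F = frame_facts[OF P]
  show "subalg E (commutant E P)" using F(2) by (intro commutant_subalg) auto
  show "self_adjoint E (commutant E P)"
    using F(2) projD(3)[OF F(4)] by (intro commutant_self_adjoint) auto
  show "P \<subseteq> commutant E P"
  proof
    fix p assume p: "p \<in> P"
    have "p \<boxtimes> q = q \<boxtimes> p" if "q \<in> P" for q using F(6)[OF p that] F(6)[OF that p] by (cases "p = q") auto
    then show "p \<in> commutant E P" using F(2) p by (auto simp: commutant_def)
  qed
qed

lemma corner_in_commutant:
  assumes P: "frame E P" and q: "q \<in> P" and y: "y \<in> carrier E" "q \<boxtimes> y \<boxtimes> q = y"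
  shows "y \<in> commutant E P"
proof -
  obtain c where "y = c \<cdot> q" using atomicD(2)[OF frame_facts(3)[OF P q] y(1)] y(2) by auto
  then show ?thesis using commutant_frame[OF P] q by (auto simp: subalg_def)
qed

text \<open>The diagonal is the linear span of the frame: an element commuting with \<open>p\<close>
  is scalar on \<open>p\<close> by atomicity.\<close>

lemma commutant_expand:
  assumes P: "frame E P" and d: "d \<in> commutant E P"
  shows "\<exists>c. d = gsum E (\<lambda>p. c p \<cdot> p) P"
proof -
  note F = frame_facts[OF P]
  have dc: "d \<in> carrier E" using d by (simp add: commutant_def)
  have "\<exists>c. d \<boxtimes> p = c \<cdot> p" if p: "p \<in> P" for p
  proof -
    note p' = projD[OF F(4)[OF p]]
    have "d \<boxtimes> p = p \<boxtimes> d" using d p by (simp add: commutant_def)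
    then have "p \<boxtimes> d \<boxtimes> p = d \<boxtimes> p \<boxtimes> p" by simp
    then have "p \<boxtimes> d \<boxtimes> p = d \<boxtimes> p" using p' dc by (simp add: mul_assoc)
    then show ?thesis using atomicD(2)[OF F(3)[OF p] dc] by simp
  qed
  then obtain c where c: "\<And>p. p \<in> P \<Longrightarrow> d \<boxtimes> p = c p \<cdot> p" by metis
  have "d = gsum E (\<lambda>p. d \<boxtimes> p) P" by (rule frame_right[OF P dc])
  also have "\<dots> = gsum E (\<lambda>p. c p \<cdot> p) P" using c F(2) by (intro gsum_cong) auto
  finally show ?thesis by blast
qed

lemma commutant_subset:
  assumes P: "frame E P" and A: "subalg E A" "P \<subseteq> A"
  shows "commutant E P \<subseteq> A"
proof
  fix d assume "d \<in> commutant E P"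
  then obtain c where "d = gsum E (\<lambda>p. c p \<cdot> p) P" using commutant_expand[OF P] by blast
  moreover have "gsum E (\<lambda>p. c p \<cdot> p) P \<in> A"
    using A by (intro subalg_gsum[OF A(1)]) (auto simp: subalg_def)
  ultimately show "d \<in> A" by simp
qed

lemma commutant_commute:
  assumes P: "frame E P" and d: "d \<in> commutant E P" and d': "d' \<in> commutant E P"
  shows "d \<boxtimes> d' = d' \<boxtimes> d"
proof -
  have sub: "subalg E (commutant E {d})"
    using d by (intro commutant_subalg) (auto simp: commutant_def)
  have "P \<subseteq> commutant E {d}" using d frame_facts(2)[OF P] by (auto simp: commutant_def)
  then have "d' \<in> commutant E {d}" using commutant_subset[OF P sub] d' by blast
  then show ?thesis by (simp add: commutant_def)
qed

text \<open>Conjugating a diagonal element by \<open>x\<close> or by its adjoint lands in the corner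
  of \<open>p\<close> or of \<open>q\<close>, and these corners are diagonal.\<close>

lemma corner_normalizing:
  assumes P: "frame E P" and pq: "p \<in> P" "q \<in> P" and x: "x \<in> carrier E" "p \<boxtimes> x \<boxtimes> q = x"
  shows "x \<in> normalizing E P"
proof -
  note p = projD[OF frame_facts(4)[OF P pq(1)]] and q = projD[OF frame_facts(4)[OF P pq(2)]]
  note pj = frame_facts(4)[OF P pq(1)] frame_facts(4)[OF P pq(2)]
  have px: "p \<boxtimes> x = x" using x p(1) q(1) proj_absorb(1)[OF pj(1), of "x \<boxtimes> q"] by (simp add: mul_assoc)
  have xq: "x \<boxtimes> q = x" using x p(1) q(1) proj_absorb(2)[OF pj(2), of "p \<boxtimes> x"] by simp
  have xp: "x\<^sup>\<star> \<boxtimes> p = x\<^sup>\<star>" "q \<boxtimes> x\<^sup>\<star> = x\<^sup>\<star>"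
    using adj_mul[OF p(1) x(1)] adj_mul[OF x(1) q(1)] px xq p(3) q(3) by simp_all
  have "x\<^sup>\<star> \<boxtimes> d \<boxtimes> x \<in> commutant E P \<and> x \<boxtimes> d \<boxtimes> x\<^sup>\<star> \<in> commutant E P" if d: "d \<in> commutant E P" for d
  proof
    have dc: "d \<in> carrier E" using d by (simp add: commutant_def)
    have "q \<boxtimes> (x\<^sup>\<star> \<boxtimes> d \<boxtimes> x) \<boxtimes> q = (q \<boxtimes> x\<^sup>\<star>) \<boxtimes> d \<boxtimes> (x \<boxtimes> q)"
      using x(1) dc q(1) by (simp add: mul_assoc)
    then show "x\<^sup>\<star> \<boxtimes> d \<boxtimes> x \<in> commutant E P"
      unfolding xp xq using x(1) dc by (intro corner_in_commutant[OF P pq(2)]) auto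
    have "p \<boxtimes> (x \<boxtimes> d \<boxtimes> x\<^sup>\<star>) \<boxtimes> p = (p \<boxtimes> x) \<boxtimes> d \<boxtimes> (x\<^sup>\<star> \<boxtimes> p)"
      using x(1) dc p(1) by (simp add: mul_assoc)
    then show "x \<boxtimes> d \<boxtimes> x\<^sup>\<star> \<in> commutant E P"
      unfolding xp px using x(1) dc by (intro corner_in_commutant[OF P pq(1)]) auto
  qed
  then show ?thesis using x(1) by (simp add: normalizing_def)
qed

end

text \<open>The nonzero images \<open>g i p\<close> under the summands are orthogonal atoms and
  extend to a frame \<open>Q\<close>. A member of \<open>Q\<close> is then either one of these
  images, where conjugation by \<open>f v\<close> is conjugation by \<open>v\<close> inside one
  summand, or orthogonal to all of them, where the conjugate is zero.\<close>

lemma frame_push: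
  assumes A: "digraph_algebra A" and B: "digraph_algebra B" and r: "regular_ext A B f"
    and P: "frame (cstar A) P"  "P \<subseteq> elems A"
  shows "\<exists>Q. frame (cstar B) Q \<and> Q \<subseteq> elems B
     \<and> f ` commutant (cstar A) P \<subseteq> commutant (cstar B) Q
     \<and> f ` normalizing (cstar A) P \<subseteq> normalizing (cstar B) Q"
proof -
  interpret A: fd_star "cstar A" using A by (rule digraph_fd_star)
  interpret B: fd_star "cstar B" using B by (rule digraph_fd_star)
  let ?m = "smul (cstar B)" and ?z = "szero (cstar B)"
  obtain s :: nat and g where d: "decomposes A B f g {..<s}" using r by (auto simp: regular_ext_def)
  note D = decomposesD[OF A B d] and F = A.frame_facts[OF P(1)]
  note gz = star_hom_zero[OF D(2) A.star_algebra_axioms B.star_algebra_axioms]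
  have gproj: "projection (cstar B) (g i p)" if "i < s" "p \<in> P" for i p
    using star_hom_projection[OF D(2) F(4)] that by blast
  define G where "G = {g i p | i p. i < s \<and> p \<in> P \<and> g i p \<noteq> ?z}"
  have gorth: "?m (g i p) (g j q) = ?z" if "i < s" "j < s" "p \<in> P" "q \<in> P" "(i, p) \<noteq> (j, q)" for i j p q
  proof (cases "i = j")
    case True
    then have "smul (cstar A) p q = szero (cstar A)" using F(6) that by auto
    then show ?thesis using True star_homD(3)[OF D(2), of i p q] F(2) that gz[of i] by simp
  qed (use D(6)[of i j p q] F(2) that in auto)
  have Gfin: "finite G"
  proof -
    have "G \<subseteq> (\<lambda>(i, p). g i p) ` ({..<s} \<times> P)" by (auto simp: G_def)
    then show ?thesis using F(1) finite_subset by blast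
  qed
  have oG: "orthogonal_family (cstar B) G"
    unfolding orthogonal_family_def
  proof (intro conjI ballI impI)
    fix x y assume "x \<in> G" "y \<in> G" "x \<noteq> y"
    then show "?m x y = ?z" unfolding G_def using gorth by blast
  qed (use Gfin gproj in \<open>auto simp: G_def\<close>)
  \<comment> \<open>The new frame has to lie in the digraph algebra, so the extension takes place in
    its self-adjoint part. Atoms of \<open>S\<close> are atoms of \<open>cstar B\<close>, because
    \<open>S\<close> contains a frame \<open>R\<close> of \<open>cstar B\<close>.\<close>
  define S where "S = {x \<in> elems B. sadj (cstar B) x \<in> elems B}"
  have sub: "subalg (cstar B) (elems B)" by (rule digraph_algebra_facts(2)[OF B])
  note elc = digraph_elems_carrier[OF B]
  have S: "subalg (cstar B) S" "self_adjoint (cstar B) S"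
  proof -
    show "subalg (cstar B) S"
      using sub elc unfolding subalg_def S_def by (auto simp: B.adj_add B.adj_mul B.adj_scale)
    show "self_adjoint (cstar B) S" using elc by (auto simp: self_adjoint_def S_def)
  qed
  interpret S: fd_star "(cstar B)\<lparr>carrier := S\<rparr>" by (rule B.fd_subalgebra[OF S])
  have projS: "p \<in> S" if "p \<in> elems B" "projection (cstar B) p" for p
    using that by (simp add: S_def projection_def)
  obtain R where R: "R \<subseteq> elems B" "frame (cstar B) R" using digraph_algebra_facts(3)[OF B] by blast
  have RS: "R \<subseteq> S" using R projS B.frame_facts(4)[OF R(2)] by blast
  have GS: "G \<subseteq> S" using projS gproj D(3) P(2) by (auto simp: G_def)
  have Gat: "atomic (cstar B) x" if "x \<in> G" for x using that D(4) F(3) by (auto simp: G_def)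
  obtain Q where Q: "frame ((cstar B)\<lparr>carrier := S\<rparr>) Q" "G \<subseteq> Q"
  proof -
    have "orthogonal_family ((cstar B)\<lparr>carrier := S\<rparr>) G"
      using oG GS by (auto simp: orthogonal_family_def projection_def)
    moreover have "atomic ((cstar B)\<lparr>carrier := S\<rparr>) x" if "x \<in> G" for x
      using Gat[OF that] GS that B.atomic_subalgebra[OF S R(2) RS] by blast
    ultimately show thesis
      using S.frame_extend[OF S.frame_facts(7)[OF B.frame_subalgebra[OF S R(2) RS]]] that by blast
  qed
  note q = S.frame_facts[OF Q(1)]
  have QS: "Q \<subseteq> S" using q(2) by auto
  have SB: "S \<subseteq> elems B" by (auto simp: S_def)
  \<comment> \<open>The frame \<open>R\<close> shows that \<open>S\<close> and
    \<open>cstar B\<close> share their unit, so a frame of \<open>S\<close> also sums to the unit of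
    \<open>cstar B\<close>.\<close>
  have sumQ: "gsum (cstar B) (\<lambda>p. p) Q = gsum (cstar B) (\<lambda>p. p) R"
  proof -
    have "gsum ((cstar B)\<lparr>carrier := S\<rparr>) (\<lambda>p. p) Q = gsum ((cstar B)\<lparr>carrier := S\<rparr>) (\<lambda>p. p) R"
      using S.unit_unique q(7) S.frame_facts(7)[OF B.frame_subalgebra[OF S R(2) RS]] by blast
    then show ?thesis using B.gsum_subalgebra[OF S, of Q] B.gsum_subalgebra[OF S, of R] QS RS by (auto simp: subset_iff)
  qed
  have fQ: "frame (cstar B) Q"
    unfolding frame_def sumQ
  proof (intro conjI ballI)
    show "orthogonal_family (cstar B) Q"
      using q(1,4,5,6) QS SB elc by (auto simp: orthogonal_family_def projection_def)
    show "is_unit_of (cstar B) (carrier (cstar B)) (gsum (cstar B) (\<lambda>p. p) R)"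
      by (rule B.frame_facts(7)[OF R(2)])
    fix x assume "x \<in> Q"
    then show "atomic (cstar B) x" using q(3) B.atomic_subalgebra[OF S R(2) RS] QS by blast
  qed
  note C = B.commutant_frame[OF fQ] and CA = A.commutant_frame[OF P(1)]
  have cQ: "x \<in> carrier (cstar B)" if "x \<in> commutant (cstar B) Q" for x using that by (simp add: commutant_def)
  have cP: "x \<in> carrier (cstar A)" if "x \<in> commutant (cstar A) P" for x using that by (simp add: commutant_def)
  have gC: "g i x \<in> commutant (cstar B) Q" if i: "i < s" and x: "x \<in> commutant (cstar A) P" for i x
  proof -
    obtain c where c: "x = gsum (cstar A) (\<lambda>p. sscale (cstar A) (c p) p) P"
      using A.commutant_expand[OF P(1) x] by blast
    have "g i x = gsum (cstar B) (\<lambda>p. g i (sscale (cstar A) (c p) p)) P"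
      unfolding c using i F(1,2)
      by (intro star_hom_gsum[OF D(2) A.star_algebra_axioms B.star_algebra_axioms]) auto
    also have "\<dots> \<in> commutant (cstar B) Q"
    proof (rule B.subalg_gsum[OF C(1)])
      fix p assume p: "p \<in> P"
      have "g i p = ?z \<or> g i p \<in> Q" using i p Q(2) by (auto simp: G_def)
      then have "g i p \<in> commutant (cstar B) Q" using C(1,3) by (auto simp: subalg_def)
      then show "g i (sscale (cstar A) (c p) p) \<in> commutant (cstar B) Q"
        using star_homD(4)[OF D(2), of i p "c p"] i F(2)[OF p] C(1) by (simp add: subalg_def)
    qed
    finally show ?thesis .
  qed
  have fC: "f ` commutant (cstar A) P \<subseteq> commutant (cstar B) Q"
  proof
    fix y assume "y \<in> f ` commutant (cstar A) P"
    then obtain x where x: "x \<in> commutant (cstar A) P" "y = f x" by blast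
    show "y \<in> commutant (cstar B) Q"
      unfolding x(2) D(7)[OF cP[OF x(1)]] by (rule B.subalg_gsum[OF C(1)]) (use gC x in auto)
  qed
  \<comment> \<open>One of the two conjugations; the other one results from replacing
    \<open>v\<close> by its adjoint.\<close>
  have half: "?m (?m (sadj (cstar B) (f v)) e) (f v) \<in> commutant (cstar B) Q"
    if v: "v \<in> carrier (cstar A)"
      and vn: "\<And>d. d \<in> commutant (cstar A) P \<Longrightarrow> smul (cstar A) (smul (cstar A) (sadj (cstar A) v) d) v \<in> commutant (cstar A) P"
      and e: "e \<in> commutant (cstar B) Q" for v e
  proof -
    have fv: "f v \<in> carrier (cstar B)" using star_homD(1)[OF D(10) v] .
    have one: "?m (?m (sadj (cstar B) (f v)) x) (f v) \<in> commutant (cstar B) Q" if x: "x \<in> Q" for x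
    proof (cases "x \<in> G")
      case True
      then obtain i p where ip: "i < s" "p \<in> P" "x = g i p" by (auto simp: G_def)
      have "?m (?m (sadj (cstar B) (f v)) x) (f v) = ?m (g i (smul (cstar A) (sadj (cstar A) v) p)) (f v)"
        unfolding ip(3) star_homD(5)[OF D(10) v, symmetric] using D(9)[of i "sadj (cstar A) v" p] ip F(2) v by simp
      also have "\<dots> = g i (smul (cstar A) (smul (cstar A) (sadj (cstar A) v) p) v)"
        using D(8)[of i "smul (cstar A) (sadj (cstar A) v) p" v] ip F(2) v by simp
      also have "\<dots> \<in> commutant (cstar B) Q"
        using vn[of p] CA(3) ip(2) by (intro gC[OF ip(1)]) auto
      finally show ?thesis .
    next
      \<comment> \<open>Each \<open>g i p\<close> is zero or a member of \<open>Q\<close> different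
        from \<open>x\<close>, so \<open>x\<close> annihilates every \<open>g i p\<close>, hence
        every \<open>g i v\<close> and \<open>f v\<close>.\<close>
      case False
      have xc: "x \<in> carrier (cstar B)" using B.frame_facts(2)[OF fQ x] .
      have xg: "?m x (g i p) = ?z" if "i < s" "p \<in> P" for i p
      proof (cases "g i p = ?z")
        case False
        then have "g i p \<in> Q" "g i p \<noteq> x" using that Q(2) \<open>x \<notin> G\<close> by (auto simp: G_def)
        then show ?thesis using B.frame_facts(6)[OF fQ x] by auto
      qed (use xc in simp)
      have xgv: "?m x (g i v) = ?z" if i: "i < s" for i
      proof -
        have gi: "g i p \<in> carrier (cstar B)" if "p \<in> P" for p using D(5)[of i p] i F(2)[OF that] by simp
        have gv: "g i v \<in> carrier (cstar B)" using D(5)[of i v] i v by simp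
        have "g i v = gsum (cstar B) (\<lambda>p. g i (smul (cstar A) p v)) P"
          using A.frame_left[OF P(1) v] star_hom_gsum[OF D(2) A.star_algebra_axioms B.star_algebra_axioms F(1), of i "\<lambda>p. smul (cstar A) p v"]
            i F(2) v by simp
        also have "\<dots> = gsum (cstar B) (\<lambda>p. ?m (g i p) (g i v)) P"
          using gi gv i F(2) v star_homD(3)[OF D(2), of i _ v] by (intro B.gsum_cong) auto
        finally have "?m x (g i v) = ?m x (gsum (cstar B) (\<lambda>p. ?m (g i p) (g i v)) P)" by simp
        also have "\<dots> = gsum (cstar B) (\<lambda>p. ?m x (?m (g i p) (g i v))) P"
          using F(1) gi gv xc by (intro B.gsum_mul_left) auto
        also have "\<dots> = ?z"
        proof (rule B.gsum_eq_zero)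
          fix p assume p: "p \<in> P"
          have "?m x (?m (g i p) (g i v)) = ?m (?m x (g i p)) (g i v)"
            using xc gi[OF p] gv by (simp add: B.mul_assoc)
          then show "?m x (?m (g i p) (g i v)) = ?z" using xg[OF i p] gv by simp
        qed
        finally show ?thesis .
      qed
      have "?m x (f v) = gsum (cstar B) (\<lambda>i. ?m x (g i v)) {..<s}"
        unfolding D(7)[OF v] using xc D(5) v by (intro B.gsum_mul_left) auto
      also have "\<dots> = ?z" using xgv by (intro B.gsum_eq_zero) auto
      finally have "?m (?m (sadj (cstar B) (f v)) x) (f v) = ?z" using xc fv by (simp add: B.mul_assoc)
      then show ?thesis using C(1) by (simp add: subalg_def)
    qed
    obtain c where c: "e = gsum (cstar B) (\<lambda>x. sscale (cstar B) (c x) x) Q"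
      using B.commutant_expand[OF fQ e] by blast
    note qc = B.frame_facts(1,2)[OF fQ]
    have "?m (?m (sadj (cstar B) (f v)) e) (f v)
        = gsum (cstar B) (\<lambda>x. sscale (cstar B) (c x) (?m (?m (sadj (cstar B) (f v)) x) (f v))) Q"
      unfolding c using qc fv
      by (simp add: B.gsum_mul_left B.gsum_mul_right B.mul_scale_left B.mul_scale_right cong: B.gsum_cong)
    also have "\<dots> \<in> commutant (cstar B) Q"
      by (rule B.subalg_gsum[OF C(1)]) (use one C(1) in \<open>auto simp: subalg_def\<close>)
    finally show ?thesis .
  qed
  have "f v \<in> normalizing (cstar B) Q" if v: "v \<in> normalizing (cstar A) P" for v
  proof -
    have vc: "v \<in> carrier (cstar A)"
      and v1: "\<And>d. d \<in> commutant (cstar A) P \<Longrightarrow> smul (cstar A) (smul (cstar A) (sadj (cstar A) v) d) v \<in> commutant (cstar A) P"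
      and v2: "\<And>d. d \<in> commutant (cstar A) P \<Longrightarrow> smul (cstar A) (smul (cstar A) v d) (sadj (cstar A) v) \<in> commutant (cstar A) P"
      using v by (auto simp: normalizing_def)
    have "?m (?m (sadj (cstar B) (f v)) e) (f v) \<in> commutant (cstar B) Q"
      if "e \<in> commutant (cstar B) Q" for e using half[OF vc v1 that] .
    moreover have "?m (?m (f v) e) (sadj (cstar B) (f v)) \<in> commutant (cstar B) Q"
      if e: "e \<in> commutant (cstar B) Q" for e
      using half[of "sadj (cstar A) v" e] v2 vc e star_homD(5)[OF D(10) vc] star_homD(1)[OF D(10) vc] by simp
    ultimately show ?thesis using star_homD(1)[OF D(10) vc] by (simp add: normalizing_def)
  qed
  then show ?thesis using fQ QS SB fC by (intro exI[of _ Q]) auto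
qed


section \<open>Direct limits\<close>

text \<open>\<open>L\<close> with the maps \<open>i k\<close> is the algebraic limit of the system \<open>(A k, h k)\<close>,
  characterised up to isomorphism. Intertwined systems thus get literally the same limit.\<close>

locale limit_cone =
  fixes A :: "nat \<Rightarrow> 'a op_alg" and h :: "nat \<Rightarrow> 'a \<Rightarrow> 'a"
    and L :: "'b op_alg" and i :: "nat \<Rightarrow> 'a \<Rightarrow> 'b"
  assumes dig: "digraph_algebra (A k)"
    and h_hom: "star_hom (cstar (A k)) (cstar (A (Suc k))) (h k)"
    and h_elems: "a \<in> elems (A k) \<Longrightarrow> h k a \<in> elems (A (Suc k))"
    and i_hom: "star_hom (cstar (A k)) (ambient L) (i k)"
    and i_comp: "x \<in> carrier (cstar (A k)) \<Longrightarrow> i (Suc k) (h k x) = i k x"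
    and i_surj: "carrier (ambient L) = (\<Union>k. i k ` carrier (cstar (A k)))"
    and i_elems: "elems L = (\<Union>k. i k ` elems (A k))"
    and i_zero: "i k (szero (cstar (A k))) = szero (ambient L)"
    and i_ker: "\<lbrakk>x \<in> carrier (cstar (A k)); i k x = szero (ambient L)\<rbrakk>
      \<Longrightarrow> \<exists>d. steps h k d x = szero (cstar (A (k + d)))"
begin

abbreviation "EE k \<equiv> cstar (A k)"

lemma sa: "star_algebra (EE k)" by (rule digraph_star_algebra[OF dig])

lemma steps_hom: "star_hom (EE k) (EE (k + d)) (steps h k d)"
proof (induction d)
  case 0
  then show ?case by (auto simp: star_hom_def)
next
  case (Suc d)
  show ?case using star_hom_comp[OF Suc h_hom] by (simp add: star_hom_def)
qed

lemma steps_elems: "a \<in> elems (A k) \<Longrightarrow> steps h k d a \<in> elems (A (k + d))"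
  using h_elems by (induction d) auto

lemma steps_closed: "x \<in> carrier (EE k) \<Longrightarrow> steps h k d x \<in> carrier (EE (k + d))"
  by (rule star_homD(1)[OF steps_hom])

lemma steps_zero: "steps h k d (szero (EE k)) = szero (EE (k + d))"
  by (rule star_hom_zero[OF steps_hom sa sa])

lemma i_steps: "x \<in> carrier (EE k) \<Longrightarrow> i (k + d) (steps h k d x) = i k x"
  by (induction d) (auto simp: i_comp steps_closed)

lemma steps_add: "steps h k (d + d') x = steps h (k + d) d' (steps h k d x)"
  by (induction d') (auto simp: add.assoc)

lemma i_closed: "x \<in> carrier (EE k) \<Longrightarrow> i k x \<in> carrier (ambient L)"
  by (rule star_homD(1)[OF i_hom])

lemma elems_closed: "x \<in> elems (A k) \<Longrightarrow> x \<in> carrier (EE k)"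
  by (rule digraph_elems_carrier[OF dig])

text \<open>The difference of \<open>x\<close> and \<open>y\<close> is in the kernel of
  \<open>i k\<close>, so it dies at some stage and stays zero afterwards.\<close>

lemma eventually_eq:
  assumes x: "x \<in> carrier (EE k)" and y: "y \<in> carrier (EE k)" and eq: "i k x = i k y"
  shows "\<exists>d0. \<forall>d\<ge>d0. steps h k d x = steps h k d y"
proof -
  interpret star_algebra "EE k" by (rule sa)
  have "i k (diff_op x y) = sadd (ambient L) (i k y) (sscale (ambient L) (-1) (i k y))"
    using x y eq by (simp add: star_homD[OF i_hom])
  also have "\<dots> = i k (diff_op y y)" using y by (simp only: star_homD[OF i_hom] closed)
  also have "\<dots> = szero (ambient L)" using y i_zero by simp
  finally obtain d0 where d0: "steps h k d0 (diff_op x y) = szero (EE (k + d0))"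
    using i_ker[of "diff_op x y" k] x y by auto
  have "steps h k d x = steps h k d y" if d: "d \<ge> d0" for d
  proof -
    interpret D: star_algebra "EE (k + d)" by (rule sa)
    obtain m where m: "d = d0 + m" using d le_Suc_ex by blast
    have "steps h k d (diff_op x y) = szero (EE (k + d))"
      unfolding m steps_add d0 using steps_zero[of "k + d0" m] by (simp add: add.assoc)
    then have "D.diff_op (steps h k d x) (steps h k d y) = szero (EE (k + d))"
      using x y by (simp add: star_homD[OF steps_hom])
    then show ?thesis using D.diff_eq_zero steps_closed x y by blast
  qed
  then show ?thesis by blast
qed

lemma eventually_represented:
  assumes W: "\<And>k. W k \<subseteq> carrier (EE k)" "\<And>k. h k ` W k \<subseteq> W (Suc k)"
    and x: "x \<in> (\<Union>k. i k ` W k)"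
  shows "\<exists>k0. \<forall>k\<ge>k0. \<exists>y\<in>W k. i k y = x"
proof -
  obtain k0 y where y: "y \<in> W k0" "x = i k0 y" using x by auto
  have st: "steps h k0 d y \<in> W (k0 + d)" for d using y W(2) by (induction d) auto
  have "\<exists>z\<in>W k. i k z = x" if k: "k \<ge> k0" for k
  proof -
    obtain d where "k = k0 + d" using k le_Suc_ex by blast
    then show ?thesis using st[of d] i_steps[of y k0 d] y W(1) by blast
  qed
  then show ?thesis by blast
qed

text \<open>Membership of \<open>i k x\<close> in the limit of the \<open>W k\<close> provides some
  representative in a late \<open>W\<close>. It meets the image of \<open>x\<close> only at a later
  stage, from which on that image lies in \<open>W\<close>.\<close>

lemma eventually_in:
  assumes W: "\<And>k. W k \<subseteq> carrier (EE k)" "\<And>k. h k ` W k \<subseteq> W (Suc k)"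
    and x: "x \<in> carrier (EE k)" "i k x \<in> (\<Union>k. i k ` W k)"
  shows "\<exists>d0. \<forall>d\<ge>d0. steps h k d x \<in> W (k + d)"
proof -
  obtain k0 where k0: "\<And>l. l \<ge> k0 \<Longrightarrow> \<exists>y\<in>W l. i l y = i k x"
    using eventually_represented[OF W x(2)] by blast
  obtain y where y: "y \<in> W (k + k0)" "i (k + k0) y = i k x" using k0[of "k + k0"] by auto
  have yc: "y \<in> carrier (EE (k + k0))" using y W(1) by blast
  have "i (k + k0) (steps h k k0 x) = i (k + k0) y" using y i_steps[OF x(1)] by simp
  then obtain d0 where d0: "\<And>d. d \<ge> d0 \<Longrightarrow> steps h (k + k0) d (steps h k k0 x) = steps h (k + k0) d y"
    using eventually_eq[OF steps_closed[OF x(1)] yc] by blast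
  have st: "steps h (k + k0) d y \<in> W (k + k0 + d)" for d using y W(2) by (induction d) auto
  have "steps h k d x \<in> W (k + d)" if d: "d \<ge> k0 + d0" for d
  proof -
    obtain m where "d = k0 + (d0 + m)" using d le_Suc_ex by (metis add.assoc)
    then show ?thesis using d0[of "d0 + m"] st[of "d0 + m"] by (simp add: steps_add add.assoc)
  qed
  then show ?thesis by blast
qed

lemma rep_carrier: "x \<in> carrier (ambient L) \<Longrightarrow> \<exists>k0. \<forall>k\<ge>k0. \<exists>y\<in>carrier (EE k). i k y = x"
  by (rule eventually_represented[where W = "\<lambda>k. carrier (EE k)"])
    (auto simp: i_surj star_homD(1)[OF h_hom])

lemma rep_elems: "x \<in> elems L \<Longrightarrow> \<exists>k0. \<forall>k\<ge>k0. \<exists>y\<in>elems (A k). i k y = x"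
  by (rule eventually_represented[where W = "\<lambda>k. elems (A k)"])
    (auto simp: i_elems h_elems elems_closed)

lemma common_stage3:
  assumes "x \<in> carrier (ambient L)" "y \<in> carrier (ambient L)" "z \<in> carrier (ambient L)"
  obtains k x' y' z' where "x' \<in> carrier (EE k)" "y' \<in> carrier (EE k)" "z' \<in> carrier (EE k)"
    "x = i k x'" "y = i k y'" "z = i k z'"
proof -
  obtain a b c where a: "\<And>k. k \<ge> a \<Longrightarrow> \<exists>y\<in>carrier (EE k). i k y = x"
    and b: "\<And>k. k \<ge> b \<Longrightarrow> \<exists>w\<in>carrier (EE k). i k w = y"
    and c: "\<And>k. k \<ge> c \<Longrightarrow> \<exists>y\<in>carrier (EE k). i k y = z"
    using rep_carrier[OF assms(1)] rep_carrier[OF assms(2)] rep_carrier[OF assms(3)] by blast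
  show thesis using a[of "a + b + c"] b[of "a + b + c"] c[of "a + b + c"] that[where k = "a + b + c"] by fastforce
qed

text \<open>Every law involves at most three elements, which have representatives at a common
  stage.\<close>

lemma limit_star_algebra: "star_algebra (ambient L)"
proof -
  interpret E: star_algebra "EE k" for k by (rule sa)
  note hom = star_homD(2-5)[OF i_hom, symmetric]
  have c: "sadd (ambient L) x y \<in> carrier (ambient L)" "smul (ambient L) x y \<in> carrier (ambient L)"
    "sscale (ambient L) c x \<in> carrier (ambient L)" "sadj (ambient L) x \<in> carrier (ambient L)"
    if x: "x \<in> carrier (ambient L)" and y: "y \<in> carrier (ambient L)" for x y c
  proof -
    obtain k x' y' z' where k: "x' \<in> carrier (EE k)" "y' \<in> carrier (EE k)" "x = i k x'" "y = i k y'"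
      by (rule common_stage3[OF x y y])
    show "sadd (ambient L) x y \<in> carrier (ambient L)" "smul (ambient L) x y \<in> carrier (ambient L)"
      "sscale (ambient L) c x \<in> carrier (ambient L)" "sadj (ambient L) x \<in> carrier (ambient L)"
      unfolding k(3,4) using k(1,2) by (simp_all add: hom i_closed)
  qed
  show ?thesis
  proof
    show "szero (ambient L) \<in> carrier (ambient L)" using i_zero[of 0] i_closed[OF E.zero_closed, of 0] by simp
  next
    fix x y z c d
    assume x: "x \<in> carrier (ambient L)" and y: "y \<in> carrier (ambient L)" and z: "z \<in> carrier (ambient L)"
    obtain k x' y' z' where k: "x' \<in> carrier (EE k)" "y' \<in> carrier (EE k)" "z' \<in> carrier (EE k)"
      and e: "x = i k x'" "y = i k y'" "z = i k z'"
      by (rule common_stage3[OF x y z])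
    show "sadd (ambient L) (sadd (ambient L) x y) z = sadd (ambient L) x (sadd (ambient L) y z)"
      "smul (ambient L) (smul (ambient L) x y) z = smul (ambient L) x (smul (ambient L) y z)"
      "smul (ambient L) (sadd (ambient L) x y) z = sadd (ambient L) (smul (ambient L) x z) (smul (ambient L) y z)"
      "smul (ambient L) x (sadd (ambient L) y z) = sadd (ambient L) (smul (ambient L) x y) (smul (ambient L) x z)"
      unfolding e using k
      by (simp_all add: hom E.add_assoc E.mul_assoc E.mul_add_left E.mul_add_right)
  next
    fix x y c d
    assume x: "x \<in> carrier (ambient L)" and y: "y \<in> carrier (ambient L)"
    obtain k x' y' z' where k: "x' \<in> carrier (EE k)" "y' \<in> carrier (EE k)"
      and e: "x = i k x'" "y = i k y'"
      by (rule common_stage3[OF x y y])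
    show "sadd (ambient L) x y = sadd (ambient L) y x"
      unfolding e using k by (simp add: hom E.add_comm)
    show "sscale (ambient L) c (sadd (ambient L) x y) = sadd (ambient L) (sscale (ambient L) c x) (sscale (ambient L) c y)"
      "smul (ambient L) (sscale (ambient L) c x) y = sscale (ambient L) c (smul (ambient L) x y)"
      "smul (ambient L) x (sscale (ambient L) c y) = sscale (ambient L) c (smul (ambient L) x y)"
      "sadj (ambient L) (sadd (ambient L) x y) = sadd (ambient L) (sadj (ambient L) x) (sadj (ambient L) y)"
      "sadj (ambient L) (smul (ambient L) x y) = smul (ambient L) (sadj (ambient L) y) (sadj (ambient L) x)"
      unfolding e using k
      by (simp_all add: hom E.scale_add_right E.mul_scale_left E.mul_scale_right E.adj_add E.adj_mul)
  next
    fix x c d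
    assume x: "x \<in> carrier (ambient L)"
    obtain k x' y' z' where k: "x' \<in> carrier (EE k)" and e: "x = i k x'"
      by (rule common_stage3[OF x x x])
    show "sadd (ambient L) x (szero (ambient L)) = x" 
      "sadd (ambient L) x (sscale (ambient L) (-1) x) = szero (ambient L)"
      "sscale (ambient L) (c + d) x = sadd (ambient L) (sscale (ambient L) c x) (sscale (ambient L) d x)"
      "sscale (ambient L) c (sscale (ambient L) d x) = sscale (ambient L) (c * d) x"
      "sscale (ambient L) 1 x = x" "sadj (ambient L) (sadj (ambient L) x) = x"
      "sadj (ambient L) (sscale (ambient L) c x) = sscale (ambient L) (cnj c) (sadj (ambient L) x)"
      unfolding e i_zero[of k, symmetric] using k
      by (simp_all add: hom E.scale_add_left E.scale_scale E.adj_scale)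
  qed (use c in auto)
qed

sublocale L: star_algebra "ambient L" by (rule limit_star_algebra)

lemma limit_elems: "subalg (ambient L) (elems L)"
proof -
  have sub: "subalg (EE k) (elems (A k))" for k by (rule digraph_algebra_facts(2)[OF dig])
  note hom = star_homD(2-5)[OF i_hom, symmetric]
  have two: "\<exists>k x' y'. x' \<in> elems (A k) \<and> y' \<in> elems (A k) \<and> x = i k x' \<and> y = i k y'"
    if x: "x \<in> elems L" and y: "y \<in> elems L" for x y
  proof -
    obtain a b where a: "\<And>k. k \<ge> a \<Longrightarrow> \<exists>y\<in>elems (A k). i k y = x"
      and b: "\<And>k. k \<ge> b \<Longrightarrow> \<exists>w\<in>elems (A k). i k w = y"
      using rep_elems[OF x] rep_elems[OF y] by blast
    show ?thesis using a[of "a + b"] b[of "a + b"] by fastforce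
  qed
  show ?thesis unfolding subalg_def
  proof (intro conjI ballI allI)
    show "elems L \<subseteq> carrier (ambient L)" using i_elems i_closed elems_closed by auto
    have "szero (EE 0) \<in> elems (A 0)" using sub by (simp add: subalg_def)
    then show "szero (ambient L) \<in> elems L" using i_zero[of 0] by (force simp: i_elems)
  next
    fix x y assume x: "x \<in> elems L" and y: "y \<in> elems L"
    then obtain k x' y' where k: "x' \<in> elems (A k)" "y' \<in> elems (A k)" and e: "x = i k x'" "y = i k y'"
      using two by blast
    have "sadd (EE k) x' y' \<in> elems (A k)" "smul (EE k) x' y' \<in> elems (A k)"
      using sub[of k] k by (auto simp: subalg_def)
    then show "sadd (ambient L) x y \<in> elems L" "smul (ambient L) x y \<in> elems L"
      unfolding e using k by (auto simp: hom elems_closed i_elems simp del: L.closed)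
  next
    fix c x assume x: "x \<in> elems L"
    then obtain k x' where k: "x' \<in> elems (A k)" and e: "x = i k x'" using two by blast
    have "sscale (EE k) c x' \<in> elems (A k)" using sub[of k] k by (auto simp: subalg_def)
    then show "sscale (ambient L) c x \<in> elems L"
      unfolding e using k by (auto simp: hom elems_closed i_elems simp del: L.closed)
  qed
qed

text \<open>The elements of a stage that map into the algebra generated by \<open>elems L\<close>
  form a star-subalgebra containing \<open>elems (A k)\<close>, hence are the whole stage.\<close>

lemma cstar_limit: "cstar L = ambient L"
proof -
  have elc: "elems L \<subseteq> carrier (ambient L)" using limit_elems by (simp add: subalg_def)
  note g = L.star_gen_subalg[OF elc]
  have "carrier (EE k) \<subseteq> {x \<in> carrier (EE k). i k x \<in> star_gen (ambient L) (elems L)}" for k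
  proof -
    interpret E: star_algebra "EE k" by (rule sa)
    show ?thesis
    proof (rule digraph_generates[OF dig])
      show "subalg (EE k) {x \<in> carrier (EE k). i k x \<in> star_gen (ambient L) (elems L)}"
        using g(1) by (auto simp: subalg_def star_homD[OF i_hom] i_zero)
      show "self_adjoint (EE k) {x \<in> carrier (EE k). i k x \<in> star_gen (ambient L) (elems L)}"
        using g(2) by (auto simp: self_adjoint_def star_homD[OF i_hom])
      show "elems (A k) \<subseteq> {x \<in> carrier (EE k). i k x \<in> star_gen (ambient L) (elems L)}"
        using g(3) elems_closed i_elems by auto
    qed
  qed
  then have "carrier (ambient L) \<subseteq> star_gen (ambient L) (elems L)" unfolding i_surj by blast
  then have "star_gen (ambient L) (elems L) = carrier (ambient L)" using g(1) by (auto simp: subalg_def)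
  then show ?thesis by (simp add: cstar_def)
qed

section \<open>The limit of the diagonals is a regular masa\<close>

context
  fixes P :: "nat \<Rightarrow> 'a set"
  assumes P: "\<And>k. frame (EE k) (P k)" "\<And>k. P k \<subseteq> elems (A k)"
    and P_diag: "\<And>k. h k ` commutant (EE k) (P k) \<subseteq> commutant (EE (Suc k)) (P (Suc k))"
    and P_norm: "\<And>k. h k ` normalizing (EE k) (P k) \<subseteq> normalizing (EE (Suc k)) (P (Suc k))"
begin

definition "limit_diag = (\<Union>k. i k ` commutant (EE k) (P k))"

lemma fd: "fd_star (EE k)" by (rule digraph_fd_star[OF dig])

lemmas D_sub = fd_star.commutant_frame[OF fd P(1)]

lemma D_closed: "d \<in> commutant (EE k) (P k) \<Longrightarrow> d \<in> carrier (EE k)"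
  by (simp add: commutant_def)

lemma limit_diag_rep: "x \<in> limit_diag \<Longrightarrow> \<exists>k0. \<forall>k\<ge>k0. \<exists>y\<in>commutant (EE k) (P k). i k y = x"
  unfolding limit_diag_def
  by (rule eventually_represented) (use P_diag in \<open>auto simp: commutant_def\<close>)

lemma limit_diag_in:
  "\<lbrakk>x \<in> carrier (EE k); i k x \<in> limit_diag\<rbrakk> \<Longrightarrow> \<exists>d0. \<forall>d\<ge>d0. steps h k d x \<in> commutant (EE (k + d)) (P (k + d))"
  unfolding limit_diag_def
  by (rule eventually_in[where W = "\<lambda>k. commutant (EE k) (P k)"]) (use P_diag in \<open>auto simp: commutant_def\<close>)

lemma steps_normalizing: "x \<in> normalizing (EE k) (P k) \<Longrightarrow> steps h k d x \<in> normalizing (EE (k + d)) (P (k + d))"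
  using P_norm by (induction d) auto

lemma diag_elems: "d \<in> commutant (EE k) (P k) \<Longrightarrow> d \<in> elems (A k)"
  using fd_star.commutant_subset[OF fd P(1) digraph_algebra_facts(2)[OF dig] P(2)] by blast

lemma limit_diag_elems: "limit_diag \<subseteq> elems L"
  unfolding limit_diag_def i_elems using diag_elems by blast

lemma limit_diag_two:
  assumes x: "x \<in> limit_diag" and y: "y \<in> limit_diag"
  shows "\<exists>k x' y'. x' \<in> commutant (EE k) (P k) \<and> y' \<in> commutant (EE k) (P k) \<and> x = i k x' \<and> y = i k y'"
proof -
  obtain a b where a: "\<And>k. k \<ge> a \<Longrightarrow> \<exists>y\<in>commutant (EE k) (P k). i k y = x"
    and b: "\<And>k. k \<ge> b \<Longrightarrow> \<exists>w\<in>commutant (EE k) (P k). i k w = y"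
    using limit_diag_rep[OF x] limit_diag_rep[OF y] by blast
  show ?thesis using a[of "a + b"] b[of "a + b"] by fastforce
qed

text \<open>The diagonal element \<open>c\<close> may have representatives only at stages after
  \<open>k\<close>; there the image of \<open>v\<close> still normalizes the diagonal.\<close>

lemma limit_normalizing:
  assumes v: "v \<in> normalizing (EE k) (P k)" and c: "c \<in> limit_diag"
  shows "smul (ambient L) (smul (ambient L) (sadj (ambient L) (i k v)) c) (i k v) \<in> limit_diag"
    "smul (ambient L) (smul (ambient L) (i k v) c) (sadj (ambient L) (i k v)) \<in> limit_diag"
proof -
  obtain a where a: "\<And>l. l \<ge> a \<Longrightarrow> \<exists>y\<in>commutant (EE l) (P l). i l y = c"
    using limit_diag_rep[OF c] by blast
  then obtain y where y: "y \<in> commutant (EE (k + a)) (P (k + a))" "i (k + a) y = c" by (meson le_add2)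
  interpret E: star_algebra "EE (k + a)" by (rule sa)
  let ?w = "steps h k a v"
  have w: "?w \<in> normalizing (EE (k + a)) (P (k + a))" by (rule steps_normalizing[OF v])
  then have wc: "?w \<in> carrier (EE (k + a))" by (simp add: normalizing_def)
  have iw: "i k v = i (k + a) ?w" using i_steps v by (simp add: normalizing_def)
  have 1: "smul (EE (k + a)) (smul (EE (k + a)) (sadj (EE (k + a)) ?w) y) ?w \<in> commutant (EE (k + a)) (P (k + a))"
    "smul (EE (k + a)) (smul (EE (k + a)) ?w y) (sadj (EE (k + a)) ?w) \<in> commutant (EE (k + a)) (P (k + a))"
    using w y(1) by (auto simp: normalizing_def)
  note hom = star_homD(3,5)[OF i_hom, symmetric]
  show "smul (ambient L) (smul (ambient L) (sadj (ambient L) (i k v)) c) (i k v) \<in> limit_diag"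
    "smul (ambient L) (smul (ambient L) (i k v) c) (sadj (ambient L) (i k v)) \<in> limit_diag"
    unfolding iw y(2)[symmetric] using wc D_closed[OF y(1)] 1
    by (auto simp: hom limit_diag_def simp del: L.closed)
qed

lemma limit_diag_sa: "abelian_sa_subalg (ambient L) limit_diag"
proof -
  note hom = star_homD(2-5)[OF i_hom, symmetric]
  show ?thesis unfolding abelian_sa_subalg_def subalg_def self_adjoint_def
  proof (intro conjI ballI allI)
    show "limit_diag \<subseteq> carrier (ambient L)" using limit_diag_elems limit_elems by (auto simp: subalg_def)
    have "szero (EE 0) \<in> commutant (EE 0) (P 0)" using D_sub(1)[of 0] by (simp add: subalg_def)
    then show "szero (ambient L) \<in> limit_diag" using i_zero[of 0] unfolding limit_diag_def by (metis UN_I UNIV_I imageI)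
  next
    fix x y assume "x \<in> limit_diag" "y \<in> limit_diag"
    then obtain k x' y' where k: "x' \<in> commutant (EE k) (P k)" "y' \<in> commutant (EE k) (P k)"
      and e: "x = i k x'" "y = i k y'" using limit_diag_two by blast
    have "sadd (EE k) x' y' \<in> commutant (EE k) (P k)" "smul (EE k) x' y' \<in> commutant (EE k) (P k)"
      using D_sub(1)[of k] k by (auto simp: subalg_def)
    then show "sadd (ambient L) x y \<in> limit_diag" "smul (ambient L) x y \<in> limit_diag"
      unfolding e using k by (auto simp: hom D_closed limit_diag_def simp del: L.closed)
    show "smul (ambient L) x y = smul (ambient L) y x"
      unfolding e using k fd_star.commutant_commute[OF fd P(1) k] by (simp add: hom D_closed)
  next
    fix x c assume "x \<in> limit_diag"
    then obtain k x' where k: "x' \<in> commutant (EE k) (P k)" and e: "x = i k x'"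
      using limit_diag_two by blast
    have "sscale (EE k) c x' \<in> commutant (EE k) (P k)" "sadj (EE k) x' \<in> commutant (EE k) (P k)"
      using D_sub(1,2)[of k] k by (auto simp: subalg_def self_adjoint_def)
    then show "sscale (ambient L) c x \<in> limit_diag" "sadj (ambient L) x \<in> limit_diag"
      unfolding e using k by (auto simp: hom D_closed limit_diag_def simp del: L.closed)
  qed
qed

text \<open>Maximality: an element commuting with the frame projections of its stage equals its
  conditional expectation onto the diagonal. Regularity: an element of a stage is the sum of its
  corners \<open>p a q\<close>, and each nonzero corner is a multiple of a partial isometry
  normalizing the diagonal.\<close>

lemma limit_regular_masa: "regular_masa L limit_diag"
proof -
  let ?m = "smul (ambient L)"
  have masa: "masa L limit_diag"
    unfolding masa_def
  proof (intro conjI allI impI)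
    fix C' assume C': "abelian_sa_subalg (ambient L) C' \<and> C' \<subseteq> elems L \<and> limit_diag \<subseteq> C'"
    show "C' = limit_diag"
    proof (rule antisym)
      show "C' \<subseteq> limit_diag"
      proof
        fix x assume x: "x \<in> C'"
        then obtain k y where y: "y \<in> elems (A k)" "x = i k y" using C' i_elems by blast
        interpret E: fd_star "EE k" by (rule fd)
        note F = E.frame_facts[OF P(1)]
        have yc: "y \<in> carrier (EE k)" by (rule elems_closed[OF y(1)])
        \<comment> \<open>The conditional expectation of \<open>y\<close> onto the diagonal of its
          stage.\<close>
        define z where "z = gsum (EE k) (\<lambda>p. E.mul_op (E.mul_op p y) p) (P k)"
        have z: "z \<in> commutant (EE k) (P k)"
          unfolding z_def
        proof (rule E.subalg_gsum[OF D_sub(1)])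
          fix p assume p: "p \<in> P k"
          note pp = F(4)[OF p]
          have "E.mul_op (E.mul_op p (E.mul_op (E.mul_op p y) p)) p = E.mul_op (E.mul_op p y) p"
            using F(2)[OF p] yc by (simp add: E.mul_assoc E.proj_absorb[OF pp] E.projD[OF pp])
          then show "E.mul_op (E.mul_op p y) p \<in> commutant (EE k) (P k)"
            using F(2)[OF p] yc by (intro E.corner_in_commutant[OF P(1) p]) auto
        qed
        have "i k z = gsum (ambient L) (\<lambda>p. i k (E.mul_op (E.mul_op p y) p)) (P k)"
          unfolding z_def using F(1,2) yc
          by (intro star_hom_gsum[OF i_hom E.star_algebra_axioms limit_star_algebra]) auto
        also have "\<dots> = gsum (ambient L) (\<lambda>p. i k (E.mul_op y p)) (P k)"
        proof (rule L.gsum_cong[OF refl])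
          fix p assume p: "p \<in> P k"
          note pc = F(2)[OF p]
          \<comment> \<open>At stage \<open>k\<close> the element \<open>y\<close> may fail to
            commute with \<open>p\<close>; only the images in the limit commute, so the computation
            passes to the limit.\<close>
          have "i k p \<in> C'" using C' D_sub(3) p unfolding limit_diag_def by blast
          then have "?m x (i k p) = ?m (i k p) x" using C' x by (auto simp: abelian_sa_subalg_def)
          then have eq: "i k (E.mul_op p y) = i k (E.mul_op y p)"
            unfolding y(2) using pc yc by (simp add: star_homD[OF i_hom])
          have "i k (E.mul_op (E.mul_op p y) p) = ?m (i k (E.mul_op p y)) (i k p)"
            using pc yc by (intro star_homD(3)[OF i_hom]) auto
          also have "\<dots> = i k (E.mul_op (E.mul_op y p) p)"
            unfolding eq using pc yc by (intro star_homD(3)[OF i_hom, symmetric]) auto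
          also have "E.mul_op (E.mul_op y p) p = E.mul_op y p" by (rule E.proj_absorb(2)[OF F(4)[OF p] yc])
          finally show "i k (E.mul_op (E.mul_op p y) p) = i k (E.mul_op y p)" .
          show "i k (E.mul_op y p) \<in> carrier (ambient L)" using pc yc by (intro i_closed) auto
        qed
        also have "\<dots> = i k (gsum (EE k) (\<lambda>p. E.mul_op y p) (P k))"
          using F(1,2) yc
          by (intro star_hom_gsum[OF i_hom E.star_algebra_axioms limit_star_algebra, symmetric]) auto
        also have "\<dots> = x" using E.frame_right[OF P(1) yc] y(2) by simp
        finally show "x \<in> limit_diag" using z unfolding limit_diag_def by blast
      qed
    qed (use C' in blast)
  qed (use limit_diag_sa limit_diag_elems in auto)
  have sub: "normalizer L limit_diag \<subseteq> elems L" by (auto simp: normalizer_def Let_def)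
  have gen: "elems L \<subseteq> S" if S: "subalg (ambient L) S" "normalizer L limit_diag \<subseteq> S" for S
  proof
    fix x assume "x \<in> elems L"
    then obtain k a where a: "a \<in> elems (A k)" "x = i k a" unfolding i_elems by blast
    interpret E: fd_star "EE k" by (rule fd)
    note F = E.frame_facts[OF P(1)] and dsub = digraph_algebra_facts(2)[OF dig, of k]
    have ac: "a \<in> carrier (EE k)" by (rule elems_closed[OF a(1)])
    have part: "i k (E.mul_op (E.mul_op p a) q) \<in> S" if pq: "p \<in> P k" "q \<in> P k" for p q
    proof -
      define y where "y = E.mul_op (E.mul_op p a) q"
      note pp = F(4)[OF pq(1)] and qq = F(4)[OF pq(2)]
      have yA: "y \<in> elems (A k)" using dsub a(1) P(2) pq unfolding y_def subalg_def by blast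
      have yc: "y \<in> carrier (EE k)" by (rule elems_closed[OF yA])
      have py: "E.mul_op p y = y" "E.mul_op y q = y"
        using F(2)[OF pq(1)] F(2)[OF pq(2)] ac
        by (simp_all add: y_def E.mul_assoc E.proj_absorb[OF pp] E.projD[OF qq])
      show ?thesis
      proof (cases "y = szero (EE k)")
        case True
        then show ?thesis using i_zero S(1) by (simp add: y_def[symmetric] subalg_def)
      next
        case False
        \<comment> \<open>A scalar turns the corner element into a partial isometry between
          \<open>p\<close> and \<open>q\<close> without leaving the digraph algebra.\<close>
        obtain c where c: "c \<noteq> 0"
          "E.mul_op (E.scale_op c y) (E.adj_op (E.scale_op c y)) = p"
          "E.mul_op (E.adj_op (E.scale_op c y)) (E.scale_op c y) = q"
          using E.atomic_equivalence[OF F(3)[OF pq(1)] F(5)[OF pq(1)] F(3)[OF pq(2)] F(5)[OF pq(2)] yc py False]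
          by blast
        define u where "u = E.scale_op c y"
        have uA: "u \<in> elems (A k)" using dsub yA by (simp add: u_def subalg_def)
        have uc: "u \<in> carrier (EE k)" by (rule elems_closed[OF uA])
        have uu: "E.mul_op (E.mul_op u (E.adj_op u)) u = u"
          using E.partial_isometry_absorb(4)[OF uc _ qq] c(3) by (simp add: u_def)
        have pu: "E.mul_op (E.mul_op p u) q = u"
          using py yc F(2)[OF pq(1)] F(2)[OF pq(2)] by (simp add: u_def E.mul_scale_left E.mul_scale_right)
        have un: "u \<in> normalizing (EE k) (P k)"
          by (rule E.corner_normalizing[OF P(1) pq uc pu])
        have "i k u \<in> normalizer L limit_diag"
          unfolding normalizer_def Let_def
        proof (intro CollectI conjI ballI)
          show "i k u \<in> elems L" using uA i_elems by blast
          show "?m (?m (i k u) (sadj (ambient L) (i k u))) (i k u) = i k u"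
            using uu uc by (simp flip: star_homD(3,5)[OF i_hom])
        qed (use limit_normalizing[OF un] in auto)
        then have "sscale (ambient L) (1 / c) (i k u) \<in> S" using S by (auto simp: subalg_def)
        then show ?thesis using c(1) yc by (simp add: u_def star_homD(4)[OF i_hom] L.scale_scale i_closed flip: y_def)
      qed
    qed
    have inner: "gsum (EE k) (\<lambda>q. E.mul_op (E.mul_op p a) q) (P k) \<in> carrier (EE k)" if "p \<in> P k" for p
      using F(2) ac that by auto
    have "x = i k (gsum (EE k) (\<lambda>p. gsum (EE k) (\<lambda>q. E.mul_op (E.mul_op p a) q) (P k)) (P k))"
      using a(2) E.frame_both[OF P(1) ac] by simp
    also have "\<dots> = gsum (ambient L) (\<lambda>p. i k (gsum (EE k) (\<lambda>q. E.mul_op (E.mul_op p a) q) (P k))) (P k)"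
      by (rule star_hom_gsum[OF i_hom E.star_algebra_axioms limit_star_algebra F(1) inner])
    also have "\<dots> \<in> S"
    proof (rule L.subalg_gsum[OF S(1)])
      fix p assume p: "p \<in> P k"
      have "i k (gsum (EE k) (\<lambda>q. E.mul_op (E.mul_op p a) q) (P k))
          = gsum (ambient L) (\<lambda>q. i k (E.mul_op (E.mul_op p a) q)) (P k)"
        using F(2) ac p
        by (intro star_hom_gsum[OF i_hom E.star_algebra_axioms limit_star_algebra F(1)]) auto
      also have "\<dots> \<in> S" by (rule L.subalg_gsum[OF S(1)]) (use part p in auto)
      finally show "i k (gsum (EE k) (\<lambda>q. E.mul_op (E.mul_op p a) q) (P k)) \<in> S" .
    qed
    finally show "x \<in> S" .
  qed
  have "alg_gen (ambient L) (normalizer L limit_diag) = elems L"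
    unfolding alg_gen_def using gen limit_elems sub by blast
  then show ?thesis using masa by (simp add: regular_masa_def)
qed

end

lemma frames_exist:
  assumes r: "\<And>k. regular_ext (A k) (A (Suc k)) (h k)"
  shows "\<exists>P. \<forall>k. (frame (EE k) (P k) \<and> P k \<subseteq> elems (A k)) \<and>
    h k ` commutant (EE k) (P k) \<subseteq> commutant (EE (Suc k)) (P (Suc k)) \<and>
    h k ` normalizing (EE k) (P k) \<subseteq> normalizing (EE (Suc k)) (P (Suc k))"
proof (rule dependent_nat_choice)
  show "\<exists>Q. frame (EE 0) Q \<and> Q \<subseteq> elems (A 0)" using digraph_algebra_facts(3)[OF dig[of 0]] by blast
next
  fix Q k assume Q: "frame (EE k) Q \<and> Q \<subseteq> elems (A k)"
  show "\<exists>R. (frame (EE (Suc k)) R \<and> R \<subseteq> elems (A (Suc k))) \<and>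
    h k ` commutant (EE k) Q \<subseteq> commutant (EE (Suc k)) R \<and>
    h k ` normalizing (EE k) Q \<subseteq> normalizing (EE (Suc k)) R"
    using frame_push[OF dig dig r, of k Q] Q by simp
qed

end


section \<open>The concrete limit; cofinal subsequences and intertwined systems\<close>

lemma steps_append: "steps h k (d + d') x = steps h (k + d) d' (steps h k d x)"
  by (induction d') (auto simp: add.assoc)

locale star_system =
  fixes E :: "nat \<Rightarrow> 'a star_alg" and h :: "nat \<Rightarrow> 'a \<Rightarrow> 'a"
  assumes alg: "star_algebra (E k)"
    and hom: "star_hom (E k) (E (Suc k)) (h k)"
begin

abbreviation "sm \<equiv> system_map h"
abbreviation "cls \<equiv> lim_class E h"

lemma steps_hom: "star_hom (E k) (E (k + d)) (steps h k d)"
proof (induction d)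
  case (Suc d)
  show ?case using star_hom_comp[OF Suc hom] by (simp add: star_hom_def)
qed (auto simp: star_hom_def)

lemma sm_hom: "k \<le> n \<Longrightarrow> star_hom (E k) (E n) (sm k n)"
  using steps_hom[of k "n - k"] by (simp add: system_map_def[abs_def])

lemma sm_trans: "\<lbrakk>k \<le> m; m \<le> n\<rbrakk> \<Longrightarrow> sm m n (sm k m x) = sm k n x"
  using steps_append[of h k "m - k" "n - m" x] by (simp add: system_map_def)

lemma sm_refl [simp]: "sm k k x = x"
  by (simp add: system_map_def)

lemma cls_mem: "(l, y) \<in> cls k x \<longleftrightarrow> y \<in> carrier (E l) \<and> (\<exists>n. k \<le> n \<and> l \<le> n \<and> sm k n x = sm l n y)"
  by (simp add: lim_class_def)

lemma cls_eqI:
  assumes "k \<le> n" "l \<le> n" "sm k n x = sm l n y"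
  shows "cls k x = cls l y"
proof -
  have *: "(\<exists>n. k \<le> n \<and> m \<le> n \<and> sm k n x = sm m n z) \<Longrightarrow> (\<exists>n. l \<le> n \<and> m \<le> n \<and> sm l n y = sm m n z)"
    if "k \<le> n" "l \<le> n" "sm k n x = sm l n y" for k l x y n m z
  proof -
    assume "\<exists>n. k \<le> n \<and> m \<le> n \<and> sm k n x = sm m n z"
    then obtain n' where n': "k \<le> n'" "m \<le> n'" "sm k n' x = sm m n' z" by blast
    have "sm l (max n n') y = sm n (max n n') (sm l n y)" using that by (simp add: sm_trans)
    also have "\<dots> = sm k (max n n') x" unfolding that(3)[symmetric] using that(1,2) by (simp add: sm_trans)
    also have "\<dots> = sm n' (max n n') (sm k n' x)" using n'(1) by (simp add: sm_trans)
    also have "\<dots> = sm m (max n n') z" unfolding n'(3) using n'(2) by (simp add: sm_trans)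
    finally show ?thesis using that n' by (intro exI[of _ "max n n'"]) auto
  qed
  have "(m, z) \<in> cls k x \<longleftrightarrow> (m, z) \<in> cls l y" for m z
    unfolding cls_mem using *[OF assms] *[OF assms(2,1) assms(3)[symmetric]] by metis
  then show ?thesis by auto
qed

lemma cls_self: "x \<in> carrier (E k) \<Longrightarrow> (k, x) \<in> cls k x"
  by (auto simp: cls_mem)

lemma cls_eqD:
  assumes "y \<in> carrier (E l)" "cls k x = cls l y"
  obtains n where "k \<le> n" "l \<le> n" "sm k n x = sm l n y"
proof -
  have "(l, y) \<in> cls k x" using cls_self[OF assms(1)] assms(2) by simp
  then show thesis using that unfolding cls_mem by blast
qed

lemma lim_op1_cls:
  assumes f: "\<And>k n x. \<lbrakk>k \<le> n; x \<in> carrier (E k)\<rbrakk> \<Longrightarrow> sm k n (f k x) = f n (sm k n x)"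
    and x: "x \<in> carrier (E k)"
  shows "lim_op1 E h f (cls k x) = cls k (f k x)"
proof -
  have "cls l (f l y) = cls k (f k x)" if ly: "(l, y) \<in> cls k x" for l y
  proof -
    obtain n where n: "y \<in> carrier (E l)" "k \<le> n" "l \<le> n" "sm k n x = sm l n y"
      using ly unfolding cls_mem by blast
    show ?thesis by (rule cls_eqI[OF n(3,2)]) (use n x f in simp)
  qed
  then have "(case p of (l, y) \<Rightarrow> cls l (f l y)) = cls k (f k x)" if "p \<in> cls k x" for p
    using that by (cases p) simp
  moreover have "cls k x \<noteq> {}" using cls_self[OF x] by blast
  ultimately show ?thesis unfolding lim_op1_def by (intro SUP_eq_const)
qed

text \<open>For any choice of representatives the results are compared at a stage \<open>N\<close>
  beyond all stages involved, so the double union runs over copies of a single class.\<close>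

lemma lim_op2_cls:
  assumes f: "\<And>k n x y. \<lbrakk>k \<le> n; x \<in> carrier (E k); y \<in> carrier (E k)\<rbrakk> \<Longrightarrow> sm k n (f k x y) = f n (sm k n x) (sm k n y)"
    and x: "x \<in> carrier (E k)" and y: "y \<in> carrier (E k)"
  shows "lim_op2 E h f (cls k x) (cls k y) = cls k (f k x y)"
proof -
  have eq: "(let n = max l m in cls n (f n (sm l n x') (sm m n y'))) = cls k (f k x y)"
    if lx: "(l, x') \<in> cls k x" and my: "(m, y') \<in> cls k y" for l x' m y'
  proof -
    obtain a where a: "x' \<in> carrier (E l)" "k \<le> a" "l \<le> a" "sm k a x = sm l a x'"
      using lx unfolding cls_mem by blast
    obtain b where b: "y' \<in> carrier (E m)" "k \<le> b" "m \<le> b" "sm k b y = sm m b y'"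
      using my unfolding cls_mem by blast
    define n where "n = max l m"
    define N where "N = max n (max a b)"
    have le: "k \<le> N" "n \<le> N" "l \<le> n" "m \<le> n" "a \<le> N" "b \<le> N" "l \<le> N" "m \<le> N"
      using a b by (auto simp: n_def N_def)
    have xN: "sm l N x' = sm k N x" using sm_trans[of l a N x'] sm_trans[of k a N x] a le by simp
    have yN: "sm m N y' = sm k N y" using sm_trans[of m b N y'] sm_trans[of k b N y] b le by simp
    have c: "sm l n x' \<in> carrier (E n)" "sm m n y' \<in> carrier (E n)"
      using star_homD(1)[OF sm_hom] a b le by blast+
    have "sm n N (f n (sm l n x') (sm m n y')) = f N (sm l N x') (sm m N y')"
      using f[OF le(2) c] sm_trans[OF le(3,2)] sm_trans[OF le(4,2)] by simp
    also have "\<dots> = sm k N (f k x y)" using f[OF le(1) x y] xN yN by simp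
    finally have "cls n (f n (sm l n x') (sm m n y')) = cls k (f k x y)"
      by (rule cls_eqI[OF le(2,1)])
    then show ?thesis by (simp add: n_def Let_def)
  qed
  have "lim_op2 E h f (cls k x) (cls k y)
      = (\<Union>(l, x')\<in>cls k x. \<Union>(m, y')\<in>cls k y. cls k (f k x y))"
    unfolding lim_op2_def by (intro SUP_cong refl) (use eq in \<open>auto\<close>)
  then show ?thesis using cls_self[OF x] cls_self[OF y] by auto
qed

lemma cls_hom: "star_hom (E k) (star_limit E h) (cls k)"
proof -
  note H = star_homD[OF sm_hom]
  show ?thesis
    unfolding star_hom_def
    by (auto simp: star_limit_def lim_op1_cls lim_op2_cls H)
qed

end

text \<open>Links the concrete limit to the abstract cone; from here on the equivalence classes are
  handled only through \<open>limit_cone\<close>.\<close>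

lemma alg_limit_cone:
  assumes dig: "\<And>k. digraph_algebra (A k)" and ext: "\<And>k. star_extendible (A k) (A (Suc k)) (\<phi> k)"
  defines "h \<equiv> \<lambda>k. star_extension (A k) (A (Suc k)) (\<phi> k)"
  shows "limit_cone A h (alg_limit A \<phi>) (lim_class (\<lambda>k. cstar (A k)) h)"
proof -
  note H = star_extension[OF dig ext]
  interpret S: star_system "\<lambda>k. cstar (A k)" h
    by (rule star_system.intro) (simp_all add: digraph_star_algebra dig H(1) h_def)
  have amb: "ambient (alg_limit A \<phi>) = star_limit (\<lambda>k. cstar (A k)) h"
    by (simp add: alg_limit_def Let_def h_def)
  have zero: "S.cls k (szero (cstar (A k))) = S.cls 0 (szero (cstar (A 0)))" for k
  proof (rule S.cls_eqI[of k k 0])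
    show "S.sm k k (szero (cstar (A k))) = S.sm 0 k (szero (cstar (A 0)))"
      using star_hom_zero[OF S.sm_hom[of 0 k] S.alg S.alg] by simp
  qed auto
  show ?thesis
  proof
    show "digraph_algebra (A k)" for k by (rule dig)
    show "star_hom (cstar (A k)) (cstar (A (Suc k))) (h k)" for k by (rule S.hom)
    show "a \<in> elems (A k) \<Longrightarrow> h k a \<in> elems (A (Suc k))" for a k
      unfolding h_def using H(2,3) by simp
    show "star_hom (cstar (A k)) (ambient (alg_limit A \<phi>)) (S.cls k)" for k
      unfolding amb by (rule S.cls_hom)
    show "S.cls (Suc k) (h k x) = S.cls k x" for k x
      by (rule S.cls_eqI[of _ "Suc k"]) (auto simp: system_map_def)
    show "carrier (ambient (alg_limit A \<phi>)) = (\<Union>k. S.cls k ` carrier (cstar (A k)))"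
      by (auto simp: amb star_limit_def)
    show "elems (alg_limit A \<phi>) = (\<Union>k. S.cls k ` elems (A k))"
      by (auto simp: alg_limit_def Let_def h_def)
    show "S.cls k (szero (cstar (A k))) = szero (ambient (alg_limit A \<phi>))" for k
      using zero by (simp add: amb star_limit_def)
    show "\<exists>d. steps h k d x = szero (cstar (A (k + d)))"
      if x: "x \<in> carrier (cstar (A k))" "S.cls k x = szero (ambient (alg_limit A \<phi>))" for x k
    proof -
      have eq: "S.cls k x = S.cls k (szero (cstar (A k)))"
        using x(2) zero[of k] by (simp add: amb star_limit_def)
      obtain n where n: "k \<le> n" "S.sm k n x = S.sm k n (szero (cstar (A k)))"
        by (rule S.cls_eqD[OF star_algebra.zero_closed[OF S.alg] eq])
      then have "S.sm k n x = szero (cstar (A n))" using star_hom_zero[OF S.sm_hom S.alg S.alg] by simp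
      then show ?thesis using n(1) by (intro exI[of _ "n - k"]) (simp add: system_map_def)
    qed
  qed
qed

text \<open>Cofinality. The maps \<open>h'\<close> are pinned down only on the carriers, so that
  composites through a second system may serve as connecting maps.\<close>

lemma (in limit_cone) subsequence_cone:
  assumes n: "strict_mono n"
    and h': "\<And>j x. x \<in> carrier (cstar (A (n j))) \<Longrightarrow> h' j x = steps h (n j) (n (Suc j) - n j) x"
  shows "limit_cone (\<lambda>j. A (n j)) h' L (\<lambda>j. i (n j))"
proof -
  have mono: "n j \<le> n (j + d)" for j d using n by (simp add: strict_mono_less_eq)
  have lt: "n j < n (Suc j)" for j using n by (simp add: strict_mono_Suc_iff)
  have later: "\<exists>j. l \<le> n j" for l using strict_mono_imp_increasing[OF n, of l] by blast
  have hom: "star_hom (cstar (A (n j))) (cstar (A (n (Suc j)))) (h' j)" for j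
    using steps_hom[of "n j" "n (Suc j) - n j"] lt[of j]
    by (intro star_hom_cong[OF _ sa h']) simp_all
  have st: "steps h' j d x = steps h (n j) (n (j + d) - n j) x" if x: "x \<in> carrier (cstar (A (n j)))" for j d x
  proof (induction d)
    case (Suc d)
    have "steps h (n j) (n (j + d) - n j) x \<in> carrier (cstar (A (n (j + d))))"
      using steps_closed[OF x, of "n (j + d) - n j"] mono[of j d] by simp
    then have "steps h' j (Suc d) x = steps h (n (j + d)) (n (Suc (j + d)) - n (j + d)) (steps h (n j) (n (j + d) - n j) x)"
      using Suc h' by simp
    also have "\<dots> = steps h (n j) ((n (j + d) - n j) + (n (Suc (j + d)) - n (j + d))) x"
      using steps_add[of "n j" "n (j + d) - n j"] mono[of j d] by simp
    also have "(n (j + d) - n j) + (n (Suc (j + d)) - n (j + d)) = n (j + Suc d) - n j"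
      using mono[of j d] lt[of "j + d"] by simp
    finally show ?case .
  qed simp
  show ?thesis
  proof
    show "digraph_algebra (A (n j))" for j by (rule dig)
    show "star_hom (cstar (A (n j))) (cstar (A (n (Suc j)))) (h' j)" for j by (rule hom)
    show "a \<in> elems (A (n j)) \<Longrightarrow> h' j a \<in> elems (A (n (Suc j)))" for a j
      using steps_elems[of a "n j" "n (Suc j) - n j"] h'[of a j] elems_closed lt[of j] by simp
    show "star_hom (cstar (A (n j))) (ambient L) (i (n j))" for j by (rule i_hom)
    show "x \<in> carrier (cstar (A (n j))) \<Longrightarrow> i (n (Suc j)) (h' j x) = i (n j) x" for x j
      using h'[of x j] i_steps[of x "n j" "n (Suc j) - n j"] lt[of j] by simp
    \<comment> \<open>An element of any stage is represented at all later ones, among them a stage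
      of the subsequence. It is used with \<open>W\<close> the carriers and with \<open>W\<close>
      the digraph algebras.\<close>
    have into: "\<exists>j. i l x \<in> i (n j) ` W (n j)"
      if W: "\<And>k. W k \<subseteq> carrier (EE k)" "\<And>k. h k ` W k \<subseteq> W (Suc k)" and x: "x \<in> W l" for W l x
    proof -
      obtain k0 where "\<And>k. k \<ge> k0 \<Longrightarrow> \<exists>y\<in>W k. i k y = i l x"
        using eventually_represented[OF W, of "i l x"] x by blast
      moreover obtain j where "k0 \<le> n j" using later by blast
      ultimately obtain y where "y \<in> W (n j)" "i l x = i (n j) y" by metis
      then show ?thesis by blast
    qed
    have "\<exists>j. i l x \<in> i (n j) ` carrier (cstar (A (n j)))" if "x \<in> carrier (EE l)" for l x
      by (rule into) (use that star_homD(1)[OF h_hom] in auto)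
    then have "carrier (ambient L) \<subseteq> (\<Union>j. i (n j) ` carrier (cstar (A (n j))))"
      unfolding i_surj by (intro UN_least image_subsetI) (metis UN_iff UNIV_I)
    then show "carrier (ambient L) = (\<Union>j. i (n j) ` carrier (cstar (A (n j))))"
      using i_closed by (intro antisym) auto
    have "\<exists>j. i l x \<in> i (n j) ` elems (A (n j))" if "x \<in> elems (A l)" for l x
      by (rule into) (use that elems_closed h_elems in auto)
    then have "elems L \<subseteq> (\<Union>j. i (n j) ` elems (A (n j)))"
      unfolding i_elems by (intro UN_least image_subsetI) (metis UN_iff UNIV_I)
    then show "elems L = (\<Union>j. i (n j) ` elems (A (n j)))"
      unfolding i_elems by (intro antisym) auto
    show "i (n j) (szero (cstar (A (n j)))) = szero (ambient L)" for j by (rule i_zero)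
    show "\<exists>d. steps h' j d x = szero (cstar (A (n (j + d))))"
      if x: "x \<in> carrier (cstar (A (n j)))" "i (n j) x = szero (ambient L)" for x j
    proof -
      obtain d where d: "steps h (n j) d x = szero (cstar (A (n j + d)))" using i_ker[OF x] by blast
      obtain j' where "n j + d \<le> n j'" using later by blast
      moreover have "n j' \<le> n (j + j')" using n by (simp add: strict_mono_less_eq)
      ultimately obtain m where m: "n (j + j') = n j + d + m" by (metis le_Suc_ex le_trans)
      have "steps h (n j) (d + m) x = szero (cstar (A (n j + (d + m))))"
        unfolding steps_add d steps_zero by (simp add: add.assoc)
      then show ?thesis using st[OF x(1), of j'] m by (intro exI[of _ j']) (simp add: add.assoc)
    qed
  qed
qed

text \<open>Stage \<open>j\<close> of \<open>B\<close> reaches the limit through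
  \<open>\<beta> j\<close>. Nothing is lost or added: each stage of \<open>A\<close> factors through
  \<open>\<alpha> j\<close>, and what dies along \<open>A\<close> after \<open>\<beta> j\<close>
  dies along \<open>B\<close> as well.\<close>

lemma (in limit_cone) interleaved_cone:
  assumes B: "\<And>j. digraph_algebra (B j)"
    and \<alpha>: "\<And>j. star_hom (cstar (A j)) (cstar (B j)) (\<alpha> j)" "\<And>j a. a \<in> elems (A j) \<Longrightarrow> \<alpha> j a \<in> elems (B j)"
    and \<beta>: "\<And>j. star_hom (cstar (B j)) (cstar (A (Suc j))) (\<beta> j)" "\<And>j b. b \<in> elems (B j) \<Longrightarrow> \<beta> j b \<in> elems (A (Suc j))"
    and h: "\<And>j x. x \<in> carrier (cstar (A j)) \<Longrightarrow> h j x = \<beta> j (\<alpha> j x)"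
  shows "limit_cone B (\<lambda>j y. \<alpha> (Suc j) (\<beta> j y)) L (\<lambda>j y. i (Suc j) (\<beta> j y))"
    and "x \<in> carrier (cstar (A j)) \<Longrightarrow> i (Suc j) (\<beta> j (\<alpha> j x)) = i j x"
proof -
  let ?k = "\<lambda>j y. \<alpha> (Suc j) (\<beta> j y)"
  have \<alpha>c: "x \<in> carrier (cstar (A j)) \<Longrightarrow> \<alpha> j x \<in> carrier (cstar (B j))" for x j by (rule star_homD(1)[OF \<alpha>(1)])
  have \<beta>c: "x \<in> carrier (cstar (B j)) \<Longrightarrow> \<beta> j x \<in> carrier (cstar (A (Suc j)))" for x j by (rule star_homD(1)[OF \<beta>(1)])
  show comp: "x \<in> carrier (cstar (A j)) \<Longrightarrow> i (Suc j) (\<beta> j (\<alpha> j x)) = i j x" for x j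
    using h[of x j] i_comp[of x j] by simp
  have kh: "star_hom (cstar (B j)) (cstar (B (Suc j))) (?k j)" for j by (rule star_hom_comp[OF \<beta>(1) \<alpha>(1)])
  have kc: "y \<in> carrier (cstar (B j)) \<Longrightarrow> steps ?k j d y \<in> carrier (cstar (B (j + d)))" for y j d
    by (induction d) (auto simp: \<alpha>c \<beta>c)
  have shift: "\<beta> (j + d) (steps ?k j d y) = steps h (Suc j) d (\<beta> j y)" if y: "y \<in> carrier (cstar (B j))" for j d y
  proof (induction d)
    case (Suc d)
    have "\<beta> (j + d) (steps ?k j d y) \<in> carrier (cstar (A (Suc (j + d))))" by (rule \<beta>c[OF kc[OF y]])
    from h[OF this] show ?case using Suc by simp
  qed simp
  show "limit_cone B ?k L (\<lambda>j y. i (Suc j) (\<beta> j y))"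
  proof
    show "digraph_algebra (B j)" for j by (rule B)
    show "star_hom (cstar (B j)) (cstar (B (Suc j))) (?k j)" for j by (rule kh)
    show "b \<in> elems (B j) \<Longrightarrow> ?k j b \<in> elems (B (Suc j))" for b j using \<alpha>(2) \<beta>(2) by simp
    show "star_hom (cstar (B j)) (ambient L) (\<lambda>y. i (Suc j) (\<beta> j y))" for j
      by (rule star_hom_comp[OF \<beta>(1) i_hom])
    show "y \<in> carrier (cstar (B j)) \<Longrightarrow> i (Suc (Suc j)) (\<beta> (Suc j) (?k j y)) = i (Suc j) (\<beta> j y)" for j y
      using comp[OF \<beta>c] .
    have "i j x \<in> (\<lambda>y. i (Suc j) (\<beta> j y)) ` carrier (cstar (B j))" if "x \<in> carrier (cstar (A j))" for j x
      by (rule image_eqI[where x = "\<alpha> j x"]) (use comp[OF that] \<alpha>c[OF that] in simp_all)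
    then have "carrier (ambient L) \<subseteq> (\<Union>j. (\<lambda>y. i (Suc j) (\<beta> j y)) ` carrier (cstar (B j)))"
      unfolding i_surj by (intro UN_least image_subsetI) (rule UN_I[OF UNIV_I])
    moreover have "i (Suc j) (\<beta> j y) \<in> carrier (ambient L)" if "y \<in> carrier (cstar (B j))" for j y
      by (rule i_closed[OF \<beta>c[OF that]])
    ultimately show "carrier (ambient L) = (\<Union>j. (\<lambda>y. i (Suc j) (\<beta> j y)) ` carrier (cstar (B j)))"
      by (intro antisym) auto
    have "i j x \<in> (\<lambda>y. i (Suc j) (\<beta> j y)) ` elems (B j)" if "x \<in> elems (A j)" for j x
      by (rule image_eqI[where x = "\<alpha> j x"]) (use comp[OF elems_closed[OF that]] \<alpha>(2)[OF that] in simp_all)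
    then have "elems L \<subseteq> (\<Union>j. (\<lambda>y. i (Suc j) (\<beta> j y)) ` elems (B j))"
      unfolding i_elems by (intro UN_least image_subsetI) (rule UN_I[OF UNIV_I])
    moreover have "i (Suc j) (\<beta> j y) \<in> elems L" if "y \<in> elems (B j)" for j y
      unfolding i_elems using \<beta>(2)[OF that] by blast
    ultimately show "elems L = (\<Union>j. (\<lambda>y. i (Suc j) (\<beta> j y)) ` elems (B j))"
      by (intro antisym) auto
    show "i (Suc j) (\<beta> j (szero (cstar (B j)))) = szero (ambient L)" for j
      using star_hom_zero[OF \<beta>(1) digraph_star_algebra[OF B] sa] i_zero by simp
    show "\<exists>d. steps ?k j d y = szero (cstar (B (j + d)))"
      if y: "y \<in> carrier (cstar (B j))" "i (Suc j) (\<beta> j y) = szero (ambient L)" for y j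
    proof -
      obtain d where d: "steps h (Suc j) d (\<beta> j y) = szero (cstar (A (Suc j + d)))"
        using i_ker[OF \<beta>c[OF y(1)] y(2)] by blast
      \<comment> \<open>The element vanishes in \<open>A\<close> after \<open>\<beta> j\<close> and
        \<open>d\<close> steps; one more \<open>\<alpha>\<close> returns to \<open>B\<close>, hence
        \<open>Suc d\<close>.\<close>
      have "steps ?k j (Suc d) y = szero (cstar (B (j + Suc d)))"
        using shift[OF y(1), of d] d star_hom_zero[OF \<alpha>(1) sa digraph_star_algebra[OF B], of "Suc (j + d)"] by simp
      then show ?thesis by blast
    qed
  qed
qed

section \<open>Splitting a homomorphism along a frame of the range\<close>

text \<open>The projections \<open>G q\<close> need not lie in the digraph algebra of the range.\<close>

lemma split_hom:
  assumes A: "fd_star A" and B: "fd_star B" and g: "star_hom A B g"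
    and P: "frame A P" and Q: "frame B Q"
    and gP: "\<And>p. p \<in> P \<Longrightarrow> g p \<in> commutant B Q"
    and r: "\<And>p. p \<in> P \<Longrightarrow> r p \<in> P" 
    and u: "\<And>p. p \<in> P \<Longrightarrow> u p \<in> carrier A"
      "\<And>p. p \<in> P \<Longrightarrow> smul A (u p) (sadj A (u p)) = r p" "\<And>p. p \<in> P \<Longrightarrow> smul A (sadj A (u p)) (u p) = p"
    and one_dim: "\<And>p q x. \<lbrakk>p \<in> P; q \<in> P; x \<in> carrier A; r p = r q\<rbrakk> \<Longrightarrow>
      \<exists>c. smul A (smul A p x) q = sscale A c (smul A (sadj A (u p)) (u q))"
    and off: "\<And>p q x. \<lbrakk>p \<in> P; q \<in> P; x \<in> carrier A; r p \<noteq> r q\<rbrakk> \<Longrightarrow> smul A (smul A p x) q = szero A"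
  defines "G \<equiv> \<lambda>q. gsum B (\<lambda>p. smul B (smul B (sadj B (g (u p))) q) (g (u p))) P"
  shows "q \<in> Q \<Longrightarrow> projection B (G q)"
    "\<lbrakk>q \<in> Q; q' \<in> Q; q \<noteq> q'\<rbrakk> \<Longrightarrow> smul B (G q) (G q') = szero B"
    "\<lbrakk>q \<in> Q; x \<in> carrier A\<rbrakk> \<Longrightarrow> smul B (G q) (g x) = smul B (g x) (G q)"
    "x \<in> carrier A \<Longrightarrow> gsum B (\<lambda>q. smul B (G q) (g x)) Q = g x"
    "\<lbrakk>q \<in> Q; atomic A e\<rbrakk> \<Longrightarrow> atomic B (smul B (G q) (g e))"
proof -
  interpret A: fd_star A by fact
  interpret B: fd_star B by fact
  note FP = A.frame_facts[OF P] and FQ = B.frame_facts[OF Q]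
  note gz = star_hom_zero[OF g A.star_algebra_axioms B.star_algebra_axioms]
  note hom = star_homD(3,5)[OF g, symmetric]
  have gc: "x \<in> carrier A \<Longrightarrow> g x \<in> carrier B" for x by (rule star_homD(1)[OF g])
  have ru: "smul A (r p) (u p) = u p" "smul A (u p) p = u p" "smul A p (sadj A (u p)) = sadj A (u p)" if "p \<in> P" for p
    using A.partial_isometry_absorb(2)[of "sadj A (u p)" "r p"] A.partial_isometry_absorb(1,2)[of "u p" p]
      u that FP(4)[OF r[OF that]] FP(4)[OF that] by simp_all
  \<comment> \<open>Images of the partial isometries: \<open>w p\<close> leads from
    \<open>g p\<close> to \<open>g (r p)\<close>.\<close>
  define w where "w p = g (u p)" for p
  have wc: "w p \<in> carrier B" if "p \<in> P" for p using gc u(1) that by (simp add: w_def)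
  have ww: "smul B (w p) (sadj B (w p)) = g (r p)" "smul B (sadj B (w p)) (w p) = g p"
    "smul B (g (r p)) (w p) = w p" "smul B (w p) (g p) = w p" if p: "p \<in> P" for p
    using u(1)[OF p] FP(2)[OF p] FP(2)[OF r[OF p]] by (simp_all add: w_def hom u[OF p] ru[OF p])
  have wg: "smul B (w p) (g p') = szero B" if p: "p \<in> P" "p' \<in> P" "p \<noteq> p'" for p p'
  proof -
    have c: "p \<in> carrier A" "p' \<in> carrier A" "u p \<in> carrier A" using FP(2) u p by auto
    have "smul A (u p) p' = smul A (smul A (u p) p) p'" using ru p by simp
    also have "\<dots> = szero A" using c FP(6)[OF p] by (simp add: A.mul_assoc)
    finally show ?thesis using c by (simp add: w_def hom gz)
  qed
  have www: "smul B (w p) (sadj B (w p')) = szero B" if p: "p \<in> P" "p' \<in> P" "p \<noteq> p'" for p p'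
  proof -
    have c: "w p \<in> carrier B" "w p' \<in> carrier B" "g p' \<in> carrier B" using wc gc FP(2) p by auto
    have "sadj B (w p') = smul B (g p') (sadj B (w p'))"
      using u(1)[OF p(2)] FP(2)[OF p(2)] by (simp add: w_def hom ru[OF p(2)])
    then have "smul B (w p) (sadj B (w p')) = smul B (smul B (w p) (g p')) (sadj B (w p'))"
      using c by (simp add: B.mul_assoc)
    then show ?thesis using wg[OF p] c by simp
  qed
  have comm: "smul B (g p) q = smul B q (g p)" if "p \<in> P" "q \<in> Q" for p q
    using gP[OF that(1)] that(2) by (simp add: commutant_def)
  \<comment> \<open>The part of \<open>G q\<close> below \<open>g p\<close>: the piece of
    \<open>q\<close> under \<open>g (r p)\<close>, transported back to \<open>g p\<close>.
    Orthogonality of these pieces rests on \<open>g (r p)\<close> commuting with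
    \<open>q\<close>.\<close>
  define T where "T p q = smul B (smul B (sadj B (w p)) q) (w p)" for p q
  have G: "G q = gsum B (\<lambda>p. T p q) P" for q by (simp add: G_def T_def w_def)
  have Tc: "T p q \<in> carrier B" if "p \<in> P" "q \<in> Q" for p q using wc FQ(2) that by (simp add: T_def)
  have Gc: "G q \<in> carrier B" if "q \<in> Q" for q unfolding G using Tc that by auto
  have Tadj: "sadj B (T p q) = T p q" if p: "p \<in> P" "q \<in> Q" for p q
    using wc[OF p(1)] FQ(2)[OF p(2)] B.projD(3)[OF FQ(4)[OF p(2)]] by (simp add: T_def B.adj_mul B.mul_assoc)
  have TT: "smul B (T p q) (T p' q') = (if p = p' \<and> q = q' then T p q else szero B)"
    if p: "p \<in> P" "p' \<in> P" and q: "q \<in> Q" "q' \<in> Q" for p p' q q'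
  proof -
    have c: "w p \<in> carrier B" "w p' \<in> carrier B" "q \<in> carrier B" "q' \<in> carrier B" "g (r p) \<in> carrier B"
      using wc p FQ(2) q gc FP(2) r by auto
    have 1: "smul B (T p q) (T p' q')
        = smul B (smul B (sadj B (w p)) q) (smul B (smul B (w p) (sadj B (w p'))) (smul B q' (w p')))"
      using c by (simp add: T_def B.mul_assoc)
    show ?thesis
    proof (cases "p = p'")
      case False
      then show ?thesis using 1 www[OF p False] c by simp
    next
      case True
      have "smul B (smul B (sadj B (w p)) q) (smul B (g (r p)) (smul B q' (w p)))
          = smul B (sadj B (w p)) (smul B (smul B q (g (r p))) (smul B q' (w p)))"
        using c by (simp add: B.mul_assoc)
      also have "smul B q (g (r p)) = smul B (g (r p)) q" using comm[OF r[OF p(1)] q(1)] by simp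
      also have "smul B (smul B (g (r p)) q) (smul B q' (w p)) = smul B (g (r p)) (smul B (smul B q q') (w p))"
        using c by (simp add: B.mul_assoc)
      finally have 2: "smul B (T p q) (T p' q') = smul B (sadj B (w p)) (smul B (g (r p)) (smul B (smul B q q') (w p)))"
        using 1 True ww(1)[OF p(1)] by simp
      show ?thesis
      proof (cases "q = q'")
        case False
        then show ?thesis using 2 FQ(6)[OF q False] c by simp
      next
        case eq: True
        have "smul B (g (r p)) (smul B q (w p)) = smul B q (smul B (g (r p)) (w p))"
          using c comm[OF r[OF p(1)] q(1)] by (simp add: B.mul_assoc[symmetric])
        then have "smul B (T p q) (T p' q') = smul B (sadj B (w p)) (smul B q (w p))"
          using 2 eq B.projD(2)[OF FQ(4)[OF q(1)]] ww(3)[OF p(1)] by simp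
        then show ?thesis using True eq c by (simp add: T_def B.mul_assoc)
      qed
    qed
  qed
  have GG: "smul B (G q) (G q') = (if q = q' then G q else szero B)" if q: "q \<in> Q" "q' \<in> Q" for q q'
  proof -
    have "smul B (G q) (G q') = gsum B (\<lambda>p. smul B (T p q) (G q')) P"
      unfolding G[of q] using FP(1) Tc[OF _ q(1)] Gc[OF q(2)] by (intro B.gsum_mul_right) auto
    also have "\<dots> = gsum B (\<lambda>p. if q = q' then T p q else szero B) P"
    proof (rule B.gsum_cong[OF refl])
      fix p assume p: "p \<in> P"
      have "smul B (T p q) (G q') = gsum B (\<lambda>p'. smul B (T p q) (T p' q')) P"
        unfolding G[of q'] using FP(1) Tc[OF p q(1)] Tc[OF _ q(2)] by (intro B.gsum_mul_left) auto
      also have "\<dots> = smul B (T p q) (T p q')"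
        by (rule B.gsum_single[OF FP(1) p]) (use Tc TT p q in auto)
      finally show "smul B (T p q) (G q') = (if q = q' then T p q else szero B)" using TT p q by simp
      show "(if q = q' then T p q else szero B) \<in> carrier B" using Tc p q by simp
    qed
    also have "\<dots> = (if q = q' then G q else szero B)" by (simp add: G)
    finally show ?thesis .
  qed
  show proj: "projection B (G q)" if q: "q \<in> Q" for q
  proof -
    have "sadj B (G q) = gsum B (\<lambda>p. sadj B (T p q)) P"
      unfolding G using FP(1) Tc q by (intro B.gsum_adj) auto
    also have "\<dots> = G q" unfolding G using Tadj Tc q by (intro B.gsum_cong) auto
    finally show ?thesis using GG[OF q q] Gc[OF q] by (simp add: projection_def)
  qed
  show "smul B (G q) (G q') = szero B" if "q \<in> Q" "q' \<in> Q" "q \<noteq> q'" for q q'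
    using GG that by simp
  have Tg: "smul B (T p q) (g p') = (if p = p' then T p q else szero B)"
    if p: "p \<in> P" "p' \<in> P" and q: "q \<in> Q" for p p' q
  proof -
    have c: "w p \<in> carrier B" "q \<in> carrier B" "g p' \<in> carrier B" using wc p FQ(2) q gc FP(2) by auto
    have "smul B (T p q) (g p') = smul B (smul B (sadj B (w p)) q) (smul B (w p) (g p'))"
      using c by (simp add: T_def B.mul_assoc)
    then show ?thesis using wg[OF p] ww(4)[OF p(1)] c by (cases "p = p'") (simp_all add: T_def)
  qed
  have Gg: "smul B (G q) (g p) = T p q" if p: "p \<in> P" and q: "q \<in> Q" for p q
  proof -
    have "smul B (G q) (g p) = gsum B (\<lambda>p'. smul B (T p' q) (g p)) P"
      unfolding G using FP(1,2) Tc[OF _ q] gc p by (intro B.gsum_mul_right) auto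
    also have "\<dots> = smul B (T p q) (g p)"
      by (rule B.gsum_single[OF FP(1) p]) (use Tc Tg p q gc FP(2) in auto)
    finally show ?thesis using Tg[OF p p q] by simp
  qed
  have gG: "smul B (g p) (G q) = T p q" if p: "p \<in> P" and q: "q \<in> Q" for p q
  proof -
    have "smul B (g p) (G q) = sadj B (smul B (G q) (g p))"
      using B.adj_mul[of "G q" "g p"] Gc[OF q] gc[OF FP(2)[OF p]] B.projD(3)[OF proj[OF q]]
        B.projD(3)[OF star_hom_projection[OF g FP(4)[OF p]]] by simp
    then show ?thesis using Gg[OF p q] Tadj[OF p q] by simp
  qed
  show commG: "smul B (G q) (g x) = smul B (g x) (G q)" if q: "q \<in> Q" and x: "x \<in> carrier A" for q x
  proof -
    have corner: "smul B (G q) (g (smul A (smul A p x) p')) = smul B (g (smul A (smul A p x) p')) (G q)"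
      if p: "p \<in> P" "p' \<in> P" for p p'
    proof (cases "r p = r p'")
      case False
      then show ?thesis using off[OF p x False] gz Gc[OF q] by simp
    next
      case True
      obtain c where c: "smul A (smul A p x) p' = sscale A c (smul A (sadj A (u p)) (u p'))"
        using one_dim[OF p x True] by blast
      have cc: "w p \<in> carrier B" "w p' \<in> carrier B" "q \<in> carrier B" "g p \<in> carrier B" "g p' \<in> carrier B"
        "g (r p) \<in> carrier B" "G q \<in> carrier B"
        using wc p FQ(2) q gc FP(2) r Gc by auto
      \<comment> \<open>It suffices to treat images of matrix units. Both products of
        \<open>G q\<close> with \<open>?v\<close> reduce to \<open>q\<close> between the adjoint of
        \<open>w p\<close> and \<open>w p'\<close>, because \<open>r p = r p'\<close> and
        \<open>g (r p)\<close> commutes with \<open>q\<close>.\<close>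
      let ?v = "smul B (sadj B (w p)) (w p')"
      have v: "g (smul A (sadj A (u p)) (u p')) = ?v" using u(1) p by (simp add: w_def hom)
      have gv: "?v = smul B (g p) ?v"
      proof -
        have "smul B (g p) (sadj B (w p)) = sadj B (w p)"
          using u(1)[OF p(1)] FP(2)[OF p(1)] by (simp add: w_def hom ru[OF p(1)])
        then show ?thesis using cc by (simp add: B.mul_assoc[symmetric])
      qed
      have vg: "?v = smul B ?v (g p')" using ww(4)[OF p(2)] cc by (simp add: B.mul_assoc)
      have "smul B (G q) ?v = smul B (G q) (smul B (g p) ?v)" using gv by simp
      also have "\<dots> = smul B (smul B (G q) (g p)) ?v" using cc by (simp add: B.mul_assoc)
      also have "\<dots> = smul B (T p q) ?v" using Gg[OF p(1) q] by simp
      also have "\<dots> = smul B (smul B (sadj B (w p)) q) (smul B (smul B (w p) (sadj B (w p))) (w p'))"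
        using cc by (simp add: T_def B.mul_assoc)
      also have "smul B (smul B (w p) (sadj B (w p))) (w p') = w p'"
        using ww(1)[OF p(1)] ww(3)[OF p(2)] True by simp
      finally have L: "smul B (G q) ?v = smul B (smul B (sadj B (w p)) q) (w p')" .
      have "smul B ?v (G q) = smul B (smul B ?v (g p')) (G q)" using vg by simp
      also have "\<dots> = smul B ?v (smul B (g p') (G q))" using cc by (simp add: B.mul_assoc)
      also have "\<dots> = smul B ?v (T p' q)" using gG[OF p(2) q] by simp
      also have "\<dots> = smul B (sadj B (w p)) (smul B (smul B (smul B (w p') (sadj B (w p'))) q) (w p'))"
        using cc by (simp add: T_def B.mul_assoc)
      also have "smul B (smul B (w p') (sadj B (w p'))) q = smul B q (g (r p'))"
        using ww(1)[OF p(2)] comm[OF r[OF p(2)] q] by simp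
      also have "smul B (smul B q (g (r p'))) (w p') = smul B q (w p')"
        using ww(3)[OF p(2)] cc True by (simp add: B.mul_assoc)
      finally have R: "smul B ?v (G q) = smul B (smul B (sadj B (w p)) q) (w p')"
        using cc by (simp add: B.mul_assoc)
      have "g (smul A (smul A p x) p') = sscale B c ?v"
        unfolding c using star_homD(4)[OF g] u(1) p v by simp
      then show ?thesis using L R cc by (simp add: B.mul_scale_left B.mul_scale_right)
    qed
    have inA: "smul A (smul A p x) p' \<in> carrier A" if "p \<in> P" "p' \<in> P" for p p' using FP(2) x that by simp
    have exp: "g x = gsum B (\<lambda>p. gsum B (\<lambda>p'. g (smul A (smul A p x) p')) P) P"
    proof -
      have "g x = g (gsum A (\<lambda>p. gsum A (\<lambda>p'. smul A (smul A p x) p') P) P)"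
        using A.frame_both[OF P x] by simp
      also have "\<dots> = gsum B (\<lambda>p. g (gsum A (\<lambda>p'. smul A (smul A p x) p') P)) P"
        using inA by (intro star_hom_gsum[OF g A.star_algebra_axioms B.star_algebra_axioms FP(1)]) auto
      also have "\<dots> = gsum B (\<lambda>p. gsum B (\<lambda>p'. g (smul A (smul A p x) p')) P) P"
      proof (rule B.gsum_cong[OF refl])
        fix p assume p: "p \<in> P"
        show "g (gsum A (\<lambda>p'. smul A (smul A p x) p') P) = gsum B (\<lambda>p'. g (smul A (smul A p x) p')) P"
          using inA p by (intro star_hom_gsum[OF g A.star_algebra_axioms B.star_algebra_axioms FP(1)]) auto
        show "gsum B (\<lambda>p'. g (smul A (smul A p x) p')) P \<in> carrier B" using inA p gc by auto
      qed
      finally show ?thesis .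
    qed
    \<comment> \<open>Commuting with \<open>G q\<close> passes from the corners to their sum, since
      the commutant is a subalgebra.\<close>
    have "subalg B (commutant B {G q})" using Gc[OF q] by (intro B.commutant_subalg) auto
    moreover have "g (smul A (smul A p x) p') \<in> commutant B {G q}" if "p \<in> P" "p' \<in> P" for p p'
      using corner[OF that] gc[OF inA[OF that]] by (simp add: commutant_def)
    ultimately have "g x \<in> commutant B {G q}"
      unfolding exp by (intro B.subalg_gsum) auto
    then show ?thesis by (simp add: commutant_def)
  qed
  show "gsum B (\<lambda>q. smul B (G q) (g x)) Q = g x" if x: "x \<in> carrier A" for x
  proof -
    \<comment> \<open>The sum of all \<open>G q\<close> acts as a unit on the range of
      \<open>g\<close>: on \<open>g p\<close> it sums the pieces \<open>T p q\<close> over the frame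
      \<open>Q\<close>.\<close>
    define \<Gamma> where "\<Gamma> = gsum B G Q"
    have \<Gamma>c: "\<Gamma> \<in> carrier B" using Gc by (auto simp: \<Gamma>_def)
    have \<Gamma>p: "smul B \<Gamma> (g p) = g p" if p: "p \<in> P" for p
    proof -
      have c: "w p \<in> carrier B" "g p \<in> carrier B" using wc gc FP(2) p by auto
      have "smul B \<Gamma> (g p) = gsum B (\<lambda>q. smul B (G q) (g p)) Q"
        unfolding \<Gamma>_def using FQ(1) Gc c by (intro B.gsum_mul_right) auto
      also have "\<dots> = gsum B (\<lambda>q. smul B (smul B (sadj B (w p)) q) (w p)) Q"
        using Gg[OF p] Tc[OF p] by (intro B.gsum_cong) (auto simp: T_def)
      also have "\<dots> = smul B (gsum B (\<lambda>q. smul B (sadj B (w p)) q) Q) (w p)"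
        using FQ(1,2) c by (intro B.gsum_mul_right[symmetric]) auto
      also have "gsum B (\<lambda>q. smul B (sadj B (w p)) q) Q = sadj B (w p)"
        by (rule B.frame_right[OF Q, symmetric]) (use c in simp)
      finally show ?thesis using ww(2)[OF p] by simp
    qed
    have gx: "g x = gsum B (\<lambda>p. smul B (g p) (g x)) P"
    proof -
      have "g x = g (gsum A (\<lambda>p. smul A p x) P)" using A.frame_left[OF P x] by simp
      also have "\<dots> = gsum B (\<lambda>p. g (smul A p x)) P"
        using FP(2) x by (intro star_hom_gsum[OF g A.star_algebra_axioms B.star_algebra_axioms FP(1)]) auto
      also have "\<dots> = gsum B (\<lambda>p. smul B (g p) (g x)) P"
        using FP(2) x gc by (intro B.gsum_cong) (auto simp: hom)
      finally show ?thesis .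
    qed
    have "smul B \<Gamma> (g x) = gsum B (\<lambda>p. smul B \<Gamma> (smul B (g p) (g x))) P"
      by (subst gx) (use FP(1,2) gc x \<Gamma>c in \<open>auto intro!: B.gsum_mul_left\<close>)
    also have "\<dots> = gsum B (\<lambda>p. smul B (g p) (g x)) P"
      using FP(2) gc x \<Gamma>c \<Gamma>p by (intro B.gsum_cong) (auto simp: B.mul_assoc[symmetric])
    also have "\<dots> = g x" using gx by simp
    finally have "smul B \<Gamma> (g x) = g x" .
    moreover have "smul B \<Gamma> (g x) = gsum B (\<lambda>q. smul B (G q) (g x)) Q"
      unfolding \<Gamma>_def using FQ(1) Gc gc x by (intro B.gsum_mul_right) auto
    ultimately show ?thesis by simp
  qed
  have atT: "atomic B (T p q)" if p: "p \<in> P" and q: "q \<in> Q" for p q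
  proof -
    have c: "w p \<in> carrier B" "q \<in> carrier B" "g (r p) \<in> carrier B" using wc p FQ(2) q gc FP(2) r by auto
    note qq = B.projD[OF FQ(4)[OF q]] and rr = B.projD[OF star_hom_projection[OF g FP(4)[OF r[OF p]]]]
    \<comment> \<open>With this \<open>y\<close>, the product \<open>y y^*\<close> is
      \<open>T p q\<close>, while \<open>y^* y\<close> is \<open>q g(r p) q\<close>, a multiple
      \<open>m q\<close>. Commuting projections force \<open>m\<close> to be 0 or 1, so
      \<open>y^* y\<close> is an atom or zero and atomicity is transferred.\<close>
    let ?y = "smul B (sadj B (w p)) q"
    have ya: "sadj B ?y = smul B q (w p)" using c qq by (simp add: B.adj_mul)
    have y1: "smul B (sadj B ?y) ?y = smul B (smul B q (g (r p))) q"
    proof -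
      have "smul B (sadj B ?y) ?y = smul B (smul B q (smul B (w p) (sadj B (w p)))) q"
        unfolding ya using c by (simp add: B.mul_assoc)
      then show ?thesis using ww(1)[OF p] by simp
    qed
    obtain m where m: "smul B (smul B q (g (r p))) q = sscale B m q"
      using B.atomicD(2)[OF FQ(3)[OF q] c(3)] by blast
    have "smul B (smul B q (g (r p))) q = smul B q (g (r p))"
      using comm[OF r[OF p] q, symmetric] c qq by (simp add: B.mul_assoc)
    then have qg: "smul B q (g (r p)) = sscale B m q" using m by simp
    have "smul B (smul B q (g (r p))) (g (r p)) = smul B q (g (r p))"
      using c rr by (simp add: B.mul_assoc)
    then have "sscale B (m * m) q = sscale B m q"
      unfolding qg using c qg by (simp add: B.mul_scale_left B.scale_scale)
    then have "m * m = m" using B.scale_left_inject[OF c(2) FQ(5)[OF q]] by blast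
    then have "m = 0 \<or> m = 1" by auto
    then have "atomic B (sscale B m q)"
      using FQ(3)[OF q] c by auto
    then have "atomic B (smul B ?y (sadj B ?y))"
      using y1 m c by (intro B.atomic_transfer) auto
    moreover have "smul B ?y (sadj B ?y) = smul B (smul B (sadj B (w p)) (smul B q q)) (w p)"
      unfolding ya using c by (simp add: B.mul_assoc)
    ultimately show ?thesis using qq(2) by (simp add: T_def)
  qed
  show "atomic B (smul B (G q) (g e))" if q: "q \<in> Q" and e: "atomic A e" for q e
  proof (cases "e = szero A")
    case True
    then show ?thesis using gz Gc[OF q] by simp
  next
    case False
    \<comment> \<open>A general atom is equivalent to a frame member \<open>p\<close>; multiplying
      the image of the equivalence by \<open>G q\<close> relates the cut of \<open>g e\<close> to
      the atom \<open>T p q\<close>.\<close>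
    then obtain p v where p: "p \<in> P" and v: "v \<in> carrier A" "smul A v (sadj A v) = e" "smul A (sadj A v) v = p"
      using A.atomic_equivalent_frame[OF P e] by blast
    have c: "g v \<in> carrier B" "G q \<in> carrier B" using gc v Gc q by auto
    note GP = B.projD[OF proj[OF q]]
    let ?y = "smul B (G q) (g v)"
    have ya: "sadj B ?y = smul B (sadj B (g v)) (G q)" using c GP by (simp add: B.adj_mul)
    have "smul B (sadj B ?y) ?y = smul B (sadj B (g v)) (smul B (smul B (G q) (G q)) (g v))"
      unfolding ya using c by (simp add: B.mul_assoc)
    also have "\<dots> = smul B (sadj B (g v)) (smul B (g v) (G q))"
      using GP(2) commG[OF q v(1)] by simp
    also have "\<dots> = smul B (smul B (sadj B (g v)) (g v)) (G q)" using c by (simp add: B.mul_assoc)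
    also have "smul B (sadj B (g v)) (g v) = g p" using v(1) by (simp add: hom v(3))
    also have "smul B (g p) (G q) = T p q" by (rule gG[OF p q])
    finally have "atomic B (smul B ?y (sadj B ?y))" using atT[OF p q] c by (intro B.atomic_transfer) auto
    moreover have "smul B ?y (sadj B ?y) = smul B (smul B (G q) (smul B (g v) (sadj B (g v)))) (G q)"
      unfolding ya using c by (simp add: B.mul_assoc)
    moreover have "smul B (g v) (sadj B (g v)) = g e" using v by (simp add: hom)
    moreover have "smul B (smul B (G q) (g e)) (G q) = smul B (G q) (g e)"
    proof -
      have ec: "g e \<in> carrier B" using e gc by (simp add: atomic_def projection_def)
      have "smul B (smul B (G q) (g e)) (G q) = smul B (smul B (g e) (G q)) (G q)"
        using commG[OF q] e by (simp add: atomic_def projection_def)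
      also have "\<dots> = smul B (g e) (G q)" using B.proj_absorb(2)[OF proj[OF q] ec] .
      finally show ?thesis using commG[OF q] e by (simp add: atomic_def projection_def)
    qed
    ultimately show ?thesis by simp
  qed
qed

text \<open>Cutting \<open>g\<close> by the projections \<open>G q\<close> gives maps of
  multiplicity one that may leave the digraph algebra of \<open>B\<close>. Composed with the
  summands of \<open>\<theta>\<close> they take values in that of \<open>C\<close>, because the
  images of the \<open>G q\<close> under \<open>\<theta>\<close> lie there.\<close>

lemma regular_ext_of_split:
  assumes A: "digraph_algebra A" and B: "digraph_algebra B" and C: "digraph_algebra C"
    and g: "star_hom (cstar A) (cstar B) g" "\<And>a. a \<in> elems A \<Longrightarrow> g a \<in> elems B"
    and \<theta>: "regular_ext B C \<theta>" and Q: "finite Q"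
    and G: "\<And>q. q \<in> Q \<Longrightarrow> projection (cstar B) (G q)"
      "\<And>q q'. \<lbrakk>q \<in> Q; q' \<in> Q; q \<noteq> q'\<rbrakk> \<Longrightarrow> smul (cstar B) (G q) (G q') = szero (cstar B)"
      "\<And>q x. \<lbrakk>q \<in> Q; x \<in> carrier (cstar A)\<rbrakk> \<Longrightarrow> smul (cstar B) (G q) (g x) = smul (cstar B) (g x) (G q)"
      "\<And>x. x \<in> carrier (cstar A) \<Longrightarrow> gsum (cstar B) (\<lambda>q. smul (cstar B) (G q) (g x)) Q = g x"
      "\<And>q e. \<lbrakk>q \<in> Q; atomic (cstar A) e\<rbrakk> \<Longrightarrow> atomic (cstar B) (smul (cstar B) (G q) (g e))"
    and \<theta>G: "\<And>q. q \<in> Q \<Longrightarrow> \<theta> (G q) \<in> elems C"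
  shows "regular_ext A C (\<lambda>x. \<theta> (g x))"
proof -
  interpret A: star_algebra "cstar A" using A by (rule digraph_star_algebra)
  interpret B: star_algebra "cstar B" using B by (rule digraph_star_algebra)
  interpret C: star_algebra "cstar C" using C by (rule digraph_star_algebra)
  obtain s :: nat and k where d: "decomposes B C \<theta> k {..<s}" using \<theta> by (auto simp: regular_ext_def)
  note D = decomposesD[OF B C d]
  have gc: "x \<in> carrier (cstar A) \<Longrightarrow> g x \<in> carrier (cstar B)" for x by (rule star_homD(1)[OF g(1)])
  note Gp = B.projD[OF G(1)]
  define f where "f q x = smul (cstar B) (G q) (g x)" for q x
  have fc: "f q x \<in> carrier (cstar B)" if "q \<in> Q" "x \<in> carrier (cstar A)" for q x
    using Gp(1) gc that by (simp add: f_def)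
  have ff: "smul (cstar B) (f q x) (f q' y) = smul (cstar B) (smul (cstar B) (G q) (G q')) (smul (cstar B) (g x) (g y))"
    if q: "q \<in> Q" "q' \<in> Q" and x: "x \<in> carrier (cstar A)" "y \<in> carrier (cstar A)" for q q' x y
  proof -
    have "smul (cstar B) (f q x) (f q' y)
        = smul (cstar B) (G q) (smul (cstar B) (smul (cstar B) (g x) (G q')) (g y))"
      using Gp(1) q gc x by (simp add: f_def B.mul_assoc)
    then show ?thesis unfolding G(3)[OF q(2) x(1), symmetric] using Gp(1) q gc x by (simp add: B.mul_assoc)
  qed
  have fh: "star_hom (cstar A) (cstar B) (f q)" if q: "q \<in> Q" for q
    unfolding star_hom_def
  proof (intro conjI ballI allI)
    show "f q \<in> carrier (cstar A) \<rightarrow> carrier (cstar B)" using fc q by auto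
  next
    fix x y assume x: "x \<in> carrier (cstar A)" and y: "y \<in> carrier (cstar A)"
    show "f q (sadd (cstar A) x y) = sadd (cstar B) (f q x) (f q y)"
      using x y gc Gp(1)[OF q] by (simp add: f_def star_homD[OF g(1)] B.mul_add_right)
    show "f q (smul (cstar A) x y) = smul (cstar B) (f q x) (f q y)"
      unfolding ff[OF q q x y] Gp(2)[OF q] using x y by (simp add: f_def star_homD[OF g(1)])
  next
    fix x c assume x: "x \<in> carrier (cstar A)"
    show "f q (sscale (cstar A) c x) = sscale (cstar B) c (f q x)"
      using x gc Gp(1)[OF q] by (simp add: f_def star_homD[OF g(1)] B.mul_scale_right)
  next
    fix x assume x: "x \<in> carrier (cstar A)"
    show "f q (sadj (cstar A) x) = sadj (cstar B) (f q x)"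
      using x gc Gp[OF q] G(3)[OF q A.adj_closed[OF x]] by (simp add: f_def star_homD[OF g(1)] B.adj_mul)
  qed
  have eB: "is_unit_of (cstar B) (carrier (cstar B)) (unit_of (ambient B) (elems B))" "unit_of (ambient B) (elems B) \<in> elems B"
    using digraph_algebra_facts(4,5)[OF B] .
  define e where "e = unit_of (ambient B) (elems B)"
  have e: "e \<in> carrier (cstar B)" "\<And>x. x \<in> carrier (cstar B) \<Longrightarrow> smul (cstar B) e x = x" "e \<in> elems B"
    using eB by (auto simp: is_unit_of_def e_def)
  have "decomposes A C (\<lambda>x. \<theta> (g x)) (\<lambda>(n, q) x. k n (f q x)) ({..<s} \<times> Q)"
    unfolding decomposes_def
  proof (intro conjI ballI impI)
    show "finite ({..<s} \<times> Q)" using Q by simp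
  next
    fix i assume "i \<in> {..<s} \<times> Q"
    then obtain n q where i: "i = (n, q)" "n \<in> {..<s}" "q \<in> Q" by auto
    have "k n (f q a) \<in> elems C" if a: "a \<in> elems A" for a
    proof -
      have ac: "a \<in> carrier (cstar A)" by (rule digraph_elems_carrier[OF A a])
      \<comment> \<open>The unit \<open>e\<close> isolates the summand: \<open>k n e\<close> lies in
        the digraph algebra and selects the part \<open>k n\<close> of the product of
        \<open>\<theta> (G q)\<close> and \<open>\<theta> (g a)\<close>, both of which lie in
        it.\<close>
      have "k n (f q a) = smul (cstar C) (k n e) (\<theta> (f q a))"
        using D(8)[OF i(2) e(1) fc[OF i(3) ac]] e(2)[OF fc[OF i(3) ac]] by simp
      also have "\<theta> (f q a) = smul (cstar C) (\<theta> (G q)) (\<theta> (g a))"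
        unfolding f_def by (rule star_homD(3)[OF D(10) Gp(1)[OF i(3)] gc[OF ac]])
      finally show ?thesis
        using D(3)[OF i(2) e(3)] \<theta>G[OF i(3)] D(11)[OF g(2)[OF a]] digraph_algebra_facts(2)[OF C]
        by (simp add: subalg_def)
    qed
    then show "mult_one_hom A C (case i of (n, q) \<Rightarrow> \<lambda>x. k n (f q x))"
      unfolding mult_one_hom_def i(1) prod.case
      using star_hom_comp[OF fh[OF i(3)] D(2)[OF i(2)]] D(4)[OF i(2)] G(5)[OF i(3)] by (auto simp: f_def)
  next
    fix i j x y assume "i \<in> {..<s} \<times> Q" "j \<in> {..<s} \<times> Q" and ne: "i \<noteq> j"
      and x: "x \<in> carrier (cstar A)" and y: "y \<in> carrier (cstar A)"
    then obtain n q n' q' where i: "i = (n, q)" "n \<in> {..<s}" "q \<in> Q"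
      and j: "j = (n', q')" "n' \<in> {..<s}" "q' \<in> Q" by auto
    have "smul (cstar C) (k n (f q x)) (k n' (f q' y)) = szero (cstar C)"
    proof (cases "n = n'")
      case True
      then have "q \<noteq> q'" using ne i j by auto
      then have "smul (cstar B) (f q x) (f q' y) = szero (cstar B)"
        unfolding ff[OF i(3) j(3) x y] using G(2)[OF i(3) j(3)] gc x y by simp
      then show ?thesis
        using True star_homD(3)[OF D(2)[OF i(2)] fc[OF i(3) x] fc[OF j(3) y]]
          star_hom_zero[OF D(2)[OF i(2)] B.star_algebra_axioms C.star_algebra_axioms] by simp
    qed (rule D(6)[OF i(2) j(2) _ fc[OF i(3) x] fc[OF j(3) y]])
    then show "smul (cstar C) ((case i of (n, q) \<Rightarrow> \<lambda>x. k n (f q x)) x) ((case j of (n, q) \<Rightarrow> \<lambda>x. k n (f q x)) y) = szero (cstar C)"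
      by (simp add: i j)
  next
    fix x assume x: "x \<in> carrier (cstar A)"
    have "\<theta> (g x) = gsum (cstar C) (\<lambda>n. k n (g x)) {..<s}" by (rule D(7)[OF gc[OF x]])
    also have "\<dots> = gsum (cstar C) (\<lambda>n. gsum (cstar C) (\<lambda>q. k n (f q x)) Q) {..<s}"
    proof (rule C.gsum_cong[OF refl])
      fix n assume n: "n \<in> {..<s}"
      have "k n (g x) = k n (gsum (cstar B) (\<lambda>q. f q x) Q)" using G(4)[OF x] by (simp add: f_def)
      also have "\<dots> = gsum (cstar C) (\<lambda>q. k n (f q x)) Q"
        by (rule star_hom_gsum[OF D(2)[OF n] B.star_algebra_axioms C.star_algebra_axioms Q fc[OF _ x]])
      finally show "k n (g x) = gsum (cstar C) (\<lambda>q. k n (f q x)) Q" .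
      show "gsum (cstar C) (\<lambda>q. k n (f q x)) Q \<in> carrier (cstar C)"
        using D(5)[OF n fc[OF _ x]] by auto
    qed
    also have "\<dots> = gsum (cstar C) (\<lambda>(n, q). k n (f q x)) ({..<s} \<times> Q)"
      using Q D(5) fc x by (intro C.gsum_Sigma) auto
    finally show "\<theta> (g x) = gsum (cstar C) (\<lambda>i. (case i of (n, q) \<Rightarrow> \<lambda>x. k n (f q x)) x) ({..<s} \<times> Q)"
      by (simp add: case_prod_beta')
  qed
  then show ?thesis by (rule regular_extI[OF C])
qed


section \<open>Approximately inner automorphisms of limits\<close>

text \<open>\<open>x\<close> is quasi-unitary when \<open>u = 1 + x\<close> is unitary, and \<open>perturb E x a\<close> is \<open>u\<^sup>\<star> a u\<close>. In
  this form no unit is needed, so that unital and nonunital limits are treated alike.\<close>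

definition quasi_unitary :: "'a star_alg \<Rightarrow> 'a \<Rightarrow> bool" where
  "quasi_unitary E x \<longleftrightarrow> x \<in> carrier E
     \<and> sadd E (smul E (sadj E x) x) (sadd E x (sadj E x)) = szero E
     \<and> sadd E (smul E x (sadj E x)) (sadd E x (sadj E x)) = szero E"

definition perturb :: "'a star_alg \<Rightarrow> 'a \<Rightarrow> 'a \<Rightarrow> 'a" where
  "perturb E x a = sadd E (sadd E a (smul E (sadj E x) a))
     (sadd E (smul E a x) (smul E (smul E (sadj E x) a) x))"

lemma star_hom_quasi_unitary:
  assumes "star_hom E E' f" "star_algebra E" "star_algebra E'" "quasi_unitary E x"
  shows "quasi_unitary E' (f x)"
proof -
  interpret star_algebra E by fact
  have x: "x \<in> carrier E" using assms(4) by (simp add: quasi_unitary_def)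
  show ?thesis
    using assms(4) x star_hom_zero[OF assms(1-3)]
    by (simp add: quasi_unitary_def star_homD(1)[OF assms(1)] flip: star_homD(2,3,5)[OF assms(1)])
qed

lemma star_hom_perturb:
  assumes "star_hom E E' f" "star_algebra E" "x \<in> carrier E" "a \<in> carrier E"
  shows "f (perturb E x a) = perturb E' (f x) (f a)"
proof -
  interpret star_algebra E by fact
  show ?thesis using assms(3,4) by (simp add: perturb_def star_homD[OF assms(1)])
qed

context star_algebra
begin

lemma perturb_closed: "\<lbrakk>x \<in> carrier E; a \<in> carrier E\<rbrakk> \<Longrightarrow> perturb E x a \<in> carrier E"
  by (simp add: perturb_def)

lemma perturb_linear:
  assumes "x \<in> carrier E" "a \<in> carrier E" "b \<in> carrier E"
  shows "perturb E x (a \<boxplus> b) = perturb E x a \<boxplus> perturb E x b"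
    "perturb E x (c \<cdot> a) = c \<cdot> perturb E x a"
    "perturb E x (szero E) = szero E"
  using assms by (simp_all add: perturb_def mul_add_left mul_add_right mul_scale_left mul_scale_right
      scale_add_right add_ac)

lemma unit_adj:
  assumes "is_unit_of E (carrier E) e"
  shows "e \<in> carrier E" "e\<^sup>\<star> = e" "x \<in> carrier E \<Longrightarrow> e \<boxtimes> x = x" "x \<in> carrier E \<Longrightarrow> x \<boxtimes> e = x"
proof -
  show e: "e \<in> carrier E" "\<And>x. x \<in> carrier E \<Longrightarrow> e \<boxtimes> x = x" "\<And>x. x \<in> carrier E \<Longrightarrow> x \<boxtimes> e = x"
    using assms by (auto simp: is_unit_of_def)
  show "e\<^sup>\<star> = e" using e(2)[of "e\<^sup>\<star>"] adj_mul[of e "e\<^sup>\<star>"] e(1) by simp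
qed

text \<open>A stage always has a unit \<open>e\<close>, even if the limit has none; there the
  quasi-unitary \<open>x\<close> becomes the genuine unitary \<open>e + x\<close>.\<close>

lemma perturb_unitary:
  assumes e: "is_unit_of E (carrier E) e" and x: "quasi_unitary E x"
  shows "(e \<boxplus> x)\<^sup>\<star> \<boxtimes> (e \<boxplus> x) = e" "(e \<boxplus> x) \<boxtimes> (e \<boxplus> x)\<^sup>\<star> = e"
    "a \<in> carrier E \<Longrightarrow> (e \<boxplus> x)\<^sup>\<star> \<boxtimes> a \<boxtimes> (e \<boxplus> x) = perturb E x a"
proof -
  note u = unit_adj[OF e]
  have xc: "x \<in> carrier E" and x1: "x\<^sup>\<star> \<boxtimes> x \<boxplus> (x \<boxplus> x\<^sup>\<star>) = szero E"
    and x2: "x \<boxtimes> x\<^sup>\<star> \<boxplus> (x \<boxplus> x\<^sup>\<star>) = szero E"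
    using x by (auto simp: quasi_unitary_def)
  have V: "(e \<boxplus> x)\<^sup>\<star> = e \<boxplus> x\<^sup>\<star>" using u(1,2) xc by (simp add: adj_add)
  have "(e \<boxplus> x\<^sup>\<star>) \<boxtimes> (e \<boxplus> x) = e \<boxplus> (x\<^sup>\<star> \<boxtimes> x \<boxplus> (x \<boxplus> x\<^sup>\<star>))"
    using u(1,3,4) xc by (simp add: mul_add_left mul_add_right add_ac)
  then show "(e \<boxplus> x)\<^sup>\<star> \<boxtimes> (e \<boxplus> x) = e" using V x1 u(1) by simp
  have "(e \<boxplus> x) \<boxtimes> (e \<boxplus> x\<^sup>\<star>) = e \<boxplus> (x \<boxtimes> x\<^sup>\<star> \<boxplus> (x \<boxplus> x\<^sup>\<star>))"
    using u(1,3,4) xc by (simp add: mul_add_left mul_add_right add_ac)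
  then show "(e \<boxplus> x) \<boxtimes> (e \<boxplus> x)\<^sup>\<star> = e" using V x2 u(1) by simp
  show "(e \<boxplus> x)\<^sup>\<star> \<boxtimes> a \<boxtimes> (e \<boxplus> x) = perturb E x a" if a: "a \<in> carrier E"
    unfolding V using u(1,3,4) xc a by (simp add: perturb_def mul_add_left mul_add_right add_ac)
qed

lemma gsum_in_subspace:
  assumes "szero E \<in> T" "\<And>x y. \<lbrakk>x \<in> T; y \<in> T\<rbrakk> \<Longrightarrow> x \<boxplus> y \<in> T"
    and "finite I" "\<And>i. i \<in> I \<Longrightarrow> f i \<in> T" "\<And>i. i \<in> I \<Longrightarrow> f i \<in> carrier E"
  shows "gsum E f I \<in> T"
  using assms(3-5) by (induction I rule: finite_induct) (auto simp: assms(1,2))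

end

text \<open>In a unital limit, \<open>x\<close> is the unitary minus the unit. Otherwise the unitary
  is \<open>y + c 1\<close> with \<open>c\<close> of modulus one; multiplying it by
  \<open>cnj c\<close> does not change the conjugation and makes the scalar part 1.\<close>

lemma (in limit_cone) approximately_inner_perturb:
  assumes \<gamma>: "approximately_inner L \<gamma>" and S: "finite S" "S \<subseteq> elems L"
  shows "\<exists>x\<in>elems L. sadj (ambient L) x \<in> elems L \<and> quasi_unitary (ambient L) x
     \<and> (\<forall>a\<in>S. \<gamma> a = perturb (ambient L) x a)"
proof -
  note sub = limit_elems[unfolded subalg_def]
  have elc: "x \<in> carrier (ambient L)" if "x \<in> elems L" for x using sub that by blast
  note mul = L.mul_add_left L.mul_add_right L.mul_scale_left L.mul_scale_right
  show ?thesis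
  proof (cases "unital L")
    case True
    then obtain e where e: "is_unit_of (ambient L) (elems L) e" by (auto simp: unital_def)
    then have eL: "e \<in> elems L" and e1: "\<And>x. x \<in> elems L \<Longrightarrow> L.mul_op e x = x \<and> L.mul_op x e = x"
      by (auto simp: is_unit_of_def)
    have ec: "e \<in> carrier (ambient L)" by (rule elc[OF eL])
    \<comment> \<open>The unit is one for \<open>elems L\<close> only, which need not be
      self-adjoint. Multiplying it by the image of the self-adjoint unit \<open>o1\<close> of a
      stage that represents it shows that the two coincide.\<close>
    have eadj: "L.adj_op e = e"
    proof -
      obtain k e' where e': "e' \<in> elems (A k)" "e = i k e'" using eL i_elems by blast
      define o1 where "o1 = unit_of (ambient (A k)) (elems (A k))"
      have o1: "is_unit_of (EE k) (carrier (EE k)) o1" "o1 \<in> elems (A k)"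
        using digraph_algebra_facts(4,5)[OF dig, of k] by (simp_all add: o1_def)
      interpret E: star_algebra "EE k" by (rule sa)
      note o = E.unit_adj[OF o1(1)]
      have "e = i k (E.mul_op e' o1)" using e' o(4)[OF elems_closed[OF e'(1)]] by simp
      also have "\<dots> = L.mul_op e (i k o1)"
        using e' o(1) elems_closed by (simp add: star_homD(3)[OF i_hom])
      also have "\<dots> = i k o1" using e1[of "i k o1"] o1(2) i_elems by blast
      finally have "e = i k o1" .
      then show ?thesis using o(1,2) by (simp flip: star_homD(5)[OF i_hom])
    qed
    have "unit_of (ambient L) (elems L) = e" by (rule L.unit_of_eq[OF e])
    then obtain u where u: "u \<in> elems L" "L.adj_op u \<in> elems L" "L.mul_op (L.adj_op u) u = e" "L.mul_op u (L.adj_op u) = e"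
      and \<gamma>u: "\<And>a. a \<in> S \<Longrightarrow> \<gamma> a = L.mul_op (L.mul_op (L.adj_op u) a) u"
      using \<gamma> S True unfolding approximately_inner_def unitaries_def Let_def by auto
    have uc: "u \<in> carrier (ambient L)" by (rule elc[OF u(1)])
    have eu: "L.mul_op e u = u" "L.mul_op u e = u" "L.mul_op e (L.adj_op u) = L.adj_op u"
      "L.mul_op (L.adj_op u) e = L.adj_op u" "L.mul_op e e = e" using e1 u eL by auto
    define x where "x = L.diff_op u e"
    have xc: "x \<in> carrier (ambient L)" using uc ec by (simp add: x_def)
    have xa: "L.adj_op x = L.diff_op (L.adj_op u) e" using uc ec eadj by (simp add: x_def L.adj_add L.adj_scale)
    have xL: "x \<in> elems L" "L.adj_op x \<in> elems L" unfolding xa using u eL sub by (auto simp: x_def)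
    \<comment> \<open>Expanding \<open>(v - e) (w - e) + (v - e) + (w - e)\<close> leaves
      \<open>v w - e\<close>. Applied in both orders, this gives the two equations of a
      quasi-unitary.\<close>
    have gen: "L.add_op (L.mul_op (L.diff_op v e) (L.diff_op w e)) (L.add_op (L.diff_op v e) (L.diff_op w e)) = szero (ambient L)"
      if c: "v \<in> carrier (ambient L)" "w \<in> carrier (ambient L)" and vw: "L.mul_op v w = e"
        "L.mul_op e w = w" "L.mul_op v e = v" for v w
    proof -
      let ?p = "L.diff_op v e" and ?q = "L.diff_op w e"
      have "L.mul_op ?p ?q = L.diff_op (L.mul_op ?p w) (L.mul_op ?p e)"
        using c ec by (simp add: mul)
      also have "L.mul_op ?p w = L.diff_op e w" using c ec vw by (simp add: mul)
      also have "L.mul_op ?p e = ?p" using c ec vw eu by (simp add: mul)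
      also have "L.diff_op e w = L.scale_op (-1) ?q"
        using c ec by (simp add: L.scale_add_right L.scale_scale L.add_comm)
      finally have "L.add_op (L.mul_op ?p ?q) (L.add_op ?p ?q)
          = L.add_op (L.diff_op ?q ?q) (L.diff_op ?p ?p)"
        using c ec by (simp only: L.add_ac L.closed)
      then show ?thesis using c ec by simp
    qed
    have q1: "L.add_op (L.mul_op (L.adj_op x) x) (L.add_op x (L.adj_op x)) = szero (ambient L)"
      using gen[of "L.adj_op u" u] uc ec u(3) eu xc by (simp add: xa x_def[symmetric] L.add_comm[of "L.diff_op (L.adj_op u) e"])
    have q2: "L.add_op (L.mul_op x (L.adj_op x)) (L.add_op x (L.adj_op x)) = szero (ambient L)"
      using gen[of u "L.adj_op u"] uc u(4) eu by (simp add: xa x_def[symmetric])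
    have "\<gamma> a = perturb (ambient L) x a" if a: "a \<in> S" for a
    proof -
      have aL: "a \<in> elems L" and ac: "a \<in> carrier (ambient L)" using S a elc by auto
      have ux: "u = L.add_op x e" using uc ec by (simp add: x_def L.add_assoc L.add_comm[of "L.scale_op (-1) e"])
      have uxa: "L.adj_op u = L.add_op (L.adj_op x) e" using xc ec eadj by (simp add: ux L.adj_add)
      let ?w = "L.mul_op (L.adj_op u) a"
      have w: "?w = L.add_op a (L.mul_op (L.adj_op x) a)"
        unfolding uxa using xc ec ac e1[OF aL] by (simp add: mul L.add_comm)
      have wL: "?w \<in> elems L" using u(2) aL sub by blast
      have "L.mul_op ?w u = L.add_op (L.mul_op ?w x) (L.mul_op ?w e)"
        by (subst ux) (use elc[OF wL] xc ec in \<open>simp add: mul\<close>)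
      also have "L.mul_op ?w e = ?w" using e1[OF wL] by simp
      finally have "L.mul_op ?w u = L.add_op (L.mul_op ?w x) ?w" .
      then have "L.mul_op ?w u = L.add_op (L.mul_op (L.add_op a (L.mul_op (L.adj_op x) a)) x) (L.add_op a (L.mul_op (L.adj_op x) a))"
        unfolding w .
      also have "\<dots> = perturb (ambient L) x a"
        unfolding perturb_def using xc ac by (simp add: L.mul_add_left L.add_ac)
      finally show ?thesis using \<gamma>u[OF a] by simp
    qed
    then show ?thesis using xL q1 q2 xc by (intro bexI[of _ x]) (auto simp: quasi_unitary_def)
  next
    case False
    have unit: "is_unit_of (unitise (ambient L)) (elems L \<times> UNIV) (szero (ambient L), 1)"
      unfolding is_unit_of_def using sub elc by (auto simp: unitise_def)
    have "e = (szero (ambient L), 1)" if "is_unit_of (unitise (ambient L)) (elems L \<times> UNIV) e" for e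
      using that unit unfolding is_unit_of_def by metis
    then have un: "unit_of (unitise (ambient L)) (elems L \<times> UNIV) = (szero (ambient L), 1)"
      unfolding unit_of_def using unit by blast
    obtain u where "u \<in> unitaries (unitisation L)"
      and \<gamma>u: "\<And>a. a \<in> S \<Longrightarrow> (\<gamma> a, 0) = smul (unitise (ambient L)) (smul (unitise (ambient L))
          (sadj (unitise (ambient L)) u) (a, 0)) u"
      using \<gamma> S False unfolding approximately_inner_def Let_def by auto
    then have u: "u \<in> elems L \<times> UNIV" "sadj (unitise (ambient L)) u \<in> elems L \<times> UNIV"
      "smul (unitise (ambient L)) (sadj (unitise (ambient L)) u) u = (szero (ambient L), 1)"
      "smul (unitise (ambient L)) u (sadj (unitise (ambient L)) u) = (szero (ambient L), 1)"
      by (auto simp: unitaries_def Let_def unitisation_def un)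
    obtain y c where yc: "u = (y, c)" by (cases u)
    have y: "y \<in> elems L" "L.adj_op y \<in> elems L" using u yc by (auto simp: unitise_def)
    have yC: "y \<in> carrier (ambient L)" by (rule elc[OF y(1)])
    have c1: "cnj c * c = 1" "c * cnj c = 1"
      and y1: "L.add_op (L.mul_op (L.adj_op y) y) (L.add_op (L.scale_op (cnj c) y) (L.scale_op c (L.adj_op y))) = szero (ambient L)"
      and y2: "L.add_op (L.mul_op y (L.adj_op y)) (L.add_op (L.scale_op c (L.adj_op y)) (L.scale_op (cnj c) y)) = szero (ambient L)"
      using u(3,4) by (auto simp: yc unitise_def)
    \<comment> \<open>The phase \<open>c\<close> is divided out; its inverse is
      \<open>cnj c\<close>.\<close>
    define x where "x = L.scale_op (cnj c) y"
    have xc: "x \<in> carrier (ambient L)" using yC by (simp add: x_def)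
    have xa: "L.adj_op x = L.scale_op c (L.adj_op y)" using yC by (simp add: x_def L.adj_scale)
    have xL: "x \<in> elems L" "L.adj_op x \<in> elems L" unfolding xa using y sub by (auto simp: x_def)
    have "L.mul_op (L.adj_op x) x = L.mul_op (L.adj_op y) y" "L.mul_op x (L.adj_op x) = L.mul_op y (L.adj_op y)"
      unfolding xa using yC c1 by (simp_all add: x_def mul L.scale_scale)
    then have q: "quasi_unitary (ambient L) x"
      using y1 y2 yC xc by (simp add: quasi_unitary_def xa) (simp add: x_def L.add_comm)
    have "\<gamma> a = perturb (ambient L) x a" if a: "a \<in> S" for a
    proof -
      have ac: "a \<in> carrier (ambient L)" using S a elc by auto
      let ?w = "L.add_op (L.mul_op (L.adj_op y) a) (L.scale_op (cnj c) a)"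
      have "\<gamma> a = L.add_op (L.mul_op ?w y) (L.scale_op c ?w)"
        using \<gamma>u[OF a] ac yC by (simp add: yc unitise_def)
      also have "L.scale_op c ?w = L.add_op a (L.mul_op (L.adj_op x) a)"
        unfolding xa using ac yC c1 by (simp add: L.scale_add_right L.scale_scale L.mul_scale_left L.add_comm)
      also have "L.mul_op ?w y = L.add_op (L.mul_op a x) (L.mul_op (L.mul_op (L.adj_op x) a) x)"
        unfolding xa using ac yC c1 by (simp add: x_def mul L.scale_scale L.add_comm)
      finally show ?thesis unfolding perturb_def using ac xc by (simp add: L.add_comm)
    qed
    then show ?thesis using xL q by blast
  qed
qed

text \<open>Each corner \<open>p A q\<close> is at most one-dimensional, so one nonzero element from
  every nonzero corner spans \<open>A\<close>. Spanning is phrased through additive sets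
  \<open>T\<close>, to be used as an induction principle for linear identities.\<close>

lemma (in fd_star) frame_spanning_set:
  assumes P: "P \<subseteq> A" "frame E P" and A: "subalg E A"
  shows "\<exists>S. finite S \<and> S \<subseteq> A \<and> (\<forall>T. S \<subseteq> T \<longrightarrow> szero E \<in> T \<longrightarrow>
    (\<forall>x\<in>T. \<forall>y\<in>T. x \<boxplus> y \<in> T) \<longrightarrow> (\<forall>c. \<forall>x\<in>T. c \<cdot> x \<in> T) \<longrightarrow> A \<subseteq> T)"
proof -
  note F = frame_facts[OF P(2)] and sub = A[unfolded subalg_def]
  have Ac: "a \<in> carrier E" if "a \<in> A" for a using sub that by blast
  define K where "K p q = {y \<in> A. p \<boxtimes> y = y \<and> y \<boxtimes> q = y \<and> y \<noteq> szero E}" for p q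
  define s where "s p q = (if K p q = {} then szero E else SOME y. y \<in> K p q)" for p q
  have sK: "s p q \<in> K p q" if "K p q \<noteq> {}" for p q using that by (auto simp: s_def some_in_eq)
  have "s p q \<in> A" for p q using sK[of p q] sub by (cases "K p q = {}") (auto simp: K_def s_def)
  then have "(\<lambda>(p, q). s p q) ` (P \<times> P) \<subseteq> A" by auto
  moreover have "A \<subseteq> T"
    if T: "(\<lambda>(p, q). s p q) ` (P \<times> P) \<subseteq> T" "szero E \<in> T" "\<forall>x\<in>T. \<forall>y\<in>T. x \<boxplus> y \<in> T" "\<forall>c. \<forall>x\<in>T. c \<cdot> x \<in> T" for T
  proof
    fix a assume a: "a \<in> A"
    have ac: "a \<in> carrier E" by (rule Ac[OF a])
    have part: "p \<boxtimes> a \<boxtimes> q \<in> T" if pq: "p \<in> P" "q \<in> P" for p q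
    proof (cases "p \<boxtimes> a \<boxtimes> q = szero E")
      case False
      note pp = F(4)[OF pq(1)] and qq = F(4)[OF pq(2)]
      have yA: "p \<boxtimes> a \<boxtimes> q \<in> A" using sub a P(1) pq by blast
      have y: "p \<boxtimes> a \<boxtimes> q \<in> carrier E" "p \<boxtimes> (p \<boxtimes> a \<boxtimes> q) = p \<boxtimes> a \<boxtimes> q" "p \<boxtimes> a \<boxtimes> q \<boxtimes> q = p \<boxtimes> a \<boxtimes> q"
        using F(2)[OF pq(1)] F(2)[OF pq(2)] ac
        by (simp_all add: mul_assoc proj_absorb[OF pp] projD[OF qq])
      then have "p \<boxtimes> a \<boxtimes> q \<in> K p q" using yA False by (simp add: K_def)
      then have "s p q \<in> K p q" using sK by blast
      then have sp: "s p q \<in> carrier E" "p \<boxtimes> s p q = s p q" "s p q \<boxtimes> q = s p q" "s p q \<noteq> szero E"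
        using Ac by (auto simp: K_def)
      obtain c where c: "(c \<cdot> s p q) \<boxtimes> (c \<cdot> s p q)\<^sup>\<star> = p" "(c \<cdot> s p q)\<^sup>\<star> \<boxtimes> (c \<cdot> s p q) = q"
        using atomic_equivalence[OF F(3)[OF pq(1)] F(5)[OF pq(1)] F(3)[OF pq(2)] F(5)[OF pq(2)] sp] by blast
      obtain d where "p \<boxtimes> a \<boxtimes> q = d \<cdot> (c \<cdot> s p q)"
        using corner_one_dim[OF _ c F(3)[OF pq(1)] qq y] sp(1) by blast
      moreover have "s p q \<in> T" using T(1) pq by auto
      ultimately show ?thesis using T(4) by simp
    qed (use T in simp)
    have inner: "gsum E (\<lambda>q. p \<boxtimes> a \<boxtimes> q) P \<in> T" "gsum E (\<lambda>q. p \<boxtimes> a \<boxtimes> q) P \<in> carrier E" if p: "p \<in> P" for p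
      using part p F(1,2) ac T by (auto intro!: gsum_in_subspace)
    have "gsum E (\<lambda>p. gsum E (\<lambda>q. p \<boxtimes> a \<boxtimes> q) P) P \<in> T"
      by (rule gsum_in_subspace) (use inner F(1) T in auto)
    then show "a \<in> T" using frame_both[OF P(2) ac] by simp
  qed
  ultimately show ?thesis using F(1) by (intro exI[of _ "(\<lambda>(p, q). s p q) ` (P \<times> P)"]) auto
qed

lemma digraph_spanning_set:
  assumes A: "digraph_algebra A"
  shows "\<exists>S. finite S \<and> S \<subseteq> elems A \<and> (\<forall>T. S \<subseteq> T \<longrightarrow> szero (cstar A) \<in> T \<longrightarrow>
    (\<forall>x\<in>T. \<forall>y\<in>T. sadd (cstar A) x y \<in> T) \<longrightarrow> (\<forall>c. \<forall>x\<in>T. sscale (cstar A) c x \<in> T) \<longrightarrow> elems A \<subseteq> T)"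
proof -
  obtain P where P: "P \<subseteq> elems A" "frame (cstar A) P" using digraph_algebra_facts(3)[OF A] by blast
  show ?thesis
    by (rule fd_star.frame_spanning_set[OF digraph_fd_star[OF A] P digraph_algebra_facts(2)[OF A]])
qed

lemma regular_ext_cong:
  assumes "regular_ext A B f" "\<And>x. x \<in> carrier (cstar A) \<Longrightarrow> f x = g x"
  shows "regular_ext A B g"
  using assms unfolding regular_ext_def decomposes_def by metis

lemma regular_ext_steps:
  assumes A: "\<And>k. digraph_algebra (A k)" and h: "\<And>k. regular_ext (A k) (A (Suc k)) (h k)"
  shows "regular_ext (A k) (A (k + d)) (steps h k d)"
proof (induction d)
  case 0
  show ?case using regular_ext_cong[OF regular_ext_id[OF A]] by simp
next
  case (Suc d)
  show ?case using regular_ext_cong[OF regular_ext_comp[OF A A A Suc h]] by simp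
qed

lemma finite_eventually:
  assumes "finite P" "\<And>p. p \<in> P \<Longrightarrow> \<exists>d0. \<forall>d\<ge>d0. R p (d::nat)"
  shows "\<exists>d0. \<forall>d\<ge>d0. \<forall>p\<in>P. R p d"
  using eventually_ball_finite[OF assms(1), of "\<lambda>d p. R p d" sequentially] assms(2)
  by (simp add: eventually_sequentially)

text \<open>Let \<open>C\<close>, \<open>D\<close> be the limits of diagonals \<open>P k\<close>, \<open>Q k\<close>, and let \<open>f\<close> extend an approximately
  inner automorphism with \<open>f ` C = D\<close>. On the stage \<open>A j\<close> it has the form \<open>u\<^sup>\<star> a u\<close>. At a late
  stage \<open>t\<close>, \<open>g = V\<^sup>\<star> \<alpha> V\<close> represents \<open>f\<close>, so the splitting projections of \<open>g\<close> along \<open>Q t\<close> lie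
  in \<open>D\<close> and hence in the algebra of some still later stage.\<close>

lemma eventually_regular:
  assumes a: "limit_cone A h L i" and b: "limit_cone B k L \<kappa>"
    and \<alpha>: "\<And>j. star_hom (cstar (A j)) (cstar (B j)) (\<alpha> j)"
      "\<And>j a. a \<in> elems (A j) \<Longrightarrow> \<alpha> j a \<in> elems (B j)"
    and compat: "\<And>j x. x \<in> carrier (cstar (A j)) \<Longrightarrow> \<kappa> j (\<alpha> j x) = i j x"
    and h: "\<And>j. regular_ext (A j) (A (Suc j)) (h j)"
    and k: "\<And>j. regular_ext (B j) (B (Suc j)) (k j)"
    and conj: "\<And>C D. \<lbrakk>regular_masa L C; regular_masa L D\<rbrakk>
      \<Longrightarrow> \<exists>\<gamma>. automorphism L \<gamma> \<and> approximately_inner L \<gamma> \<and> \<gamma> ` C = D"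
  shows "\<exists>r>j. regular_ext (A j) (B r) (\<lambda>x. steps k j (r - j) (\<alpha> j x))"
proof -
  interpret a: limit_cone A h L i by fact
  interpret b: limit_cone B k L \<kappa> by fact
  obtain P where "\<forall>k. (frame (cstar (A k)) (P k) \<and> P k \<subseteq> elems (A k)) \<and>
    h k ` commutant (cstar (A k)) (P k) \<subseteq> commutant (cstar (A (Suc k))) (P (Suc k)) \<and>
    h k ` normalizing (cstar (A k)) (P k) \<subseteq> normalizing (cstar (A (Suc k))) (P (Suc k))"
    using a.frames_exist[OF h] by blast
  then have P: "\<And>k. frame (cstar (A k)) (P k)" "\<And>k. P k \<subseteq> elems (A k)"
    "\<And>k. h k ` commutant (cstar (A k)) (P k) \<subseteq> commutant (cstar (A (Suc k))) (P (Suc k))"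
    "\<And>k. h k ` normalizing (cstar (A k)) (P k) \<subseteq> normalizing (cstar (A (Suc k))) (P (Suc k))"
    by auto
  obtain Q where "\<forall>l. (frame (cstar (B l)) (Q l) \<and> Q l \<subseteq> elems (B l)) \<and>
    k l ` commutant (cstar (B l)) (Q l) \<subseteq> commutant (cstar (B (Suc l))) (Q (Suc l)) \<and>
    k l ` normalizing (cstar (B l)) (Q l) \<subseteq> normalizing (cstar (B (Suc l))) (Q (Suc l))"
    using b.frames_exist[OF k] by blast
  then have Q: "\<And>l. frame (cstar (B l)) (Q l)" "\<And>l. Q l \<subseteq> elems (B l)"
    "\<And>l. k l ` commutant (cstar (B l)) (Q l) \<subseteq> commutant (cstar (B (Suc l))) (Q (Suc l))"
    "\<And>l. k l ` normalizing (cstar (B l)) (Q l) \<subseteq> normalizing (cstar (B (Suc l))) (Q (Suc l))"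
    by auto
  define C where "C = a.limit_diag P"
  define D where "D = b.limit_diag Q"
  have DL: "D \<subseteq> elems L" unfolding D_def by (rule b.limit_diag_elems[OF Q])
  have CL: "C \<subseteq> elems L" unfolding C_def by (rule a.limit_diag_elems[OF P])
  obtain \<gamma> where \<gamma>: "automorphism L \<gamma>" "approximately_inner L \<gamma>" "\<gamma> ` C = D"
    using conj[OF a.limit_regular_masa[OF P] b.limit_regular_masa[OF Q]] by (auto simp: C_def D_def)
  obtain f where f: "star_hom (ambient L) (ambient L) f" "\<And>x. x \<in> elems L \<Longrightarrow> \<gamma> x = f x"
    using \<gamma>(1) unfolding automorphism_def star_iso_def a.cstar_limit by blast
  have "f ` C = \<gamma> ` C" using f(2) CL by (intro image_cong) auto
  then have fC: "f ` C = D" using \<gamma>(3) by simp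
  \<comment> \<open>Being approximately inner is exploited for this finite set only; linearity
    extends the conclusion to the whole stage.\<close>
  obtain S where S: "finite S" "S \<subseteq> elems (A j)"
    and span: "\<And>T. \<lbrakk>S \<subseteq> T; szero (cstar (A j)) \<in> T; \<forall>x\<in>T. \<forall>y\<in>T. sadd (cstar (A j)) x y \<in> T;
      \<forall>c. \<forall>x\<in>T. sscale (cstar (A j)) c x \<in> T\<rbrakk> \<Longrightarrow> elems (A j) \<subseteq> T"
    using digraph_spanning_set[OF a.dig[of j]] by blast
  have "finite (i j ` S)" "i j ` S \<subseteq> elems L" using S a.i_elems by auto
  then obtain x where x: "x \<in> elems L" "sadj (ambient L) x \<in> elems L" "quasi_unitary (ambient L) x"
    and \<gamma>x: "\<And>s. s \<in> S \<Longrightarrow> \<gamma> (i j s) = perturb (ambient L) x (i j s)"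
    using a.approximately_inner_perturb[OF \<gamma>(2)] by (metis imageI)
  obtain n1 n2 where n1: "\<And>l. l \<ge> n1 \<Longrightarrow> \<exists>y\<in>elems (B l). \<kappa> l y = x"
    and n2: "\<And>l. l \<ge> n2 \<Longrightarrow> \<exists>y\<in>elems (B l). \<kappa> l y = sadj (ambient L) x"
    using b.rep_elems[OF x(1)] b.rep_elems[OF x(2)] by blast
  \<comment> \<open>Late enough that both \<open>x\<close> and its adjoint have representatives in
    the digraph algebra. The representative \<open>y2\<close> of the adjoint need not be the adjoint
    of \<open>y1\<close> yet.\<close>
  define m where "m = n1 + n2"
  define l where "l = j + m"
  obtain y1 y2 where y1: "y1 \<in> elems (B l)" "\<kappa> l y1 = x" and y2: "y2 \<in> elems (B l)" "\<kappa> l y2 = sadj (ambient L) x"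
    using n1[of l] n2[of l] by (auto simp: l_def m_def)
  interpret Bl: star_algebra "cstar (B l)" by (rule b.sa)
  interpret Aj: fd_star "cstar (A j)" by (rule digraph_fd_star[OF a.dig])
  have y1c: "y1 \<in> carrier (cstar (B l))" and y2c: "y2 \<in> carrier (cstar (B l))"
    using y1 y2 b.elems_closed by auto
  define \<alpha>' where "\<alpha>' = (\<lambda>z. steps k j m (\<alpha> j z))"
  have \<alpha>'h: "star_hom (cstar (A j)) (cstar (B l)) \<alpha>'"
    unfolding \<alpha>'_def l_def by (rule star_hom_comp[OF \<alpha>(1) b.steps_hom])
  have \<alpha>'e: "z \<in> elems (A j) \<Longrightarrow> \<alpha>' z \<in> elems (B l)" for z
    unfolding \<alpha>'_def l_def by (intro b.steps_elems \<alpha>(2))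
  have \<alpha>'c: "z \<in> carrier (cstar (A j)) \<Longrightarrow> \<alpha>' z \<in> carrier (cstar (B l))" for z by (rule star_homD(1)[OF \<alpha>'h])
  have \<kappa>\<alpha>': "\<kappa> l (\<alpha>' z) = i j z" if z: "z \<in> carrier (cstar (A j))" for z
    unfolding \<alpha>'_def l_def using b.i_steps[OF star_homD(1)[OF \<alpha>(1) z]] compat[OF z] by simp
  define w where "w z = perturb (cstar (B l)) y1 (\<alpha>' z)" for z
  have wc: "w z \<in> carrier (cstar (B l))" if "z \<in> carrier (cstar (A j))" for z
    unfolding w_def by (rule Bl.perturb_closed[OF y1c \<alpha>'c[OF that]])
  have \<kappa>w: "\<kappa> l (w z) = perturb (ambient L) x (i j z)" if z: "z \<in> carrier (cstar (A j))" for z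
    unfolding w_def using star_hom_perturb[OF b.i_hom b.sa y1c \<alpha>'c[OF z]] y1 \<kappa>\<alpha>'[OF z] by simp
  have fw: "f (i j z) = \<kappa> l (w z)" if z: "z \<in> elems (A j)" for z
  proof -
    \<comment> \<open>Both sides are linear in \<open>z\<close>, so agreement on the spanning set
      \<open>S\<close> gives agreement on the stage.\<close>
    define T where "T = {z \<in> carrier (cstar (A j)). f (i j z) = \<kappa> l (w z)}"
    have "S \<subseteq> T"
    proof
      fix s assume s: "s \<in> S"
      have sc: "s \<in> carrier (cstar (A j))" using s S a.elems_closed by blast
      have "i j s \<in> elems L" using s S a.i_elems by blast
      then show "s \<in> T" using \<gamma>x[OF s] f(2) \<kappa>w[OF sc] sc by (simp add: T_def)
    qed
    moreover have "szero (cstar (A j)) \<in> T"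
      using Bl.perturb_linear(3)[OF y1c y1c y1c] star_hom_zero[OF \<alpha>'h a.sa b.sa]
        star_hom_zero[OF f(1) a.limit_star_algebra a.limit_star_algebra]
      by (simp add: T_def w_def a.i_zero b.i_zero)
    moreover have "\<forall>z\<in>T. \<forall>z'\<in>T. sadd (cstar (A j)) z z' \<in> T"
      using wc \<alpha>'c a.i_closed
      by (auto simp: T_def star_homD(2)[OF a.i_hom] star_homD(2)[OF f(1)] star_homD(2)[OF \<alpha>'h]
          w_def Bl.perturb_linear[OF y1c] star_homD(2)[OF b.i_hom])
    moreover have "\<forall>c. \<forall>z\<in>T. sscale (cstar (A j)) c z \<in> T"
      using wc \<alpha>'c a.i_closed
      by (auto simp: T_def star_homD(4)[OF a.i_hom] star_homD(4)[OF f(1)] star_homD(4)[OF \<alpha>'h]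
          w_def Bl.perturb_linear(2)[OF y1c _ y1c] star_homD(4)[OF b.i_hom])
    ultimately have "elems (A j) \<subseteq> T" by (rule span)
    then show ?thesis using z by (auto simp: T_def)
  qed
  have ev_adj: "\<exists>d0. \<forall>d\<ge>d0. steps k l d (sadj (cstar (B l)) y1) = steps k l d y2"
    using y1 y2 y1c y2c by (intro b.eventually_eq) (auto simp: star_homD(5)[OF b.i_hom])
  have ev0: "\<exists>d0. \<forall>d\<ge>d0. steps k l d z = szero (cstar (B (l + d)))"
    if z: "z \<in> carrier (cstar (B l))" "\<kappa> l z = szero (ambient L)" for z
    using b.eventually_eq[of z l "szero (cstar (B l))"] z b.i_zero b.steps_zero by simp
  \<comment> \<open>The defects of \<open>y1\<close> from being quasi-unitary. They vanish in the
    limit, hence from some stage on.\<close>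
  define z1 where "z1 = Bl.add_op (Bl.mul_op (Bl.adj_op y1) y1) (Bl.add_op y1 (Bl.adj_op y1))"
  define z2 where "z2 = Bl.add_op (Bl.mul_op y1 (Bl.adj_op y1)) (Bl.add_op y1 (Bl.adj_op y1))"
  have z12c: "z1 \<in> carrier (cstar (B l))" "z2 \<in> carrier (cstar (B l))" using y1c by (simp_all add: z1_def z2_def)
  have "\<kappa> l z1 = szero (ambient L)" "\<kappa> l z2 = szero (ambient L)"
    using x(3) y1c y1(2) by (simp_all add: z1_def z2_def star_homD[OF b.i_hom] quasi_unitary_def)
  note ev1 = ev0[OF z12c(1) this(1)] and ev2 = ev0[OF z12c(2) this(2)]
  have PC: "i j p \<in> C" if "p \<in> P j" for p
    using fd_star.commutant_frame(3)[OF digraph_fd_star[OF a.dig] P(1)] that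
    unfolding C_def a.limit_diag_def[OF P] by blast
  have ev3: "\<exists>d0. \<forall>d\<ge>d0. \<forall>p\<in>P j. steps k l d (w p) \<in> commutant (cstar (B (l + d))) (Q (l + d))"
  proof (rule finite_eventually)
    show "finite (P j)" by (rule Aj.frame_facts(1)[OF P(1)])
    fix p assume p: "p \<in> P j"
    have "\<kappa> l (w p) \<in> D" using fw[of p] p P(2) PC[OF p] fC by (metis imageI subsetD)
    then show "\<exists>d0. \<forall>d\<ge>d0. steps k l d (w p) \<in> commutant (cstar (B (l + d))) (Q (l + d))"
      unfolding D_def using wc Aj.frame_facts(2)[OF P(1) p] by (intro b.limit_diag_in[OF Q]) auto
  qed
  obtain d1 d2 d3 d4 where
    d1: "\<And>d. d \<ge> d1 \<Longrightarrow> steps k l d (sadj (cstar (B l)) y1) = steps k l d y2"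
    and d2: "\<And>d. d \<ge> d2 \<Longrightarrow> steps k l d z1 = szero (cstar (B (l + d)))"
    and d3: "\<And>d. d \<ge> d3 \<Longrightarrow> steps k l d z2 = szero (cstar (B (l + d)))"
    and d4: "\<And>d. d \<ge> d4 \<Longrightarrow> \<forall>p\<in>P j. steps k l d (w p) \<in> commutant (cstar (B (l + d))) (Q (l + d))"
    using ev_adj ev1 ev2 ev3 by metis
  \<comment> \<open>Beyond all four thresholds: the adjoint of \<open>y1\<close> lies in the digraph
    algebra, both defects are zero, and the images of the frame \<open>P j\<close> are
    diagonal.\<close>
  define d where "d = d1 + d2 + d3 + d4"
  define t where "t = l + d"
  interpret Bt: fd_star "cstar (B t)" by (rule digraph_fd_star[OF b.dig])
  define \<tau> where "\<tau> = steps k l d"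
  have \<tau>h: "star_hom (cstar (B l)) (cstar (B t)) \<tau>" unfolding \<tau>_def t_def by (rule b.steps_hom)
  have \<tau>e: "z \<in> elems (B l) \<Longrightarrow> \<tau> z \<in> elems (B t)" for z unfolding \<tau>_def t_def by (rule b.steps_elems)
  define y where "y = \<tau> y1"
  have yc: "y \<in> carrier (cstar (B t))" unfolding y_def by (rule star_homD(1)[OF \<tau>h y1c])
  have yadj: "Bt.adj_op y = \<tau> y2"
    unfolding y_def star_homD(5)[OF \<tau>h y1c, symmetric] unfolding \<tau>_def by (rule d1) (simp add: d_def)
  have ye: "y \<in> elems (B t)" "Bt.adj_op y \<in> elems (B t)"
    unfolding yadj using \<tau>e y1(1) y2(1) by (auto simp: y_def)
  have "\<tau> z1 = szero (cstar (B t))" "\<tau> z2 = szero (cstar (B t))"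
    unfolding \<tau>_def t_def by (rule d2, simp add: d_def, rule d3, simp add: d_def)
  then have yq: "quasi_unitary (cstar (B t)) y"
    using yc y1c by (simp add: quasi_unitary_def z1_def z2_def star_homD[OF \<tau>h] y_def)
  define f' where "f' z = \<tau> (\<alpha>' z)" for z
  have f'h: "star_hom (cstar (A j)) (cstar (B t)) f'" unfolding f'_def by (rule star_hom_comp[OF \<alpha>'h \<tau>h])
  have f'e: "z \<in> elems (A j) \<Longrightarrow> f' z \<in> elems (B t)" for z unfolding f'_def by (intro \<tau>e \<alpha>'e)
  define e where "e = unit_of (ambient (B t)) (elems (B t))"
  have e: "is_unit_of (cstar (B t)) (carrier (cstar (B t))) e" "e \<in> elems (B t)"
    using digraph_algebra_facts(4,5)[OF b.dig] by (simp_all add: e_def)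
  define V where "V = Bt.add_op e y"
  note V = Bt.perturb_unitary[OF e(1) yq, folded V_def]
  note eu = Bt.unit_adj[OF e(1)]
  have Vc: "V \<in> carrier (cstar (B t))" using eu yc by (simp add: V_def)
  have "Bt.adj_op V = Bt.add_op e (Bt.adj_op y)" using eu yc by (simp add: V_def Bt.adj_add)
  then have Ve: "V \<in> elems (B t)" "Bt.adj_op V \<in> elems (B t)"
    using e(2) ye digraph_algebra_facts(2)[OF b.dig, of t] by (auto simp: V_def subalg_def)
  \<comment> \<open>Conjugation by the adjoint of \<open>V\<close>, written with a double adjoint to
    fit \<open>regular_ext_conj\<close>.\<close>
  define c where "c z = Bt.mul_op (Bt.mul_op (Bt.adj_op V) z) (Bt.adj_op (Bt.adj_op V))" for z
  have "regular_ext (B t) (B t) c"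
    unfolding c_def by (rule regular_ext_conj[OF b.dig Ve(2) _ e(1)]) (use Ve V Vc in auto)
  note ch = regular_ext_hom[OF b.dig b.dig this]
  define g where "g z = c (f' z)" for z
  have gh: "star_hom (cstar (A j)) (cstar (B t)) g" unfolding g_def by (rule star_hom_comp[OF f'h ch(1)])
  have ge: "z \<in> elems (A j) \<Longrightarrow> g z \<in> elems (B t)" for z unfolding g_def by (intro ch(2) f'e)
  have gp: "g z = perturb (cstar (B t)) y (f' z)" if "z \<in> carrier (cstar (A j))" for z
    unfolding g_def c_def using V(3)[OF star_homD(1)[OF f'h that]] Vc by simp
  have g\<tau>: "g z = \<tau> (w z)" if z: "z \<in> carrier (cstar (A j))" for z
    unfolding gp[OF z] w_def f'_def y_def by (rule star_hom_perturb[OF \<tau>h b.sa y1c \<alpha>'c[OF z], symmetric])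
  \<comment> \<open>The earlier identity holds on the digraph algebra only. Since \<open>g\<close>
    is a star-homomorphism, uniqueness extends it to the generated C*-algebra, where the partial
    isometries \<open>u p\<close> live.\<close>
  have \<kappa>g: "\<kappa> t (g z) = f (i j z)" if z: "z \<in> carrier (cstar (A j))" for z
  proof (rule star_hom_unique[OF a.dig star_hom_comp[OF gh b.i_hom] star_hom_comp[OF a.i_hom f(1)] _ z])
    fix s assume s: "s \<in> elems (A j)"
    then have sc: "s \<in> carrier (cstar (A j))" by (rule a.elems_closed)
    show "\<kappa> t (g s) = f (i j s)"
      unfolding g\<tau>[OF sc] fw[OF s] \<tau>_def t_def by (rule b.i_steps[OF wc[OF sc]])
  qed
  have gP: "g p \<in> commutant (cstar (B t)) (Q t)" if p: "p \<in> P j" for p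
    unfolding g\<tau>[OF Aj.frame_facts(2)[OF P(1) p]] \<tau>_def t_def using d4[of d] p by (simp add: d_def)
  obtain r u where r: "\<And>p. p \<in> P j \<Longrightarrow> r p \<in> P j"
    and u: "\<And>p. p \<in> P j \<Longrightarrow> u p \<in> carrier (cstar (A j))"
      "\<And>p. p \<in> P j \<Longrightarrow> Aj.mul_op (u p) (Aj.adj_op (u p)) = r p"
      "\<And>p. p \<in> P j \<Longrightarrow> Aj.mul_op (Aj.adj_op (u p)) (u p) = p"
    and one_dim: "\<And>p q x. \<lbrakk>p \<in> P j; q \<in> P j; x \<in> carrier (cstar (A j)); r p = r q\<rbrakk> \<Longrightarrow>
      \<exists>c. Aj.mul_op (Aj.mul_op p x) q = Aj.scale_op c (Aj.mul_op (Aj.adj_op (u p)) (u q))"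
    and off: "\<And>p q x. \<lbrakk>p \<in> P j; q \<in> P j; x \<in> carrier (cstar (A j)); r p \<noteq> r q\<rbrakk> \<Longrightarrow>
      Aj.mul_op (Aj.mul_op p x) q = szero (cstar (A j))"
    by (rule Aj.matrix_units[OF P(1)]) blast
  define G where "G q = gsum (cstar (B t)) (\<lambda>p. Bt.mul_op (Bt.mul_op (Bt.adj_op (g (u p))) q) (g (u p))) (P j)" for q
  note split_hom' = split_hom[OF Aj.fd_star_axioms Bt.fd_star_axioms gh P(1) Q(1), where r = r and u = u, folded G_def]
  have split: "projection (cstar (B t)) (G q)" if "q \<in> Q t" for q
    by (rule split_hom'(1)) (assumption | rule gP r u one_dim off that)+
  have split2: "Bt.mul_op (G q) (G q') = szero (cstar (B t))" if "q \<in> Q t" "q' \<in> Q t" "q \<noteq> q'" for q q'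
    by (rule split_hom'(2)) (assumption | rule gP r u one_dim off that)+
  have split3: "Bt.mul_op (G q) (g z) = Bt.mul_op (g z) (G q)" if "q \<in> Q t" "z \<in> carrier (cstar (A j))" for q z
    by (rule split_hom'(3)) (assumption | rule gP r u one_dim off that)+
  have split4: "gsum (cstar (B t)) (\<lambda>q. Bt.mul_op (G q) (g z)) (Q t) = g z" if "z \<in> carrier (cstar (A j))" for z
    by (rule split_hom'(4)) (assumption | rule gP r u one_dim off that)+
  have split5: "atomic (cstar (B t)) (Bt.mul_op (G q) (g p))" if "q \<in> Q t" "atomic (cstar (A j)) p" for q p
    by (rule split_hom'(5)) (assumption | rule gP r u one_dim off that)+
  have gc: "z \<in> carrier (cstar (A j)) \<Longrightarrow> g z \<in> carrier (cstar (B t))" for z by (rule star_homD(1)[OF gh])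
  have \<kappa>G: "\<kappa> t (G q) \<in> elems L" if q: "q \<in> Q t" for q
  proof -
    have qc: "q \<in> carrier (cstar (B t))" by (rule Bt.frame_facts(2)[OF Q(1) q])
    have "\<kappa> t (G q) = gsum (ambient L) (\<lambda>p. \<kappa> t (Bt.mul_op (Bt.mul_op (Bt.adj_op (g (u p))) q) (g (u p)))) (P j)"
      unfolding G_def using Aj.frame_facts(1)[OF P(1)] gc u(1) qc
      by (intro star_hom_gsum[OF b.i_hom b.sa b.limit_star_algebra]) auto
    also have "\<dots> \<in> elems L"
    proof (rule a.L.subalg_gsum[OF a.limit_elems])
      fix p assume p: "p \<in> P j"
      note up = u(1)[OF p]
      have "u p \<in> normalizing (cstar (A j)) (P j)"
      proof (rule Aj.corner_normalizing[OF P(1) r[OF p] p up])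
        have "Aj.mul_op (u p) p = u p" "Aj.mul_op (r p) (u p) = u p"
          using Aj.partial_isometry_absorb(1)[OF up u(3)[OF p] Aj.frame_facts(4)[OF P(1) p]]
            Aj.partial_isometry_absorb(2)[of "Aj.adj_op (u p)" "r p"] up u(2)[OF p]
            Aj.frame_facts(4)[OF P(1) r[OF p]] by simp_all
        then show "Aj.mul_op (Aj.mul_op (r p) (u p)) p = u p" by simp
      qed
      note norm = a.limit_normalizing(1)[OF P this, folded C_def]
      have "\<kappa> t q \<in> D"
        using Bt.commutant_frame(3)[OF Q(1)] q unfolding D_def b.limit_diag_def[OF Q] by blast
      \<comment> \<open>Pulling \<open>\<kappa> t q\<close> back through \<open>f\<close> to
        \<open>s\<close> in \<open>C\<close> exhibits the summand as the image of the conjugate of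
        \<open>s\<close> by \<open>i j (u p)\<close>. That conjugate stays in \<open>C\<close>
        because \<open>u p\<close> normalizes the diagonal, so the summand lies in
        \<open>D\<close>.\<close>
      then obtain s where s: "s \<in> C" "\<kappa> t q = f s" using fC by blast
      have sc: "s \<in> carrier (ambient L)" using s(1) CL a.limit_elems by (auto simp: subalg_def)
      have "\<kappa> t (Bt.mul_op (Bt.mul_op (Bt.adj_op (g (u p))) q) (g (u p)))
          = a.L.mul_op (a.L.mul_op (a.L.adj_op (f (i j (u p)))) (f s)) (f (i j (u p)))"
        using gc[OF up] qc by (simp add: star_homD[OF b.i_hom] \<kappa>g[OF up] s(2))
      also have "\<dots> = f (a.L.mul_op (a.L.mul_op (a.L.adj_op (i j (u p))) s) (i j (u p)))"
        using a.i_closed[OF up] sc by (simp add: star_homD[OF f(1)])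
      also have "\<dots> \<in> f ` C" using norm[OF s(1)] by (rule imageI)
      finally show "\<kappa> t (Bt.mul_op (Bt.mul_op (Bt.adj_op (g (u p))) q) (g (u p))) \<in> elems L"
        using fC DL by blast
    qed
    finally show ?thesis .
  qed
  have "\<exists>d0. \<forall>d\<ge>d0. \<forall>q\<in>Q t. steps k t d (G q) \<in> elems (B (t + d))"
  proof (rule finite_eventually)
    show "finite (Q t)" by (rule Bt.frame_facts(1)[OF Q(1)])
    fix q assume q: "q \<in> Q t"
    show "\<exists>d0. \<forall>d\<ge>d0. steps k t d (G q) \<in> elems (B (t + d))"
      using Bt.projD(1)[OF split[OF q]] \<kappa>G[OF q] b.h_elems b.elems_closed unfolding b.i_elems
      by (intro b.eventually_in[where W = "\<lambda>k. elems (B k)"]) auto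
  qed
  then obtain d0 where d0: "\<And>d. d \<ge> d0 \<Longrightarrow> \<forall>q\<in>Q t. steps k t d (G q) \<in> elems (B (t + d))" by blast
  \<comment> \<open>At least one further step makes the final stage strictly larger than
    \<open>j\<close>, as the conclusion demands.\<close>
  define d' where "d' = Suc d0"
  define t' where "t' = t + d'"
  define \<theta> where "\<theta> = steps k t d'"
  have \<theta>: "regular_ext (B t) (B t') \<theta>" unfolding \<theta>_def t'_def by (rule regular_ext_steps[where A = B and h = k, OF b.dig k])
  note \<theta>h = regular_ext_hom[OF b.dig b.dig \<theta>]
  interpret B': star_algebra "cstar (B t')" by (rule b.sa)
  have reg: "regular_ext (A j) (B t') (\<lambda>z. \<theta> (g z))"
  proof (rule regular_ext_of_split[where B = "B t" and Q = "Q t" and G = G and g = g and \<theta> = \<theta>])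
    show "\<theta> (G q) \<in> elems (B t')" if "q \<in> Q t" for q
      using d0[of d'] that by (simp add: d'_def \<theta>_def t'_def)
  qed (assumption | rule a.dig b.dig gh ge \<theta> Bt.frame_facts(1)[OF Q(1)] split split2 split3 split4 split5)+
  define y' where "y' = \<theta> y"
  have y'q: "quasi_unitary (cstar (B t')) y'"
    unfolding y'_def by (rule star_hom_quasi_unitary[OF \<theta>h(1) b.sa b.sa yq])
  have y'c: "y' \<in> carrier (cstar (B t'))" unfolding y'_def by (rule star_homD(1)[OF \<theta>h(1) yc])
  have y'e: "y' \<in> elems (B t')" "B'.adj_op y' \<in> elems (B t')"
    unfolding y'_def star_homD(5)[OF \<theta>h(1) yc, symmetric] using \<theta>h(2) ye by auto
  define e' where "e' = unit_of (ambient (B t')) (elems (B t'))"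
  have e': "is_unit_of (cstar (B t')) (carrier (cstar (B t'))) e'" "e' \<in> elems (B t')"
    using digraph_algebra_facts(4,5)[OF b.dig] by (simp_all add: e'_def)
  \<comment> \<open>The connecting map \<open>\<theta>\<close> may fail to be unital, so the unitary
    of the last stage is built from \<open>y'\<close> and the unit there, not as the image of
    \<open>V\<close>. It undoes the conjugation contained in \<open>g\<close>.\<close>
  define V' where "V' = B'.add_op e' y'"
  note V' = B'.perturb_unitary[OF e'(1) y'q, folded V'_def] and e'u = B'.unit_adj[OF e'(1)]
  have V'c: "V' \<in> carrier (cstar (B t'))" using e'u y'c by (simp add: V'_def)
  have "B'.adj_op V' = B'.add_op e' (B'.adj_op y')" using e'u y'c by (simp add: V'_def B'.adj_add)
  then have V'e: "V' \<in> elems (B t')" "B'.adj_op V' \<in> elems (B t')"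
    using e'(2) y'e digraph_algebra_facts(2)[OF b.dig, of t'] by (auto simp: V'_def subalg_def)
  have "regular_ext (A j) (B t') (\<lambda>z. B'.mul_op (B'.mul_op V' (\<theta> (g z))) (B'.adj_op V'))"
    by (rule regular_ext_comp[OF a.dig b.dig b.dig reg regular_ext_conj[OF b.dig V'e e'(1) V'(1,2)]])
  moreover have "B'.mul_op (B'.mul_op V' (\<theta> (g z))) (B'.adj_op V') = steps k j (t' - j) (\<alpha> j z)"
    if z: "z \<in> carrier (cstar (A j))" for z
  proof -
    have f'c: "f' z \<in> carrier (cstar (B t))" by (rule star_homD(1)[OF f'h z])
    let ?s = "\<theta> (f' z)"
    have sc: "?s \<in> carrier (cstar (B t'))" by (rule star_homD(1)[OF \<theta>h(1) f'c])
    have "\<theta> (g z) = B'.mul_op (B'.mul_op (B'.adj_op V') ?s) V'"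
      unfolding gp[OF z] V'(3)[OF sc] y'_def by (rule star_hom_perturb[OF \<theta>h(1) b.sa yc f'c])
    then have "B'.mul_op (B'.mul_op V' (\<theta> (g z))) (B'.adj_op V')
        = B'.mul_op (B'.mul_op (B'.mul_op V' (B'.adj_op V')) ?s) (B'.mul_op V' (B'.adj_op V'))"
      using V'c sc by (simp add: B'.mul_assoc)
    also have "\<dots> = ?s" unfolding V'(2) using e'u sc by simp
    also have "\<dots> = steps k j (m + d + d') (\<alpha> j z)"
      by (simp add: \<theta>_def f'_def \<tau>_def \<alpha>'_def t_def l_def steps_append add.assoc)
    also have "m + d + d' = t' - j" by (simp add: t'_def t_def l_def)
    finally show ?thesis .
  qed
  ultimately have "regular_ext (A j) (B t') (\<lambda>z. steps k j (t' - j) (\<alpha> j z))"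
    by (rule regular_ext_cong)
  then show ?thesis by (intro exI[of _ t']) (simp add: t'_def t_def l_def d'_def)
qed

section \<open>Functoriality\<close>

lemma direct_system_regular:
  assumes F: "regular_family F" and d: "direct_system F A \<phi>"
  shows "digraph_algebra (A k)" "regular_hom (A k) (A (Suc k)) (\<phi> k)" "star_extendible (A k) (A (Suc k)) (\<phi> k)"
    "regular_ext (A k) (A (Suc k)) (star_extension (A k) (A (Suc k)) (\<phi> k))"
    "a \<in> elems (A k) \<Longrightarrow> steps (\<lambda>k. star_extension (A k) (A (Suc k)) (\<phi> k)) k d a = steps \<phi> k d a
      \<and> steps \<phi> k d a \<in> elems (A (k + d))"
proof -
  have "(A k, \<phi> k, A (Suc k)) \<in> F" for k using d by (simp add: direct_system_def)
  then show dig: "digraph_algebra (A k)" and reg: "regular_hom (A k) (A (Suc k)) (\<phi> k)" for k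
    using F unfolding regular_family_def by fast+
  then show ext: "star_extendible (A k) (A (Suc k)) (\<phi> k)" for k by (simp add: regular_hom_def)
  show "regular_ext (A k) (A (Suc k)) (star_extension (A k) (A (Suc k)) (\<phi> k))" by (rule regular_hom_ext[OF dig dig reg])
  show "a \<in> elems (A k) \<Longrightarrow> steps (\<lambda>k. star_extension (A k) (A (Suc k)) (\<phi> k)) k d a = steps \<phi> k d a
      \<and> steps \<phi> k d a \<in> elems (A (k + d))"
    using star_extension(2,3)[OF dig ext] by (induction d) auto
qed

text \<open>Regularity of the zigzag is turned into membership by saturation: \<open>A (n k)\<close>
  is the domain of a connecting map and \<open>B (m r)\<close> the range of one. The limit of the
  first system serves as the limit of both.\<close>

lemma zigzag_in_family:
  fixes F :: "'a arrow set"
  assumes F: "regular_family F" "saturated F"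
    and conj: "\<And>A C D. \<lbrakk>A \<in> Alglim F; regular_masa A C; regular_masa A D\<rbrakk>
      \<Longrightarrow> \<exists>\<gamma>. automorphism A \<gamma> \<and> approximately_inner A \<gamma> \<and> \<gamma> ` C = D"
    and A: "direct_system F A \<phi>" and B: "direct_system F B \<theta>"
    and tw: "intertwining A \<phi> B \<theta> n m \<alpha> \<beta>"
  shows "\<exists>r\<ge>k. (A (n k), restrict (zigzag \<alpha> \<beta> k (r - k)) (elems (A (n k))), B (m r)) \<in> F"
proof -
  note dA = direct_system_regular[OF F(1) A] and dB = direct_system_regular[OF F(1) B]
  have mono: "strict_mono n" "strict_mono m"
    and \<alpha>: "\<And>k. star_extendible (A (n k)) (B (m k)) (\<alpha> k)"
    and \<beta>: "\<And>k. star_extendible (B (m k)) (A (n (Suc k))) (\<beta> k)"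
    and \<beta>\<alpha>: "\<And>k a. a \<in> elems (A (n k)) \<Longrightarrow> \<beta> k (\<alpha> k a) = system_map \<phi> (n k) (n (Suc k)) a"
    and \<alpha>\<beta>: "\<And>k b. b \<in> elems (B (m k)) \<Longrightarrow> \<alpha> (Suc k) (\<beta> k b) = system_map \<theta> (m k) (m (Suc k)) b"
    using tw by (auto simp: intertwining_def)
  define h where "h = (\<lambda>k. star_extension (A k) (A (Suc k)) (\<phi> k))"
  define h' where "h' = (\<lambda>k. star_extension (B k) (B (Suc k)) (\<theta> k))"
  define L where "L = alg_limit A \<phi>"
  interpret c: limit_cone A h L "lim_class (\<lambda>k. cstar (A k)) h"
    unfolding h_def L_def by (rule alg_limit_cone[where A = A and \<phi> = \<phi>, OF dA(1,3)])
  define a where "a = (\<lambda>k. star_extension (A (n k)) (B (m k)) (\<alpha> k))"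
  define b where "b = (\<lambda>k. star_extension (B (m k)) (A (n (Suc k))) (\<beta> k))"
  have ah: "star_hom (cstar (A (n k))) (cstar (B (m k))) (a k)"
    and ae: "x \<in> elems (A (n k)) \<Longrightarrow> a k x = \<alpha> k x" "x \<in> elems (A (n k)) \<Longrightarrow> \<alpha> k x \<in> elems (B (m k))" for k x
    unfolding a_def using star_extension[OF dA(1) \<alpha>] by blast+
  have bh: "star_hom (cstar (B (m k))) (cstar (A (n (Suc k)))) (b k)"
    and be: "x \<in> elems (B (m k)) \<Longrightarrow> b k x = \<beta> k x" "x \<in> elems (B (m k)) \<Longrightarrow> \<beta> k x \<in> elems (A (n (Suc k)))" for k x
    unfolding b_def using star_extension[OF dB(1) \<beta>] by blast+
  have ltn: "n k + (n (Suc k) - n k) = n (Suc k)" and ltm: "m k + (m (Suc k) - m k) = m (Suc k)" for k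
    using mono by (auto simp: strict_mono_Suc_iff less_imp_le)
  have regh: "regular_ext (A k) (A (Suc k)) (h k)" "regular_ext (B k) (B (Suc k)) (h' k)" for k
    unfolding h_def h'_def by (rule dA(4) dB(4))+
  have regA: "regular_ext (A (n k)) (A (n (Suc k))) (steps h (n k) (n (Suc k) - n k))" for k
    using regular_ext_steps[where A = A and h = h, OF dA(1) regh(1), of "n k" "n (Suc k) - n k"] ltn[of k] by simp
  have regB: "regular_ext (B (m k)) (B (m (Suc k))) (steps h' (m k) (m (Suc k) - m k))" for k
    using regular_ext_steps[where A = B and h = h', OF dB(1) regh(2), of "m k" "m (Suc k) - m k"] ltm[of k] by simp
  \<comment> \<open>The intertwining relations are given on the digraph algebras; uniqueness of
    star-extensions carries them to the generated C*-algebras.\<close>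
  have ba: "b k (a k x) = steps h (n k) (n (Suc k) - n k) x" if x: "x \<in> carrier (cstar (A (n k)))" for k x
  proof (rule star_hom_unique[OF dA(1) star_hom_comp[OF ah bh] regular_ext_hom(1)[OF dA(1) dA(1) regA] _ x])
    fix s assume s: "s \<in> elems (A (n k))"
    show "b k (a k s) = steps h (n k) (n (Suc k) - n k) s"
      using ae[OF s] be[of "\<alpha> k s" k] \<beta>\<alpha>[OF s] dA(5)[OF s] by (simp add: system_map_def h_def)
  qed
  have ab: "a (Suc k) (b k x) = steps h' (m k) (m (Suc k) - m k) x" if x: "x \<in> carrier (cstar (B (m k)))" for k x
  proof (rule star_hom_unique[OF dB(1) star_hom_comp[OF bh ah] regular_ext_hom(1)[OF dB(1) dB(1) regB] _ x])
    fix s assume s: "s \<in> elems (B (m k))"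
    show "a (Suc k) (b k s) = steps h' (m k) (m (Suc k) - m k) s"
      using be[OF s] ae[of "\<beta> k s" "Suc k"] \<alpha>\<beta>[OF s] dB(5)[OF s] by (simp add: system_map_def h'_def)
  qed
  define \<iota> where "\<iota> = (\<lambda>j. lim_class (\<lambda>k. cstar (A k)) h (n j))"
  have coneA: "limit_cone (\<lambda>j. A (n j)) (\<lambda>j x. b j (a j x)) L \<iota>"
    unfolding \<iota>_def by (rule c.subsequence_cone[OF mono(1) ba])
  define K where "K = (\<lambda>j y. a (Suc j) (b j y))"
  have aelem: "x \<in> elems (A (n k)) \<Longrightarrow> a k x \<in> elems (B (m k))" for k x using ae[of x k] by simp
  have belem: "x \<in> elems (B (m k)) \<Longrightarrow> b k x \<in> elems (A (n (Suc k)))" for k x using be[of x k] by simp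
  note coneB = limit_cone.interleaved_cone[OF coneA, where B = "\<lambda>j. B (m j)", OF dB(1) ah aelem bh belem refl, folded K_def]
  have conjL: "\<exists>\<gamma>. automorphism L \<gamma> \<and> approximately_inner L \<gamma> \<and> \<gamma> ` C = D"
    if "regular_masa L C" "regular_masa L D" for C D
    using conj[OF _ that] A by (auto simp: Alglim_def L_def)
  have "regular_ext (A (n j)) (A (n (Suc j))) (\<lambda>x. b j (a j x))" for j
    by (rule regular_ext_cong[OF regA]) (simp add: ba)
  moreover have "regular_ext (B (m j)) (B (m (Suc j))) (K j)" for j
    by (rule regular_ext_cong[OF regB]) (simp add: ab K_def)
  ultimately obtain r where r: "r > k" "regular_ext (A (n k)) (B (m r)) (\<lambda>x. steps K k (r - k) (a k x))"
    using eventually_regular[OF coneA coneB(1) ah aelem coneB(2) _ _ conjL, of k] by blast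
  have zz: "steps K k d (a k x) = zigzag \<alpha> \<beta> k d x \<and> zigzag \<alpha> \<beta> k d x \<in> elems (B (m (k + d)))"
    if x: "x \<in> elems (A (n k))" for d x
    by (induction d) (use ae be x in \<open>auto simp: K_def\<close>)
  have "restrict (\<lambda>x. steps K k (r - k) (a k x)) (elems (A (n k))) = restrict (zigzag \<alpha> \<beta> k (r - k)) (elems (A (n k)))"
    using zz by (intro restrict_ext) simp
  then have "regular_hom (A (n k)) (B (m r)) (restrict (zigzag \<alpha> \<beta> k (r - k)) (elems (A (n k))))"
    using regular_ext_regular_hom[OF dA(1) dB(1) r(2)] by simp
  moreover have "A (n k) \<in> domain_algebras F"
    using A unfolding direct_system_def domain_algebras_def by force
  moreover have "B (m r) \<in> range_algebras F"
  proof -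
    \<comment> \<open>Stage 0 need not be the range of a map of the family. Here
      \<open>r > k\<close> and strict monotonicity make \<open>m r\<close> positive, so
      \<open>B (m r)\<close> is the range of the preceding connecting map.\<close>
    have "m r = Suc (m r - 1)" using r(1) strict_mono_imp_increasing[OF mono(2), of r] by simp
    moreover have "(B (m r - 1), \<theta> (m r - 1), B (Suc (m r - 1))) \<in> F" using B by (simp add: direct_system_def)
    ultimately show ?thesis unfolding range_algebras_def by force
  qed
  ultimately have "(A (n k), restrict (zigzag \<alpha> \<beta> k (r - k)) (elems (A (n k))), B (m r)) \<in> F"
    using F(2) unfolding saturated_def by blast
  then show ?thesis using r(1) by (intro exI[of _ r]) simp
qed

theorem theorem3p3:
  fixes F :: "'a arrow set"
  assumes "regular_family F"
    and "saturated F"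
    and "\<And>A C D. A \<in> Alglim F \<Longrightarrow> regular_masa A C \<Longrightarrow> regular_masa A D \<Longrightarrow>
           \<exists>\<gamma>. automorphism A \<gamma> \<and> approximately_inner A \<gamma> \<and> \<gamma> ` C = D"
  shows "functorial F"
  unfolding functorial_def
proof (intro allI impI, elim conjE, intro conjI)
  fix A \<phi> B \<theta> n m \<alpha> \<beta> k
  assume A: "direct_system F A \<phi>" and B: "direct_system F B \<theta>" and tw: "intertwining A \<phi> B \<theta> n m \<alpha> \<beta>"
  show "\<exists>r\<ge>k. (A (n k), restrict (zigzag \<alpha> \<beta> k (r - k)) (elems (A (n k))), B (m r)) \<in> F"
    by (rule zigzag_in_family[OF assms A B tw])
  \<comment> \<open>Exchanging the systems reduces the second claim to the first. As
    \<open>\<beta> k\<close> ends at stage \<open>n (Suc k)\<close>, the sequence \<open>n\<close>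
    and the maps \<open>\<alpha>\<close> are shifted by one.\<close>
  have "intertwining B \<theta> A \<phi> m (\<lambda>k. n (Suc k)) \<beta> (\<lambda>k. \<alpha> (Suc k))"
    using tw by (auto simp: intertwining_def strict_mono_Suc_iff)
  from zigzag_in_family[OF assms B A this, of k]
  show "\<exists>s\<ge>k. (B (m k), restrict (zigzag \<beta> (\<lambda>i. \<alpha> (Suc i)) k (s - k)) (elems (B (m k))), A (n (Suc s))) \<in> F"
    by simp
qed

end
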